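(* Let $V\in C^\infty(\mathbb T^2;\mathbb R^2)$ be divergence free with mean zero and let $f$ be a KPP nonlinearity. Then one of the following holds. (i) $c_p=c_p^*=0$ for all $p\in\mathbb R^2$. (ii) There exists a nonzero vector $Q\in\mathbb R^2$ such that $$c_p\ge c_p^*>0\quad\text{for all } p\in\mathbb R^2 \text{ with } p\cdot Q\ne0,$$ and for all $A>0$ $$\alpha_A(p),\ \beta_A(p),\ \gamma_A(p),\ \kappa_A(p),\ c_p^*(A)\le O(1)\quad\text{if } |p|=1 \text{ and } p\cdot Q=0.$$ Moreover, case (ii) happens if and only if there exists a periodic orbit with rotation vector $Q\neq 0$.
   Context: $\mathbb T^2=\mathbb R^2/\mathbb Z^2$; functions on it are $\mathbb Z^2$-periodic functions on $\mathbb R^2$. KPP nonlinearity: $f\in C^{1,\epsilon}([0,1])$ for some $\epsilon>0$, $f(0)=f(1)=0$, $f$ is non-increasing on $(1-\epsilon,1)$, and $0<f(s)\le s f'(0)$ for $s\in(0,1)$. "$\le O(1)$ for all $A$" means bounded above by a constant independent of $A$. Orbits: a smooth curve $\xi:\mathbb R\to\mathbb R^2$ is an orbit if $\dot\xi(t)=V(\xi(t))$. It is a periodic orbit with period $T>0$ if it is an orbit and $\xi(T)-\xi(0)\in\mathbb Z^2$; its rotation vector is $\frac{\xi(T)-\xi(0)}{T}$. For $A>0$ and $p\in\mathbb R^2$: $\alpha_A(p)$ is the unique number such that $|p+DG|+AV(x)\cdot(p+DG)=\alpha_A(p)$ admits approximate periodic viscosity solutions (for every $\epsilon>0$ there is a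 continuous periodic $G_\epsilon$ that is a viscosity subsolution with right side $\alpha_A(p)+\epsilon$ and a viscosity supersolution with right side $\alpha_A(p)-\epsilon$); $\alpha_A(p)=\inf_{\phi\in C^1(\mathbb T^2)}\max_{\mathbb T^2}\{|p+D\phi|+AV\cdot(p+D\phi)\}$. $\beta_A(p)$ is the unique number such that $|p+DF|^2+AV(x)\cdot(p+DF)=\beta_A(p)$ admits a periodic viscosity solution; $\beta_A(p)=\inf_{\phi\in C^1(\mathbb T^2)}\max_{\mathbb T^2}\{|p+D\phi|^2+AV\cdot(p+D\phi)\}$. $\gamma_A(p)=\inf_{\lambda>0}\frac{f'(0)+\beta_A(\lambda p)}{\lambda}$. $\kappa_A(p)$ is the unique number such that $-\Delta u+|p+Du|^2+AV(x)\cdot(p+Du)=\kappa_A(p)$ has a periodic (smooth) solution $u$. $c_p^*(A)=\inf_{\lambda>0}\frac{f'(0)+\kappa_A(\lambda p)}{\lambda}$ (flame speed of the reaction-diffusion-advection equation). $c_p=\inf_{\phi\in C^1(\mathbb T^2)}\max_{\mathbb T^2}\{V(x)\cdot(p+D\phi)\}$, which is the common limit of $\alpha_A(p)/A$, $\beta_A(p)/A$, $\gamma_A(p)/A$ as $A\to+\infty$. $c_p^*=\lim_{A\to+\infty}\frac{c_p^*(A)}{A}$; it is a known result that this limit exists and equals $\sup_{w\in\Gamma}\frac{\int_{\mathbb T^2}V\cdot p\,w^2dx}{\int_{\mathbb T^2}w^2dx}$, where $\Gamma=\{w\in H^1(\mathbb T^2)\setminus\{0\}: V\cdot Dw=0,\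 \|Dw\|_2^2\le f'(0)\|w\|_2^2\}$. *)

theory Defs
  imports "HOL-Analysis.Analysis"
begin

type_synonym plane = "real^2"

definition dir_deriv :: "'a::euclidean_space \<Rightarrow> ('a \<Rightarrow> 'b::real_normed_vector) \<Rightarrow> 'a \<Rightarrow> 'b" where
  "dir_deriv b g x = frechet_derivative g (at x) b"

primrec C_k :: "nat \<Rightarrow> ('a::euclidean_space \<Rightarrow> 'b::real_normed_vector) \<Rightarrow> bool" where
  "C_k 0 g \<longleftrightarrow> continuous_on UNIV g"
| "C_k (Suc k) g \<longleftrightarrow> (\<forall>x. g differentiable (at x)) \<and> (\<forall>b\<in>Basis. C_k k (dir_deriv b g))"

definition smooth :: "('a::euclidean_space \<Rightarrow> 'b::real_normed_vector) \<Rightarrow> bool" where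
  "smooth g \<longleftrightarrow> (\<forall>k. C_k k g)"

definition grad :: "('a::euclidean_space \<Rightarrow> real) \<Rightarrow> 'a \<Rightarrow> 'a" where
  "grad g x = (\<Sum>b\<in>Basis. dir_deriv b g x *\<^sub>R b)"

definition divergence :: "('a::euclidean_space \<Rightarrow> 'a) \<Rightarrow> 'a \<Rightarrow> real" where
  "divergence W x = (\<Sum>b\<in>Basis. dir_deriv b W x \<bullet> b)"

definition laplacian :: "('a::euclidean_space \<Rightarrow> real) \<Rightarrow> 'a \<Rightarrow> real" where
  "laplacian g x = (\<Sum>b\<in>Basis. dir_deriv b (dir_deriv b g) x)"

text \<open>Functions on the torus are functions on the plane that are invariant under the integer
  lattice.  Maxima over the torus are written as suprema over the plane; they are attained, since
  the functions involved are continuous and periodic.\<close>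

definition int_lattice :: "plane set" where
  "int_lattice = {k. \<forall>i. k $ i \<in> \<int>}"

definition periodic :: "(plane \<Rightarrow> 'b) \<Rightarrow> bool" where
  "periodic g \<longleftrightarrow> (\<forall>k\<in>int_lattice. \<forall>x. g (x + k) = g x)"

definition C1_torus :: "(plane \<Rightarrow> real) set" where
  "C1_torus = {\<phi>. C_k 1 \<phi> \<and> periodic \<phi>}"

text \<open>The box \<open>cbox 0 1\<close> is the unit square: \<open>1\<close> is the vector with all entries one.\<close>

definition mean_zero :: "(plane \<Rightarrow> plane) \<Rightarrow> bool" where
  "mean_zero W \<longleftrightarrow> integral (cbox 0 1) W = 0"

text \<open>The derivative relative to \<open>[0,1]\<close>, one-sided at the end points.\<close>

definition deriv01 :: "(real \<Rightarrow> real) \<Rightarrow> real \<Rightarrow> real" where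
  "deriv01 f s = vector_derivative f (at s within {0..1})"

definition C1_holder :: "real \<Rightarrow> (real \<Rightarrow> real) \<Rightarrow> bool" where
  "C1_holder \<epsilon> f \<longleftrightarrow> f differentiable_on {0..1} \<and>
     (\<exists>C. \<forall>s\<in>{0..1}. \<forall>t\<in>{0..1}. \<bar>deriv01 f s - deriv01 f t\<bar> \<le> C * \<bar>s - t\<bar> powr \<epsilon>)"

definition KPP :: "(real \<Rightarrow> real) \<Rightarrow> bool" where
  "KPP f \<longleftrightarrow> (\<exists>\<epsilon>>0. C1_holder \<epsilon> f \<and> antimono_on {1 - \<epsilon><..<1} f) \<and> f 0 = 0 \<and> f 1 = 0 \<and>
     (\<forall>s\<in>{0<..<1}. 0 < f s \<and> f s \<le> s * deriv01 f 0)"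

text \<open>Sub- and supersolutions of the first-order equation \<open>H x (D v) = c\<close> on the plane.\<close>

definition visc_sub :: "(plane \<Rightarrow> plane \<Rightarrow> real) \<Rightarrow> real \<Rightarrow> (plane \<Rightarrow> real) \<Rightarrow> bool" where
  "visc_sub H c v \<longleftrightarrow> (\<forall>\<phi> x. C_k 1 \<phi> \<longrightarrow>
     (\<forall>\<^sub>F y in nhds x. v y - \<phi> y \<le> v x - \<phi> x) \<longrightarrow> H x (grad \<phi> x) \<le> c)"

definition visc_super :: "(plane \<Rightarrow> plane \<Rightarrow> real) \<Rightarrow> real \<Rightarrow> (plane \<Rightarrow> real) \<Rightarrow> bool" where
  "visc_super H c v \<longleftrightarrow> (\<forall>\<phi> x. C_k 1 \<phi> \<longrightarrow>
     (\<forall>\<^sub>F y in nhds x. v y - \<phi> y \<ge> v x - \<phi> x) \<longrightarrow> H x (grad \<phi> x) \<ge> c)"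

text \<open>The infima below are over sets of reals that are bounded below when \<open>V\<close> is periodic,
  divergence free and of mean zero: then \<open>beta\<close>, \<open>kappa\<close> and the suprema in \<open>c_lim\<close> are
  nonnegative, because \<open>V x \<bullet> (p + D \<phi>)\<close> has mean zero over the torus.\<close>

definition alpha :: "(plane \<Rightarrow> plane) \<Rightarrow> real \<Rightarrow> plane \<Rightarrow> real" where
  "alpha V A p = (THE c. \<forall>\<epsilon>>0. \<exists>G. continuous_on UNIV G \<and> periodic G \<and>
     visc_sub (\<lambda>x q. norm (p + q) + A * (V x \<bullet> (p + q))) (c + \<epsilon>) G \<and>
     visc_super (\<lambda>x q. norm (p + q) + A * (V x \<bullet> (p + q))) (c - \<epsilon>) G)"

definition beta :: "(plane \<Rightarrow> plane) \<Rightarrow> real \<Rightarrow> plane \<Rightarrow> real" where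
  "beta V A p = (THE c. \<exists>F. continuous_on UNIV F \<and> periodic F \<and>
     visc_sub (\<lambda>x q. (norm (p + q))\<^sup>2 + A * (V x \<bullet> (p + q))) c F \<and>
     visc_super (\<lambda>x q. (norm (p + q))\<^sup>2 + A * (V x \<bullet> (p + q))) c F)"

definition gamma :: "(plane \<Rightarrow> plane) \<Rightarrow> (real \<Rightarrow> real) \<Rightarrow> real \<Rightarrow> plane \<Rightarrow> real" where
  "gamma V f A p = (INF l\<in>{0<..}. (deriv01 f 0 + beta V A (l *\<^sub>R p)) / l)"

definition kappa :: "(plane \<Rightarrow> plane) \<Rightarrow> real \<Rightarrow> plane \<Rightarrow> real" where
  "kappa V A p = (THE c. \<exists>u. smooth u \<and> periodic u \<and>
     (\<forall>x. - laplacian u x + (norm (p + grad u x))\<^sup>2 + A * (V x \<bullet> (p + grad u x)) = c))"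

definition flame_speed :: "(plane \<Rightarrow> plane) \<Rightarrow> (real \<Rightarrow> real) \<Rightarrow> real \<Rightarrow> plane \<Rightarrow> real" where
  "flame_speed V f A p = (INF l\<in>{0<..}. (deriv01 f 0 + kappa V A (l *\<^sub>R p)) / l)"

definition c_lim :: "(plane \<Rightarrow> plane) \<Rightarrow> plane \<Rightarrow> real" where
  "c_lim V p = (INF \<phi>\<in>C1_torus. SUP x. V x \<bullet> (p + grad \<phi> x))"

definition c_star :: "(plane \<Rightarrow> plane) \<Rightarrow> (real \<Rightarrow> real) \<Rightarrow> plane \<Rightarrow> real" where
  "c_star V f p = Lim at_top (\<lambda>A. flame_speed V f A p / A)"

definition orbit :: "(plane \<Rightarrow> plane) \<Rightarrow> (real \<Rightarrow> plane) \<Rightarrow> bool" where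
  "orbit V \<xi> \<longleftrightarrow> smooth \<xi> \<and> (\<forall>t. (\<xi> has_vector_derivative V (\<xi> t)) (at t))"

definition periodic_orbit :: "(plane \<Rightarrow> plane) \<Rightarrow> real \<Rightarrow> (real \<Rightarrow> plane) \<Rightarrow> bool" where
  "periodic_orbit V T \<xi> \<longleftrightarrow> orbit V \<xi> \<and> T > 0 \<and> \<xi> T - \<xi> 0 \<in> int_lattice"

definition rotation_vector :: "real \<Rightarrow> (real \<Rightarrow> plane) \<Rightarrow> plane" where
  "rotation_vector T \<xi> = (\<xi> T - \<xi> 0) /\<^sub>R T"

definition case_i :: "(plane \<Rightarrow> plane) \<Rightarrow> (real \<Rightarrow> real) \<Rightarrow> bool" where
  "case_i V f \<longleftrightarrow> (\<forall>p. c_lim V p = 0 \<and> c_star V f p = 0)"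

definition case_ii :: "(plane \<Rightarrow> plane) \<Rightarrow> (real \<Rightarrow> real) \<Rightarrow> plane \<Rightarrow> bool" where
  "case_ii V f Q \<longleftrightarrow>
     (\<forall>p. p \<bullet> Q \<noteq> 0 \<longrightarrow> c_lim V p \<ge> c_star V f p \<and> c_star V f p > 0) \<and>
     (\<exists>C. \<forall>A>0. \<forall>p. norm p = 1 \<and> p \<bullet> Q = 0 \<longrightarrow>
        alpha V A p \<le> C \<and> beta V A p \<le> C \<and> gamma V f A p \<le> C \<and>
        kappa V A p \<le> C \<and> flame_speed V f A p \<le> C)"

end

(* The quantities c_p and c_p^* are decided by the displacement of the flow of V. By time averaging, the function
   p . (X_T x - x) / T is, up to small errors, of the form V . (p + D phi). If no periodic orbit winds around the
   torus, the level sets of the stream function form flow boxes, and a pigeonhole argument makes displacements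
   o(T), so c_p = 0. A winding orbit lies in a tube of such orbits; a cutoff psi of the stream function
   concentrated there is invariant under the flow. Perturbing w = 1 by a multiple of psi in the variational
   formula gives c_p^* > 0 unless p . Q = 0, and the stream function of psi V provides Phi with
   V . (q + D Phi) = 0 for some q orthogonal to Q, a test function that bounds all effective Hamiltonians
   independently of A.

   The cell problems are solved as follows: kappa by the Collatz-Wielandt characterisation of the principal
   eigenvalue of the linearised operator, alpha and beta as limits of a discrete control scheme, where for alpha
   the oscillation of the value functions is bounded because the flow preserves Lebesgue measure. The limit
   defining c_p^* exists because the flame speed divided by A is nonincreasing. *)
theory Submission
  imports Defs "HOL-Complex_Analysis.Great_Picard"
begin

text \<open>\<open>alpha\<close>, \<open>beta\<close> and \<open>kappa\<close> are definite
  descriptions, so not even an upper bound is available before existence and uniqueness for the cell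
  problems; this, rather than the dichotomy, takes most of the work. The elliptic theory rests on
  sup norm estimates alone: the resolvent of the Laplacian commutes with translations, hence with
  differentiation, and lower-order terms are small perturbations for large l. For
  \<open>alpha\<close> the Hamiltonian |q| + A V . q is not coercive once A is large, so discounted
  solutions have no modulus of continuity uniform in the discount; hence only approximate solutions
  are sought, and a global argument must bound the oscillation. In the monotonicity of the flame
  speed over A the obstacle is the Laplacian, which does not scale with the drift; integration
  against an invariant density removes it. The dichotomy is tied to dimension two: orbits are
  confined to level sets of a stream function, and the vectors orthogonal to Q form a line, so one
  corrector serves all p in case (ii).\<close>

notation scaleR (infixr "*R" 75)

abbreviation pd :: "2 => (plane => 'b::real_normed_vector) => plane => 'b" where
 "pd i == dir_deriv (axis i 1)"

subsection \<open>Calculus of \<open>C_k\<close> functions\<close>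

lemma dir_deriv_eq: "(g has_derivative g') (at x) ==> dir_deriv b g x = g' b"
 unfolding dir_deriv_def by (simp add: frechet_derivative_at[symmetric])

lemma C_k_Suc_imp: "C_k (Suc k) g ==> C_k k g"
proof (induction k arbitrary: g)
 case 0
 then show ?case
  by (auto intro!: differentiable_imp_continuous_on simp: differentiable_on_def intro: differentiable_at_withinI)
next
 case (Suc k)
 then show ?case by auto
qed

lemma C_k_mono: "C_k k g ==> j <= k ==> C_k j g"
 by (induction k) (auto simp: le_Suc_eq dest: C_k_Suc_imp simp del: C_k.simps)

lemma C_k_continuous: "C_k k g ==> continuous_on UNIV g"
 using C_k_mono[of k g 0] by simp

text \<open>Uniqueness of the derivative lets any explicit formula for it replace
  \<open>frechet_derivative\<close>, of which the definition of \<open>C_k\<close> speaks.\<close>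

lemma C_k_SucI:
 assumes "!!x. (g has_derivative D x) (at x)" "!!b. b \<in> Basis ==> C_k k (%x. D x b)"
 shows "C_k (Suc k) g"
proof -
 have "dir_deriv b g = (%x. D x b)" for b
  using dir_deriv_eq[OF assms(1)] by auto
 then show ?thesis using assms by (auto simp: differentiable_def)
qed

lemma C_k_Suc_has_derivative:
 "C_k (Suc k) g ==> (g has_derivative (%h. frechet_derivative g (at x) h)) (at x)"
 by (simp add: frechet_derivative_works)

lemma C_k_const [simp]: "C_k k (%x. c)"
proof (induction k arbitrary: c)
 case (Suc k)
 show ?case by (rule C_k_SucI[where D="%x h. 0"]) (auto simp: Suc)
qed simp

lemma C_k_linear:
 assumes L: "bounded_linear L" and "C_k k g"
 shows "C_k k (%x. L (g x))"
 using assms(2)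
proof (induction k arbitrary: g)
 case 0
 then show ?case by (simp add: bounded_linear.continuous_on[OF L])
next
 case (Suc k)
 show ?case
 proof (rule C_k_SucI)
  show "((%x. L (g x)) has_derivative (%h. L (frechet_derivative g (at x) h))) (at x)" for x
   by (rule bounded_linear.has_derivative[OF L C_k_Suc_has_derivative[OF Suc.prems]])
  show "C_k k (%x. L (frechet_derivative g (at x) b))" if "b \<in> Basis" for b
   using Suc.IH[of "dir_deriv b g"] Suc.prems that by (simp add: dir_deriv_def[abs_def])
 qed
qed

lemma C_k_id [simp]: "C_k k (%x. x)"
proof (cases k)
 case (Suc n)
 show ?thesis unfolding Suc by (rule C_k_SucI[where D="%x h. h"]) auto
qed simp

lemma C_k_add:
 "C_k k f ==> C_k k g ==> C_k k (%x. f x + g x)"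
proof (induction k arbitrary: f g)
 case 0
 then show ?case by (auto intro: continuous_intros)
next
 case (Suc k)
 show ?case
 proof (rule C_k_SucI)
  show "((%x. f x + g x) has_derivative
   (%h. frechet_derivative f (at x) h + frechet_derivative g (at x) h)) (at x)" for x
   using Suc.prems by (intro has_derivative_add C_k_Suc_has_derivative)
  show "C_k k (%x. frechet_derivative f (at x) b + frechet_derivative g (at x) b)" if "b \<in> Basis" for b
   using Suc.IH[of "dir_deriv b f" "dir_deriv b g"] Suc.prems that by (simp add: dir_deriv_def[abs_def])
 qed
qed

lemma C_k_minus: "C_k k f ==> C_k k (%x. - f x)"
 by (rule C_k_linear[OF bounded_linear_minus[OF bounded_linear_ident]])

lemma C_k_diff: "C_k k f ==> C_k k g ==> C_k k (%x. f x - g x)"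
 using C_k_add[of k f "%x. - g x"] by (simp add: C_k_minus)

lemma C_k_bilinear:
 assumes B: "bounded_bilinear P" and "C_k k f" "C_k k g"
 shows "C_k k (%x. P (f x) (g x))"
 using assms(2,3)
proof (induction k arbitrary: f g)
 case 0
 then show ?case by (simp add: bounded_bilinear.continuous_on[OF B])
next
 case (Suc k)
 show ?case
 proof (rule C_k_SucI)
  show "((%x. P (f x) (g x)) has_derivative
   (%h. P (f x) (frechet_derivative g (at x) h) + P (frechet_derivative f (at x) h) (g x))) (at x)" for x
   using Suc.prems by (intro bounded_bilinear.FDERIV[OF B] C_k_Suc_has_derivative)
  show "C_k k (%x. P (f x) (frechet_derivative g (at x) b) + P (frechet_derivative f (at x) b) (g x))"
   if "b \<in> Basis" for b
   using Suc.IH[of f "dir_deriv b g"] Suc.IH[of "dir_deriv b f" g] Suc.prems that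
    C_k_Suc_imp[OF Suc.prems(1)] C_k_Suc_imp[OF Suc.prems(2)]
   by (intro C_k_add) (simp_all add: dir_deriv_def[abs_def])
 qed
qed

lemmas C_k_scaleR = C_k_bilinear[OF bounded_bilinear_scaleR]
lemmas C_k_mult = C_k_bilinear[OF bounded_bilinear_mult]
lemmas C_k_inner = C_k_bilinear[OF bounded_bilinear_inner]

lemma C_k_sum: "(!!i. i \<in> I ==> C_k k (f i)) ==> C_k k (%x. \<Sum>i\<in>I. f i x)"
 by (induction I rule: infinite_finite_induct) (auto intro: C_k_add)

lemma frechet_expand:
 assumes "(g :: 'a::euclidean_space => _) differentiable (at x)"
 shows "frechet_derivative g (at x) h = (\<Sum>b\<in>Basis. (h \<bullet> b) *R dir_deriv b g x)"
proof -
 have "linear (frechet_derivative g (at x))"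
  using assms by (rule linear_frechet_derivative)
 then have "frechet_derivative g (at x) (\<Sum>b\<in>Basis. (h \<bullet> b) *R b) = (\<Sum>b\<in>Basis. (h \<bullet> b) *R frechet_derivative g (at x) b)"
  by (simp add: linear_sum linear_scale)
 then show ?thesis by (simp add: euclidean_representation dir_deriv_def)
qed

lemma C_k_compose:
 fixes g :: "'a::euclidean_space => 'b::euclidean_space"
 shows "C_k k W ==> C_k k g ==> C_k k (%x. W (g x))"
proof (induction k arbitrary: W g)
 case 0
 then show ?case by (auto intro: continuous_on_compose2)
next
 case (Suc k)
 show ?case
 proof (rule C_k_SucI)
  \<comment> \<open>The derivative of W is expanded in partial derivatives, so that every factor is
    a \<open>C_k k\<close> function of x and the induction hypothesis applies to each.\<close>
  show "((%x. W (g x)) has_derivative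
   (%h. \<Sum>c\<in>Basis. (frechet_derivative g (at x) h \<bullet> c) *R dir_deriv c W (g x))) (at x)" for x
  proof -
   have "W differentiable (at (g x))" using Suc.prems by simp
   then have "frechet_derivative W (at (g x)) = (%h. \<Sum>c\<in>Basis. (h \<bullet> c) *R dir_deriv c W (g x))"
    by (auto simp: frechet_expand)
   then show ?thesis
    using has_derivative_compose[OF C_k_Suc_has_derivative[OF Suc.prems(2)] C_k_Suc_has_derivative[OF Suc.prems(1)], of x]
    by simp
  qed
  show "C_k k (%x. \<Sum>c\<in>Basis. (frechet_derivative g (at x) b \<bullet> c) *R dir_deriv c W (g x))"
   if "b \<in> Basis" for b
  proof (intro C_k_sum C_k_scaleR C_k_inner C_k_const)
   show "C_k k (%x. frechet_derivative g (at x) b)"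
    using Suc.prems that by (simp add: dir_deriv_def[abs_def])
   show "C_k k (%x. dir_deriv c W (g x))" if "c \<in> Basis" for c
    using Suc.IH[of "dir_deriv c W" g] Suc.prems C_k_Suc_imp[OF Suc.prems(2)] that by simp
  qed
 qed
qed

lemma C_k_inverse:
 fixes g :: "'a::euclidean_space => real"
 shows "C_k k g ==> (!!x. g x ~= 0) ==> C_k k (%x. inverse (g x))"
proof (induction k arbitrary: g)
 case 0
 then show ?case by (auto intro: continuous_intros)
next
 case (Suc k)
 show ?case
 proof (rule C_k_SucI)
  show "((%x. inverse (g x)) has_derivative
   (%h. - (inverse (g x) * frechet_derivative g (at x) h * inverse (g x)))) (at x)" for x
   using Suc.prems by (intro Deriv.has_derivative_inverse C_k_Suc_has_derivative) auto
  show "C_k k (%x. - (inverse (g x) * frechet_derivative g (at x) b * inverse (g x)))" if "b \<in> Basis" for b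
   using Suc.prems that Suc.IH[of g] C_k_Suc_imp[OF Suc.prems(1)]
   by (intro C_k_minus C_k_mult) (auto simp: dir_deriv_def[abs_def])
 qed
qed

lemma C_k_ln:
 fixes g :: "'a::euclidean_space => real"
 assumes "C_k k g" "!!x. g x > 0" shows "C_k k (%x. ln (g x))"
proof (cases k)
 case 0
 then show ?thesis using assms by (auto intro!: continuous_intros simp: less_imp_neq[symmetric])
next
 case (Suc n)
 show ?thesis unfolding Suc
 proof (rule C_k_SucI)
  show "((%x. ln (g x)) has_derivative (%h. inverse (g x) * frechet_derivative g (at x) h)) (at x)" for x
   using has_derivative_ln[OF assms(2) C_k_Suc_has_derivative[OF assms(1)[unfolded Suc], of x]]
   by (simp add: mult.commute)
  show "C_k n (%x. inverse (g x) * frechet_derivative g (at x) b)" if "b \<in> Basis" for b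
   using that assms Suc C_k_Suc_imp[of n g]
   by (intro C_k_mult C_k_inverse) (auto simp: dir_deriv_def[abs_def] less_imp_neq[symmetric])
 qed
qed

lemma C_k_translate: "C_k k g ==> C_k k (%x. g (x + a))"
 by (rule C_k_compose) (auto intro: C_k_add)

lemma has_derivative_translate:
 assumes "(g has_derivative D) (at (x + a))"
 shows "((%x. g (x + a)) has_derivative D) (at x)"
proof -
 have "((%x. x + a) has_derivative (%h. h)) (at x)"
  by (auto intro!: derivative_eq_intros)
 from has_derivative_compose[OF this assms] show ?thesis .
qed

lemma dir_deriv_translate:
 assumes "g differentiable (at (x + a))"
 shows "dir_deriv b (%x. g (x + a)) x = dir_deriv b g (x + a)"
 using has_derivative_translate[OF assms[unfolded frechet_derivative_works]]
 by (simp add: dir_deriv_eq) (simp add: dir_deriv_def)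

lemma grad_inner:
 assumes "(g :: 'a::euclidean_space => real) differentiable (at x)"
 shows "frechet_derivative g (at x) h = grad g x \<bullet> h"
 by (simp add: frechet_expand[OF assms] grad_def inner_sum_left inner_commute[of h] mult.commute)

lemma has_derivative_grad:
 assumes "(g :: 'a::euclidean_space => real) differentiable (at x)"
 shows "(g has_derivative (%h. grad g x \<bullet> h)) (at x)"
proof -
 have "frechet_derivative g (at x) = (%h. grad g x \<bullet> h)"
  using grad_inner[OF assms] by auto
 then show ?thesis using assms by (simp add: frechet_derivative_works)
qed

lemma grad_eq:
 assumes "((g :: 'a::euclidean_space => real) has_derivative (%h. v \<bullet> h)) (at x)"
 shows "grad g x = v"
 by (simp add: grad_def dir_deriv_eq[OF assms] euclidean_representation)

lemma C_k_grad:
 assumes "C_k (Suc k) (g :: 'a::euclidean_space => real)" shows "C_k k (grad g)"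
 using assms unfolding grad_def[abs_def] by (intro C_k_sum C_k_scaleR) auto

lemma C_k_gradI:
 assumes "!!x. ((g :: 'a::euclidean_space => real) has_derivative (%h. G x \<bullet> h)) (at x)" "C_k k G"
 shows "C_k (Suc k) g" "grad g = G"
proof -
 show "C_k (Suc k) g"
  using assms by (intro C_k_SucI[where D="%x h. G x \<bullet> h"] C_k_inner) auto
 show "grad g = G" using grad_eq[OF assms(1)] by auto
qed

lemma inner_grad: "b \<in> Basis ==> grad g x \<bullet> b = dir_deriv b g x"
 by (simp add: grad_def inner_sum_left inner_Basis if_distrib cong: if_cong)

lemma dir_deriv_line:
 assumes "(g :: 'a::euclidean_space => 'b::real_normed_vector) differentiable (at (x + s *R b))"
 shows "((%s. g (x + s *R b)) has_vector_derivative dir_deriv b g (x + s *R b)) (at s)"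
proof -
 have "((%s. x + s *R b) has_derivative (%h. h *R b)) (at s)"
  by (auto intro!: derivative_eq_intros)
 from has_derivative_compose[OF this assms[unfolded frechet_derivative_works]]
 show ?thesis
  unfolding has_vector_derivative_def
  by (rule has_derivative_eq_rhs)
   (auto simp: dir_deriv_def linear_scale[OF linear_frechet_derivative[OF assms]])
qed

lemma dir_deriv_line_real:
 assumes "(g :: 'a::euclidean_space => real) differentiable (at (x + s *R b))"
 shows "((%s. g (x + s *R b)) has_real_derivative dir_deriv b g (x + s *R b)) (at s)"
 using dir_deriv_line[OF assms] by (simp add: has_real_derivative_iff_has_vector_derivative)

lemma dir_deriv_add:
 "f differentiable (at x) ==> g differentiable (at x) ==>
 dir_deriv b (%x. f x + g x) x = dir_deriv b f x + dir_deriv b g x"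
 unfolding frechet_derivative_works
 by (drule (1) has_derivative_add) (simp add: dir_deriv_eq, simp add: dir_deriv_def)

lemma dir_deriv_linear:
 "bounded_linear L ==> f differentiable (at x) ==>
 dir_deriv b (%x. L (f x)) x = L (dir_deriv b f x)"
 unfolding frechet_derivative_works
 by (drule (1) bounded_linear.has_derivative, drule dir_deriv_eq) (simp add: dir_deriv_def)

lemma dir_deriv_bilinear:
 "bounded_bilinear P ==> f differentiable (at x) ==> g differentiable (at x) ==>
 dir_deriv b (%x. P (f x) (g x)) x = P (f x) (dir_deriv b g x) + P (dir_deriv b f x) (g x)"
 unfolding frechet_derivative_works
 by (drule (2) bounded_bilinear.FDERIV, drule dir_deriv_eq) (simp add: dir_deriv_def)

lemmas dir_deriv_mult = dir_deriv_bilinear[OF bounded_bilinear_mult]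
lemmas dir_deriv_scaleR = dir_deriv_bilinear[OF bounded_bilinear_scaleR]
lemmas dir_deriv_minus = dir_deriv_linear[OF bounded_linear_minus[OF bounded_linear_ident]]

lemma dir_deriv_diff:
 "f differentiable (at x) ==> g differentiable (at x) ==>
 dir_deriv b (%x. f x - g x) x = dir_deriv b f x - dir_deriv b g x"
 unfolding frechet_derivative_works
 by (drule (1) has_derivative_diff) (simp add: dir_deriv_eq, simp add: dir_deriv_def)

lemma dir_deriv_const [simp]: "dir_deriv b (%x. c) x = 0"
 using dir_deriv_eq[OF has_derivative_const[of c "at x"]] by simp

lemma grad_add: "f differentiable (at x) ==> g differentiable (at x) ==>
 grad (%x. f x + g x) x = grad f x + grad g x"
 by (simp add: grad_def dir_deriv_add scaleR_add_left sum.distrib)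

lemma grad_diff: "f differentiable (at x) ==> g differentiable (at x) ==>
 grad (%x. f x - g x) x = grad f x - grad g x"
 by (simp add: grad_def dir_deriv_diff scaleR_diff_left sum_subtractf)

lemma grad_mult: "f differentiable (at x) ==> g differentiable (at x) ==>
 grad (%x. f x * g x) x = f x *R grad g x + g x *R grad f x"
 by (simp add: grad_def dir_deriv_mult scaleR_add_left sum.distrib scaleR_sum_right mult.commute)

lemma grad_cmult: "f differentiable (at x) ==> grad (%x. c * f x) x = c *R grad f x"
 using grad_mult[of "%x. c" x f] by (simp add: grad_def)

lemma smooth_C_k: "smooth g ==> C_k k g"
 by (simp add: smooth_def)

lemma Basis_plane: "(Basis :: plane set) = {axis 1 1, axis 2 1}"
 unfolding Basis_vec_def UNIV_2 by auto

lemma axis_12_neq [simp]: "axis 1 (1::real) ~= (axis 2 1 :: plane)" "axis 2 (1::real) ~= (axis 1 1 :: plane)"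
 by (auto simp: axis_eq_axis)

lemma sum_Basis_plane: "(\<Sum>b\<in>(Basis::plane set). f b) = f (axis 1 1) + f (axis 2 1)"
 unfolding Basis_plane by simp

lemma axis_in_Basis_plane [simp]: "axis i 1 \<in> (Basis :: plane set)"
 by (simp add: axis_in_Basis_iff)

subsection \<open>Periodic functions\<close>

lemma int_lattice_zero [simp]: "0 \<in> int_lattice"
 and int_lattice_axis [simp]: "axis i 1 \<in> int_lattice"
 and int_lattice_add: "k \<in> int_lattice ==> l \<in> int_lattice ==> k + l \<in> int_lattice"
 and int_lattice_minus: "k \<in> int_lattice ==> - k \<in> int_lattice"
 and int_lattice_diff: "k \<in> int_lattice ==> l \<in> int_lattice ==> k - l \<in> int_lattice"
 by (auto simp: int_lattice_def axis_def)

lemma cell_reduce: "\<exists>k\<in>int_lattice. x + k \<in> cbox 0 (1 :: plane)"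
proof
 show "(\<chi> i. - of_int \<lfloor>x $ i\<rfloor>) \<in> int_lattice"
  by (auto simp: int_lattice_def)
 show "x + (\<chi> i. - of_int \<lfloor>x $ i\<rfloor>) \<in> cbox 0 1"
  by (auto simp: mem_box_cart) linarith
qed

lemma plane_norm_le: "norm (x :: plane) <= \<bar>x $ 1\<bar> + \<bar>x $ 2\<bar>"
 using norm_le_l1_cart[of x] by (simp add: sum_2)

lemma cell_norm: "x \<in> cbox 0 (1 :: plane) ==> norm x <= 2"
 using plane_norm_le[of x] by (force simp: mem_box_cart forall_2)

text \<open>These are the continuous functions on the torus; through \<open>cell_reduce\<close> they
  inherit attained extrema and uniform continuity from the compact unit cell.\<close>

definition cper :: "(plane => 'b::topological_space) => bool" where
 "cper g \<longleftrightarrow> continuous_on UNIV g & periodic g"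

lemma cperD: "cper g ==> continuous_on S g" "cper g ==> periodic g"
 by (auto simp: cper_def intro: continuous_on_subset)

lemma cper_isCont: "cper g ==> isCont g x"
 by (simp add: cper_def continuous_on_eq_continuous_at)

lemma periodicD: "periodic g ==> k \<in> int_lattice ==> g (x + k) = g x"
 by (simp add: periodic_def)

lemma cper_const [simp]: "cper (%x. c)"
 by (simp add: cper_def periodic_def)

lemma cper_add: "cper f ==> cper g ==> cper (%x. f x + g x :: 'b::real_normed_vector)"
 and cper_diff: "cper f ==> cper g ==> cper (%x. f x - g x)"
 and cper_minus: "cper f ==> cper (%x. - f x)"
 and cper_scaleR: "cper h ==> cper f ==> cper (%x. h x *R f x)"
 and cper_mult: "cper u ==> cper v ==> cper (%x. u x * v x :: real)"
 and cper_inner: "cper a ==> cper b ==> cper (%x. a x \<bullet> b x)"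
 and cper_norm: "cper f ==> cper (%x. norm (f x))"
 by (auto simp: cper_def periodic_def intro!: continuous_intros)

lemma cper_translate: "cper g ==> cper (%x. g (x + a))"
 unfolding cper_def periodic_def
 by (auto intro!: continuous_intros intro: continuous_on_compose2) (metis add.assoc add.commute)

lemma cper_nth: "cper g ==> cper (%x. g x $ i :: real)"
 by (auto simp: cper_def periodic_def intro!: continuous_intros)

lemmas cper_intros = cper_const cper_add cper_diff cper_minus cper_scaleR cper_mult cper_inner
 cper_norm cper_translate cper_nth

lemma cper_attains_sup:
 assumes "cper (g :: plane => real)" shows "EX x. ALL y. g y <= g x"
proof -
 have "0 \<in> cbox 0 (1::plane)" by (simp add: mem_box_cart)
 then have "cbox 0 (1::plane) ~= {}" by blast
 then obtain x where x: "\<forall>y\<in>cbox 0 1. g y <= g x"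
  using continuous_attains_sup[OF compact_cbox _ cperD(1)[OF assms], of 0 1] by blast
 have "g y <= g x" for y
  using cell_reduce[of y] x periodicD[OF cperD(2)[OF assms]] by metis
 then show ?thesis by blast
qed

lemma cper_attains_inf:
 assumes "cper (g :: plane => real)" shows "EX x. ALL y. g x <= g y"
 using cper_attains_sup[OF cper_minus[OF assms]] by auto

lemma cper_bounded:
 assumes "cper (g :: plane => 'b::real_normed_vector)" shows "EX M>0. ALL x. norm (g x) <= M"
proof -
 obtain x where "ALL y. norm (g y) <= norm (g x)"
  using cper_attains_sup[OF cper_norm[OF assms]] by auto
 then show ?thesis by (intro exI[of _ "norm (g x) + 1"]) (auto intro: add_nonneg_pos order_trans)
qed

lemma cper_uniform:
 assumes "cper (g :: plane => 'b::metric_space)" "0 < e"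
 shows "EX d>0. ALL x y. dist x y < d --> dist (g x) (g y) < e"
proof -
 \<comment> \<open>A point moved into the unit cell has norm at most 2, and a neighbour at distance
   below 1 then stays within radius 3.\<close>
 have "uniformly_continuous_on (cball 0 3) g"
  by (intro compact_uniformly_continuous cperD(1)[OF assms(1)] compact_cball)
 then obtain d where d: "d > 0" "!!x y. x \<in> cball 0 3 ==> y \<in> cball 0 3 ==> dist y x < d ==> dist (g y) (g x) < e"
  unfolding uniformly_continuous_on_def using assms(2) by metis
 have "dist (g x) (g y) < e" if "dist x y < min d 1" for x y
 proof -
  obtain k where k: "k \<in> int_lattice" "x + k \<in> cbox 0 1" using cell_reduce by blast
  have n: "norm (x + k) <= 2" using cell_norm k(2) by blast
  have "norm (y + k) <= norm (x + k) + norm (y - x)"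
   using norm_triangle_ineq[of "x + k" "y - x"] by (simp add: algebra_simps)
  then have "norm (y + k) <= 3" using that n by (simp add: dist_norm norm_minus_commute)
  moreover have "dist (x + k) (y + k) < d" using that by simp
  ultimately have "dist (g (x + k)) (g (y + k)) < e"
   using d(2)[of "y + k" "x + k"] n by simp
  then show ?thesis using periodicD[OF cperD(2)[OF assms(1)] k(1)] by simp
 qed
 then show ?thesis using d(1) by (intro exI[of _ "min d 1"]) auto
qed

lemma C_k_cper: "C_k k g ==> periodic g ==> cper g"
 by (simp add: cper_def C_k_continuous)

lemma periodic_dir_deriv:
 assumes "periodic g" "!!x. g differentiable (at x)" shows "periodic (dir_deriv b g)"
 unfolding periodic_def
proof safe
 fix k x assume "k \<in> int_lattice"
 then have "(%x. g (x + k)) = g" using assms(1) by (auto simp: periodic_def)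
 then show "dir_deriv b g (x + k) = dir_deriv b g x"
  using dir_deriv_translate[of g x k b] assms(2) by simp
qed

lemma periodic_grad:
 assumes "periodic g" "!!x. g differentiable (at x)" shows "periodic (grad g)"
 using periodic_dir_deriv[OF assms] by (simp add: periodic_def grad_def)

lemma cper_dir_deriv: "C_k (Suc k) g ==> periodic g ==> b \<in> Basis ==> cper (dir_deriv b g)"
 by (intro C_k_cper periodic_dir_deriv) auto

lemma cper_grad: "C_k (Suc k) g ==> periodic g ==> cper (grad g)"
 by (intro C_k_cper periodic_grad C_k_grad) auto

lemma cper_laplacian:
 assumes "C_k (Suc (Suc k)) g" "periodic g" shows "cper (laplacian g)"
proof -
 have "cper (dir_deriv b (dir_deriv b g))" if "b \<in> Basis" for b
  using assms that by (intro cper_dir_deriv[where k=k] periodic_dir_deriv) auto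
 then show ?thesis unfolding laplacian_def[abs_def] sum_Basis_plane
  by (intro cper_add) auto
qed

subsection \<open>Integrals over the unit cell\<close>

lemma cper_integrable: "cper (g :: plane => 'b::euclidean_space) ==> g integrable_on cbox a b"
 by (intro integrable_continuous cperD(1))

lemma axis_nth_plane: "(axis i 1 :: plane) $ j = (if j = i then 1 else 0)"
 by (simp add: axis_def)

text \<open>The box elongated by t in direction i is cut once at height 1 and once at height t. The
  slab above 1 is a lattice translate of the slab below t, so the two remaining unit boxes carry the
  same integral.\<close>

lemma integral_cell_translate_axis:
 assumes g: "cper (g :: plane => 'b::euclidean_space)" and t: "0 <= t" "t <= 1"
 shows "integral (cbox 0 1) (%x. g (x + t *R axis i 1)) = integral (cbox 0 1) g"
proof -
 let ?e = "axis i 1 :: plane"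
 have shift: "integral (cbox (a + c) (b + c)) g = integral (cbox a b) (%x. g (x + c))" for a b c :: plane
 proof -
  show ?thesis using integral_shift_cbox_plus[of a b g c] by (simp add: o_def add.commute)
 qed
 have ib: "?e \<in> Basis" by simp
 let ?b = "1 + t *R ?e"
 have sp: "integral (cbox 0 ?b) g = integral (cbox 0 ?b \<inter> {x. x \<bullet> ?e <= c}) g + integral (cbox 0 ?b \<inter> {x. x \<bullet> ?e >= c}) g" for c
 proof -
  have "cbox 0 ?b \<inter> {x. x \<bullet> ?e <= c} = cbox 0 (\<Sum>j\<in>Basis. (if j = ?e then min (?b \<bullet> ?e) c else ?b \<bullet> j) *R j)"
   "cbox 0 ?b \<inter> {x. x \<bullet> ?e >= c} = cbox (\<Sum>j\<in>Basis. (if j = ?e then max (0 \<bullet> ?e) c else 0 \<bullet> j) *R j) ?b"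
   using interval_split[OF ib, of 0 ?b c] by auto
  then have "g integrable_on (cbox 0 ?b \<inter> {x. x \<bullet> ?e <= c})" "g integrable_on (cbox 0 ?b \<inter> {x. x \<bullet> ?e >= c})"
   using cper_integrable[OF g] by simp_all
  then show ?thesis
   by (intro integral_unique has_integral_split[OF _ _ ib]) (auto intro: integrable_integral)
 qed
 have ax: "x \<bullet> ?e = x $ i" for x by (simp add: inner_axis)
 have s1: "cbox 0 ?b \<inter> {x. x \<bullet> ?e <= 1} = cbox 0 1"
  using t exhaust_2[of i] by (auto simp: mem_box_cart ax axis_nth_plane forall_2)
 let ?m = "\<chi> j. if j = i then t else 1"
 have s2: "cbox 0 ?b \<inter> {x. x \<bullet> ?e >= 1} = cbox (0 + ?e) (?m + ?e)"
  using t exhaust_2[of i] by (auto simp: mem_box_cart ax axis_nth_plane forall_2)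
 have s3: "cbox 0 ?b \<inter> {x. x \<bullet> ?e <= t} = cbox 0 ?m"
  using t exhaust_2[of i] by (auto simp: mem_box_cart ax axis_nth_plane forall_2)
 have s4: "cbox 0 ?b \<inter> {x. x \<bullet> ?e >= t} = cbox (0 + t *R ?e) (1 + t *R ?e)"
  using t exhaust_2[of i] by (auto simp: mem_box_cart ax axis_nth_plane forall_2)
 have "(%x. g (x + ?e)) = g" using periodicD[OF cperD(2)[OF g]] by auto
 then have "integral (cbox (0 + ?e) (?m + ?e)) g = integral (cbox 0 ?m) g"
  using shift[of 0 ?e ?m] by simp
 with sp[of 1] sp[of t] have "integral (cbox 0 1) g = integral (cbox (0 + t *R ?e) (1 + t *R ?e)) g"
  unfolding s1 s2 s3 s4 by simp
 then show ?thesis using shift[of 0 "t *R ?e" 1] by simp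
qed

lemma integral_cell_translate:
 assumes g: "cper (g :: plane => 'b::euclidean_space)"
 shows "integral (cbox 0 1) (%x. g (x + a)) = integral (cbox 0 1) g"
proof -
 define k :: plane where "k = (\<chi> i. of_int \<lfloor>a $ i\<rfloor>)"
 define r where "r i = a $ i - of_int \<lfloor>a $ i\<rfloor>" for i
 have r: "0 <= r i" "r i <= 1" for i unfolding r_def by linarith+
 have k: "k \<in> int_lattice" by (auto simp: k_def int_lattice_def)
 have "a = (r 1 *R axis 1 1 + r 2 *R axis 2 1) + k"
  by (simp add: vec_eq_iff forall_2 k_def r_def axis_def)
 then have "g (x + a) = g ((x + r 1 *R axis 1 1) + r 2 *R axis 2 1)" for x
  using periodicD[OF cperD(2)[OF g] k, of "(x + r 1 *R axis 1 1) + r 2 *R axis 2 1"]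
  by (simp add: algebra_simps)
 then have "integral (cbox 0 1) (%x. g (x + a))
  = integral (cbox 0 1) (%x. g ((x + r 1 *R axis 1 1) + r 2 *R axis 2 1))" by simp
 also have "... = integral (cbox 0 1) (%x. g (x + r 2 *R axis 2 1))"
  using integral_cell_translate_axis[OF cper_translate[OF g, of "r 2 *R axis 2 1"] r[of 1]] by simp
 also have "... = integral (cbox 0 1) g"
  by (rule integral_cell_translate_axis[OF g r])
 finally show ?thesis .
qed

lemma content_cell [simp]: "Henstock_Kurzweil_Integration.content (cbox 0 (1::plane)) = 1"
proof -
 have "0 \<in> cbox 0 (1::plane)" by (simp add: mem_box_cart)
 then have "cbox 0 (1::plane) ~= {}" by blast
 then show ?thesis by (subst content_cbox_cart) simp_all
qed

section \<open>Uniform first-order expansions and partial derivatives\<close>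

lemma mvt_line:
 assumes "!!t. (F has_real_derivative F' t) (at t)"
 shows "EX z. \<bar>z\<bar> <= \<bar>s\<bar> & F s - F 0 = s * F' z"
proof -
 consider "s = 0" | "s > 0" | "s < 0" by linarith
 then show ?thesis
 proof cases
  case 2
  then show ?thesis using MVT2[of 0 s F F'] assms by force
 next
  case 3
  then obtain z where "s < z" "z < 0" "F 0 - F s = (0 - s) * F' z"
   using MVT2[of s 0 F F'] assms by force
  then show ?thesis using 3 by (intro exI[of _ z]) (auto simp: algebra_simps)
 qed auto
qed

text \<open>By the mean value theorem the error is t times an increment of the derivative, and the
  derivative is uniformly continuous on the torus.\<close>

lemma difference_quotient_uniform:
 assumes "C_k 1 (g :: plane => real)" "periodic g" "b \<in> Basis" "0 < e"
 shows "EX d>0. ALL x t. \<bar>t\<bar> < d --> \<bar>g (x + t *R b) - g x - t * dir_deriv b g x\<bar> <= e * \<bar>t\<bar>"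
proof -
 have "cper (dir_deriv b g)" using assms by (intro cper_dir_deriv[where k=0]) auto
 from cper_uniform[OF this \<open>0 < e\<close>]
 obtain d where d: "d > 0" "!!x y. dist x y < d ==> dist (dir_deriv b g x) (dir_deriv b g y) < e" by blast
 have "\<bar>g (x + t *R b) - g x - t * dir_deriv b g x\<bar> <= e * \<bar>t\<bar>" if t: "\<bar>t\<bar> < d" for x t
 proof -
  have diff: "g differentiable (at y)" for y using assms(1) by simp
  obtain z where z: "\<bar>z\<bar> <= \<bar>t\<bar>" "g (x + t *R b) - g (x + 0 *R b) = t * dir_deriv b g (x + z *R b)"
   using mvt_line[of "%s. g (x + s *R b)", OF dir_deriv_line_real[OF diff]] by blast
  have "dist (x + z *R b) x < d" using z(1) t assms(3) by (simp add: dist_norm)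
  then have "\<bar>dir_deriv b g (x + z *R b) - dir_deriv b g x\<bar> <= e"
   using d(2) by (force simp: dist_real_def)
  then have "\<bar>t\<bar> * \<bar>dir_deriv b g (x + z *R b) - dir_deriv b g x\<bar> <= \<bar>t\<bar> * e"
   by (intro mult_left_mono) auto
  moreover have "g (x + t *R b) - g x - t * dir_deriv b g x = t * (dir_deriv b g (x + z *R b) - dir_deriv b g x)"
   using z(2) by (simp add: algebra_simps)
  ultimately show ?thesis by (simp add: abs_mult mult.commute)
 qed
 then show ?thesis using d(1) by blast
qed

text \<open>Difference quotients have mean zero because integrals over the cell are translation
  invariant, and they converge uniformly to the derivative; no iterated integral appears.\<close>

lemma integral_dir_deriv:
 assumes "C_k 1 (g :: plane => real)" "periodic g" "b \<in> Basis"
 shows "integral (cbox 0 1) (dir_deriv b g) = 0"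
proof (rule ccontr)
 let ?I = "integral (cbox 0 1) (dir_deriv b g)"
 assume "?I ~= 0"
 then have "\<bar>?I\<bar> / 2 > 0" by simp
 from difference_quotient_uniform[OF assms this]
 obtain d where d: "d > 0" "!!x t. \<bar>t\<bar> < d ==> \<bar>g (x + t *R b) - g x - t * dir_deriv b g x\<bar> <= \<bar>?I\<bar> / 2 * \<bar>t\<bar>"
  by blast
 have c: "cper g" "cper (dir_deriv b g)"
  using assms cper_dir_deriv[of 0 g b] C_k_cper[of 1 g] by auto
 let ?t = "d / 2"
 let ?f = "%x. g (x + ?t *R b) - g x - ?t * dir_deriv b g x"
 have "cper ?f" by (intro cper_intros c)
 then have int: "?f integrable_on cbox 0 1" by (rule cper_integrable)
 have "norm (integral (cbox 0 1) ?f) <= \<bar>?I\<bar> / 2 * ?t * Henstock_Kurzweil_Integration.content (cbox 0 (1::plane))"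
  using d(2)[of ?t] d(1)
  by (intro integrable_bound[OF _ int]) (auto simp: mult_nonneg_nonneg)
 moreover have "integral (cbox 0 1) ?f = - ?t * ?I"
 proof -
  have "integral (cbox 0 1) ?f = integral (cbox 0 1) (%x. g (x + ?t *R b)) - integral (cbox 0 1) g - integral (cbox 0 1) (%x. ?t * dir_deriv b g x)"
   by (simp add: integral_diff cper_integrable cper_intros c)
  then show ?thesis by (simp add: integral_cell_translate[OF c(1)])
 qed
 ultimately show False using d(1) \<open>?I ~= 0\<close> by (simp add: abs_mult)
qed

text \<open>The increment is taken along one axis and then along the other, with the mean value
  theorem on each leg; continuity of the partial derivatives controls the intermediate
  points.\<close>

lemma C1_partialsI:
 fixes g :: "plane => real"
 assumes D: "!!x i. ((%s. g (x + s *R axis i 1)) has_real_derivative D i x) (at 0)"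
  and cont: "!!i. continuous_on UNIV (D i)"
 shows "(g has_derivative (%h. (\<chi> i. D i x) \<bullet> h)) (at x)"
proof -
 have D': "((%s. g (x + s *R axis i 1)) has_real_derivative D i (x + t *R axis i 1)) (at t)" for i x t
 proof -
  have "((%s. g ((x + t *R axis i 1) + (s - t) *R axis i 1)) has_real_derivative D i (x + t *R axis i 1) * 1) (at t)"
   by (rule DERIV_chain2[where g="%s. s - t"]) (use D in \<open>auto intro!: derivative_eq_intros\<close>)
  then show ?thesis by (simp add: algebra_simps)
 qed
 have mv: "EX z. \<bar>z\<bar> <= \<bar>s\<bar> & g (y + s *R axis i 1) - g y = s * D i (y + z *R axis i 1)" for y s i
  using mvt_line[of "%s. g (y + s *R axis i 1)", OF D', of s] by simp
 show ?thesis
  unfolding has_derivative_at_alt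
 proof (intro conjI allI impI)
  show "bounded_linear (%h. (\<chi> i. D i x) \<bullet> h)" by (rule bounded_linear_inner_right)
  fix e :: real assume "e > 0"
  have "EX d>0. ALL y. dist y x < d --> dist (D i y) (D i x) < e / 2" for i
   using cont[of i] \<open>e > 0\<close> unfolding continuous_on_iff by (metis UNIV_I half_gt_zero)
  then obtain d where d: "d i > 0" "!!y. dist y x < d i ==> dist (D i y) (D i x) < e / 2" for i
   by metis
  show "EX d>0. ALL y. norm (y - x) < d --> norm (g y - g x - (\<chi> i. D i x) \<bullet> (y - x)) <= e * norm (y - x)"
  proof (intro exI[of _ "min (d 1) (d 2) / 2"] conjI allI impI)
   show "min (d 1) (d 2) / 2 > 0" using d(1) by simp
   fix y assume y: "norm (y - x) < min (d 1) (d 2) / 2"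
   define h where "h = y - x"
   have h: "\<bar>h $ i\<bar> <= norm h" for i by (rule component_le_norm_cart)
   have yx: "y = x + h $ 1 *R axis 1 1 + h $ 2 *R axis 2 1"
    by (simp add: vec_eq_iff forall_2 h_def axis_def)
   obtain z1 where z1: "\<bar>z1\<bar> <= \<bar>h $ 1\<bar>" "g (x + h $ 1 *R axis 1 1) - g x = h $ 1 * D 1 (x + z1 *R axis 1 1)"
    using mv by blast
   obtain z2 where z2: "\<bar>z2\<bar> <= \<bar>h $ 2\<bar>"
    "g y - g (x + h $ 1 *R axis 1 1) = h $ 2 * D 2 (x + h $ 1 *R axis 1 1 + z2 *R axis 2 1)"
    using mv yx by metis
   have "dist (x + z1 *R axis 1 1) x < d 1"
    using order_le_less_trans[OF norm_ge_zero y] z1(1) h[of 1] y by (simp add: dist_norm h_def)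
   then have a: "\<bar>D 1 (x + z1 *R axis 1 1) - D 1 x\<bar> <= e / 2" using d(2) by (force simp: dist_real_def)
   have "dist (x + h $ 1 *R axis 1 1 + z2 *R axis 2 1) x <= norm (h $ 1 *R axis 1 1 :: plane) + norm (z2 *R axis 2 1 :: plane)"
    by (simp add: dist_norm add.assoc) (metis norm_triangle_ineq norm_scaleR norm_axis_1 mult.right_neutral real_norm_def)
   also have "... < d 2" using z2(1) h[of 1] h[of 2] y by (simp add: h_def)
   finally have b: "\<bar>D 2 (x + h $ 1 *R axis 1 1 + z2 *R axis 2 1) - D 2 x\<bar> <= e / 2" using d(2) by (force simp: dist_real_def)
   have "g y - g x - (\<chi> i. D i x) \<bullet> h = h $ 1 * (D 1 (x + z1 *R axis 1 1) - D 1 x)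
    + h $ 2 * (D 2 (x + h $ 1 *R axis 1 1 + z2 *R axis 2 1) - D 2 x)"
    using z1(2) z2(2) by (simp add: inner_vec_def sum_2 algebra_simps)
   also have "\<bar>...\<bar> <= \<bar>h $ 1\<bar> * (e / 2) + \<bar>h $ 2\<bar> * (e / 2)"
    by (rule order_trans[OF abs_triangle_ineq], unfold abs_mult) (intro add_mono mult_left_mono a b abs_ge_zero)
   also have "... <= norm h * (e / 2) + norm h * (e / 2)"
    using h \<open>e > 0\<close> by (intro add_mono mult_right_mono) auto
   finally show "norm (g y - g x - (\<chi> i. D i x) \<bullet> (y - x)) <= e * norm (y - x)"
    by (simp add: h_def algebra_simps)
  qed
 qed
qed

lemma C1_partials:
 fixes g :: "plane => real"
 assumes D: "!!x i. ((%s. g (x + s *R axis i 1)) has_real_derivative D i x) (at 0)"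
  and C: "!!i. C_k k (D i)"
 shows "C_k (Suc k) g" "pd i g = D i"
proof -
 have der: "(g has_derivative (%h. (\<chi> i. D i x) \<bullet> h)) (at x)" for x
  by (rule C1_partialsI[OF D C_k_continuous[OF C]])
 have ax: "(\<chi> i. D i x) \<bullet> axis j 1 = D j x" for x j by (simp add: inner_axis)
 show "pd i g = D i"
  using dir_deriv_eq[OF der] ax by auto
 show "C_k (Suc k) g"
  by (rule C_k_SucI[OF der]) (auto simp: Basis_plane ax C)
qed

subsection \<open>Translation invariant operators\<close>

text \<open>Bounded linear operators on the continuous functions of the torus that commute with
  translations; \<open>C\<close> bounds their norm. Averages, resolvents and derivatives of
  resolvents are all of this kind, and therefore commute with differentiation.\<close>

definition trans_inv :: "((plane => real) => (plane => real)) => real => bool" where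
 "trans_inv E C \<longleftrightarrow> 0 <= C & (ALL g. cper g --> cper (E g)) &
  (ALL g h. cper g --> cper h --> E (%x. g x + h x) = (%x. E g x + E h x)) &
  (ALL c g. cper g --> E (%x. c * g x) = (%x. c * E g x)) &
  (ALL a g. cper g --> E (%x. g (x + a)) = (%x. E g (x + a))) &
  (ALL g M. cper g --> (ALL x. \<bar>g x\<bar> <= M) --> (ALL x. \<bar>E g x\<bar> <= C * M))"

context
 fixes E C assumes E: "trans_inv E C"
begin

lemma trans_inv_cper: "cper g ==> cper (E g)"
 and trans_inv_nonneg: "0 <= C"
 and trans_inv_add: "cper g ==> cper h ==> E (%x. g x + h x) = (%x. E g x + E h x)"
 and trans_inv_cmult: "cper g ==> E (%x. c * g x) = (%x. c * E g x)"
 and trans_inv_translate: "cper g ==> E (%x. g (x + a)) = (%x. E g (x + a))"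
 and trans_inv_bound: "cper g ==> (!!x. \<bar>g x\<bar> <= M) ==> \<bar>E g x\<bar> <= C * M"
 using E unfolding trans_inv_def by blast+

lemma trans_inv_diff:
 assumes "cper g" "cper h" shows "E (%x. g x - h x) = (%x. E g x - E h x)"
 using trans_inv_add[OF assms(1), of "%x. -1 * h x"] trans_inv_cmult[OF assms(2), of "-1"]
  cper_minus[OF assms(2)] by (simp add: fun_eq_iff)

lemma trans_inv_near:
 assumes "cper g" "cper h" "!!x. \<bar>g x - h x\<bar> <= M"
 shows "\<bar>E g x - E h x\<bar> <= C * M"
 using trans_inv_bound[OF cper_diff[OF assms(1,2)] assms(3), of x] trans_inv_diff[OF assms(1,2)] by simp

lemma trans_inv_partial:
 assumes g: "C_k 1 g" "periodic g" and b: "b \<in> Basis"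
 shows "((%s. E g (x + s *R b)) has_real_derivative E (dir_deriv b g) x) (at 0)"
proof -
 have c: "cper g" "cper (dir_deriv b g)"
  using g b cper_dir_deriv[of 0 g b] C_k_cper[of 1 g] by auto
 have "((%h. (E g (x + h *R b) - E g x) / h) \<longlongrightarrow> E (dir_deriv b g) x) (at 0)"
  unfolding LIM_eq
 proof (intro allI impI)
  fix r :: real assume r: "0 < r"
  \<comment> \<open>The added 1 keeps the quotient meaningful when C = 0.\<close>
  define e where "e = r / (2 * (C + 1))"
  have e: "0 < e" "C * e < r"
   using r trans_inv_nonneg by (auto simp: e_def field_simps intro!: add_nonneg_pos)
  obtain d where d: "d > 0" "!!x t. \<bar>t\<bar> < d ==> \<bar>g (x + t *R b) - g x - t * dir_deriv b g x\<bar> <= e * \<bar>t\<bar>"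
   using difference_quotient_uniform[OF g b e(1)] by blast
  show "EX s>0. ALL h. h ~= 0 & norm (h - 0) < s --> norm ((E g (x + h *R b) - E g x) / h - E (dir_deriv b g) x) < r"
  proof (intro exI[of _ d] conjI allI impI, rule d(1))
   fix h :: real assume h: "h ~= 0 & norm (h - 0) < d"
   define q where "q = (%y. (1 / h) * (g (y + h *R b) - g y))"
   have cq: "cper q" unfolding q_def by (intro cper_intros c)
   have "\<bar>q y - dir_deriv b g y\<bar> <= e" for y
   proof -
    have "\<bar>g (y + h *R b) - g y - h * dir_deriv b g y\<bar> / \<bar>h\<bar> <= e"
     using d(2)[of h y] h by (simp add: field_simps)
    moreover have "q y - dir_deriv b g y = (g (y + h *R b) - g y - h * dir_deriv b g y) / h"
     using h by (simp add: q_def field_simps)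
    ultimately show ?thesis by simp
   qed
   then have "\<bar>E q x - E (dir_deriv b g) x\<bar> <= C * e"
    by (rule trans_inv_near[OF cq c(2)])
   moreover have "E q = (%y. (1 / h) * (E g (y + h *R b) - E g y))"
    unfolding q_def
    by (subst trans_inv_cmult, intro cper_intros c)
     (simp add: trans_inv_diff cper_translate c trans_inv_translate)
   ultimately show "norm ((E g (x + h *R b) - E g x) / h - E (dir_deriv b g) x) < r"
    using e(2) by simp
  qed
 qed
 then show ?thesis by (simp add: DERIV_def)
qed

lemma trans_inv_C_k:
 "C_k k g ==> periodic g ==> C_k k (E g)"
proof (induction k arbitrary: g)
 case 0
 then show ?case using trans_inv_cper[of g] by (auto simp: cper_def)
next
 case (Suc k)
 have g1: "C_k 1 g" using C_k_mono[OF Suc.prems(1), of 1] by simp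
 have "C_k k (E (pd i g))" for i
  using Suc.prems by (intro Suc.IH periodic_dir_deriv) auto
 then show ?case
  by (intro C1_partials(1)[OF trans_inv_partial[OF g1 Suc.prems(2) axis_in_Basis_plane]])
qed

lemma trans_inv_dir_deriv:
 assumes "C_k 1 g" "periodic g" "b \<in> Basis"
 shows "dir_deriv b (E g) = E (dir_deriv b g)"
proof -
 have "C_k 0 (E (pd i g))" for i
  using cperD(1)[OF trans_inv_cper[OF cper_dir_deriv[of 0 g "axis i 1"]]] assms by simp
 from C1_partials(2)[OF trans_inv_partial[OF assms(1,2) axis_in_Basis_plane] this]
 show ?thesis using assms(3) by (auto simp: Basis_plane)
qed

end

subsection \<open>Steklov averages\<close>

text \<open>The average over a segment of length r is written over the unit interval; this covers r
  = 0 and makes linearity and translation invariance immediate.\<close>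

definition stek1 :: "2 => real => (plane => real) => plane => real" where
 "stek1 i r g x = integral {0..1} (%s. g (x + (r * s) *R axis i 1))"

definition stek :: "real => (plane => real) => plane => real" where
 "stek r g = stek1 1 r (stek1 2 r g)"

lemma cper_line_continuous: "cper g ==> continuous_on S (%s. g (x + (r * s) *R b))"
 by (rule continuous_on_compose2[OF cperD(1)[of g UNIV]]) (auto intro!: continuous_intros)

lemma stek1_integrable: "cper g ==> (%s. g (x + (r * s) *R axis i 1) :: real) integrable_on {0..1}"
 by (intro integrable_continuous_interval cper_line_continuous)

lemma stek1_near:
 assumes "cper g" "!!s. s \<in> {0..1} ==> \<bar>g (x + (r * s) *R axis i 1) - c\<bar> <= M"
 shows "\<bar>stek1 i r g x - c\<bar> <= M"
proof -
 have "stek1 i r g x - c = integral {0..1} (%s. g (x + (r * s) *R axis i 1) - c)"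
  unfolding stek1_def by (subst integral_diff[OF stek1_integrable[OF assms(1)]]) auto
 moreover have "\<bar>integral (cbox 0 1) (%s. g (x + (r * s) *R axis i 1) - c)\<bar> <= M * Henstock_Kurzweil_Integration.content (cbox 0 (1::real))"
  unfolding real_norm_def[symmetric]
  using assms(2)[of 0]
  by (intro integrable_bound) (auto intro!: integrable_diff stek1_integrable[OF assms(1)] assms(2))
 ultimately show ?thesis by simp
qed

lemma stek1_trans_inv: "trans_inv (stek1 i r) 1"
 unfolding trans_inv_def
proof (intro conjI allI impI)
 fix g :: "plane => real" assume g: "cper g"
 show "cper (stek1 i r g)"
  unfolding cper_def
 proof
  show "continuous_on UNIV (stek1 i r g)"
   unfolding continuous_on_iff
  proof (intro ballI allI impI)
   fix x and e :: real assume "0 < e"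
   then obtain d where d: "d > 0" "!!x y. dist x y < d ==> dist (g x) (g y) < e / 2"
    using cper_uniform[OF g, of "e / 2"] by auto
   have "dist (stek1 i r g y) (stek1 i r g x) < e" if "dist y x < d" for y
   proof -
    have *: "\<bar>(g (y + (r * s) *R axis i 1) - g (x + (r * s) *R axis i 1)) - 0\<bar> <= e / 2" for s
     using d(2)[of "y + (r * s) *R axis i 1" "x + (r * s) *R axis i 1"] that
     by (simp add: dist_norm)
    have eq: "x + c + (y - x) = y + c" for c by simp
    have "\<bar>stek1 i r (%z. g (z + (y - x)) - g z) x - 0\<bar> <= e / 2"
     by (rule stek1_near, intro cper_diff cper_translate g, subst eq, rule *)
    moreover have "stek1 i r (%z. g (z + (y - x)) - g z) x = stek1 i r g y - stek1 i r g x"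
     unfolding stek1_def eq by (rule integral_diff[OF stek1_integrable[OF g] stek1_integrable[OF g]])
    ultimately show ?thesis using \<open>0 < e\<close> by (simp add: dist_real_def)
   qed
   then show "EX d>0. \<forall>x'\<in>UNIV. dist x' x < d --> dist (stek1 i r g x') (stek1 i r g x) < e"
    using d(1) by blast
  qed
  show "periodic (stek1 i r g)"
   unfolding periodic_def
  proof safe
   fix k x :: plane assume "k \<in> int_lattice"
   then have "g (x + k + y) = g (x + y)" for y
    using periodicD[OF cperD(2)[OF g], of k "x + y"] by (simp add: algebra_simps)
   then show "stek1 i r g (x + k) = stek1 i r g x" by (simp add: stek1_def)
  qed
 qed
next
 fix g :: "plane => real" and M x assume g: "cper g" "ALL x. \<bar>g x\<bar> <= M"
 then show "\<bar>stek1 i r g x\<bar> <= 1 * M" using stek1_near[OF g(1), of x r i 0 M] by simp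
qed (auto simp: stek1_def fun_eq_iff integral_add stek1_integrable add_ac)

lemma stek1_partial:
 assumes g: "cper g" and r: "r > 0"
 shows "((%s. stek1 i r g (x + s *R axis i 1)) has_real_derivative (g (x + r *R axis i 1) - g x) / r) (at 0)"
proof -
 define \<gamma> where "\<gamma> u = g (x + u *R axis i 1)" for u
 have c: "continuous_on S \<gamma>" for S
  using cper_line_continuous[OF g, of S x 1] by (simp add: \<gamma>_def[abs_def])
 \<comment> \<open>The primitive lives on an interval exceeding [0, r] by 1 at each end, because the
   two-sided derivative at s = 0 involves the windows [s, s + r] for s near 0 of either
   sign.\<close>
 obtain \<Gamma> where \<Gamma>: "!!u. u \<in> {-1..r+1} ==> (\<Gamma> has_vector_derivative \<gamma> u) (at u within {-1..r+1})"
  using antiderivative_continuous[OF c[of "{-1..r+1}"]] by blast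
 have \<Gamma>': "(\<Gamma> has_real_derivative \<gamma> u) (at u)" if "u \<in> {-1<..<r+1}" for u
 proof -
  have "(\<Gamma> has_vector_derivative \<gamma> u) (at u within {-1<..<r+1})"
   by (rule has_vector_derivative_within_subset[OF \<Gamma>]) (use that in auto)
  then show ?thesis
   using that at_within_open[of u "{-1<..<r+1}"] by (simp add: has_real_derivative_iff_has_vector_derivative)
 qed
 have st: "stek1 i r g (x + s *R axis i 1) = (\<Gamma> (s + r) - \<Gamma> s) / r" if s: "\<bar>s\<bar> < 1" for s
 proof -
  have "((%\<sigma>. \<gamma> (s + r * \<sigma>)) has_integral (\<Gamma> (s + r * 1) / r - \<Gamma> (s + r * 0) / r)) {0..1}"
  proof (rule fundamental_theorem_of_calculus)
   fix \<sigma> :: real assume \<sigma>: "\<sigma> \<in> {0..1}"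
   then have "r * \<sigma> <= r" "0 <= r * \<sigma>" using r mult_left_le[of \<sigma> r] by auto
   then have "(\<Gamma> has_real_derivative \<gamma> (s + r * \<sigma>)) (at (s + r * \<sigma>))"
    using s by (intro \<Gamma>') auto
   then have "((%\<sigma>. \<Gamma> (s + r * \<sigma>)) has_real_derivative \<gamma> (s + r * \<sigma>) * r) (at \<sigma>)"
    by (rule DERIV_chain2) (auto intro!: derivative_eq_intros)
   from DERIV_cdivide[OF this, of r]
   have "((%\<sigma>. \<Gamma> (s + r * \<sigma>) / r) has_real_derivative \<gamma> (s + r * \<sigma>)) (at \<sigma>)"
    using r by simp
   then show "((%\<sigma>. \<Gamma> (s + r * \<sigma>) / r) has_vector_derivative \<gamma> (s + r * \<sigma>)) (at \<sigma> within {0..1})"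
    by (auto simp: has_real_derivative_iff_has_vector_derivative intro: has_vector_derivative_at_within)
  qed simp
  then show ?thesis
   by (simp add: stek1_def \<gamma>_def integral_unique algebra_simps diff_divide_distrib)
 qed
 have "((%s. (\<Gamma> (s + r) - \<Gamma> s) / r) has_real_derivative (\<gamma> r - \<gamma> 0) / r) (at 0)"
 proof -
  have "(\<Gamma> has_real_derivative \<gamma> (0 + r)) (at (0 + r))" "(\<Gamma> has_real_derivative \<gamma> 0) (at 0)"
   using r by (auto intro!: \<Gamma>')
  then show ?thesis
   using r unfolding DERIV_shift
   by (auto intro!: DERIV_cdivide DERIV_diff)
 qed
 then have "((%s. stek1 i r g (x + s *R axis i 1)) has_real_derivative (\<gamma> r - \<gamma> 0) / r) (at 0)"
  by (rule has_field_derivative_transform_within_open[where S="ball 0 1"])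
   (auto simp: st dist_real_def)
 then show ?thesis by (simp add: \<gamma>_def)
qed

text \<open>The fundamental theorem of calculus differentiates only the outer average, so both
  orders are needed for the two partial derivatives of \<open>stek\<close>.\<close>

lemma stek1_commute:
 assumes g: "cper g" shows "stek1 i r (stek1 j r g) = stek1 j r (stek1 i r g)"
proof
 fix x
 have c: "continuous_on (cbox (0,0) (1,1)) (%(s, t). g (x + (r * s) *R axis i 1 + (r * t) *R axis j 1))"
  unfolding split_beta
  by (rule continuous_on_compose2[OF cperD(1)[OF g, of UNIV]]) (auto intro!: continuous_intros)
 have "integral (cbox 0 1) (%s. integral (cbox 0 1) (%t. g (x + (r * s) *R axis i 1 + (r * t) *R axis j 1)))
  = integral (cbox 0 1) (%t. integral (cbox 0 1) (%s. g (x + (r * s) *R axis i 1 + (r * t) *R axis j 1)))"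
  by (rule integral_swap_continuous[OF c])
 then show "stek1 i r (stek1 j r g) x = stek1 j r (stek1 i r g) x"
  by (simp add: stek1_def add_ac)
qed

lemma trans_inv_comp:
 assumes E: "trans_inv E C" and F: "trans_inv F D"
 shows "trans_inv (%g. E (F g)) (C * D)"
 unfolding trans_inv_def
proof (intro conjI allI impI)
 show "0 <= C * D" using trans_inv_nonneg[OF E] trans_inv_nonneg[OF F] by simp
next
 fix g :: "plane => real" and M x assume "cper g" "ALL x. \<bar>g x\<bar> <= M"
 then show "\<bar>E (F g) x\<bar> <= C * D * M"
  using trans_inv_bound[OF E trans_inv_cper[OF F], of g "D * M" x] trans_inv_bound[OF F, of g M]
  by (metis mult.assoc)
qed (simp_all add: trans_inv_add[OF F] trans_inv_add[OF E] trans_inv_cmult[OF F] trans_inv_cmult[OF E]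
  trans_inv_translate[OF F] trans_inv_translate[OF E] trans_inv_cper[OF E] trans_inv_cper[OF F])

lemma stek_trans_inv: "trans_inv (stek r) 1"
 using trans_inv_comp[OF stek1_trans_inv[of 1 r] stek1_trans_inv[of 2 r]]
 by (simp add: stek_def[abs_def])

text \<open>Each partial derivative is a difference quotient of the average in the other direction,
  and averages preserve \<open>C_k\<close>; hence one derivative is gained.\<close>

lemma stek_C_k:
 assumes g: "C_k k g" "periodic g" and r: "r > 0"
 shows "C_k (Suc k) (stek r g)"
proof -
 have c: "cper g" using C_k_cper[OF g] .
 define D where "D i x = (stek1 (if i = 1 then 2 else 1) r g (x + r *R axis i 1) - stek1 (if i = 1 then 2 else 1) r g x) / r" for i :: 2 and x
 have "((%s. stek r g (x + s *R axis i 1)) has_real_derivative D i x) (at 0)" for x i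
 proof (cases "i = 1")
  case True
  then show ?thesis unfolding stek_def D_def
   using stek1_partial[OF trans_inv_cper[OF stek1_trans_inv c] r] by simp
 next
  case False
  then have i: "i = 2" using exhaust_2 by blast
  show ?thesis unfolding stek_def D_def i stek1_commute[OF c, of 1 r 2]
   using stek1_partial[OF trans_inv_cper[OF stek1_trans_inv c] r] by simp
 qed
 moreover have "C_k k (D i)" for i
 proof -
  have "C_k k (stek1 j r g)" for j
   by (rule trans_inv_C_k[OF stek1_trans_inv g])
  then show ?thesis unfolding D_def[abs_def] divide_inverse
   by (intro C_k_mult[OF C_k_diff[OF C_k_translate] C_k_const])
 qed
 ultimately show ?thesis by (rule C1_partials(1))
qed

lemma stek_near:
 assumes "cper g" "0 <= r" "!!y. norm y <= 2 * r ==> \<bar>g (x + y) - c\<bar> <= M"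
 shows "\<bar>stek r g x - c\<bar> <= M"
 unfolding stek_def
proof (rule stek1_near[OF trans_inv_cper[OF stek1_trans_inv assms(1)]])
 fix s :: real assume s: "s \<in> {0..1}"
 show "\<bar>stek1 2 r g (x + (r * s) *R axis 1 1) - c\<bar> <= M"
 proof (rule stek1_near[OF assms(1)])
  fix t :: real assume t: "t \<in> {0..1}"
  have "norm ((r * s) *R axis 1 1 + (r * t) *R axis 2 1 :: plane) <= \<bar>r * s\<bar> + \<bar>r * t\<bar>"
   by (rule order_trans[OF norm_triangle_ineq]) simp
  also have "... <= 2 * r" using s t assms(2) by (auto simp: abs_mult intro!: mult_left_le add_mono) (metis add_mono mult_2 mult_left_le)
  finally show "\<bar>g (x + (r * s) *R axis 1 1 + (r * t) *R axis 2 1) - c\<bar> <= M"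
   using assms(3) by (simp add: add.assoc)
 qed
qed

lemma stek_nonneg:
 assumes "cper g" "!!x. 0 <= g x" shows "0 <= stek r g x"
proof -
 have "0 <= stek1 i r h x" if "cper h" "!!x. 0 <= h x" for h i x
  unfolding stek1_def using that by (intro integral_nonneg stek1_integrable) auto
 then show ?thesis unfolding stek_def
  using assms trans_inv_cper[OF stek1_trans_inv assms(1)] by blast
qed

lemma stek_tendsto:
 assumes g: "cper g" and e: "0 < e"
 shows "EX d>0. ALL r x. 0 <= r --> r < d --> \<bar>stek r g x - g x\<bar> <= e"
proof -
 obtain d where d: "d > 0" "!!x y. dist x y < d ==> dist (g x) (g y) < e"
  using cper_uniform[OF g e] by blast
 have "\<bar>stek r g x - g x\<bar> <= e" if "0 <= r" "r < d / 2" for r x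
 proof (rule stek_near[OF g that(1)])
  fix y :: plane assume "norm y <= 2 * r"
  then have "dist (x + y) x < d" using that by (simp add: dist_norm)
  then show "\<bar>g (x + y) - g x\<bar> <= e" using d(2) by (force simp: dist_real_def)
 qed
 then show ?thesis using d(1) by (intro exI[of _ "d / 2"]) auto
qed

text \<open>Each averaging gains one derivative and costs half of the remaining error. Averages of
  nonnegative functions are nonnegative, which \<open>elliptic_sol_nonneg\<close> relies on.\<close>

lemma cper_approx_C_k:
 assumes g: "cper (g :: plane => real)" and e: "0 < e"
 shows "EX h. C_k k h & periodic h & (ALL x. \<bar>h x - g x\<bar> <= e) & ((ALL x. 0 <= g x) --> (ALL x. 0 <= h x))"
 using e
proof (induction k arbitrary: e)
 case 0
 then show ?case using g by (intro exI[of _ g]) (auto simp: cper_def)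
next
 case (Suc k)
 then obtain h where h: "C_k k h" "periodic h" "ALL x. \<bar>h x - g x\<bar> <= e / 2" "(ALL x. 0 <= g x) --> (ALL x. 0 <= h x)"
  using half_gt_zero by blast
 have c: "cper h" using C_k_cper[OF h(1,2)] .
 obtain d where d: "d > 0" "!!r x. 0 <= r ==> r < d ==> \<bar>stek r h x - h x\<bar> <= e / 2"
  using stek_tendsto[OF c, of "e / 2"] Suc.prems by auto
 show ?case
 proof (intro exI[of _ "stek (d / 2) h"] conjI allI impI)
  show "C_k (Suc k) (stek (d / 2) h)" using d(1) by (intro stek_C_k h) auto
  show "periodic (stek (d / 2) h)" using trans_inv_cper[OF stek_trans_inv c] by (simp add: cper_def)
  show "\<bar>stek (d / 2) h x - g x\<bar> <= e" for x using d(2)[of "d / 2" x] h(3)[rule_format, of x] d(1) by linarith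
  show "0 <= stek (d / 2) h x" if "ALL x. 0 <= g x" for x
   using stek_nonneg[OF c] h(4) that by blast
 qed
qed

text \<open>Averages commute with partial derivatives, so the gradients converge as uniformly as the
  values do.\<close>

lemma C1_approx_C2:
 assumes g: "C_k 1 g" "periodic g" and e: "0 < e"
 shows "EX h. C_k 2 h & periodic h & (ALL x. \<bar>h x - g x\<bar> <= e) & (ALL x. norm (grad h x - grad g x) <= e)"
proof -
 have c: "cper g" "cper (pd i g)" for i
  using g cper_dir_deriv[of 0 g] C_k_cper[of 1 g] by auto
 have "EX d>0. ALL r x. 0 <= r --> r < d --> \<bar>stek r (pd i g) x - pd i g x\<bar> <= e / 2" for i
  using stek_tendsto[OF c(2), of "e / 2"] half_gt_zero[OF e] by blast
 then obtain d where d: "d i > 0" "!!r x. 0 <= r ==> r < d i ==> \<bar>stek r (pd i g) x - pd i g x\<bar> <= e / 2" for i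
  by metis
 obtain d0 where d0: "d0 > 0" "!!r x. 0 <= r ==> r < d0 ==> \<bar>stek r g x - g x\<bar> <= e"
  using stek_tendsto[OF c(1) e] by blast
 define r where "r = min d0 (min (d 1) (d 2)) / 2"
 have r: "0 < r" "r < d 1" "r < d 2" "r < d0" using d(1)[of 1] d(1)[of 2] d0(1) by (auto simp: r_def min_def)
 have "\<bar>stek r g x - g x\<bar> <= e" for x using d0(2) r by simp
 moreover
 have "C_k 2 (stek r g)" using stek_C_k[OF g r(1)] by (simp add: numeral_2_eq_2)
 moreover have "periodic (stek r g)" using trans_inv_cper[OF stek_trans_inv c(1)] by (simp add: cper_def)
 moreover have "norm (grad (stek r g) x - grad g x) <= e" for x
 proof -
  have "grad (stek r g) x - grad g x = (\<Sum>b\<in>Basis. (stek r (dir_deriv b g) x - dir_deriv b g x) *R b)"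
   using trans_inv_dir_deriv[OF stek_trans_inv g]
   by (simp add: grad_def sum_subtractf scaleR_diff_left)
  also have "norm ... <= (\<Sum>b\<in>(Basis::plane set). e / 2)"
   using d(2)[of r 1 x] d(2)[of r 2 x] r by (intro sum_norm_le) (auto simp: Basis_plane)
  finally show ?thesis by simp
 qed
 ultimately show ?thesis by blast
qed

subsection \<open>Uniform limits\<close>

lemma cper_uniform_limit:
 fixes F :: "nat => plane => real"
 assumes "!!n. cper (F n)" "!!e. e > 0 ==> EX N. ALL n>=N. ALL x. \<bar>F n x - f x\<bar> <= e"
 shows "cper f"
 unfolding cper_def
proof
 have "uniform_limit UNIV F f sequentially"
  unfolding uniform_limit_sequentially_iff
 proof (intro allI impI)
  fix e :: real assume "e > 0"
  then obtain N where N: "!!n x. n >= N ==> \<bar>F n x - f x\<bar> <= e / 2" using assms(2)[OF half_gt_zero] by blast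
  have "dist (F n x) (f x) < e" if "n >= N" for n x
   using N[OF that, of x] \<open>e > 0\<close> by (simp add: dist_real_def)
  then show "EX N. ALL n>=N. \<forall>x\<in>UNIV. dist (F n x) (f x) < e" by blast
 qed
 then show "continuous_on UNIV f"
  by (rule uniform_limit_theorem[rotated]) (auto intro!: always_eventually cperD(1)[OF assms(1)])
 show "periodic f"
  unfolding periodic_def
 proof safe
  fix k x :: plane assume k: "k \<in> int_lattice"
  have "\<bar>f (x + k) - f x\<bar> <= e" if "e > 0" for e
  proof -
   obtain N where "ALL n>=N. ALL x. \<bar>F n x - f x\<bar> <= e / 2" using assms(2)[of "e/2"] \<open>e > 0\<close> by (meson half_gt_zero)
   then have "\<bar>F N (x + k) - f (x + k)\<bar> <= e / 2" "\<bar>F N x - f x\<bar> <= e / 2" by auto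
   moreover have "F N (x + k) = F N x" using periodicD[OF cperD(2)[OF assms(1)] k] .
   ultimately show ?thesis by linarith
  qed
  from field_le_epsilon[of "\<bar>f (x + k) - f x\<bar>" 0] this show "f (x + k) = f x" by simp
 qed
qed

lemma cper_Cauchy:
 assumes "!!n. cper (F n :: plane => real)" "!!e. e > 0 ==> EX N. ALL m>=N. ALL n>=N. ALL x. \<bar>F m x - F n x\<bar> <= e"
 shows "cper (%x. lim (%n. F n x))" "!!e. e > 0 ==> EX N. ALL n>=N. ALL x. \<bar>F n x - lim (%n. F n x)\<bar> <= e"
proof -
 have lim: "(%n. F n x) \<longlonglongrightarrow> lim (%n. F n x)" for x
 proof -
  have "Cauchy (%n. F n x)"
   unfolding Cauchy_def
  proof (intro allI impI)
   fix e :: real assume "e > 0"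
   then obtain N where N: "!!m n. m >= N ==> n >= N ==> \<bar>F m x - F n x\<bar> <= e / 2"
    using assms(2)[OF half_gt_zero] by blast
   have "dist (F m x) (F n x) < e" if "m >= N" "n >= N" for m n
   proof -
    have "\<bar>F m x - F n x\<bar> <= e / 2" using N that by blast
    then show ?thesis using \<open>e > 0\<close> by (simp add: dist_real_def)
   qed
   then show "EX M. ALL m>=M. ALL n>=M. dist (F m x) (F n x) < e" by blast
  qed
  then show ?thesis by (simp add: Cauchy_convergent_iff convergent_LIMSEQ_iff)
 qed
 show *: "EX N. ALL n>=N. ALL x. \<bar>F n x - lim (%n. F n x)\<bar> <= e" if "e > 0" for e
 proof -
  obtain N where N: "ALL m>=N. ALL n>=N. ALL x. \<bar>F m x - F n x\<bar> <= e" using assms(2)[OF \<open>e > 0\<close>] by blast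
  have "\<bar>F n x - lim (%n. F n x)\<bar> <= e" if "n >= N" for n x
   by (rule LIMSEQ_le_const2[OF tendsto_rabs[OF tendsto_diff[OF tendsto_const lim]]])
    (use N that in blast)
  then show ?thesis by blast
 qed
 show "cper (%x. lim (%n. F n x))" by (rule cper_uniform_limit[OF assms(1) *])
qed

text \<open>Banach's fixed point theorem for the sup norm on the torus, with the contraction phrased
  by pointwise bounds. All iterates of the zero function stay within M / (1 - q) of it, which yields
  the geometric Cauchy estimate.\<close>

lemma cper_contraction:
 assumes Q: "!!f. cper (f :: plane => real) ==> cper (Q f)"
  and c: "!!f g d x. cper f ==> cper g ==> (!!x. \<bar>f x - g x\<bar> <= d) ==> \<bar>Q f x - Q g x\<bar> <= q * d"
  and q: "0 <= q" "q < 1"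
 shows "EX f. cper f & Q f = f"
proof -
 define F where "F n = (Q ^^ n) (%x. 0)" for n
 have F: "cper (F n)" "F (Suc n) = Q (F n)" for n
  by (induction n) (auto simp: F_def Q)
 obtain M where M: "!!x. \<bar>F 1 x - F 0 x\<bar> <= M"
  using cper_bounded[OF cper_diff[OF F(1)[of 1] F(1)[of 0]]] by auto
 have D: "\<bar>F k x - F 0 x\<bar> <= M / (1 - q)" for k x
 proof (induction k arbitrary: x)
  case 0
  then show ?case using M[of x] q by (auto intro: order_trans[of _ "\<bar>F 1 x - F 0 x\<bar>"])
 next
  case (Suc k)
  have "\<bar>F (Suc k) x - F (Suc 0) x\<bar> <= q * (M / (1 - q))"
   unfolding F(2) by (intro c F Suc)
  then have "\<bar>F (Suc k) x - F 0 x\<bar> <= q * (M / (1 - q)) + M" using M[of x] by simp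
  also have "... = M / (1 - q)" using q by (simp add: field_simps)
  finally show ?case .
 qed
 have C: "\<bar>F (n + k) x - F n x\<bar> <= q ^ n * (M / (1 - q))" for n k x
 proof (induction n arbitrary: x)
  case (Suc n)
  then show ?case using c[OF F(1)[of "n + k"] F(1)[of n] Suc] F(2) by (simp add: mult.assoc)
 qed (use D in auto)
 have "(%n. q ^ n * (M / (1 - q))) \<longlonglongrightarrow> 0 * (M / (1 - q))"
  by (intro tendsto_mult tendsto_const LIMSEQ_realpow_zero q)
 then have small: "EX N. ALL n>=N. q ^ n * (M / (1 - q)) <= e" if "e > 0" for e
  using order_tendstoD(2)[of _ 0 sequentially e] that
  unfolding eventually_sequentially by (simp, meson less_imp_le)
 have "EX N. ALL m>=N. ALL n>=N. ALL x. \<bar>F m x - F n x\<bar> <= e" if "e > 0" for e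
 proof -
  obtain N where N: "ALL n>=N. q ^ n * (M / (1 - q)) <= e / 2" using small[of "e / 2"] \<open>e > 0\<close> by (meson half_gt_zero)
  have "\<bar>F m x - F N x\<bar> <= e / 2" if "m >= N" for m x
   using order_trans[OF C[of N "m - N" x] N[rule_format, of N]] that by simp
  note N' = this
  have "\<bar>F m x - F n x\<bar> <= e" if "m >= N" "n >= N" for m n x
   using N'[OF that(1), of x] N'[OF that(2), of x] by linarith
  then show ?thesis by blast
 qed
 note lim = cper_Cauchy[OF F(1) this]
 define f where "f x = lim (%n. F n x)" for x
 have f: "cper f" and conv: "!!e. e > 0 ==> EX N. ALL n>=N. ALL x. \<bar>F n x - f x\<bar> <= e"
  using lim by (simp_all add: f_def[abs_def])
 have "Q f x = f x" for x
 proof -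
  have "\<bar>Q f x - f x\<bar> <= e" if "e > 0" for e
  proof -
   obtain N where N: "ALL n>=N. ALL x. \<bar>F n x - f x\<bar> <= e / 2" using conv[of "e/2"] \<open>e > 0\<close> by auto
   then have "\<bar>Q (F N) x - Q f x\<bar> <= q * (e / 2)" by (intro c F f) auto
   moreover have "q * (e / 2) <= e / 2" using q that by simp
   moreover have "\<bar>Q (F N) x - f x\<bar> <= e / 2" using N[rule_format, of "Suc N" x] F(2) by simp
   ultimately show ?thesis by linarith
  qed
  from field_le_epsilon[of "\<bar>Q f x - f x\<bar>" 0] this show ?thesis by simp
 qed
 then show ?thesis using f by blast
qed

lemma C1_uniform_limit:
 fixes g :: "nat => plane => real"
 assumes g: "!!n. C_k 1 (g n)" "!!n. periodic (g n)"
  and lim: "!!e. e > 0 ==> EX N. ALL n>=N. ALL x. \<bar>g n x - f x\<bar> <= e"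
  and lim': "!!i e. e > 0 ==> EX N. ALL n>=N. ALL x. \<bar>pd i (g n) x - D i x\<bar> <= e"
 shows "C_k 1 f" "pd i f = D i"
proof -
 have D: "cper (D i)" for i
 proof (rule cper_uniform_limit[of "%n. pd i (g n)"])
  show "cper (pd i (g n))" for n
   using cper_dir_deriv[of 0 "g n" "axis i 1"] g(1)[of n] g(2)[of n] by simp
 qed (rule lim')
 have "((%s. f (x + s *R axis i 1)) has_real_derivative D i x) (at 0)" for x i
  unfolding DERIV_def LIM_eq
 proof (intro allI impI)
  fix r :: real assume "r > 0"
  then have "r / 4 > 0" by simp
  from cper_uniform[OF D this]
  obtain d where d: "d > 0" "!!x y. dist x y < d ==> dist (D i x) (D i y) < r / 4"
   by blast
  show "EX s>0. ALL h. h ~= 0 & norm (h - 0) < s -->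
   norm ((f (x + (0 + h) *R axis i 1) - f (x + 0 *R axis i 1)) / h - D i x) < r"
  proof (intro exI[of _ d] conjI d(1) allI impI)
   fix h :: real assume h: "h ~= 0 & norm (h - 0) < d"
   \<comment> \<open>The error in the values is divided by the increment h, so it must be small
     relative to h; hence n is chosen after h.\<close>
   define e where "e = r / 8 * \<bar>h\<bar>"
   have e: "e > 0" using h \<open>r > 0\<close> by (simp add: e_def)
   obtain N1 where N1: "ALL n>=N1. ALL x. \<bar>g n x - f x\<bar> <= e" using lim[OF e] by blast
   obtain N2 where N2: "ALL n>=N2. ALL x. \<bar>pd i (g n) x - D i x\<bar> <= r / 4" using lim'[of "r/4" i] \<open>r > 0\<close> by auto
   define n where "n = max N1 N2"
   have gd: "g n differentiable (at y)" for y using g(1)[of n] by simp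
   obtain z where z: "\<bar>z\<bar> <= \<bar>h\<bar>" "g n (x + h *R axis i 1) - g n (x + 0 *R axis i 1) = h * pd i (g n) (x + z *R axis i 1)"
    using mvt_line[of "%s. g n (x + s *R axis i 1)", OF dir_deriv_line_real[OF gd]] by blast
   let ?y = "x + z *R axis i 1"
   have "dist ?y x < d" using z(1) h by (simp add: dist_norm)
   then have a1: "\<bar>D i ?y - D i x\<bar> < r / 4" using d(2) by (force simp: dist_real_def)
   have a2: "\<bar>pd i (g n) ?y - D i ?y\<bar> <= r / 4" using N2 by (simp add: n_def)
   have a3: "\<bar>g n (x + h *R axis i 1) - f (x + h *R axis i 1)\<bar> <= e" "\<bar>g n x - f x\<bar> <= e"
    using N1 by (simp_all add: n_def)
   have "\<bar>pd i (g n) ?y - D i x\<bar> < r / 2" using a1 a2 by linarith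
   then have "\<bar>h\<bar> * \<bar>pd i (g n) ?y - D i x\<bar> < \<bar>h\<bar> * (r / 2)"
    using h by (intro mult_strict_left_mono) auto
   then have "\<bar>h * pd i (g n) ?y - h * D i x\<bar> < \<bar>h\<bar> * (r / 2)"
    by (simp add: abs_mult[symmetric] right_diff_distrib)
   then have "\<bar>f (x + h *R axis i 1) - f x - h * D i x\<bar> < \<bar>h\<bar> * (r / 2) + 2 * e"
    using a3 z(2) by (simp, linarith)
   also have "... <= \<bar>h\<bar> * r" using \<open>r > 0\<close> by (simp add: e_def algebra_simps)
   finally have "\<bar>f (x + h *R axis i 1) - f x - h * D i x\<bar> / \<bar>h\<bar> < r"
    using h by (simp add: field_simps)
   moreover have "(f (x + h *R axis i 1) - f x) / h - D i x = (f (x + h *R axis i 1) - f x - h * D i x) / h"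
    using h by (simp add: field_simps)
   ultimately show "norm ((f (x + (0 + h) *R axis i 1) - f (x + 0 *R axis i 1)) / h - D i x) < r"
    by simp
  qed
 qed
 note * = C1_partials[OF this, of 0]
 show "C_k 1 f" "pd i f = D i"
  using *(1) *(2)[of i] cperD(1)[OF D] by auto
qed

subsection \<open>The resolvent of the Laplacian\<close>

text \<open>The five-point difference Laplacian, acting on functions of a continuous variable, so
  that the step h need not be commensurable with the lattice.\<close>

definition lap_h :: "real => (plane => real) => plane => real" where
 "lap_h h f x = (\<Sum>b\<in>Basis. (f (x + h *R b) + f (x - h *R b) - 2 * f x) / h\<^sup>2)"

lemma lap_h_eq: "lap_h h f x =
 (f (x + h *R axis 1 1) + f (x - h *R axis 1 1) + f (x + h *R axis 2 1) + f (x - h *R axis 2 1) - 4 * f x) / h\<^sup>2"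
 by (simp add: lap_h_def sum_Basis_plane add_divide_distrib diff_divide_distrib)

lemma cper_translate_diff: "cper g ==> cper (%x. g (x - a))"
 using cper_translate[of g "- a"] by simp

lemma cper_lap_h: "cper f ==> cper (lap_h h f)"
 unfolding lap_h_eq[abs_def] divide_inverse by (intro cper_intros cper_translate_diff)

lemma trans_inv_lap_h:
 assumes E: "trans_inv E C" and f: "cper f"
 shows "E (lap_h h f) = lap_h h (E f)"
proof -
 have tr: "E (%x. f (x - a)) = (%x. E f (x - a))" for a
  using trans_inv_translate[OF E f, of "- a"] by simp
 define S where "S = (%x. f (x + h *R axis 1 1) + f (x - h *R axis 1 1) + f (x + h *R axis 2 1) + f (x - h *R axis 2 1) - 4 * f x)"
 have cS: "cper S" unfolding S_def by (intro cper_intros cper_translate_diff f)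
 have ES: "E S = (%x. E f (x + h *R axis 1 1) + E f (x - h *R axis 1 1) + E f (x + h *R axis 2 1) + E f (x - h *R axis 2 1) - 4 * E f x)"
  unfolding S_def
  by (simp add: trans_inv_cmult[OF E] trans_inv_add[OF E] trans_inv_diff[OF E] cper_intros cper_translate_diff f
    trans_inv_translate[OF E] tr)
 have "lap_h h f = (%x. (1 / h\<^sup>2) * S x)" by (auto simp: lap_h_eq S_def)
 then have "E (lap_h h f) = (%x. (1 / h\<^sup>2) * E S x)" by (simp only: trans_inv_cmult[OF E cS])
 then show ?thesis unfolding ES by (auto simp: lap_h_eq)
qed

lemma lap_h_add: "lap_h h (%x. f x + g x) x = lap_h h f x + lap_h h g x"
 and lap_h_diff: "lap_h h (%x. f x - g x) x = lap_h h f x - lap_h h g x"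
 and lap_h_cmult: "lap_h h (%x. c * f x) x = c * lap_h h f x"
 and lap_h_translate: "lap_h h (%x. f (x + a)) x = lap_h h f (x + a)"
 by (simp_all add: lap_h_eq field_simps add_divide_distrib[symmetric])

text \<open>Discrete maximum principle: second differences are nonpositive at a maximum and
  nonnegative at a minimum.\<close>

lemma resolvent_h_bound:
 assumes "0 < l" "0 < h" "cper \<phi>" "!!x. l * \<phi> x - lap_h h \<phi> x = f x" "!!x. \<bar>f x\<bar> <= M"
 shows "\<bar>\<phi> x\<bar> <= 1 / l * M"
proof -
 obtain a where a: "!!y. \<phi> y <= \<phi> a" using cper_attains_sup[OF assms(3)] by blast
 obtain b where b: "!!y. \<phi> b <= \<phi> y" using cper_attains_inf[OF assms(3)] by blast
 have "\<phi> (a + y) + \<phi> (a - y) - 2 * \<phi> a <= 0" "\<phi> (b + y) + \<phi> (b - y) - 2 * \<phi> b >= 0" for y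
  using a[of "a + y"] a[of "a - y"] b[of "b + y"] b[of "b - y"] by linarith+
 note ab = this
 have "lap_h h \<phi> a <= 0" unfolding lap_h_def
  by (intro sum_nonpos divide_nonpos_nonneg ab) simp
 then have "l * \<phi> a <= M" using assms(4)[of a] assms(5)[of a] by linarith
 moreover have "lap_h h \<phi> b >= 0" unfolding lap_h_def
  by (intro sum_nonneg divide_nonneg_nonneg ab) simp
 then have "- M <= l * \<phi> b" using assms(4)[of b] assms(5)[of b] by linarith
 moreover have "l * \<phi> x <= l * \<phi> a" "l * \<phi> b <= l * \<phi> x" using a b assms(1) by auto
 ultimately have "\<bar>l * \<phi> x\<bar> <= M" by linarith
 then show ?thesis using assms(1) by (simp add: field_simps abs_mult)
qed

text \<open>Solving for the central value gives a fixed point equation with contraction factor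
  \<open>(4 / h\<^sup>2) / (l + 4 / h\<^sup>2)\<close>. Uniqueness is the maximum principle for the
  difference of two solutions.\<close>

lemma resolvent_h_exists:
 assumes "0 < l" "0 < h" "cper f"
 shows "\<exists>!\<phi>. cper \<phi> & (ALL x. l * \<phi> x - lap_h h \<phi> x = f x)"
proof -
 let ?c = "inverse (l + 4 / h\<^sup>2)"
 define S where "S \<phi> x = \<phi> (x + h *R axis 1 1) + \<phi> (x - h *R axis 1 1) + \<phi> (x + h *R axis 2 1) + \<phi> (x - h *R axis 2 1)" for \<phi> :: "plane => real" and x
 define Q where "Q \<phi> = (%x. ?c * (f x + (1 / h\<^sup>2) * S \<phi> x))" for \<phi>
 have pos: "l + 4 / h\<^sup>2 > 0" using assms by (intro add_pos_pos) auto
 have "\<exists>\<phi>. cper \<phi> & Q \<phi> = \<phi>"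
 proof (rule cper_contraction)
  show "cper (Q \<phi>)" if "cper \<phi>" for \<phi>
   unfolding Q_def S_def using that by (intro cper_intros cper_translate_diff assms)
  show "0 <= ?c * (4 / h\<^sup>2)" "?c * (4 / h\<^sup>2) < 1"
   using pos assms by (auto simp: field_simps)
  fix \<phi> \<psi> :: "plane => real" and d x assume "cper \<phi>" "cper \<psi>" and d: "!!x. \<bar>\<phi> x - \<psi> x\<bar> <= d"
  have "Q \<phi> x - Q \<psi> x = ?c * ((1 / h\<^sup>2) * (S \<phi> x - S \<psi> x))"
   unfolding Q_def by (simp add: algebra_simps diff_divide_distrib)
  moreover have "\<bar>S \<phi> x - S \<psi> x\<bar> <= 4 * d"
   unfolding S_def using d[of "x + h *R axis 1 1"] d[of "x - h *R axis 1 1"] d[of "x + h *R axis 2 1"] d[of "x - h *R axis 2 1"]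
   by linarith
  then have "(1 / h\<^sup>2) * \<bar>S \<phi> x - S \<psi> x\<bar> <= (1 / h\<^sup>2) * (4 * d)" by (intro mult_left_mono) auto
  then have "?c * ((1 / h\<^sup>2) * \<bar>S \<phi> x - S \<psi> x\<bar>) <= ?c * ((1 / h\<^sup>2) * (4 * d))"
   using pos by (rule_tac mult_left_mono) auto
  moreover have "\<bar>?c * ((1 / h\<^sup>2) * (S \<phi> x - S \<psi> x))\<bar> = ?c * ((1 / h\<^sup>2) * \<bar>S \<phi> x - S \<psi> x\<bar>)"
   using pos by (simp add: abs_mult)
  ultimately have "\<bar>Q \<phi> x - Q \<psi> x\<bar> <= ?c * ((1 / h\<^sup>2) * (4 * d))" by linarith
  then show "\<bar>Q \<phi> x - Q \<psi> x\<bar> <= ?c * (4 / h\<^sup>2) * d" by simp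
 qed
 then obtain \<phi> where \<phi>: "cper \<phi>" "Q \<phi> = \<phi>" by blast
 have "l * \<phi> x - lap_h h \<phi> x = f x" for x
 proof -
  have "(l + 4 / h\<^sup>2) * \<phi> x = f x + (1 / h\<^sup>2) * S \<phi> x"
   using fun_cong[OF \<phi>(2), of x] pos unfolding Q_def by (metis left_inverse mult.assoc mult_1 less_irrefl right_inverse)
  then show ?thesis unfolding lap_h_eq S_def by (simp add: algebra_simps add_divide_distrib diff_divide_distrib)
 qed
 then have ex: "cper \<phi> & (ALL x. l * \<phi> x - lap_h h \<phi> x = f x)" using \<phi> by blast
 show ?thesis
 proof (rule ex1I)
  show "cper \<phi> & (ALL x. l * \<phi> x - lap_h h \<phi> x = f x)" by (rule ex)
  fix \<psi> assume \<psi>: "cper \<psi> & (ALL x. l * \<psi> x - lap_h h \<psi> x = f x)"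
  have "\<bar>\<psi> x - \<phi> x\<bar> <= 1 / l * 0" for x
  proof (rule resolvent_h_bound[OF assms(1,2)])
   show "cper (%x. \<psi> x - \<phi> x)" using \<psi> ex by (intro cper_diff) auto
   show "l * (\<psi> x - \<phi> x) - lap_h h (%x. \<psi> x - \<phi> x) x = 0" for x
    using \<psi> ex by (simp add: lap_h_diff algebra_simps)
  qed simp
  then show "\<psi> = \<phi>" by (auto simp: fun_eq_iff)
 qed
qed

definition resolvent_h :: "real => real => (plane => real) => plane => real" where
 "resolvent_h l h f = (THE \<phi>. cper \<phi> & (ALL x. l * \<phi> x - lap_h h \<phi> x = f x))"

context
 fixes l h :: real assumes l: "0 < l" and h: "0 < h"
begin

lemma resolvent_h: "cper f ==> cper (resolvent_h l h f)"
 "cper f ==> l * resolvent_h l h f x - lap_h h (resolvent_h l h f) x = f x"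
 using theI'[OF resolvent_h_exists[OF l h]] unfolding resolvent_h_def by blast+

lemma resolvent_h_unique: "cper \<phi> ==> cper f ==> (!!x. l * \<phi> x - lap_h h \<phi> x = f x) ==> resolvent_h l h f = \<phi>"
 unfolding resolvent_h_def using resolvent_h_exists[OF l h] by (intro the1_equality) auto

lemma resolvent_h_trans_inv: "trans_inv (resolvent_h l h) (1 / l)"
 unfolding trans_inv_def
proof (intro conjI allI impI)
 show "0 <= 1 / l" using l by simp
 show "cper (resolvent_h l h g)" if "cper g" for g by (rule resolvent_h[OF that])
 show "\<bar>resolvent_h l h g x\<bar> <= 1 / l * M" if "cper g" "ALL x. \<bar>g x\<bar> <= M" for g M x
  using that by (intro resolvent_h_bound[OF l h resolvent_h]) auto
 show "resolvent_h l h (%x. g x + k x) = (%x. resolvent_h l h g x + resolvent_h l h k x)"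
  if "cper g" "cper k" for g k
  using that by (intro resolvent_h_unique cper_intros resolvent_h)
   (auto simp: lap_h_add distrib_left add_diff_add resolvent_h)
 show "resolvent_h l h (%x. c * g x) = (%x. c * resolvent_h l h g x)"
  if "cper g" for c g
 proof (intro resolvent_h_unique cper_intros resolvent_h that)
  show "l * (c * resolvent_h l h g x) - lap_h h (%x. c * resolvent_h l h g x) x = c * g x" for x
   unfolding resolvent_h(2)[OF that, symmetric, of x] by (simp add: lap_h_cmult algebra_simps)
 qed
 show "resolvent_h l h (%x. g (x + a)) = (%x. resolvent_h l h g (x + a))" if "cper g" for g a
  using that by (intro resolvent_h_unique cper_intros resolvent_h) (auto simp: lap_h_translate resolvent_h)
qed

end

text \<open>Resolvent identity. The difference solves the equation for h' with right side
  \<open>lap_h h\<close> minus \<open>lap_h h'\<close> of the solution for h. Since the resolvent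
  commutes with difference Laplacians, this right side is the resolvent of the consistency error of
  f itself, and no regularity of the solution has to be known.\<close>

lemma resolvent_h_diff:
 assumes l: "0 < l" and h: "0 < h" "0 < h'" and f: "cper f" and e: "!!x. \<bar>lap_h h f x - lap_h h' f x\<bar> <= e"
 shows "\<bar>resolvent_h l h f x - resolvent_h l h' f x\<bar> <= 1 / l * (1 / l * e)"
proof -
 let ?\<phi> = "resolvent_h l h f"
 note tih = resolvent_h_trans_inv[OF l h(1)] and tih' = resolvent_h_trans_inv[OF l h(2)]
 have c: "cper ?\<phi>" by (rule resolvent_h[OF l h(1) f])
 have "resolvent_h l h (%x. lap_h h f x - lap_h h' f x) y = lap_h h ?\<phi> y - lap_h h' ?\<phi> y" for y
  by (simp add: trans_inv_diff[OF tih] cper_lap_h f trans_inv_lap_h[OF tih])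
 with trans_inv_bound[OF tih cper_diff[OF cper_lap_h cper_lap_h, OF f f] e]
 have b: "\<bar>lap_h h ?\<phi> y - lap_h h' ?\<phi> y\<bar> <= 1 / l * e" for y by metis
 show ?thesis
 proof (rule resolvent_h_bound[OF l h(2)])
  show "cper (%x. ?\<phi> x - resolvent_h l h' f x)" by (intro cper_diff c resolvent_h[OF l h(2) f])
  show "l * (?\<phi> x - resolvent_h l h' f x) - lap_h h' (%x. ?\<phi> x - resolvent_h l h' f x) x
   = lap_h h ?\<phi> x - lap_h h' ?\<phi> x" for x
   using resolvent_h(2)[OF l h(1) f, of x] resolvent_h(2)[OF l h(2) f, of x]
   by (simp add: lap_h_diff algebra_simps)
 qed (rule b)
qed

lemma lap_h_tendsto:
 assumes f: "C_k 2 (f :: plane => real)" "periodic f" and e: "0 < e"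
 shows "EX d>0. ALL h x. 0 < h --> h < d --> \<bar>lap_h h f x - laplacian f x\<bar> <= e"
proof -
 have f2: "C_k (Suc (Suc 0)) f" using f(1) by (simp add: numeral_2_eq_2)
 have D: "EX d>0. ALL h x. 0 < h --> h < d -->
   \<bar>(f (x + h *R b) + f (x - h *R b) - 2 * f x) / h\<^sup>2 - dir_deriv b (dir_deriv b f) x\<bar> <= e / 2" if b: "b \<in> Basis" for b
 proof -
  let ?g = "dir_deriv b f"
  have g: "C_k 1 ?g" "periodic ?g" using f2 f(2) b by (auto intro: periodic_dir_deriv)
  obtain d where d: "d > 0" "!!x t. \<bar>t\<bar> < d ==> \<bar>?g (x + t *R b) - ?g x - t * dir_deriv b ?g x\<bar> <= e / 4 * \<bar>t\<bar>"
   using difference_quotient_uniform[OF g b, of "e / 4"] e by auto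
  have "\<bar>(f (x + h *R b) + f (x - h *R b) - 2 * f x) / h\<^sup>2 - dir_deriv b ?g x\<bar> <= e / 2" if h: "0 < h" "h < d" for h x
  proof -
   \<comment> \<open>The mean value theorem for this even function reduces the second difference to
     the first-order expansion of the derivative at two opposite points.\<close>
   define G where "G s = f (x + s *R b) + f (x + (- s) *R b) - s\<^sup>2 * dir_deriv b ?g x" for s
   have fd: "f differentiable (at y)" for y using f2 by simp
   have "((%s. f (x + (- s) *R b)) has_real_derivative ?g (x + (- s) *R b) * (-1)) (at s)" for s
    by (rule DERIV_chain2[OF dir_deriv_line_real[OF fd]]) (auto intro!: derivative_eq_intros)
   then have "(G has_real_derivative ?g (x + s *R b) - ?g (x + (- s) *R b) - 2 * s * dir_deriv b ?g x) (at s)" for s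
    unfolding G_def using dir_deriv_line_real[OF fd] by (auto intro!: derivative_eq_intros)
   from mvt_line[OF this, of h] obtain z where z: "\<bar>z\<bar> <= h" "G h - G 0 = h * (?g (x + z *R b) - ?g (x + (- z) *R b) - 2 * z * dir_deriv b ?g x)"
    using h by auto
   have "\<bar>?g (x + z *R b) - ?g x - z * dir_deriv b ?g x\<bar> <= e / 4 * \<bar>z\<bar>"
    "\<bar>?g (x + (-z) *R b) - ?g x - (-z) * dir_deriv b ?g x\<bar> <= e / 4 * \<bar>-z\<bar>"
    using z(1) h d(2)[of z x] d(2)[of "- z" x] by linarith+
   then have "\<bar>?g (x + z *R b) - ?g (x + (- z) *R b) - 2 * z * dir_deriv b ?g x\<bar> <= e / 2 * \<bar>z\<bar>"
   proof -
    have *: "\<bar>a - b - 2 * z * c\<bar> <= e / 2 * \<bar>z\<bar>"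
     if "\<bar>a - g - z * c\<bar> <= e / 4 * \<bar>z\<bar>" "\<bar>b - g - (-z) * c\<bar> <= e / 4 * \<bar>-z\<bar>" for a b g c
    proof -
     have "a - b - 2 * z * c = (a - g - z * c) - (b - g - (-z) * c)" by simp
     then have "\<bar>a - b - 2 * z * c\<bar> <= \<bar>a - g - z * c\<bar> + \<bar>b - g - (-z) * c\<bar>"
      by (metis abs_triangle_ineq4)
     then show ?thesis using that by simp
    qed
    show ?thesis by (rule *) fact+
   qed
   also have "... <= e / 2 * h" using z(1) e by (intro mult_left_mono) auto
   finally have "h * \<bar>?g (x + z *R b) - ?g (x + (- z) *R b) - 2 * z * dir_deriv b ?g x\<bar> <= h * (e / 2 * h)"
    using h by (intro mult_left_mono) auto
   then have "\<bar>G h - G 0\<bar> <= e / 2 * h\<^sup>2"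
    using h unfolding z(2) abs_mult by (simp add: power2_eq_square)
   then have "\<bar>G h - G 0\<bar> / h\<^sup>2 <= e / 2" using h by (simp add: field_simps)
   moreover have "(f (x + h *R b) + f (x - h *R b) - 2 * f x) / h\<^sup>2 - dir_deriv b ?g x = (G h - G 0) / h\<^sup>2"
    using h by (simp add: G_def field_simps)
   ultimately show ?thesis by simp
  qed
  then show ?thesis using d(1) by blast
 qed
 obtain d1 where d1: "d1 > 0" "!!h x. 0 < h ==> h < d1 ==>
   \<bar>(f (x + h *R axis 1 1) + f (x - h *R axis 1 1) - 2 * f x) / h\<^sup>2 - pd 1 (pd 1 f) x\<bar> <= e / 2"
  using D[OF axis_in_Basis_plane[of 1]] by blast
 obtain d2 where d2: "d2 > 0" "!!h x. 0 < h ==> h < d2 ==>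
   \<bar>(f (x + h *R axis 2 1) + f (x - h *R axis 2 1) - 2 * f x) / h\<^sup>2 - pd 2 (pd 2 f) x\<bar> <= e / 2"
  using D[OF axis_in_Basis_plane[of 2]] by blast
 have "\<bar>lap_h h f x - laplacian f x\<bar> <= e" if h: "0 < h" "h < min d1 d2" for h x
  using d1(2)[of h x] d2(2)[of h x] h unfolding lap_h_def laplacian_def sum_Basis_plane by linarith
 then show ?thesis using d1(1) d2(1) by (intro exI[of _ "min d1 d2"]) auto
qed

section \<open>The resolvent as a limit of vanishing step size\<close>

definition resolvent :: "real => (plane => real) => plane => real" where
 "resolvent l f x = lim (%n. resolvent_h l (1 / real (Suc n)) f x)"

lemma inverse_Suc_less: "d > 0 ==> EX N. ALL n>=N. 1 / real (Suc n) < d"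
 using LIMSEQ_inverse_real_of_nat unfolding lim_sequentially
 by (simp add: dist_real_def divide_inverse)

context
 fixes l :: real assumes l: "0 < l"
begin

text \<open>For C^2 data the consistency error tends to zero, so \<open>resolvent_h_diff\<close>
  makes the discrete solutions Cauchy. Continuous data are approximated by C^2 data, at a cost of 1
  / l times the distance, whatever the step.\<close>

lemma resolvent_limit:
 assumes f: "cper f"
 shows "cper (resolvent l f)"
  "!!e. e > 0 ==> EX N. ALL n>=N. ALL x. \<bar>resolvent_h l (1 / real (Suc n)) f x - resolvent l f x\<bar> <= e"
proof -
 let ?F = "%n. resolvent_h l (1 / real (Suc n)) f"
 have cF: "cper (?F n)" for n by (rule resolvent_h[OF l _ f]) simp
 have Ca: "EX N. ALL m>=N. ALL n>=N. ALL x. \<bar>?F m x - ?F n x\<bar> <= e" if e: "e > 0" for e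
 proof -
  have "e * l / 4 > 0" using e l by simp
  then obtain g where g: "C_k 2 g" "periodic g" "ALL x. \<bar>g x - f x\<bar> <= e * l / 4"
   using cper_approx_C_k[OF f, of "e * l / 4" 2] by blast
  have cg: "cper g" using C_k_cper g by blast
  have "e * l\<^sup>2 / 4 > 0" using e l by simp
  then obtain d where d: "d > 0" "!!h x. 0 < h ==> h < d ==> \<bar>lap_h h g x - laplacian g x\<bar> <= e * l\<^sup>2 / 4"
   using lap_h_tendsto[OF g(1,2), of "e * l\<^sup>2 / 4"] by blast
  obtain N where N: "ALL n>=N. 1 / real (Suc n) < d" using inverse_Suc_less[OF d(1)] by blast
  have "\<bar>?F m x - ?F n x\<bar> <= e" if mn: "m >= N" "n >= N" for m n x
  proof -
   let ?h = "1 / real (Suc m)" and ?h' = "1 / real (Suc n)"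
   have p: "0 < ?h" "0 < ?h'" by simp_all
   have "\<bar>lap_h ?h g x - lap_h ?h' g x\<bar> <= e * l\<^sup>2 / 2" for x
   proof -
    have "?h < d" "?h' < d" using N mn by blast+
    then have "\<bar>lap_h ?h g x - laplacian g x\<bar> <= e * l\<^sup>2 / 4" "\<bar>lap_h ?h' g x - laplacian g x\<bar> <= e * l\<^sup>2 / 4"
     using d(2) p by blast+
    then show ?thesis by linarith
   qed
   from resolvent_h_diff[OF l p cg this]
   have 1: "\<bar>resolvent_h l ?h g x - resolvent_h l ?h' g x\<bar> <= e / 2"
    using l by (simp add: power2_eq_square field_simps)
   have 2: "\<bar>resolvent_h l k g x - resolvent_h l k f x\<bar> <= e / 4" if "0 < k" for k
    using trans_inv_near[OF resolvent_h_trans_inv[OF l that] cg f, of "e * l / 4" x] g(3) l by simp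
   show ?thesis using 1 2[OF p(1)] 2[OF p(2)] by linarith
  qed
  then show ?thesis by blast
 qed
 show "cper (resolvent l f)" using cper_Cauchy(1)[of ?F, OF cF Ca] by (simp add: resolvent_def[abs_def])
 show "EX N. ALL n>=N. ALL x. \<bar>?F n x - resolvent l f x\<bar> <= e" if "e > 0" for e
  using cper_Cauchy(2)[of ?F, OF cF Ca that] by (simp add: resolvent_def)
qed

lemma resolvent_LIMSEQ:
 assumes f: "cper f" shows "(%n. resolvent_h l (1 / real (Suc n)) f x) \<longlonglongrightarrow> resolvent l f x"
 unfolding LIMSEQ_iff
proof (intro allI impI)
 fix r :: real assume "r > 0"
 then obtain N where N: "!!n x. n >= N ==> \<bar>resolvent_h l (1 / real (Suc n)) f x - resolvent l f x\<bar> <= r / 2"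
  using resolvent_limit(2)[OF f half_gt_zero] by blast
 have "norm (resolvent_h l (1 / real (Suc n)) f x - resolvent l f x) < r" if "n >= N" for n
  using N[OF that, of x] \<open>r > 0\<close> by simp
 then show "EX no. ALL n>=no. norm (resolvent_h l (1 / real (Suc n)) f x - resolvent l f x) < r" by blast
qed

lemma resolvent_trans_inv: "trans_inv (resolvent l) (1 / l)"
 unfolding trans_inv_def
proof (intro conjI allI impI)
 note ti = resolvent_h_trans_inv[OF l, of "1 / real (Suc n)" for n, simplified]
 show "0 <= 1 / l" using l by simp
 show "cper (resolvent l g)" if "cper g" for g by (rule resolvent_limit[OF that])
 show "\<bar>resolvent l g x\<bar> <= 1 / l * M" if g: "cper g" "ALL x. \<bar>g x\<bar> <= M" for g M x
  by (rule LIMSEQ_le_const2[OF tendsto_rabs[OF resolvent_LIMSEQ[OF g(1)]]])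
   (use trans_inv_bound[OF resolvent_h_trans_inv[OF l] g(1)] g(2) in auto)
 show "resolvent l (%x. g x + k x) = (%x. resolvent l g x + resolvent l k x)"
  if "cper g" "cper k" for g k
 proof
  fix x show "resolvent l (%x. g x + k x) x = resolvent l g x + resolvent l k x"
   using tendsto_add[OF resolvent_LIMSEQ[OF that(1)] resolvent_LIMSEQ[OF that(2)]]
    resolvent_LIMSEQ[OF cper_add[OF that]] trans_inv_add[OF resolvent_h_trans_inv[OF l] that]
   by (intro LIMSEQ_unique[OF resolvent_LIMSEQ[OF cper_add[OF that]]]) simp
 qed
 show "resolvent l (%x. c * g x) = (%x. c * resolvent l g x)" if "cper g" for c g
 proof
  fix x show "resolvent l (%x. c * g x) x = c * resolvent l g x"
   using tendsto_mult[OF tendsto_const[of c] resolvent_LIMSEQ[OF that]]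
    trans_inv_cmult[OF resolvent_h_trans_inv[OF l] that]
   by (intro LIMSEQ_unique[OF resolvent_LIMSEQ[OF cper_mult[OF cper_const that]]]) simp
 qed
 show "resolvent l (%x. g (x + a)) = (%x. resolvent l g (x + a))" if "cper g" for g a
 proof
  fix x show "resolvent l (%x. g (x + a)) x = resolvent l g (x + a)"
   using resolvent_LIMSEQ[OF that, of "x + a"] trans_inv_translate[OF resolvent_h_trans_inv[OF l] that]
   by (intro LIMSEQ_unique[OF resolvent_LIMSEQ[OF cper_translate[OF that]]]) simp
 qed
qed

text \<open>The discrete resolvent inverts \<open>l * f - lap_h h f\<close> exactly, and the
  difference Laplacian of f tends uniformly to its Laplacian.\<close>

lemma resolvent_left_inverse:
 assumes f: "C_k 2 f" "periodic f"
 shows "resolvent l (%x. l * f x - laplacian f x) = f"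
proof
 fix x
 have c: "cper f" "cper (laplacian f)"
  using f cper_laplacian[of 0 f] C_k_cper[OF f] by (auto simp: numeral_2_eq_2)
 let ?g = "%x. l * f x - laplacian f x"
 have cg: "cper ?g" by (intro cper_intros c)
 have "\<bar>resolvent l ?g x - f x\<bar> <= e" if "e > 0" for e
 proof -
  have "e / 2 * l > 0" using that l by simp
  then obtain d where d: "d > 0" "!!h x. 0 < h ==> h < d ==> \<bar>lap_h h f x - laplacian f x\<bar> <= e / 2 * l"
   using lap_h_tendsto[OF f, of "e / 2 * l"] by blast
  obtain N1 where N1: "ALL n>=N1. 1 / real (Suc n) < d" using inverse_Suc_less[OF d(1)] by blast
  obtain N2 where N2: "ALL n>=N2. ALL x. \<bar>resolvent_h l (1 / real (Suc n)) ?g x - resolvent l ?g x\<bar> <= e / 2"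
   using resolvent_limit(2)[OF cg, of "e / 2"] \<open>e > 0\<close> by auto
  define n where "n = max N1 N2"
  let ?h = "1 / real (Suc n)"
  have h: "0 < ?h" "?h < d" using N1 by (simp_all add: n_def)
  have cn: "cper (%x. l * f x - lap_h ?h f x)" by (intro cper_intros cper_lap_h c)
  have "resolvent_h l ?h (%x. l * f x - lap_h ?h f x) = f"
   by (rule resolvent_h_unique[OF l h(1) c(1) cn]) simp
  moreover have "\<bar>resolvent_h l ?h ?g x - resolvent_h l ?h (%x. l * f x - lap_h ?h f x) x\<bar> <= 1 / l * (e / 2 * l)"
   using d(2)[OF h] by (intro trans_inv_near[OF resolvent_h_trans_inv[OF l h(1)] cg cn]) simp
  ultimately have "\<bar>resolvent_h l ?h ?g x - f x\<bar> <= e / 2" using l by simp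
  moreover have "\<bar>resolvent_h l ?h ?g x - resolvent l ?g x\<bar> <= e / 2" using N2 by (simp add: n_def)
  ultimately show ?thesis by linarith
 qed
 from field_le_epsilon[of "\<bar>resolvent l ?g x - f x\<bar>" 0] this show "resolvent l ?g x = f x" by simp
qed

text \<open>The resolvent commutes with differentiation, hence with the Laplacian; on C^2 data the
  left inverse is therefore a right inverse too.\<close>

lemma resolvent_C2_equation:
 assumes f: "C_k 2 f" "periodic f"
 shows "C_k 2 (resolvent l f)" "l * resolvent l f x - laplacian (resolvent l f) x = f x"
proof -
 note ti = resolvent_trans_inv
 show "C_k 2 (resolvent l f)" by (rule trans_inv_C_k[OF ti f])
 have f2: "C_k (Suc (Suc 0)) f" using f(1) by (simp add: numeral_2_eq_2)
 have f1: "C_k 1 f" using C_k_mono[OF f(1), of 1] by simp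
 have c: "cper f" "cper (laplacian f)"
  using f2 f(2) cper_laplacian[of 0 f] C_k_cper[OF f] by auto
 have "dir_deriv b (dir_deriv b (resolvent l f)) = resolvent l (dir_deriv b (dir_deriv b f))" if "b \<in> Basis" for b
 proof -
  have "C_k 1 (dir_deriv b f)" "periodic (dir_deriv b f)" using f2 f(2) that by (auto intro: periodic_dir_deriv)
  then show ?thesis
   using trans_inv_dir_deriv[OF ti f1 f(2) that] trans_inv_dir_deriv[OF ti _ _ that, of "dir_deriv b f"] by simp
 qed
 moreover have "cper (dir_deriv b (dir_deriv b f))" if "b \<in> Basis" for b
  using f2 f(2) that by (intro cper_dir_deriv[of 0] periodic_dir_deriv) auto
 ultimately have "laplacian (resolvent l f) = resolvent l (laplacian f)"
  unfolding laplacian_def[abs_def] sum_Basis_plane by (simp add: trans_inv_add[OF ti])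
 then show "l * resolvent l f x - laplacian (resolvent l f) x = f x"
  using fun_cong[OF resolvent_left_inverse[OF f], of x]
  by (simp add: trans_inv_diff[OF ti] cper_intros c trans_inv_cmult[OF ti])
qed

end

section \<open>Maximum principle and gradient estimate\<close>

lemma max_second_derivative:
 assumes F: "!!s. (F has_real_derivative F' s) (at s)" and F': "(F' has_real_derivative c) (at s0)"
  and max: "0 < d" "!!s. \<bar>s - s0\<bar> < d ==> F s <= F s0"
 shows "F' s0 = 0" "c <= 0"
proof -
 show z: "F' s0 = 0"
  by (rule DERIV_local_max[OF F max(1)]) (use max(2) in \<open>auto simp: abs_minus_commute\<close>)
 show "c <= 0"
 proof (rule ccontr)
  assume "\<not> c <= 0"
  then obtain e where e: "e > 0" "!!h. 0 < h ==> h < e ==> F' s0 < F' (s0 + h)"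
   using DERIV_pos_inc_right[OF F'] by force
  define h where "h = min d e / 2"
  have h: "0 < h" "h < d" "h < e" using max(1) e(1) by (auto simp: h_def)
  obtain y where y: "s0 < y" "y < s0 + h" "F (s0 + h) - F s0 = (s0 + h - s0) * F' y"
   using MVT2[of s0 "s0 + h" F F'] F h by auto
  have "F' y > 0" using e(2)[of "y - s0"] y h z by simp
  then have "F (s0 + h) > F s0" using y(3) mult_pos_pos[OF h(1), of "F' y"] by simp
  then show False using max(2)[of "s0 + h"] h by simp
 qed
qed

lemma laplacian_at_max:
 assumes g: "C_k 2 (g :: plane => real)" and max: "!!y. g y <= g x"
 shows "dir_deriv b g x = 0" "b \<in> Basis ==> dir_deriv b (dir_deriv b g) x <= 0" "grad g x = 0" "laplacian g x <= 0"
proof -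
 have g2: "C_k (Suc (Suc 0)) g" using g by (simp add: numeral_2_eq_2)
 have gd: "g differentiable (at y)" for y using g2 by simp
 show z: "dir_deriv b g x = 0" for b
 proof -
  have "(%h. frechet_derivative g (at x) h) = (%h. 0)"
   by (rule has_derivative_local_max[where f=g and x=x]) (use gd max in \<open>auto simp: frechet_derivative_works\<close>)
  then show ?thesis by (simp add: dir_deriv_def fun_eq_iff)
 qed
 then show "grad g x = 0" by (simp add: grad_def)
 show n: "dir_deriv b (dir_deriv b g) x <= 0" if b: "b \<in> Basis" for b
 proof -
  have bd: "dir_deriv b g differentiable (at y)" for y using g2 b by simp
  show ?thesis
   by (rule max_second_derivative(2)[of "%s. g (x + s *R b)" "%s. dir_deriv b g (x + s *R b)" _ 0 1])
    (use dir_deriv_line_real[OF gd] dir_deriv_line_real[where g="dir_deriv b g" and x=x and s=0 and b=b, OF bd] max in auto)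
 qed
 show "laplacian g x <= 0" unfolding laplacian_def by (intro sum_nonpos n)
qed

lemma laplacian_at_min:
 assumes g: "C_k 2 (g :: plane => real)" and min: "!!y. g x <= g y"
 shows "grad g x = 0" "laplacian g x >= 0"
proof -
 have g2: "C_k (Suc (Suc 0)) g" using g by (simp add: numeral_2_eq_2)
 have m: "C_k 2 (%x. - g x)" by (rule C_k_minus[OF g])
 have eq: "dir_deriv b (%x. - g x) = (%x. - dir_deriv b g x)" for b
  using g2 by (auto simp: dir_deriv_minus)
 then have eq2: "dir_deriv b (dir_deriv b (%x. - g x)) = (%x. - dir_deriv b (dir_deriv b g) x)" if "b \<in> Basis" for b
  using g2 that by (auto simp: dir_deriv_minus)
 have "grad (%x. - g x) x = - grad g x" by (simp add: grad_def eq sum_negf)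
 moreover have "laplacian (%x. - g x) x = - laplacian g x" by (simp add: laplacian_def eq2 sum_negf)
 ultimately show "grad g x = 0" "laplacian g x >= 0"
  using laplacian_at_max(3,4)[OF m, of x] min by auto
qed

lemma plane_other_axis:
 obtains j :: 2 where "!!f :: plane => 'a::comm_monoid_add. sum f Basis = f (axis i 1) + f (axis j 1)"
proof (cases "i = 1")
 case True
 show ?thesis by (rule that[of 2]) (simp add: True sum_Basis_plane)
next
 case False
 then have "i = 2" using exhaust_2 by blast
 then show ?thesis by (intro that[of 1]) (simp add: sum_Basis_plane add.commute)
qed

text \<open>Comparison of the odd part \<open>\<phi> (x + s e) - \<phi> (x - s e)\<close> with a concave function of \<open>s\<close>.\<close>

lemma resolvent_gradient_C2:
 assumes l: "0 < l" and f: "C_k 2 f" "periodic f" and M: "!!x. \<bar>f x\<bar> <= M"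
 shows "pd i (resolvent l f) x <= 2 / sqrt l * M"
proof -
 define \<phi> where "\<phi> = resolvent l f"
 let ?e = "axis i 1 :: plane"
 obtain j :: 2 where j: "!!f :: plane => real. sum f Basis = f ?e + f (axis j 1)"
  using plane_other_axis by blast
 let ?o = "axis j 1 :: plane"
 have cf: "cper f" using C_k_cper[OF f] .
 have \<phi>: "C_k 2 \<phi>" "!!x. l * \<phi> x - laplacian \<phi> x = f x" "cper \<phi>"
  unfolding \<phi>_def using resolvent_C2_equation[OF l f] trans_inv_cper[OF resolvent_trans_inv[OF l] cf] by auto
 have \<phi>2: "C_k (Suc (Suc 0)) \<phi>" using \<phi>(1) by (simp add: numeral_2_eq_2)
 have M0: "0 <= M" using M[of 0] by linarith
 define N where "N = M / l"
 define s0 where "s0 = 1 / sqrt l"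
 have N: "\<bar>\<phi> x\<bar> <= N" for x
  unfolding \<phi>_def N_def using trans_inv_bound[OF resolvent_trans_inv[OF l] cf M] by simp
 have N0: "0 <= N" using M0 l by (simp add: N_def)
 have s0: "0 < s0" using l by (simp add: s0_def)
 \<comment> \<open>The second derivative -2 M of \<open>B\<close> offsets the difference of two
   values of f, and \<open>B s0 = 2 * N\<close> dominates the oscillation of the solution. The
   choice s0 = 1 / sqrt l makes both contributions to the slope at 0 multiples of M / sqrt
   l.\<close>
 define B where "B s = M * s * (s0 - s) + 2 * N * s / s0" for s
 define Z where "Z x s = \<phi> (x + s *R ?e) - \<phi> (x + (- s) *R ?e) - B s" for x s
 have d1: "\<phi> differentiable (at y)" for y using \<phi>2 by simp
 have d2: "dir_deriv b \<phi> differentiable (at y)" if "b \<in> Basis" for y b using \<phi>2 that by simp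
 have Zs: "((%s. Z x s) has_real_derivative dir_deriv ?e \<phi> (x + s *R ?e) + dir_deriv ?e \<phi> (x + (- s) *R ?e)
  - (M * (s0 - 2 * s) + 2 * N / s0)) (at s)" for x s
 proof -
  have "((%s. \<phi> (x + (- s) *R ?e)) has_real_derivative dir_deriv ?e \<phi> (x + (- s) *R ?e) * (-1)) (at s)"
   by (rule DERIV_chain2[OF dir_deriv_line_real[OF d1]]) (auto intro!: derivative_eq_intros)
  then show ?thesis unfolding Z_def B_def using dir_deriv_line_real[OF d1] s0
   by (auto intro!: derivative_eq_intros simp: algebra_simps)
 qed
 have Zss: "((%s. dir_deriv ?e \<phi> (x + s *R ?e) + dir_deriv ?e \<phi> (x + (- s) *R ?e)
  - (M * (s0 - 2 * s) + 2 * N / s0)) has_real_derivative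
  dir_deriv ?e (dir_deriv ?e \<phi>) (x + s *R ?e) - dir_deriv ?e (dir_deriv ?e \<phi>) (x + (- s) *R ?e) + 2 * M) (at s)" for x s
 proof -
  have d: "dir_deriv ?e \<phi> differentiable (at y)" for y by (rule d2) simp
  have "((%s. dir_deriv ?e \<phi> (x + (- s) *R ?e)) has_real_derivative dir_deriv ?e (dir_deriv ?e \<phi>) (x + (- s) *R ?e) * (-1)) (at s)"
   by (rule DERIV_chain2[OF dir_deriv_line_real[OF d]]) (auto intro!: derivative_eq_intros)
  then show ?thesis using dir_deriv_line_real[OF d]
   by (auto intro!: derivative_eq_intros simp: algebra_simps)
 qed
 have Zle: "Z x s <= 0" if xs: "0 <= s" "s <= s0" for x s
 proof (rule ccontr)
  assume pos: "\<not> Z x s <= 0"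
  have Zper: "Z (x + k) s = Z x s" if "k \<in> int_lattice" for x k s
  proof -
   have "\<phi> (x + k + y) = \<phi> (x + y)" for y
    using periodicD[OF cperD(2)[OF \<phi>(3)] that, of "x + y"] by (simp add: add_ac)
   then show ?thesis by (simp add: Z_def del: scaleR_minus_left)
  qed
  have "continuous_on (cbox 0 1 \<times> {0..s0}) (%p. Z (fst p) (snd p))"
   unfolding Z_def B_def using s0
   by (intro continuous_intros continuous_on_compose2[OF cperD(1)[OF \<phi>(3), of UNIV]]) auto
  note cont = this
  have "(0, 0) \<in> cbox 0 (1::plane) \<times> {0..s0}" using s0 by (simp add: mem_box_cart)
  then have ne: "cbox 0 (1::plane) \<times> {0..s0} ~= {}" by blast
  obtain q where q: "q \<in> cbox 0 1 \<times> {0..s0}" "!!p. p \<in> cbox 0 1 \<times> {0..s0} ==> Z (fst p) (snd p) <= Z (fst q) (snd q)"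
   using continuous_attains_sup[OF compact_Times[OF compact_cbox compact_Icc] ne cont] by blast
  obtain a t where at: "q = (a, t)" by (cases q)
  have t: "0 <= t" "t <= s0" using q(1) at by auto
  have mx: "Z y r <= Z a t" if "0 <= r" "r <= s0" for y r
  proof -
   obtain k where k: "k \<in> int_lattice" "y + k \<in> cbox 0 1" using cell_reduce by blast
   show ?thesis using q(2)[of "(y + k, r)"] k that Zper[OF k(1)] at by simp
  qed
  have posa: "Z a t > 0" using mx[OF xs, of x] pos by linarith
  have "t ~= 0" using posa by (auto simp: Z_def B_def)
  moreover have "t ~= s0"
  proof
   assume "t = s0"
   then have "Z a t = \<phi> (a + t *R ?e) - \<phi> (a + (- t) *R ?e) - 2 * N" using s0 by (simp add: Z_def B_def)
   then show False using posa N[of "a + t *R ?e"] N[of "a + (- t) *R ?e"] by linarith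
  qed
  ultimately have t': "0 < t" "t < s0" using t by auto
  \<comment> \<open>At the maximum the distance t and the transversal position are varied
    separately. The two inequalities add up to one for the Laplacians at the two points; by the
    equation the odd part is then nonpositive, contrary to \<open>posa\<close>.\<close>
  have 1: "dir_deriv ?e (dir_deriv ?e \<phi>) (a + t *R ?e) - dir_deriv ?e (dir_deriv ?e \<phi>) (a + (- t) *R ?e) + 2 * M <= 0"
  proof (rule max_second_derivative(2)[OF Zs Zss])
   show "0 < min t (s0 - t)" using t' by simp
   show "Z a s <= Z a t" if "\<bar>s - t\<bar> < min t (s0 - t)" for s
    using that by (intro mx) (auto simp: abs_less_iff)
  qed
  have 2: "dir_deriv ?o (dir_deriv ?o \<phi>) (a + t *R ?e) - dir_deriv ?o (dir_deriv ?o \<phi>) (a + (- t) *R ?e) <= 0"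
  proof (rule max_second_derivative(2))
   let ?Y = "%r. \<phi> ((a + t *R ?e) + r *R ?o) - \<phi> ((a + (- t) *R ?e) + r *R ?o)"
   let ?Y' = "%r. dir_deriv ?o \<phi> ((a + t *R ?e) + r *R ?o) - dir_deriv ?o \<phi> ((a + (- t) *R ?e) + r *R ?o)"
   show "(?Y has_real_derivative ?Y' r) (at r)" for r
    by (intro DERIV_diff dir_deriv_line_real d1)
   have "(?Y' has_real_derivative dir_deriv ?o (dir_deriv ?o \<phi>) ((a + t *R ?e) + 0 *R ?o) - dir_deriv ?o (dir_deriv ?o \<phi>) ((a + (- t) *R ?e) + 0 *R ?o)) (at 0)"
    by (intro DERIV_diff dir_deriv_line_real d2) simp_all
   then show "(?Y' has_real_derivative dir_deriv ?o (dir_deriv ?o \<phi>) (a + t *R ?e) - dir_deriv ?o (dir_deriv ?o \<phi>) (a + (- t) *R ?e)) (at 0)"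
    by simp
   show "?Y r <= ?Y 0" for r
    using mx[OF t, of "a + r *R ?o"] by (simp add: Z_def add_ac del: scaleR_minus_left)
   show "(0::real) < 1" by simp
  qed
  have lap: "laplacian \<phi> y = dir_deriv ?e (dir_deriv ?e \<phi>) y + dir_deriv ?o (dir_deriv ?o \<phi>) y" for y
   unfolding laplacian_def by (rule j)
  have "laplacian \<phi> (a + t *R ?e) - laplacian \<phi> (a + (- t) *R ?e) + 2 * M <= 0"
   unfolding lap using 1 2 by linarith
  moreover have "l * (\<phi> (a + t *R ?e) - \<phi> (a + (- t) *R ?e)) =
   (laplacian \<phi> (a + t *R ?e) - laplacian \<phi> (a + (- t) *R ?e)) + (f (a + t *R ?e) - f (a + (- t) *R ?e))"
   using \<phi>(2)[of "a + t *R ?e"] \<phi>(2)[of "a + (- t) *R ?e"] by (simp add: right_diff_distrib)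
  ultimately have "l * (\<phi> (a + t *R ?e) - \<phi> (a + (- t) *R ?e)) <= 0"
   using M[of "a + t *R ?e"] M[of "a + (- t) *R ?e"] by linarith
  then have "\<phi> (a + t *R ?e) - \<phi> (a + (- t) *R ?e) <= 0" using l by (simp add: mult_le_0_iff)
  moreover have "B t >= 0" unfolding B_def using M0 N0 t s0 by simp
  ultimately show False using posa by (simp add: Z_def)
 qed
 have "dir_deriv ?e \<phi> (x + 0 *R ?e) + dir_deriv ?e \<phi> (x + (- 0) *R ?e) - (M * (s0 - 2 * 0) + 2 * N / s0) <= 0"
 proof (rule ccontr)
  assume "\<not> ?thesis"
  then have "0 < dir_deriv ?e \<phi> (x + 0 *R ?e) + dir_deriv ?e \<phi> (x + (- 0) *R ?e) - (M * (s0 - 2 * 0) + 2 * N / s0)" by linarith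
  from DERIV_pos_inc_right[OF Zs[of x 0] this]
  obtain d where "d > 0" "!!h. 0 < h ==> h < d ==> Z x 0 < Z x (0 + h)" by blast
  moreover have "Z x 0 = 0" by (simp add: Z_def B_def)
  moreover have "0 < min d s0 / 2" "min d s0 / 2 < d" "min d s0 / 2 <= s0" using s0 \<open>d > 0\<close> by auto
  ultimately have "Z x (min d s0 / 2) > 0" by (metis add_0)
  then show False using Zle[of "min d s0 / 2" x] \<open>0 < min d s0 / 2\<close> \<open>min d s0 / 2 <= s0\<close> by simp
 qed
 moreover have "N / s0 = M * s0" using l by (simp add: N_def s0_def field_simps)
 ultimately have "2 * dir_deriv ?e \<phi> x <= 3 * (M * s0)" by simp
 moreover have "0 <= M * s0" using M0 s0 by simp
 ultimately have "dir_deriv ?e \<phi> x <= 2 * (M * s0)" by linarith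
 then show ?thesis by (simp add: \<phi>_def s0_def)
qed

lemma resolvent_gradient_C2_abs:
 assumes l: "0 < l" and f: "C_k 2 f" "periodic f" and M: "!!x. \<bar>f x\<bar> <= M"
 shows "\<bar>pd i (resolvent l f) x\<bar> <= 2 / sqrt l * M"
proof -
 have cf: "cper f" using C_k_cper[OF f] .
 have "resolvent l (%x. - 1 * f x) = (%x. - 1 * resolvent l f x)"
  by (rule trans_inv_cmult[OF resolvent_trans_inv[OF l] cf])
 then have eq: "resolvent l (%x. - f x) = (%x. - resolvent l f x)" by simp
 have "C_k 1 (resolvent l f)" using C_k_mono[OF resolvent_C2_equation(1)[OF l f], of 1] by simp
 then have "pd i (resolvent l (%x. - f x)) x = - pd i (resolvent l f) x"
  unfolding eq by (intro dir_deriv_minus) simp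
 moreover have "periodic (%x. - f x)" using f(2) by (simp add: periodic_def)
 ultimately show ?thesis
  using resolvent_gradient_C2[OF l f M, of i x] resolvent_gradient_C2[OF l C_k_minus[OF f(1)], of M i x] M
  by simp
qed

section \<open>The resolvent on continuous and on C^1 data\<close>

definition resolvent_d :: "2 => real => (plane => real) => plane => real" where
 "resolvent_d i l f = pd i (resolvent l f)"

lemma cper_approx_seq:
 assumes "cper (f :: plane => real)"
 obtains h where "!!n. C_k k (h n)" "!!n. periodic (h n)" "!!n x. \<bar>h n x - f x\<bar> <= 1 / real (Suc n)"
  "!!n x. (!!y. 0 <= f y) ==> 0 <= h n x"
proof -
 have "EX h. C_k k h & periodic h & (ALL x. \<bar>h x - f x\<bar> <= 1 / real (Suc n)) & ((ALL x. 0 <= f x) --> (ALL x. 0 <= h x))" for n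
  by (rule cper_approx_C_k[OF assms]) simp
 then show ?thesis using that by metis
qed

context
 fixes l :: real assumes l: "0 < l"
begin

text \<open>The datum is approximated uniformly by C^2 functions; the gradient estimate makes the
  derivatives of the approximate solutions a Cauchy sequence.\<close>

lemma resolvent_C1:
 assumes f: "cper f"
 shows "C_k 1 (resolvent l f)" "!!M. (!!x. \<bar>f x\<bar> <= M) ==> \<bar>resolvent_d i l f x\<bar> <= 2 / sqrt l * M"
proof -
 obtain h where h: "!!n. C_k 2 (h n)" "!!n. periodic (h n)" "!!n x. \<bar>h n x - f x\<bar> <= 1 / real (Suc n)"
  using cper_approx_seq[OF f, of 2] by metis
 have ch: "cper (h n)" for n using C_k_cper[OF h(1,2)] .
 note ti = resolvent_trans_inv[OF l]
 define g where "g n = resolvent l (h n)" for n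
 have g2: "C_k 2 (g n)" "periodic (g n)" for n
  unfolding g_def using resolvent_C2_equation(1)[OF l h(1,2)] trans_inv_cper[OF ti ch] by (auto simp: cper_def)
 have g1: "C_k 1 (g n)" for n using C_k_mono[OF g2(1), of 1] by simp
 have cg: "cper (pd i (g n))" for i n using g1[of n] g2(2)[of n] cper_dir_deriv[of 0 "g n" "axis i 1"] by simp
 have sq: "sqrt l > 0" using l by simp
 have near: "\<bar>pd i (g m) x - pd i (g n) x\<bar> <= 2 / sqrt l * (1 / real (Suc m) + 1 / real (Suc n))" for m n i x
 proof -
  have "\<bar>h m x - h n x\<bar> <= 1 / real (Suc m) + 1 / real (Suc n)" for x
   using h(3)[of m x] h(3)[of n x] by linarith
  moreover have "resolvent l (%x. h m x - h n x) = (%x. g m x - g n x)"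
   unfolding g_def by (rule trans_inv_diff[OF ti ch ch])
  moreover have "C_k 2 (%x. h m x - h n x)" "periodic (%x. h m x - h n x)"
   using h(1,2) by (auto intro: C_k_diff simp: periodic_def)
  ultimately have "\<bar>pd i (%x. g m x - g n x) x\<bar> <= 2 / sqrt l * (1 / real (Suc m) + 1 / real (Suc n))"
   using resolvent_gradient_C2_abs[OF l, of "%x. h m x - h n x" "1 / real (Suc m) + 1 / real (Suc n)" i x] by simp
  then show ?thesis using g1 by (subst (asm) dir_deriv_diff) auto
 qed
 have Ca: "EX N. ALL m>=N. ALL n>=N. ALL x. \<bar>pd i (g m) x - pd i (g n) x\<bar> <= e" if e: "e > 0" for e i
 proof -
  have "e * sqrt l / 4 > 0" using e sq by simp
  then obtain N where N: "ALL n>=N. 1 / real (Suc n) < e * sqrt l / 4" using inverse_Suc_less by blast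
  have "\<bar>pd i (g m) x - pd i (g n) x\<bar> <= e" if "m >= N" "n >= N" for m n x
  proof -
   have "1 / real (Suc m) + 1 / real (Suc n) <= e * sqrt l / 2"
    using N[rule_format, OF that(1)] N[rule_format, OF that(2)] by linarith
   then have "2 / sqrt l * (1 / real (Suc m) + 1 / real (Suc n)) <= 2 / sqrt l * (e * sqrt l / 2)"
    using sq by (intro mult_left_mono) auto
   also have "... = e" using sq by simp
   finally show ?thesis using near[of i m x n] by linarith
  qed
  then show ?thesis by blast
 qed
 define D where "D i x = lim (%n. pd i (g n) x)" for i x
 have lim': "EX N. ALL n>=N. ALL x. \<bar>pd i (g n) x - D i x\<bar> <= e" if "e > 0" for i e
  unfolding D_def by (rule cper_Cauchy(2)[of "%n. pd i (g n)", OF cg Ca that])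
 have lim: "EX N. ALL n>=N. ALL x. \<bar>g n x - resolvent l f x\<bar> <= e" if e: "e > 0" for e
 proof -
  obtain N where N: "ALL n>=N. 1 / real (Suc n) < e * l" using inverse_Suc_less[of "e * l"] e l by auto
  have "\<bar>g n x - resolvent l f x\<bar> <= e" if "n >= N" for n x
  proof -
   have "\<bar>g n x - resolvent l f x\<bar> <= 1 / l * (1 / real (Suc n))"
    unfolding g_def by (rule trans_inv_near[OF ti ch f h(3)])
   also have "... <= 1 / l * (e * l)" using N that l by (intro mult_left_mono) (auto simp: less_imp_le)
   finally show ?thesis using l by simp
  qed
  then show ?thesis by blast
 qed
 note C = C1_uniform_limit[of g "resolvent l f" D, OF g1 g2(2) lim lim']
 show "C_k 1 (resolvent l f)" by (rule C(1))
 fix M assume M: "!!x. \<bar>f x\<bar> <= M"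
 have "\<bar>resolvent_d i l f x\<bar> <= 2 / sqrt l * M + e" if e: "e > 0" for e
 proof -
  have "e / 2 > 0" "e * sqrt l / 4 > 0" using e sq by auto
  obtain N1 where N1: "ALL n>=N1. ALL x. \<bar>pd i (g n) x - D i x\<bar> <= e / 2"
   using lim'[OF \<open>e / 2 > 0\<close>] by blast
  obtain N2 where N2: "ALL n>=N2. 1 / real (Suc n) < e * sqrt l / 4" using inverse_Suc_less[OF \<open>e * sqrt l / 4 > 0\<close>] by blast
  define n where "n = max N1 N2"
  have "1 / real (Suc n) < e * sqrt l / 4" using N2 by (simp add: n_def)
  then have "\<bar>h n y\<bar> <= M + e * sqrt l / 4" for y using h(3)[of n y] M[of y] by linarith
  then have "\<bar>pd i (g n) x\<bar> <= 2 / sqrt l * (M + e * sqrt l / 4)"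
   unfolding g_def by (rule resolvent_gradient_C2_abs[OF l h(1,2)])
  also have "... = 2 / sqrt l * M + e / 2" using sq by (simp add: field_simps)
  finally have "\<bar>pd i (g n) x\<bar> <= 2 / sqrt l * M + e / 2" .
  moreover have "\<bar>pd i (g n) x - D i x\<bar> <= e / 2" using N1 by (simp add: n_def)
  moreover have "resolvent_d i l f x = D i x" unfolding resolvent_d_def using C(2) by simp
  ultimately show ?thesis by linarith
 qed
 then show "\<bar>resolvent_d i l f x\<bar> <= 2 / sqrt l * M" by (rule field_le_epsilon)
qed

text \<open>The norm 2 / sqrt l tends to zero as l grows, which is what allows first-order terms to
  be treated as a perturbation.\<close>

lemma resolvent_d_trans_inv: "trans_inv (resolvent_d i l) (2 / sqrt l)"
 unfolding trans_inv_def
proof (intro conjI allI impI)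
 note ti = resolvent_trans_inv[OF l]
 have d: "resolvent l g differentiable (at x)" if "cper g" for g x
  using resolvent_C1(1)[OF that] by simp
 show "0 <= 2 / sqrt l" using l by simp
 show "cper (resolvent_d i l g)" if "cper g" for g
  unfolding resolvent_d_def
  using resolvent_C1(1)[OF that] trans_inv_cper[OF ti that] by (intro cper_dir_deriv[of 0]) (auto simp: cper_def)
 show "\<bar>resolvent_d i l g x\<bar> <= 2 / sqrt l * M" if "cper g" "ALL x. \<bar>g x\<bar> <= M" for g M x
  using resolvent_C1(2)[OF that(1)] that(2) by blast
 show "resolvent_d i l (%x. g x + k x) = (%x. resolvent_d i l g x + resolvent_d i l k x)" if "cper g" "cper k" for g k
  unfolding resolvent_d_def trans_inv_add[OF ti that] by (intro ext dir_deriv_add d that)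
 show "resolvent_d i l (%x. c * g x) = (%x. c * resolvent_d i l g x)" if "cper g" for c g
  unfolding resolvent_d_def trans_inv_cmult[OF ti that] by (intro ext dir_deriv_linear[OF bounded_linear_mult_right] d that)
 show "resolvent_d i l (%x. g (x + a)) = (%x. resolvent_d i l g (x + a))" if "cper g" for a g
  unfolding resolvent_d_def trans_inv_translate[OF ti that] by (intro ext dir_deriv_translate d that)
qed

text \<open>For C^1 data the pure second derivatives are \<open>resolvent_d\<close> of first
  derivatives of the datum. Hence the equation passes to the limit from C^2 data that converge
  together with their gradients.\<close>

lemma resolvent_C1_equation:
 assumes f: "C_k 1 f" "periodic f"
 shows "C_k 2 (resolvent l f)" "l * resolvent l f x - laplacian (resolvent l f) x = f x"
proof -
 note ti = resolvent_trans_inv[OF l] and tid = resolvent_d_trans_inv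
 have cf: "cper f" "cper (pd i f)" for i
  using C_k_cper[OF f] cper_dir_deriv[of 0 f] f by auto
 have dd: "pd i (resolvent l g) = resolvent l (pd i g)" if "C_k 1 g" "periodic g" for g i
  by (rule trans_inv_dir_deriv[OF ti that]) simp
 have ddd: "pd i (pd i (resolvent l g)) = resolvent_d i l (pd i g)"
  if "C_k 1 g" "periodic g" for g i
  unfolding dd[OF that] resolvent_d_def ..
 have lap: "laplacian (resolvent l g) x = resolvent_d 1 l (pd 1 g) x + resolvent_d 2 l (pd 2 g) x"
  if "C_k 1 g" "periodic g" for g x
  unfolding laplacian_def sum_Basis_plane by (simp add: ddd[OF that])
 have d1: "C_k 1 (pd i (resolvent l f))" for i
  unfolding dd[OF f] by (rule resolvent_C1[OF cf(2)])
 have "C_k (Suc 1) (resolvent l f)"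
  using d1 resolvent_C1(1)[OF cf(1)] by (simp add: Basis_plane)
 then show "C_k 2 (resolvent l f)" by (simp add: numeral_2_eq_2)
 have "\<bar>l * resolvent l f x - laplacian (resolvent l f) x - f x\<bar> <= 0 + e" if e: "e > 0" for e
 proof -
  define e' where "e' = e / (2 + 4 / sqrt l)"
  have p: "2 + 4 / sqrt l > 0" using l by (intro add_pos_nonneg) auto
  then have e': "e' > 0" using e by (simp add: e'_def)
  obtain h where h: "C_k 2 h" "periodic h" "!!x. \<bar>h x - f x\<bar> <= e'" "!!x. norm (grad h x - grad f x) <= e'"
   using C1_approx_C2[OF f e'] by blast
  have h1: "C_k 1 h" using C_k_mono[OF h(1), of 1] by simp
  have ch: "cper h" "cper (pd i h)" for i
   using C_k_cper[OF h1 h(2)] cper_dir_deriv[of 0 h] h1 h(2) by auto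
  have "\<bar>pd i h x - pd i f x\<bar> <= e'" for i x
  proof -
   have "pd i h x - pd i f x = (grad h x - grad f x) \<bullet> axis i 1"
    by (simp add: inner_diff_left inner_grad)
   also have "\<bar>...\<bar> <= norm (grad h x - grad f x) * norm (axis i 1 :: plane)" by (rule Cauchy_Schwarz_ineq2)
   finally show ?thesis using h(4)[of x] by simp
  qed
  then have rd: "\<bar>resolvent_d i l (pd i h) x - resolvent_d i l (pd i f) x\<bar> <= 2 / sqrt l * e'" for i
   by (rule trans_inv_near[OF tid ch(2) cf(2)])
  have "\<bar>laplacian (resolvent l h) x - laplacian (resolvent l f) x\<bar> <= 2 * (2 / sqrt l * e')"
   unfolding lap[OF f] lap[OF h1 h(2)] using rd[of 1] rd[of 2] by linarith
  moreover have "\<bar>resolvent l h x - resolvent l f x\<bar> <= 1 / l * e'"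
   by (rule trans_inv_near[OF ti ch(1) cf(1) h(3)])
  then have "l * \<bar>resolvent l h x - resolvent l f x\<bar> <= e'" using l by (simp add: field_simps)
  then have "\<bar>l * resolvent l h x - l * resolvent l f x\<bar> <= e'" using l by (simp add: abs_mult right_diff_distrib[symmetric])
  moreover have "l * resolvent l h x - laplacian (resolvent l h) x = h x" by (rule resolvent_C2_equation(2)[OF l h(1,2)])
  ultimately have "\<bar>l * resolvent l f x - laplacian (resolvent l f) x - f x\<bar> <= e' + 2 * (2 / sqrt l * e') + e'"
   using h(3)[of x] by linarith
  also have "... = (2 + 4 / sqrt l) * e'" by (simp add: algebra_simps)
  also have "... = e" using p by (simp add: e'_def)
  finally show ?thesis by simp
 qed
 from field_le_epsilon[of _ 0, OF this] show "l * resolvent l f x - laplacian (resolvent l f) x = f x" by simp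
qed

end

lemma cper_Arzela_Ascoli:
 fixes F :: "nat => plane => real"
 assumes F: "!!n. cper (F n)" and M: "!!n x. \<bar>F n x\<bar> <= M"
  and eq: "!!e. e > 0 ==> EX d>0. ALL n x y. dist x y < d --> \<bar>F n x - F n y\<bar> < e"
 obtains g k where "cper g" "strict_mono (k :: nat => nat)"
  "!!e. e > 0 ==> EX N. ALL n>=N. ALL x. \<bar>F (k n) x - g x\<bar> <= e"
proof -
 have "EX d. 0 < d & (ALL n y. y \<in> cbox 0 1 & norm (x - y) < d --> norm (F n x - F n y) < e)"
  if "x \<in> cbox 0 1" "0 < e" for x e
  using eq[OF that(2)] by (auto simp: dist_norm)
 then obtain g0 k where k: "strict_mono (k :: nat => nat)"
  and conv: "!!e. 0 < e ==> EX N. ALL n x. n >= N & x \<in> cbox 0 1 --> norm (F (k n) x - g0 x) < e"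
  using Arzela_Ascoli[of "cbox 0 (1::plane)" F M] M by (metis compact_cbox real_norm_def)
 have Ca: "EX N. ALL m>=N. ALL n>=N. ALL x. \<bar>F (k m) x - F (k n) x\<bar> <= e" if e: "e > 0" for e
 proof -
  have "e / 2 > 0" using e by simp
  from conv[OF this] obtain N where N: "!!n x. n >= N ==> x \<in> cbox 0 1 ==> \<bar>F (k n) x - g0 x\<bar> < e / 2"
   by auto
  have "\<bar>F (k m) x - F (k n) x\<bar> <= e" if "m >= N" "n >= N" for m n x
  proof -
   obtain a where a: "a \<in> int_lattice" "x + a \<in> cbox 0 1" using cell_reduce by blast
   have "F (k j) (x + a) = F (k j) x" for j using periodicD[OF cperD(2)[OF F] a(1)] .
   from this[of m] this[of n] show ?thesis using N[OF that(1) a(2)] N[OF that(2) a(2)] by linarith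
  qed
  then show ?thesis by blast
 qed
 show ?thesis
  using cper_Cauchy[of "%n. F (k n)", OF F Ca] k by (intro that[of "%x. lim (%n. F (k n) x)" k]) auto
qed

subsection \<open>Linear elliptic equations on the torus\<close>

text \<open>A solution of \<open>l \<phi> - \<Delta>\<phi> - b \<bullet> D\<phi> - c \<phi> = g\<close> with merely continuous \<open>g\<close> is a fixed point
 involving the resolvent of the Laplacian.\<close>

definition elliptic_rhs :: "(2 => plane => real) => (plane => real) => (plane => real) => (plane => real) => plane => real" where
 "elliptic_rhs b c g \<phi> x = g x + (b 1 x * pd 1 \<phi> x + b 2 x * pd 2 \<phi> x + c x * \<phi> x)"

definition elliptic_sol :: "real => (2 => plane => real) => (plane => real) => (plane => real) => (plane => real) => bool" where
 "elliptic_sol l b c g \<phi> \<longleftrightarrow> C_k 1 \<phi> & periodic \<phi> & \<phi> = resolvent l (elliptic_rhs b c g \<phi>)"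

context
 fixes l :: real and b :: "2 => plane => real" and c :: "plane => real" and Bb Bc :: real
 assumes l: "0 < l" and cb: "!!i. cper (b i)" and cc: "cper c"
  and Bb: "!!i x. \<bar>b i x\<bar> <= Bb" and Bc: "!!x. \<bar>c x\<bar> <= Bc"
  and small: "4 * Bb / sqrt l + Bc / l <= 1 / 2"
begin

lemma elliptic_rhs_cper: "C_k 1 \<phi> ==> periodic \<phi> ==> cper g ==> cper (elliptic_rhs b c g \<phi>)"
 unfolding elliptic_rhs_def using C_k_cper[of 1 \<phi>]
 by (intro cper_intros cb cc cper_dir_deriv[of 0]) auto

text \<open>The norms 1 / l and 2 / sqrt l of the resolvent and its derivatives make the lower-order
  part an operator of norm at most 1/2; this is the purpose of \<open>small\<close>.\<close>

lemma lower_order_bound: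
 assumes F: "cper F" "!!x. \<bar>F x\<bar> <= S"
 shows "\<bar>b 1 x * resolvent_d 1 l F x + b 2 x * resolvent_d 2 l F x + c x * resolvent l F x\<bar> <= 1 / 2 * S"
proof -
 have S: "0 <= S" using F(2)[of 0] by linarith
 have B: "0 <= Bb" "0 <= Bc" using Bb[of 1 0] Bc[of 0] by linarith+
 have d: "\<bar>resolvent_d i l F x\<bar> <= 2 / sqrt l * S" for i
  by (rule trans_inv_bound[OF resolvent_d_trans_inv[OF l] F])
 have r: "\<bar>resolvent l F x\<bar> <= 1 / l * S"
  by (rule trans_inv_bound[OF resolvent_trans_inv[OF l] F])
 have "\<bar>b i x * resolvent_d i l F x\<bar> <= Bb * (2 / sqrt l * S)" for i unfolding abs_mult by (intro mult_mono Bb d B) simp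
 from this[of 1] this[of 2] have "\<bar>b 1 x * resolvent_d 1 l F x\<bar> <= Bb * (2 / sqrt l * S)"
  "\<bar>b 2 x * resolvent_d 2 l F x\<bar> <= Bb * (2 / sqrt l * S)" by simp_all
 moreover have "\<bar>c x * resolvent l F x\<bar> <= Bc * (1 / l * S)"
  unfolding abs_mult by (intro mult_mono Bc r B) simp
 ultimately have "\<bar>b 1 x * resolvent_d 1 l F x + b 2 x * resolvent_d 2 l F x + c x * resolvent l F x\<bar>
  <= Bb * (2 / sqrt l * S) + Bb * (2 / sqrt l * S) + Bc * (1 / l * S)"
  by linarith
 also have "... = (4 * Bb / sqrt l + Bc / l) * S" by (simp add: algebra_simps)
 also have "... <= 1 / 2 * S" using small S by (rule mult_right_mono)
 finally show ?thesis .
qed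

text \<open>The unknown is F, formally \<open>l \<phi> - \<Delta>\<phi>\<close>, rather than \<phi>:
  in terms of F the equation is a contraction on merely continuous functions.\<close>

lemma elliptic_sol_exists:
 assumes g: "cper g" shows "\<exists>\<phi>. elliptic_sol l b c g \<phi>"
proof -
 note ti = resolvent_trans_inv[OF l] and tid = resolvent_d_trans_inv[OF l]
 define P where "P F = (%x. b 1 x * resolvent_d 1 l F x + b 2 x * resolvent_d 2 l F x + c x * resolvent l F x)" for F
 have cP: "cper (P F)" if "cper F" for F
  unfolding P_def by (intro cper_intros cb cc trans_inv_cper[OF ti] trans_inv_cper[OF tid] that)
 have "EX F. cper F & (%x. g x + P F x) = F"
 proof (rule cper_contraction)
  show "cper (%x. g x + P F x)" if "cper F" for F by (intro cper_intros g cP that)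
  show "\<bar>(g x + P F x) - (g x + P G x)\<bar> <= 1 / 2 * d"
   if "cper F" "cper G" "!!x. \<bar>F x - G x\<bar> <= d" for F G d x
  proof -
   have "P F x - P G x = P (%x. F x - G x) x"
    unfolding P_def by (simp add: trans_inv_diff[OF ti] trans_inv_diff[OF tid] that algebra_simps)
   then show ?thesis using lower_order_bound[OF cper_diff[OF that(1,2)] that(3), of x] by (simp add: P_def)
  qed
 qed auto
 then obtain F where F: "cper F" "!!x. F x = g x + P F x" by metis
 have "elliptic_rhs b c g (resolvent l F) = F"
  using F(2) unfolding elliptic_rhs_def P_def resolvent_d_def by auto
 then have "elliptic_sol l b c g (resolvent l F)"
  unfolding elliptic_sol_def using resolvent_C1(1)[OF l F(1)] trans_inv_cper[OF ti F(1)] by (auto simp: cper_def)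
 then show ?thesis by blast
qed

text \<open>Where the total right side F is largest in modulus, |F| <= |g| + |F| / 2, so F is at
  most twice the bound on the datum.\<close>

lemma elliptic_sol_bound:
 assumes s: "elliptic_sol l b c g \<phi>" and g: "cper g" and M: "!!x. \<bar>g x\<bar> <= M"
 shows "\<bar>\<phi> x\<bar> <= 2 / l * M" "\<bar>pd i \<phi> x\<bar> <= 4 / sqrt l * M"
proof -
 note ti = resolvent_trans_inv[OF l] and tid = resolvent_d_trans_inv[OF l]
 define F where "F = elliptic_rhs b c g \<phi>"
 have F: "cper F" unfolding F_def using s g by (intro elliptic_rhs_cper) (auto simp: elliptic_sol_def)
 have \<phi>: "\<phi> = resolvent l F" using s by (simp add: elliptic_sol_def F_def)
 then have d\<phi>: "pd i \<phi> = resolvent_d i l F" for i by (simp add: resolvent_d_def)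
 have eq: "F x = g x + (b 1 x * resolvent_d 1 l F x + b 2 x * resolvent_d 2 l F x + c x * resolvent l F x)" for x
  by (subst F_def) (simp add: elliptic_rhs_def d\<phi> \<phi>[symmetric])
 obtain a where a: "!!y. \<bar>F y\<bar> <= \<bar>F a\<bar>" using cper_attains_sup[OF cper_norm[OF F]] by auto
 have "\<bar>F a\<bar> <= \<bar>g a\<bar> + 1 / 2 * \<bar>F a\<bar>"
  using lower_order_bound[OF F a, of a] eq[of a] by linarith
 then have "\<bar>F a\<bar> <= 2 * M" using M[of a] by linarith
 then have b: "!!y. \<bar>F y\<bar> <= 2 * M" using a by (meson order_trans)
 show "\<bar>\<phi> x\<bar> <= 2 / l * M" using trans_inv_bound[OF ti F b] by (simp add: \<phi>[symmetric] mult.commute)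
 show "\<bar>pd i \<phi> x\<bar> <= 4 / sqrt l * M"
  using trans_inv_bound[OF tid F b, of i x] by (simp add: d\<phi>)
qed

lemma elliptic_sol_diff:
 assumes "elliptic_sol l b c g \<phi>" "elliptic_sol l b c h \<psi>" "cper g" "cper h"
 shows "elliptic_sol l b c (%x. g x - h x) (%x. \<phi> x - \<psi> x)"
proof -
 have d: "\<phi> differentiable (at x)" "\<psi> differentiable (at x)" for x
  using assms(1,2) by (auto simp: elliptic_sol_def)
 have "elliptic_rhs b c (%x. g x - h x) (%x. \<phi> x - \<psi> x) = (%x. elliptic_rhs b c g \<phi> x - elliptic_rhs b c h \<psi> x)"
  by (simp add: elliptic_rhs_def fun_eq_iff dir_deriv_diff d algebra_simps)
 moreover have "resolvent l (%x. elliptic_rhs b c g \<phi> x - elliptic_rhs b c h \<psi> x) =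
  (%x. resolvent l (elliptic_rhs b c g \<phi>) x - resolvent l (elliptic_rhs b c h \<psi>) x)"
  using assms by (intro trans_inv_diff[OF resolvent_trans_inv[OF l]] elliptic_rhs_cper) (auto simp: elliptic_sol_def)
 ultimately show ?thesis using assms(1,2)
  unfolding elliptic_sol_def by (auto intro: C_k_diff simp: periodic_def simp del: C_k.simps)
qed

lemma elliptic_sol_cmult:
 assumes "elliptic_sol l b c g \<phi>" "cper g"
 shows "elliptic_sol l b c (%x. a * g x) (%x. a * \<phi> x)"
proof -
 have d: "\<phi> differentiable (at x)" for x using assms(1) by (auto simp: elliptic_sol_def)
 have "elliptic_rhs b c (%x. a * g x) (%x. a * \<phi> x) = (%x. a * elliptic_rhs b c g \<phi> x)"
  by (simp add: elliptic_rhs_def fun_eq_iff dir_deriv_linear[OF bounded_linear_mult_right] d algebra_simps)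
 moreover have "resolvent l (%x. a * elliptic_rhs b c g \<phi> x) = (%x. a * resolvent l (elliptic_rhs b c g \<phi>) x)"
  using assms by (intro trans_inv_cmult[OF resolvent_trans_inv[OF l]] elliptic_rhs_cper) (auto simp: elliptic_sol_def)
 ultimately show ?thesis using assms(1)
  unfolding elliptic_sol_def by (auto intro: C_k_mult simp: periodic_def simp del: C_k.simps)
qed

lemma elliptic_sol_near:
 assumes "elliptic_sol l b c g \<phi>" "elliptic_sol l b c h \<psi>" "cper g" "cper h" "!!x. \<bar>g x - h x\<bar> <= M"
 shows "\<bar>\<phi> x - \<psi> x\<bar> <= 2 / l * M"
 by (rule elliptic_sol_bound(1)[OF elliptic_sol_diff[OF assms(1-4)] cper_diff[OF assms(3,4)] assms(5)])

lemma elliptic_sol_unique: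
 assumes "elliptic_sol l b c g \<phi>" "elliptic_sol l b c g \<psi>" "cper g" shows "\<phi> = \<psi>"
 using elliptic_sol_near[OF assms(1,2,3,3), of 0] by (auto simp: fun_eq_iff)

text \<open>Difference quotients of the solution solve the same equation with datum
  \<open>Rt t\<close>, in which the differences of the coefficients act on shifted values. These
  data converge uniformly to the formally differentiated datum, and stability carries the quotients
  to its solution.\<close>

lemma elliptic_sol_derivative:
 assumes s: "elliptic_sol l b c g \<phi>" and g: "C_k 1 g" "periodic g"
  and b1: "!!i. C_k 1 (b i)" and c1: "C_k 1 c" and e: "e \<in> Basis"
 shows "elliptic_sol l b c (%x. dir_deriv e g x + (dir_deriv e (b 1) x * pd 1 \<phi> x
   + dir_deriv e (b 2) x * pd 2 \<phi> x + dir_deriv e c x * \<phi> x)) (dir_deriv e \<phi>)"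
proof -
 note ti = resolvent_trans_inv[OF l]
 have \<phi>: "C_k 1 \<phi>" "periodic \<phi>" "\<phi> = resolvent l (elliptic_rhs b c g \<phi>)" using s by (auto simp: elliptic_sol_def)
 have pb: "periodic (b i)" "periodic c" for i using cb cc by (auto simp: cper_def)
 have c\<phi>: "cper \<phi>" "cper (pd i \<phi>)" for i
  using \<phi> C_k_cper[of 1 \<phi>] cper_dir_deriv[of 0 \<phi>] by auto
 have cg: "cper g" "cper (dir_deriv e g)" using g C_k_cper[OF g] cper_dir_deriv[of 0 g] e by auto
 have cbd: "cper (dir_deriv e (b i))" "cper (dir_deriv e c)" for i
  using b1 c1 pb e cper_dir_deriv[of 0 "b i" e] cper_dir_deriv[of 0 c e] by auto
 define R where "R x = dir_deriv e g x + (dir_deriv e (b 1) x * pd 1 \<phi> x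
   + dir_deriv e (b 2) x * pd 2 \<phi> x + dir_deriv e c x * \<phi> x)" for x
 have cR: "cper R" unfolding R_def by (intro cper_intros cg cbd c\<phi>)
 obtain \<psi> where \<psi>: "elliptic_sol l b c R \<psi>" using elliptic_sol_exists[OF cR] by blast
 define Rt where "Rt t x = (g (x + t *R e) - g x) / t + ((b 1 (x + t *R e) - b 1 x) / t * pd 1 \<phi> (x + t *R e)
  + (b 2 (x + t *R e) - b 2 x) / t * pd 2 \<phi> (x + t *R e) + (c (x + t *R e) - c x) / t * \<phi> (x + t *R e))" for t x
 define q where "q t x = (\<phi> (x + t *R e) - \<phi> x) / t" for t x
 have cRt: "cper (Rt t)" for t
  unfolding Rt_def divide_inverse by (intro cper_intros cg cb cc c\<phi>)
 have sq: "elliptic_sol l b c (Rt t) (q t)" if t: "t ~= 0" for t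
 proof -
  have d: "\<phi> differentiable (at x)" for x using \<phi>(1) by simp
  have dt: "(%x. \<phi> (x + t *R e)) differentiable (at x)" for x
   using C_k_translate[OF \<phi>(1), of "t *R e"] by simp
  have "C_k 1 (%x. inverse t * (\<phi> (x + t *R e) - \<phi> x))"
   by (rule C_k_mult[OF C_k_const C_k_diff[OF C_k_translate[OF \<phi>(1)] \<phi>(1)]])
  moreover have "q t = (%x. inverse t * (\<phi> (x + t *R e) - \<phi> x))" by (auto simp: q_def divide_inverse)
  ultimately have q1: "C_k 1 (q t)" by (simp only:)
  have "cper (q t)" unfolding q_def[abs_def] divide_inverse by (intro cper_intros c\<phi>)
  then have qp: "periodic (q t)" by (simp add: cper_def)
  have dq: "dir_deriv a (q t) x = (dir_deriv a \<phi> (x + t *R e) - dir_deriv a \<phi> x) / t" for a x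
  proof -
   have "q t = (%x. inverse t * (\<phi> (x + t *R e) - \<phi> x))" by (auto simp: q_def divide_inverse)
   then have "dir_deriv a (q t) x = inverse t * dir_deriv a (%x. \<phi> (x + t *R e) - \<phi> x) x"
    using dir_deriv_linear[OF bounded_linear_mult_right[of "inverse t"] differentiable_diff[OF dt d]] by simp
   then show ?thesis by (simp add: dir_deriv_diff[OF dt d] dir_deriv_translate[OF d] divide_inverse mult.commute)
  qed
  let ?r = "elliptic_rhs b c g \<phi>"
  have cr: "cper ?r" by (rule elliptic_rhs_cper[OF \<phi>(1,2) cg(1)])
  have "elliptic_rhs b c (Rt t) (q t) x = (?r (x + t *R e) - ?r x) / t" for x
  proof -
   have ring: "(g' - g0) / t + ((u' - u0) / t * p' + (v' - v0) / t * r' + (w' - w0) / t * f')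
    + (u0 * ((p' - p0) / t) + v0 * ((r' - r0) / t) + w0 * ((f' - f0) / t)) =
    ((g' + (u' * p' + v' * r' + w' * f')) - (g0 + (u0 * p0 + v0 * r0 + w0 * f0))) / t"
    for g' g0 u' u0 p' p0 v' v0 r' r0 w' w0 f' f0 :: real
    by (simp add: divide_inverse algebra_simps)
   show ?thesis unfolding elliptic_rhs_def Rt_def dq unfolding q_def by (rule ring)
  qed
  then have "elliptic_rhs b c (Rt t) (q t) = (%x. inverse t * (?r (x + t *R e) - ?r x))"
   by (auto simp: divide_inverse)
  then have "resolvent l (elliptic_rhs b c (Rt t) (q t)) = (%x. inverse t * resolvent l (%x. ?r (x + t *R e) - ?r x) x)"
   using trans_inv_cmult[OF ti cper_diff[OF cper_translate[OF cr] cr]] by simp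
  also have "resolvent l (%x. ?r (x + t *R e) - ?r x) = (%x. \<phi> (x + t *R e) - \<phi> x)"
   using trans_inv_diff[OF ti cper_translate[OF cr] cr] trans_inv_translate[OF ti cr, of "t *R e"] \<phi>(3)[symmetric] by simp
  finally show ?thesis using q1 qp unfolding elliptic_sol_def
   by (auto simp: q_def[abs_def] divide_inverse mult.commute simp del: C_k.simps)
 qed
 have ul: "uniform_limit UNIV (%t x. (h (x + t *R e) - h x) / t) (dir_deriv e h) (at 0)"
  if h: "C_k 1 h" "periodic h" for h :: "plane => real"
  unfolding uniform_limit_iff
 proof (intro allI impI)
  fix r :: real assume "r > 0"
  then have "r / 2 > 0" by simp
  from difference_quotient_uniform[OF h e this] obtain d where d: "d > 0"
   "!!x t. \<bar>t\<bar> < d ==> \<bar>h (x + t *R e) - h x - t * dir_deriv e h x\<bar> <= r / 2 * \<bar>t\<bar>" by blast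
  have "dist ((h (x + t *R e) - h x) / t) (dir_deriv e h x) < r" if t: "t ~= 0" "\<bar>t\<bar> < d" for t x
  proof -
   have "(h (x + t *R e) - h x) / t - dir_deriv e h x = (h (x + t *R e) - h x - t * dir_deriv e h x) / t"
    using t by (simp add: field_simps)
   also have "\<bar>...\<bar> <= r / 2" using d(2)[OF t(2), of x] t by (simp add: field_simps)
   finally show ?thesis using \<open>r > 0\<close> by (simp add: dist_real_def)
  qed
  then show "\<forall>\<^sub>F t in at 0. \<forall>x\<in>UNIV. dist ((h (x + t *R e) - h x) / t) (dir_deriv e h x) < r"
   unfolding eventually_at using d(1) by (intro exI[of _ d]) (auto simp: dist_real_def)
 qed
 have ut: "uniform_limit UNIV (%t x. h (x + t *R e)) h (at 0)" if h: "cper h" for h :: "plane => real"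
  unfolding uniform_limit_iff
 proof (intro allI impI)
  fix r :: real assume "r > 0"
  from cper_uniform[OF h this] obtain d where d: "d > 0" "!!x y. dist x y < d ==> dist (h x) (h y) < r" by blast
  then show "\<forall>\<^sub>F t in at 0. \<forall>x\<in>UNIV. dist (h (x + t *R e)) (h x) < r"
   unfolding eventually_at using d(1) e by (intro exI[of _ d]) (auto simp: dist_norm)
 qed
 have bd: "bounded (range h)" if h: "cper h" for h :: "plane => real"
  using cper_bounded[OF h] unfolding bounded_iff by auto
 have "uniform_limit UNIV Rt R (at 0)"
  unfolding Rt_def[abs_def] R_def[abs_def]
  by (intro uniform_limit_add uniform_lim_mult ul ut bd g b1 c1 pb c\<phi> cbd)
 have "((%t. q t x) \<longlongrightarrow> \<psi> x) (at 0)" for x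
 proof (rule tendstoI)
  fix r :: real assume r: "r > 0"
  define r' where "r' = r * l / 4"
  have r': "r' > 0" "2 / l * r' < r" using r l by (auto simp: r'_def)
  have "\<forall>\<^sub>F t in at 0. ALL x. dist (Rt t x) (R x) < r'"
   using \<open>uniform_limit UNIV Rt R (at 0)\<close> r'(1) unfolding uniform_limit_iff by auto
  moreover have "\<forall>\<^sub>F t in at (0::real). t ~= 0" by (simp add: eventually_at_filter)
  ultimately show "\<forall>\<^sub>F t in at 0. dist (q t x) (\<psi> x) < r"
  proof eventually_elim
   case (elim t)
   have "\<bar>q t x - \<psi> x\<bar> <= 2 / l * r'"
    by (rule elliptic_sol_near[OF sq[OF elim(2)] \<psi> cRt cR]) (use elim(1) in \<open>auto simp: dist_real_def less_imp_le\<close>)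
   then show ?case using r'(2) by (simp add: dist_real_def)
  qed
 qed
 then have "((%s. \<phi> (x + s *R e)) has_real_derivative \<psi> x) (at 0)" for x
  by (simp add: DERIV_def q_def)
 moreover have "((%s. \<phi> (x + s *R e)) has_real_derivative dir_deriv e \<phi> x) (at 0)" for x
  using dir_deriv_line_real[of \<phi> x 0 e] \<phi>(1) by simp
 ultimately have "dir_deriv e \<phi> = \<psi>" using DERIV_unique by blast
 then show ?thesis using \<psi> by (simp add: R_def[abs_def])
qed

text \<open>The datum for the derivative contains the solution and its first derivatives only, so
  each use of \<open>elliptic_sol_derivative\<close> raises the order by one.\<close>

lemma elliptic_sol_C_k:
 assumes b1: "!!k i. C_k k (b i)" and c1: "!!k. C_k k c"
 shows "elliptic_sol l b c g \<phi> ==> C_k k g ==> periodic g ==> C_k (Suc k) \<phi>"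
proof (induction k arbitrary: g \<phi>)
 case 0
 then show ?case by (simp add: elliptic_sol_def)
next
 case (Suc k)
 have g1: "C_k 1 g" using C_k_mono[OF Suc.prems(2), of 1] by simp
 have \<phi>k: "C_k (Suc k) \<phi>" by (rule Suc.IH[OF Suc.prems(1) C_k_Suc_imp[OF Suc.prems(2)] Suc.prems(3)])
 have \<phi>p: "periodic \<phi>" using Suc.prems(1) by (simp add: elliptic_sol_def)
 have "C_k (Suc k) (dir_deriv e \<phi>)" if e: "e \<in> Basis" for e
 proof (rule Suc.IH[OF elliptic_sol_derivative[OF Suc.prems(1) g1 Suc.prems(3) b1 c1 e]])
  have ck: "C_k k (dir_deriv e (b i))" "C_k k (dir_deriv e c)" "C_k k (pd i \<phi>)" "C_k k (dir_deriv e g)" for i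
   using b1[of "Suc k" i] c1[of "Suc k"] \<phi>k e Suc.prems(2) by auto
  then show "C_k k (%x. dir_deriv e g x + (dir_deriv e (b 1) x * pd 1 \<phi> x
   + dir_deriv e (b 2) x * pd 2 \<phi> x + dir_deriv e c x * \<phi> x))"
   using C_k_Suc_imp[OF \<phi>k] by (intro C_k_add C_k_mult) auto
  have "cper (dir_deriv e g)" "cper (dir_deriv e (b i))" "cper (dir_deriv e c)" "cper (pd i \<phi>)" "cper \<phi>" for i
   using cper_dir_deriv[of k g e] cper_dir_deriv[OF b1[of "Suc 0" i]] cper_dir_deriv[OF c1[of "Suc 0"]]
    cper_dir_deriv[OF \<phi>k \<phi>p] C_k_cper[OF \<phi>k \<phi>p] Suc.prems e cb cc by (auto simp: cper_def)
  then have "cper (%x. dir_deriv e g x + (dir_deriv e (b 1) x * pd 1 \<phi> x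
   + dir_deriv e (b 2) x * pd 2 \<phi> x + dir_deriv e c x * \<phi> x))"
   by (intro cper_intros)
  then show "periodic (%x. dir_deriv e g x + (dir_deriv e (b 1) x * pd 1 \<phi> x
   + dir_deriv e (b 2) x * pd 2 \<phi> x + dir_deriv e c x * \<phi> x))" by (simp add: cper_def)
 qed
 then show ?case using \<phi>k by simp
qed

lemma elliptic_sol_equation:
 assumes b1: "!!k i. C_k k (b i)" and c1: "!!k. C_k k c"
  and s: "elliptic_sol l b c g \<phi>" and g: "C_k 1 g" "periodic g"
 shows "C_k 2 \<phi>" "l * \<phi> x - laplacian \<phi> x = elliptic_rhs b c g \<phi> x"
proof -
 have C: "C_k (Suc 1) \<phi>" by (rule elliptic_sol_C_k[OF b1 c1 s g])
 then show "C_k 2 \<phi>" by (simp add: numeral_2_eq_2)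
 have \<phi>: "C_k 1 \<phi>" "periodic \<phi>" "\<phi> = resolvent l (elliptic_rhs b c g \<phi>)" using s by (auto simp: elliptic_sol_def)
 have "C_k 1 (pd i \<phi>)" for i using C by simp
 then have "C_k 1 (elliptic_rhs b c g \<phi>)"
  unfolding elliptic_rhs_def[abs_def] by (intro C_k_add C_k_mult g b1 c1 \<phi>)
 moreover have "periodic (elliptic_rhs b c g \<phi>)"
  using elliptic_rhs_cper[OF \<phi>(1,2) C_k_cper[OF g]] by (simp add: cper_def)
 ultimately show "l * \<phi> x - laplacian \<phi> x = elliptic_rhs b c g \<phi> x"
  using resolvent_C1_equation(2)[OF l] \<phi>(3) by metis
qed

lemma coefficient_less: "c x < l"
proof -
 have B: "0 <= Bb" "0 <= Bc" using Bb[of 1 0] Bc[of 0] by linarith+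
 then have "0 <= 4 * Bb / sqrt l" using l by simp
 then have "Bc / l <= 1 / 2" using small by linarith
 then have "Bc <= l / 2" using l by (simp add: field_simps)
 then show ?thesis using Bc[of x] l by linarith
qed

text \<open>At a minimum the gradient vanishes and the Laplacian is nonnegative; this argument
  requires a C^2 solution, so a continuous datum is approximated by nonnegative C^1 data.\<close>

lemma elliptic_sol_nonneg:
 assumes b1: "!!k i. C_k k (b i)" and c1: "!!k. C_k k c"
  and s: "elliptic_sol l b c g \<phi>" and g: "cper g" "!!x. 0 <= g x"
 shows "0 <= \<phi> x"
proof -
 have 1: "0 <= \<psi> x" if s: "elliptic_sol l b c h \<psi>" and h: "C_k 1 h" "periodic h" "!!x. 0 <= h x" for h \<psi> x
 proof -
  note E = elliptic_sol_equation[OF b1 c1 s h(1,2)]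
  have "cper \<psi>" using C_k_cper[OF E(1)] s by (simp add: elliptic_sol_def)
  then obtain a where a: "!!y. \<psi> a <= \<psi> y" using cper_attains_inf by blast
  have "grad \<psi> a = 0" "laplacian \<psi> a >= 0" using laplacian_at_min[OF E(1) a] by auto
  then have "pd i \<psi> a = 0" for i using inner_grad[of "axis i 1" \<psi> a] by simp
  then have "(l - c a) * \<psi> a = h a + laplacian \<psi> a" using E(2)[of a] by (simp add: elliptic_rhs_def algebra_simps)
  then have "(l - c a) * \<psi> a >= 0" using h(3)[of a] \<open>laplacian \<psi> a >= 0\<close> by linarith
  then have "0 <= \<psi> a" using coefficient_less[of a] by (simp add: zero_le_mult_iff)
  then show ?thesis using a[of x] by linarith
 qed
 obtain h where h: "!!n. C_k 1 (h n)" "!!n. periodic (h n)" "!!n x. \<bar>h n x - g x\<bar> <= 1 / real (Suc n)"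
  "!!n x. 0 <= h n x" using cper_approx_seq[OF g(1), of 1] g(2) by metis
 have "- \<phi> x <= 0 + e" if e: "e > 0" for e
 proof -
  obtain N where N: "1 / real (Suc N) < e * l / 2" using inverse_Suc_less[of "e * l / 2"] e l by auto
  have ch: "cper (h N)" using C_k_cper[OF h(1,2)] .
  obtain \<psi> where \<psi>: "elliptic_sol l b c (h N) \<psi>" using elliptic_sol_exists[OF ch] by blast
  have "0 <= \<psi> x" by (rule 1[OF \<psi> h(1,2,4)])
  moreover have "\<bar>\<psi> x - \<phi> x\<bar> <= 2 / l * (1 / real (Suc N))"
   by (rule elliptic_sol_near[OF \<psi> s ch g(1) h(3)])
  moreover have "2 / l * (1 / real (Suc N)) <= 2 / l * (e * l / 2)"
   using N l by (intro mult_left_mono) auto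
  ultimately show ?thesis using l by simp
 qed
 from field_le_epsilon[OF this] show ?thesis by simp
qed

end

section \<open>Strong maximum principle and principal eigenvalue\<close>

lemma inner_Basis_square: "(\<Sum>e\<in>(Basis::plane set). (w \<bullet> e)\<^sup>2) = (norm w)\<^sup>2"
 unfolding power2_norm_eq_inner by (subst euclidean_inner) (simp add: power2_eq_square)

text \<open>The barrier is \<open>exp (- \<alpha> |x - y|\<^sup>2) - exp (- 9 \<alpha>)\<close> on the annulus \<open>\<rho> <= |x - y| <= 3\<close>; the disc of
 radius \<open>3\<close> contains a fundamental cell.\<close>

lemma strong_maximum_principle:
 fixes \<phi> :: "plane => real"
 assumes \<phi>: "C_k 2 \<phi>" "periodic \<phi>" "!!x. 0 <= \<phi> x" and y: "0 < \<phi> y"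
  and B: "!!x. norm (b x) <= B" and c: "!!x. c x < l" "!!x. l - c x <= C"
  and super: "!!x. 0 <= l * \<phi> x - laplacian \<phi> x - b x \<bullet> grad \<phi> x - c x * \<phi> x"
 shows "0 < \<phi> x"
proof -
 have \<phi>2: "C_k (Suc (Suc 0)) \<phi>" using \<phi>(1) by (simp add: numeral_2_eq_2)
 have d1: "\<phi> differentiable (at z)" for z using \<phi>2 by simp
 have d2: "dir_deriv e \<phi> differentiable (at z)" if "e \<in> Basis" for z e using \<phi>2 that by simp
 have cont: "continuous_on S \<phi>" for S using cperD(1)[OF C_k_cper[OF \<phi>(1,2)]] .
 define m where "m = \<phi> y / 2"
 have m: "m > 0" using y by (simp add: m_def)
 obtain \<rho>' where \<rho>': "\<rho>' > 0" "!!z. dist z y < \<rho>' ==> dist (\<phi> z) (\<phi> y) < m"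
  using cont[of UNIV] m unfolding continuous_on_iff by (metis UNIV_I)
 define \<rho> where "\<rho> = min (\<rho>' / 2) 1"
 have \<rho>: "0 < \<rho>" "\<rho> <= 1" "!!z. norm (z - y) <= \<rho> ==> m <= \<phi> z"
 proof -
  show "0 < \<rho>" "\<rho> <= 1" using \<rho>'(1) by (auto simp: \<rho>_def)
  fix z assume "norm (z - y) <= \<rho>"
  then have "dist z y < \<rho>'" using \<rho>'(1) by (auto simp: \<rho>_def dist_norm min_def split: if_splits)
  from \<rho>'(2)[OF this] show "m <= \<phi> z" unfolding dist_real_def m_def by linarith
 qed
 have B0: "0 <= B" using B[of 0] norm_ge_zero order_trans by blast
 have C0: "0 < C" using c[of 0] by linarith
 \<comment> \<open>This makes the barrier a strict subsolution on the annulus: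
   \<open>4 * \<alpha>\<^sup>2 * \<rho>\<^sup>2\<close> beats the zeroth-order coefficient C, the
   term 4 \<alpha> from the second derivatives, and the drift, which contributes at most 6 \<alpha>
   B because the radius is at most 3.\<close>
 define \<alpha> where "\<alpha> = (C + 4 + 6 * B) / \<rho>\<^sup>2 + 1"
 have \<alpha>: "\<alpha> >= 1" using B0 C0 by (simp add: \<alpha>_def)
 have \<alpha>\<rho>: "4 * \<alpha>\<^sup>2 * \<rho>\<^sup>2 > C + 4 * \<alpha> + 6 * \<alpha> * B"
 proof -
  have "\<alpha> * \<rho>\<^sup>2 = C + 4 + 6 * B + \<rho>\<^sup>2" using \<rho>(1) by (simp add: \<alpha>_def field_simps)
  then have "\<alpha> * \<rho>\<^sup>2 > C + 4 + 6 * B" using \<rho>(1) by simp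
  then have "\<alpha> * (\<alpha> * \<rho>\<^sup>2) > \<alpha> * (C + 4 + 6 * B)" using \<alpha> by (intro mult_strict_left_mono) auto
  moreover have "\<alpha> * C >= 1 * C" using \<alpha> C0 by (intro mult_right_mono) auto
  moreover have "\<alpha> * (\<alpha> * \<rho>\<^sup>2) >= 0" using \<alpha> by simp
  moreover have "4 * \<alpha>\<^sup>2 * \<rho>\<^sup>2 = 4 * (\<alpha> * (\<alpha> * \<rho>\<^sup>2))" "\<alpha> * (C + 4 + 6 * B) = \<alpha> * C + 4 * \<alpha> + 6 * \<alpha> * B"
   by (simp_all add: power2_eq_square algebra_simps)
  ultimately show ?thesis by linarith
 qed
 define E where "E z = exp (- \<alpha> * (norm (z - y))\<^sup>2)" for z
 define W where "W z = E z - exp (- 9 * \<alpha>)" for z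
 define A where "A = {z. \<rho> <= norm (z - y) & norm (z - y) <= 3}"
 \<comment> \<open>The scaled barrier is at most m / 2 on the inner circle, where \<phi> >= m, and
   it vanishes on the outer one; a negative minimum of \<open>v\<close> is therefore
   interior.\<close>
 define v where "v z = \<phi> z - m / 2 * W z" for z
 have contv: "continuous_on S v" for S
  unfolding v_def W_def E_def by (intro continuous_intros cont)
 have W1: "W z <= 1" for z
 proof -
  have "E z <= 1" unfolding E_def using \<alpha> by simp
  moreover have "exp (- 9 * \<alpha>) >= 0" by simp
  ultimately show ?thesis unfolding W_def by linarith
 qed
 have A: "compact A"
 proof -
  have "A = cball y 3 - ball y \<rho>" by (auto simp: A_def dist_norm norm_minus_commute)
  then show ?thesis by (simp add: compact_diff)
 qed
 have vA: "v z >= 0" if zA: "z \<in> A" for z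
 proof (rule ccontr)
  assume neg: "\<not> v z >= 0"
  obtain a where a: "a \<in> A" "!!z. z \<in> A ==> v a <= v z"
   using continuous_attains_inf[OF A _ contv] zA by blast
  have va: "v a < 0" using a(2)[OF zA] neg by linarith
  have "norm (a - y) ~= \<rho>"
  proof
   assume "norm (a - y) = \<rho>"
   then have "\<phi> a >= m" using \<rho>(3) by simp
   moreover have "m / 2 * W a <= m / 2 * 1" using m W1 by (intro mult_left_mono) auto
   ultimately show False using va m unfolding v_def by linarith
  qed
  moreover have "norm (a - y) ~= 3"
  proof
   assume "norm (a - y) = 3"
   then have "W a = 0" by (simp add: W_def E_def)
   then show False using va \<phi>(3)[of a] by (simp add: v_def)
  qed
  ultimately have r: "\<rho> < norm (a - y)" "norm (a - y) < 3" using a(1) by (auto simp: A_def)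
  define d where "d = min (norm (a - y) - \<rho>) (3 - norm (a - y))"
  have d: "d > 0" using r by (simp add: d_def)
  let ?w = "a - y"
  have crit: "dir_deriv e \<phi> a = - (m * \<alpha> * (?w \<bullet> e) * E a) &
   dir_deriv e (dir_deriv e \<phi>) a >= m / 2 * (4 * \<alpha>\<^sup>2 * (?w \<bullet> e)\<^sup>2 - 2 * \<alpha>) * E a" if e: "e \<in> Basis" for e
  proof -
   define G where "G s = \<alpha> * ((norm ?w)\<^sup>2 + 2 * s * (?w \<bullet> e) + s\<^sup>2)" for s
   have nE: "E (a + s *R e) = exp (- G s)" for s
   proof -
    have "(norm (a + s *R e - y))\<^sup>2 = (norm ?w)\<^sup>2 + 2 * s * (?w \<bullet> e) + s\<^sup>2"
     using e unfolding power2_norm_eq_inner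
     by (simp add: algebra_simps inner_diff_left inner_diff_right inner_add_left inner_add_right inner_commute power2_eq_square inner_Basis)
    then show ?thesis by (simp add: E_def G_def)
   qed
   define F where "F s = - (\<phi> (a + s *R e) - m / 2 * (exp (- G s) - exp (- 9 * \<alpha>)))" for s
   define F' where "F' s = - (dir_deriv e \<phi> (a + s *R e) + m / 2 * (\<alpha> * (2 * (?w \<bullet> e) + 2 * s)) * exp (- G s))" for s
   have G': "(G has_real_derivative \<alpha> * (2 * (?w \<bullet> e) + 2 * s)) (at s)" for s
    unfolding G_def by (auto intro!: derivative_eq_intros)
   have ex: "((%s. exp (- G s)) has_real_derivative - (\<alpha> * (2 * (?w \<bullet> e) + 2 * s)) * exp (- G s)) (at s)" for s
    using G' by (auto intro!: derivative_eq_intros)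
   have F1: "(F has_real_derivative F' s) (at s)" for s
    unfolding F_def F'_def using dir_deriv_line_real[OF d1] G'
    by (auto intro!: derivative_eq_intros simp: field_simps)
   have lin: "((%s. \<alpha> * (2 * (?w \<bullet> e) + 2 * s)) has_real_derivative 2 * \<alpha>) (at s)" for s
    by (auto intro!: derivative_eq_intros)
   have "(F' has_real_derivative - (dir_deriv e (dir_deriv e \<phi>) (a + 0 *R e) +
    (m / 2 * (\<alpha> * (2 * (?w \<bullet> e) + 2 * 0)) * (- (\<alpha> * (2 * (?w \<bullet> e) + 2 * 0)) * exp (- G 0)) + m / 2 * (2 * \<alpha>) * exp (- G 0)))) (at 0)"
    unfolding F'_def
    by (intro DERIV_minus DERIV_add dir_deriv_line_real[OF d2[OF e]] DERIV_mult'[OF DERIV_cmult[OF lin] ex])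
   then have F2: "(F' has_real_derivative - (dir_deriv e (dir_deriv e \<phi>) a - m / 2 * (4 * \<alpha>\<^sup>2 * (?w \<bullet> e)\<^sup>2 - 2 * \<alpha>) * exp (- G 0))) (at 0)"
    by (rule DERIV_cong) (simp add: algebra_simps power2_eq_square)
   have mx: "F s <= F 0" if s: "\<bar>s - 0\<bar> < d" for s
   proof -
    have "\<bar>norm (a + s *R e - y) - norm ?w\<bar> <= norm (s *R e)"
     using norm_triangle_ineq3[of "a + s *R e - y" ?w] by (simp add: algebra_simps)
    then have "\<bar>norm (a + s *R e - y) - norm ?w\<bar> < d" using s e by simp
    then have "a + s *R e \<in> A" unfolding A_def d_def by auto
    then have "v a <= v (a + s *R e)" by (rule a(2))
    then show ?thesis using nE[of s] nE[of 0] by (simp add: F_def v_def W_def)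
   qed
   have z: "F' 0 = 0" "- (dir_deriv e (dir_deriv e \<phi>) a - m / 2 * (4 * \<alpha>\<^sup>2 * (?w \<bullet> e)\<^sup>2 - 2 * \<alpha>) * exp (- G 0)) <= 0"
    using max_second_derivative[OF F1 F2 d mx] by auto
   then show ?thesis using nE[of 0] by (simp add: F'_def algebra_simps)
  qed
  have lap: "laplacian \<phi> a >= m / 2 * (4 * \<alpha>\<^sup>2 * (norm ?w)\<^sup>2 - 4 * \<alpha>) * E a"
  proof -
   have "(\<Sum>e\<in>Basis. m / 2 * (4 * \<alpha>\<^sup>2 * (?w \<bullet> e)\<^sup>2 - 2 * \<alpha>) * E a) <= laplacian \<phi> a"
    unfolding laplacian_def using crit by (intro sum_mono) auto
   moreover have "(\<Sum>e\<in>Basis. m / 2 * (4 * \<alpha>\<^sup>2 * (?w \<bullet> e)\<^sup>2 - 2 * \<alpha>) * E a) = m / 2 * (4 * \<alpha>\<^sup>2 * (\<Sum>e\<in>(Basis::plane set). (?w \<bullet> e)\<^sup>2) - 4 * \<alpha>) * E a"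
    by (simp add: sum_Basis_plane algebra_simps)
   ultimately show ?thesis by (simp add: inner_Basis_square)
  qed
  have gr: "grad \<phi> a = - (m * \<alpha> * E a) *R ?w"
  proof -
   have "grad \<phi> a = (\<Sum>e\<in>Basis. - (m * \<alpha> * E a) *R ((?w \<bullet> e) *R e))"
    unfolding grad_def using crit by (intro sum.cong) auto
   also have "... = - (m * \<alpha> * E a) *R (\<Sum>e\<in>Basis. (?w \<bullet> e) *R e)" by (simp only: scaleR_sum_right)
   finally show ?thesis by (simp only: euclidean_representation)
  qed
  have E0: "E a > 0" by (simp add: E_def)
  have mE: "m * E a > 0" using m E0 by simp
  have bw: "b a \<bullet> ?w <= 3 * B"
  proof -
   have "b a \<bullet> ?w <= norm (b a) * norm ?w" by (rule norm_cauchy_schwarz)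
   also have "... <= B * 3" using B[of a] r B0 by (intro mult_mono) auto
   finally show ?thesis by simp
  qed
  have "\<rho>\<^sup>2 <= (norm ?w)\<^sup>2" using r \<rho>(1) by (intro power_mono) auto
  then have "4 * \<alpha>\<^sup>2 * \<rho>\<^sup>2 <= 4 * \<alpha>\<^sup>2 * (norm ?w)\<^sup>2" using \<alpha> by (intro mult_left_mono) auto
  then have k1: "4 * \<alpha>\<^sup>2 * (norm ?w)\<^sup>2 - 4 * \<alpha> - 6 * \<alpha> * B > C" using \<alpha>\<rho> by linarith
  have bg: "- (b a \<bullet> grad \<phi> a) <= m * E a * (3 * \<alpha> * B)"
  proof -
   have "- (b a \<bullet> grad \<phi> a) = (m * E a * \<alpha>) * (b a \<bullet> ?w)" by (simp add: gr)
   also have "... <= (m * E a * \<alpha>) * (3 * B)" using mE \<alpha> bw by (intro mult_left_mono) auto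
   finally show ?thesis by (simp add: algebra_simps)
  qed
  have W0: "m / 2 * W a <= m / 2 * E a" using m by (intro mult_left_mono) (auto simp: W_def)
  have "(l - c a) * v a <= 0" using c(1)[of a] va by (intro mult_nonneg_nonpos) auto
  moreover have "(l - c a) * v a = (l - c a) * \<phi> a - (l - c a) * (m / 2 * W a)"
   by (simp only: v_def right_diff_distrib)
  ultimately have "(l - c a) * \<phi> a <= (l - c a) * (m / 2 * W a)" by linarith
  also have "... <= (l - c a) * (m / 2 * E a)" using c(1)[of a] by (intro mult_left_mono W0) auto
  also have "... <= C * (m / 2 * E a)" using c(2)[of a] mE by (intro mult_right_mono) auto
  also have "... = m * E a * (C / 2)" by simp
  finally have cv: "(l - c a) * \<phi> a <= m * E a * (C / 2)" .
  have "0 <= (l - c a) * \<phi> a - laplacian \<phi> a - b a \<bullet> grad \<phi> a" using super[of a] by (simp add: algebra_simps)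
  also have "... <= m * E a * (C / 2) - m / 2 * (4 * \<alpha>\<^sup>2 * (norm ?w)\<^sup>2 - 4 * \<alpha>) * E a + m * E a * (3 * \<alpha> * B)"
   using cv lap bg by linarith
  also have "... = m * E a * ((C - (4 * \<alpha>\<^sup>2 * (norm ?w)\<^sup>2 - 4 * \<alpha> - 6 * \<alpha> * B)) / 2)" by (simp add: algebra_simps)
  also have "... < 0" using k1 mE by (intro mult_pos_neg) auto
  finally show False by simp
 qed
 \<comment> \<open>Some lattice translate of x lies at distance at most 2 from y, strictly inside
   the outer circle.\<close>
 obtain k where k: "k \<in> int_lattice" "(x - y) + k \<in> cbox 0 1" using cell_reduce by blast
 let ?x = "x + k"
 have n: "norm (?x - y) <= 2" using cell_norm[OF k(2)] by (simp add: algebra_simps)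
 have "0 < \<phi> ?x"
 proof (cases "norm (?x - y) <= \<rho>")
  case True
  then show ?thesis using \<rho>(3) m by force
 next
  case False
  then have "v ?x >= 0" using n by (intro vA) (auto simp: A_def)
  moreover have "W ?x > 0"
  proof -
   have "(norm (?x - y))\<^sup>2 <= 2\<^sup>2" using n by (intro power_mono) auto
   then have "\<alpha> * (norm (?x - y))\<^sup>2 <= \<alpha> * 4" using \<alpha> by (intro mult_left_mono) auto
   then have "- 9 * \<alpha> < - \<alpha> * (norm (?x - y))\<^sup>2" using \<alpha> by simp
   then show ?thesis unfolding W_def E_def by simp
  qed
  then have "m / 2 * W ?x > 0" using m by simp
  ultimately show ?thesis by (simp add: v_def)
 qed
 then show ?thesis using periodicD[OF \<phi>(2) k(1)] by simp
qed

text \<open>The eigenvalue is the largest \<open>s\<close> such that \<open>T f >= s f\<close> for some nonnegative \<open>f ~= 0\<close>, where \<open>T\<close> is the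
 solution operator (Collatz--Wielandt).\<close>

theorem principal_eigenfunction:
 fixes b :: "plane => plane" and c :: "plane => real"
 assumes b: "smooth b" "periodic b" and c: "smooth c" "periodic c"
 shows "\<exists>\<phi> \<kappa>. smooth \<phi> & periodic \<phi> & (ALL x. 0 < \<phi> x) &
  (ALL x. laplacian \<phi> x + b x \<bullet> grad \<phi> x + c x * \<phi> x = \<kappa> * \<phi> x)"
proof -
 define \<beta> where "\<beta> i x = b x $ i" for i :: 2 and x
 have \<beta>1: "C_k k (\<beta> i)" for k i
  unfolding \<beta>_def using C_k_linear[OF bounded_linear_vec_nth smooth_C_k[OF b(1)]] .
 have cb: "cper b" using C_k_cper[OF smooth_C_k[OF b(1), of 0] b(2)] .
 have c\<beta>: "cper (\<beta> i)" for i unfolding \<beta>_def by (rule cper_nth[OF cb])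
 have c1: "C_k k c" for k by (rule smooth_C_k[OF c(1)])
 have cc: "cper c" using C_k_cper[OF c1[of 0] c(2)] .
 obtain Bb where Bb: "Bb > 0" "!!x. norm (b x) <= Bb" using cper_bounded[OF cb] by blast
 obtain Bc where Bc: "Bc > 0" "!!x. \<bar>c x\<bar> <= Bc" using cper_bounded[OF cc] by auto
 have \<beta>b: "\<bar>\<beta> i x\<bar> <= Bb" for i x
  unfolding \<beta>_def using component_le_norm_cart[of "b x" i] Bb(2)[of x] by linarith
 \<comment> \<open>The two terms limit the contributions of the drift and of the potential to 1/4
   each.\<close>
 define l where "l = (16 * Bb)\<^sup>2 + 4 * Bc"
 have l: "l > 0" using Bb(1) Bc(1) by (simp add: l_def add_pos_pos)
 have small: "4 * Bb / sqrt l + Bc / l <= 1 / 2"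
 proof -
  have "16 * Bb <= sqrt l" using Bc(1) Bb(1) by (intro real_le_rsqrt) (simp add: l_def)
  then have "4 * Bb / sqrt l <= 1 / 4" using l by (simp add: field_simps)
  moreover have "Bc / l <= 1 / 4" using l by (simp add: field_simps) (simp add: l_def)
  ultimately show ?thesis by linarith
 qed
 note ctx = l c\<beta> cc \<beta>b Bc(2) small
 define sol where "sol = elliptic_sol l \<beta> c"
 note exs = elliptic_sol_exists[where l=l and b=\<beta> and c=c and Bb=Bb and Bc=Bc, OF ctx, folded sol_def]
  and bound = elliptic_sol_bound[where l=l and b=\<beta> and c=c and Bb=Bb and Bc=Bc, OF ctx, folded sol_def]
  and sdiff = elliptic_sol_diff[where l=l and b=\<beta> and c=c and Bb=Bb and Bc=Bc, OF ctx, folded sol_def]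
  and scm = elliptic_sol_cmult[where l=l and b=\<beta> and c=c and Bb=Bb and Bc=Bc, OF ctx, folded sol_def]
  and near = elliptic_sol_near[where l=l and b=\<beta> and c=c and Bb=Bb and Bc=Bc, OF ctx, folded sol_def]
  and uniq = elliptic_sol_unique[where l=l and b=\<beta> and c=c and Bb=Bb and Bc=Bc, OF ctx, folded sol_def]
  and Ck = elliptic_sol_C_k[where l=l and b=\<beta> and c=c and Bb=Bb and Bc=Bc, OF ctx \<beta>1 c1, folded sol_def]
  and equ = elliptic_sol_equation[where l=l and b=\<beta> and c=c and Bb=Bb and Bc=Bc, OF ctx \<beta>1 c1, folded sol_def]
  and nn = elliptic_sol_nonneg[where l=l and b=\<beta> and c=c and Bb=Bb and Bc=Bc, OF ctx \<beta>1 c1, folded sol_def]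
  and cl = coefficient_less[where l=l and b=\<beta> and c=c and Bb=Bb and Bc=Bc, OF ctx]
 define T where "T g = (THE \<phi>. sol g \<phi>)" for g
 have T: "sol g (T g)" if g: "cper g" for g
 proof -
  obtain \<phi> where \<phi>: "sol g \<phi>" using exs[OF g] by blast
  show ?thesis unfolding T_def by (rule theI[of "sol g", OF \<phi>]) (rule uniq[OF _ \<phi> g])
 qed
 have Teq: "T g = \<phi>" if "sol g \<phi>" "cper g" for g \<phi> using uniq[OF T[OF that(2)] that] .
 have T1: "C_k 1 (T g)" "periodic (T g)" if "cper g" for g
  using T[OF that] by (auto simp: sol_def elliptic_sol_def)
 have cT: "cper (T g)" if "cper g" for g using C_k_cper[OF T1[OF that]] .
 have Tdiff: "T (%x. g x - h x) = (%x. T g x - T h x)" if "cper g" "cper h" for g h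
  using that by (intro Teq sdiff T cper_intros)
 have Tcm: "T (%x. a * g x) = (%x. a * T g x)" if "cper g" for a g
  using that by (intro Teq scm T cper_intros)
 have Tnn: "0 <= T g x" if "cper g" "!!x. 0 <= g x" for g x by (rule nn[OF T[OF that(1)] that])
 have Tmono: "T h x <= T g x" if "cper g" "cper h" "!!x. h x <= g x" for g h x
  using Tnn[OF cper_diff[OF that(1,2)], of x] that Tdiff[OF that(1,2)] by simp
 have gradT: "elliptic_rhs \<beta> c g \<phi> x = g x + (b x \<bullet> grad \<phi> x + c x * \<phi> x)" for g \<phi> x
 proof -
  have "grad \<phi> x = pd 1 \<phi> x *R axis 1 1 + pd 2 \<phi> x *R axis 2 1"
   by (simp add: grad_def sum_Basis_plane)
  then have "b x \<bullet> grad \<phi> x = \<beta> 1 x * pd 1 \<phi> x + \<beta> 2 x * pd 2 \<phi> x"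
   by (simp add: inner_add_right inner_axis \<beta>_def)
  then show ?thesis by (simp add: elliptic_rhs_def)
 qed
 have TE: "l * T g x - laplacian (T g) x - b x \<bullet> grad (T g) x - c x * T g x = g x" if "C_k 1 g" "periodic g" for g x
  using equ(2)[OF T[OF C_k_cper[OF that]] that, of x] by (simp add: gradT)
 have Tpos: "0 < T g x" if g: "C_k 1 g" "periodic g" "!!x. 0 <= g x" and y: "0 < g y" for g x y
 proof -
  have cg: "cper g" by (rule C_k_cper[OF g(1,2)])
  have "EX z. T g z ~= 0"
  proof (rule ccontr)
   assume "\<not> ?thesis"
   then have "T g = (%x. 0)" by auto
   moreover have "laplacian (%x. 0) y = 0" "grad (%x. 0::real) y = 0"
    by (simp_all add: laplacian_def grad_def dir_deriv_const[abs_def])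
   ultimately show False using TE[OF g(1,2), of y] y by simp
  qed
  then obtain z where z: "0 < T g z" using Tnn[OF cg g(3)] by (metis less_eq_real_def)
  have "l - c x <= l + Bc" for x using Bc(2)[of x] by linarith
  then show ?thesis
   using TE[OF g(1,2)] g(3)
   by (intro strong_maximum_principle[where b=b and c=c and l=l and C="l + Bc" and B=Bb,
      OF equ(1)[OF T[OF cg] g(1,2)] T1(2)[OF cg] Tnn[OF cg g(3)] z Bb(2) cl]) auto
 qed
 \<comment> \<open>The normalisation by an attained maximum 1 keeps maximising sequences from
   degenerating to zero.\<close>
 define adm where "adm s f \<longleftrightarrow> cper f & (ALL x. 0 <= f x & f x <= 1) & (EX x. f x = 1) & (ALL x. s * f x <= T f x)" for s f
 define S where "S = {s. EX f. adm s f}"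
 have S_le: "s <= 2 / l" if sf: "adm s f" for s f
 proof -
  obtain x where x: "f x = 1" using sf by (auto simp: adm_def)
  have "\<bar>T f x\<bar> <= 2 / l * 1" using sf by (intro bound(1)[OF T]) (auto simp: adm_def)
  moreover have "s * f x <= T f x" using sf by (simp add: adm_def)
  ultimately show ?thesis using x by simp
 qed
 obtain a where a: "!!y. T (%x. 1) a <= T (%x. 1) y" using cper_attains_inf[OF cT[OF cper_const]] by blast
 have "0 < T (%x. 1) a" by (rule Tpos) (auto simp: periodic_def)
 moreover have "adm (T (%x. 1) a) (%x. 1)" using a by (auto simp: adm_def)
 ultimately have S: "T (%x. 1) a \<in> S" "0 < T (%x. 1) a" by (auto simp: S_def)
 have bdd: "bdd_above S" using S_le by (auto simp: S_def bdd_above_def)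
 define r where "r = Sup S"
 have r0: "r > 0" using S cSup_upper[OF S(1) bdd] by (simp add: r_def)
 have "EX s f. adm s f & r - 1 / real (Suc n) < s" for n
  using less_cSup_iff[of S "r - 1 / real (Suc n)"] bdd S(1) by (auto simp: r_def S_def)
 then obtain s f where sf: "!!n. adm (s n) (f n)" "!!n. r - 1 / real (Suc n) < s n" by metis
 have s_le: "s n <= r" for n unfolding r_def using sf(1) bdd by (intro cSup_upper) (auto simp: S_def)
 have cf: "cper (f n)" for n using sf(1) by (simp add: adm_def)
 have f1: "\<bar>f n x\<bar> <= 1" for n x using sf(1) by (simp add: adm_def)
 have Tf_b: "\<bar>T (f n) x\<bar> <= 2 / l" for n x using bound(1)[OF T[OF cf] cf f1] by simp
 have eqc: "EX d>0. ALL n x y. dist x y < d --> \<bar>T (f n) x - T (f n) y\<bar> < e" if e: "e > 0" for e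
 proof -
  define L where "L = 8 / sqrt l + 1"
  have L: "L > 0" using l by (simp add: L_def add_nonneg_pos)
  have lip: "\<bar>T (f n) x - T (f n) y\<bar> <= L * norm (x - y)" for n x y
  proof -
   have d: "T (f n) differentiable (at x)" for x using T1(1)[OF cf] by simp
   have "norm (T (f n) x - T (f n) y) <= L * norm (x - y)"
   proof (rule differentiable_bound[of UNIV "T (f n)" "%x h. grad (T (f n)) x \<bullet> h"])
    show "(T (f n) has_derivative (%h. grad (T (f n)) x \<bullet> h)) (at x within UNIV)" for x
     using has_derivative_grad[OF d] by simp
    show "onorm (%h. grad (T (f n)) x \<bullet> h) <= L" for x
    proof (rule onorm_le)
     fix h
     have "norm (grad (T (f n)) x) <= (\<Sum>e\<in>(Basis::plane set). 4 / sqrt l)"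
      unfolding grad_def using bound(2)[OF T[OF cf] cf f1] by (intro sum_norm_le) (auto simp: Basis_plane)
     then have g: "norm (grad (T (f n)) x) <= L" using l by (simp add: L_def)
     have "norm (grad (T (f n)) x \<bullet> h) <= norm (grad (T (f n)) x) * norm h"
      using Cauchy_Schwarz_ineq2 by simp
     also have "... <= L * norm h" using g by (intro mult_right_mono) auto
     finally show "norm (grad (T (f n)) x \<bullet> h) <= L * norm h" .
    qed
   qed auto
   then show ?thesis by simp
  qed
  have "\<bar>T (f n) x - T (f n) y\<bar> < e" if "dist x y < e / L" for n x y
  proof -
   have "L * norm (x - y) < e" using that L by (simp add: dist_norm field_simps)
   then show ?thesis using lip[of n x y] by linarith
  qed
  then show ?thesis using e L by (intro exI[of _ "e / L"]) auto
 qed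
 \<comment> \<open>Compactness is available for \<open>T (f n)\<close> and not for
   \<open>f n\<close>, so the limit is extracted after one application of the operator.\<close>
 obtain g k where g: "cper g" and k: "strict_mono (k :: nat => nat)"
  and conv: "!!e. e > 0 ==> EX N. ALL n>=N. ALL x. \<bar>T (f (k n)) x - g x\<bar> <= e"
  using cper_Arzela_Ascoli[of "%n. T (f n)" "2 / l", OF cT[OF cf] Tf_b eqc] by metis
 have big: "EX N. ALL n>=N. 1 / real (Suc (k n)) < e" if "e > 0" for e
  using inverse_Suc_less[OF that] seq_suble[OF k] by (meson order_trans)
 have g0: "0 <= g x" for x
 proof -
  have "- g x <= 0 + e" if e: "e > 0" for e
  proof -
   obtain N where "ALL n>=N. ALL x. \<bar>T (f (k n)) x - g x\<bar> <= e" using conv[OF e] by blast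
   then have "\<bar>T (f (k N)) x - g x\<bar> <= e" by blast
   moreover have "0 <= T (f (k N)) x" using sf(1) by (intro Tnn cf) (simp add: adm_def)
   ultimately show ?thesis by linarith
  qed
  from field_le_epsilon[OF this] show ?thesis by simp
 qed
 have gpos: "EX x. g x > 0"
 proof (rule ccontr)
  assume "\<not> ?thesis"
  then have z: "g x = 0" for x using g0[of x] by (metis less_eq_real_def)
  have "r / 4 > 0" "r / 2 > 0" using r0 by auto
  obtain N1 where N1: "ALL n>=N1. ALL x. \<bar>T (f (k n)) x - g x\<bar> <= r / 4" using conv[OF \<open>r / 4 > 0\<close>] by blast
  obtain N2 where N2: "ALL n>=N2. 1 / real (Suc (k n)) < r / 2" using big[OF \<open>r / 2 > 0\<close>] by blast
  define n where "n = max N1 N2"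
  obtain x where x: "f (k n) x = 1" using sf(1)[of "k n"] by (auto simp: adm_def)
  have "s (k n) * f (k n) x <= T (f (k n)) x" using sf(1)[of "k n"] by (simp add: adm_def)
  then have "s (k n) <= T (f (k n)) x" by (simp only: x mult_1_right)
  moreover have "\<bar>T (f (k n)) x - g x\<bar> <= r / 4" using N1 by (simp add: n_def)
  moreover have "1 / real (Suc (k n)) < r / 2" using N2 by (simp add: n_def)
  ultimately show False using z[of x] sf(2)[of "k n"] r0 by linarith
 qed
 have rg: "r * g x <= T g x" for x
 proof -
  have "r * g x <= T g x + e" if e: "e > 0" for e
  proof -
   define e1 where "e1 = e / (r + 2 / l + 2 / l)"
   have D: "r + 2 / l + 2 / l > 0" using r0 l by (intro add_pos_pos) auto
   have e1: "e1 > 0" using e D by (simp add: e1_def)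
   obtain N1 where N1: "ALL n>=N1. ALL x. \<bar>T (f (k n)) x - g x\<bar> <= e1" using conv[OF e1] by blast
   obtain N2 where N2: "ALL n>=N2. 1 / real (Suc (k n)) < e1" using big[OF e1] by blast
   define n where "n = max N1 N2"
   let ?g = "T (f (k n))"
   have cgn: "cper ?g" by (rule cT[OF cf])
   have A1: "\<bar>?g x - g x\<bar> <= e1" for x using N1 by (simp add: n_def)
   have A2: "1 / real (Suc (k n)) < e1" using N2 by (simp add: n_def)
   have "\<bar>T ?g x - T g x\<bar> <= 2 / l * e1" by (rule near[OF T[OF cgn] T[OF g] cgn g A1])
   moreover have "s (k n) * ?g x <= T ?g x"
    using Tmono[OF cgn cper_mult[OF cper_const cf], of "s (k n)" "k n" x] sf(1)[of "k n"] Tcm[OF cf, of "s (k n)" "k n"]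
    by (simp add: adm_def)
   moreover have "r * g x <= r * ?g x + r * e1" using A1[of x] r0
    by (simp add: distrib_left[symmetric] abs_le_iff)
   moreover have "r * ?g x <= s (k n) * ?g x + 2 / l * e1"
   proof -
    have "(r - s (k n)) * ?g x <= e1 * (2 / l)"
     using sf(2)[of "k n"] s_le[of "k n"] A2 Tf_b[of "k n" x] e1
     by (intro mult_mono') (auto simp: abs_le_iff intro!: Tnn cf, use sf(1)[of "k n"] in \<open>simp add: adm_def\<close>)
    then show ?thesis by (simp add: algebra_simps)
   qed
   moreover have "(r + 2 / l + 2 / l) * e1 = r * e1 + 2 / l * e1 + 2 / l * e1" by (simp only: distrib_right)
   ultimately have "r * g x <= T g x + (r + 2 / l + 2 / l) * e1" by linarith
   then show ?thesis using D by (simp add: e1_def)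
  qed
  then show ?thesis by (rule field_le_epsilon)
 qed
 \<comment> \<open>One more application of \<open>T\<close> gives a C^1 function, to which
   \<open>Tpos\<close> applies.\<close>
 define g' where "g' = T g"
 have g'1: "C_k 1 g'" "periodic g'" unfolding g'_def by (rule T1[OF g])+
 have cg': "cper g'" by (rule C_k_cper[OF g'1])
 have g'0: "0 <= g' x" for x unfolding g'_def by (rule Tnn[OF g g0])
 obtain x0 where x0: "g' x0 > 0"
  using gpos rg r0 unfolding g'_def by (metis less_le_trans mult_pos_pos)
 have Tg'pos: "0 < T g' x" for x by (rule Tpos[OF g'1 g'0 x0])
 have rg': "r * g' x <= T g' x" for x
 proof -
  have "T (%x. r * g x) x <= T g' x"
   by (rule Tmono[OF cg' cper_mult[OF cper_const g]]) (use rg in \<open>simp add: g'_def\<close>)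
  then show ?thesis by (simp add: Tcm[OF g] g'_def)
 qed
 have eig: "T g' x = r * g' x" for x
 proof (rule ccontr)
  assume ne: "T g' x ~= r * g' x"
  \<comment> \<open>A strict inequality at one point becomes, after applying \<open>T\<close>,
    strict everywhere with a margin \<epsilon>; the normalised \<open>T g'\<close> is then
    admissible for r + \<epsilon>, against the choice of r.\<close>
  let ?h = "%x. T g' x - r * g' x"
  have h1: "C_k 1 ?h" by (intro C_k_diff C_k_mult C_k_const T1 cg' g'1)
  have ch: "cper ?h" by (intro cper_intros cT cg')
  have hp: "periodic ?h" using ch by (simp add: cper_def)
  have "0 < ?h x" using ne rg'[of x] by simp
  then have Th: "0 < T ?h y" for y using rg' by (intro Tpos[OF h1 hp]) auto
  obtain y1 where y1: "!!y. T ?h y1 <= T ?h y" using cper_attains_inf[OF cT[OF ch]] by blast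
  obtain y2 where y2: "!!y. T g' y <= T g' y2" using cper_attains_sup[OF cT[OF cg']] by blast
  let ?M = "T g' y2"
  have M: "?M > 0" by (rule Tg'pos)
  define \<epsilon> where "\<epsilon> = T ?h y1 / ?M"
  have eps: "\<epsilon> > 0" using Th M by (simp add: \<epsilon>_def)
  have hle: "\<epsilon> * T g' y <= T ?h y" for y
  proof -
   have "\<epsilon> * T g' y <= \<epsilon> * ?M" using eps y2 by (intro mult_left_mono) auto
   also have "... = T ?h y1" using M by (simp add: \<epsilon>_def)
   finally show ?thesis using y1[of y] by linarith
  qed
  have Th_eq: "T ?h = (%y. T (T g') y - r * T g' y)"
   by (simp add: Tdiff[OF cT[OF cg'] cper_mult[OF cper_const cg']] Tcm[OF cg'])
  have "adm (r + \<epsilon>) (%y. (1 / ?M) * T g' y)"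
   unfolding adm_def
  proof (intro conjI allI)
   show "cper (%y. (1 / ?M) * T g' y)" by (intro cper_intros cT cg')
   show "0 <= (1 / ?M) * T g' y" for y using M Tg'pos[of y] by simp
   show "(1 / ?M) * T g' y <= 1" for y using M y2[of y] by (simp add: field_simps)
   show "EX y. (1 / ?M) * T g' y = 1" using M by (intro exI[of _ y2]) simp
   show "(r + \<epsilon>) * ((1 / ?M) * T g' y) <= T (%y. (1 / ?M) * T g' y) y" for y
   proof -
    have "(r + \<epsilon>) * T g' y <= T (T g') y" using hle[of y] by (simp add: Th_eq algebra_simps)
    then have "(1 / ?M) * ((r + \<epsilon>) * T g' y) <= (1 / ?M) * T (T g') y" using M by (intro mult_left_mono) auto
    then show ?thesis unfolding Tcm[OF cT[OF cg']] by (simp only: mult.left_commute)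
   qed
  qed
  then have "r + \<epsilon> <= r" unfolding r_def using bdd by (intro cSup_upper) (auto simp: S_def)
  then show False using eps by simp
 qed
 have Tg': "T g' = (%x. r * g' x)" using eig by auto
 \<comment> \<open>The eigenfunction is \<open>T g'\<close> divided by r, so the derivative gained
   by \<open>T\<close> feeds back into its argument.\<close>
 have "C_k k g'" for k
 proof (induction k)
  case 0
  then show ?case using cg' by (simp add: cper_def)
 next
  case (Suc k)
  have "C_k (Suc k) (%x. r * g' x)" using Ck[OF T[OF cg'] Suc g'1(2)] by (simp only: Tg')
  then have "C_k (Suc k) (%x. inverse r * (r * g' x))" by (rule C_k_mult[OF C_k_const])
  then show ?case using r0 by (simp add: mult.assoc[symmetric])
 qed
 then have sm: "smooth g'" by (simp add: smooth_def)
 have dg: "dir_deriv e g' differentiable (at x)" if "e \<in> Basis" for e x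
  using \<open>!!k. C_k k g'\<close>[of "Suc (Suc 0)"] that by simp
 have dg0: "g' differentiable (at x)" for x using g'1(1) by simp
 have dd: "dir_deriv e (%x. r * g' x) = (%x. r * dir_deriv e g' x)" for e
  by (intro ext dir_deriv_linear[OF bounded_linear_mult_right] dg0)
 have "laplacian (%x. r * g' x) x = r * laplacian g' x" for x
  unfolding laplacian_def dd
  using dir_deriv_linear[OF bounded_linear_mult_right dg] by (simp add: sum_distrib_left)
 moreover have "grad (%x. r * g' x) x = r *R grad g' x" for x by (rule grad_cmult[OF dg0])
 ultimately have "r * (laplacian g' x + b x \<bullet> grad g' x + c x * g' x) = r * ((l - 1 / r) * g' x)" for x
  using TE[OF g'1, of x] r0 unfolding Tg' by (simp add: algebra_simps)
 then have "laplacian g' x + b x \<bullet> grad g' x + c x * g' x = (l - 1 / r) * g' x" for x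
  using r0 by simp
 moreover have "0 < g' x" for x using Tg'pos[of x] eig[of x] r0 by (simp add: zero_less_mult_iff)
 ultimately show ?thesis using sm g'1(2) by blast
qed

subsection \<open>The flow of a Lipschitz vector field\<close>

text \<open>Joins the one-sided derivatives of the forward and the backward solution at time
  0.\<close>

lemma has_vector_derivative_within_Un:
 assumes "(f has_vector_derivative D) (at a within S)" "(f has_vector_derivative D) (at a within T)"
 shows "(f has_vector_derivative D) (at a within (S \<union> T))"
 using assms unfolding has_vector_derivative_def has_derivative_within
 by (auto intro: filterlim_sup simp: at_within_union)

lemma lipschitz_continuous:
 assumes "!!x y. norm (f x - f y) <= C * norm (x - y :: 'a::real_normed_vector)"
 shows "continuous_on S (f :: 'a => 'b::real_normed_vector)"
proof (rule lipschitz_on_continuous_on[of "\<bar>C\<bar>"], rule lipschitz_onI)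
 show "dist (f x) (f y) <= \<bar>C\<bar> * dist x y" for x y
  using assms[of x y] mult_right_mono[OF abs_ge_self[of C] norm_ge_zero[of "x - y"]] by (simp add: dist_norm)
qed simp

lemma Picard_forward:
 fixes V :: "plane => plane"
 assumes M: "!!x. norm (V x) <= M" and L: "0 < L" "!!x y. norm (V x - V y) <= L * norm (x - y)"
 shows "\<exists>\<xi>. \<xi> 0 = x & (ALL t>=0. (\<xi> has_vector_derivative V (\<xi> t)) (at t within {0..}))"
proof -
 have M0: "0 <= M" using M[of 0] norm_ge_zero order_trans by blast
 have cV: "continuous_on UNIV V"
  by (rule lipschitz_continuous[OF L(2)])
 \<comment> \<open>The displacement from x is weighted by \<open>exp (- 2 * L * s)\<close>, which
   makes the Picard operator a contraction by 1/2 on the whole half line at once, without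
   continuation.\<close>
 define g where "g \<nu> s = V (x + exp (2 * L * s) *R apply_bcontfun \<nu> s)" for \<nu> :: "real \<Rightarrow>\<^sub>C plane" and s
 have cg: "continuous_on S (g \<nu>)" for S \<nu>
  unfolding g_def
  by (rule continuous_on_compose2[OF cV]) (auto intro!: continuous_intros continuous_on_subset[OF continuous_on_apply_bcontfun[of UNIV]])
 have ig: "g \<nu> integrable_on {0..t}" for \<nu> t by (rule integrable_continuous_interval[OF cg])
 define J where "J \<nu> t = integral {0..t} (g \<nu>)" for \<nu> and t :: real
 have J': "(J \<nu> has_vector_derivative g \<nu> t) (at t within {0..})" if "0 <= t" for \<nu> t
 proof -
  have "(J \<nu> has_vector_derivative g \<nu> t) (at t within {0..t+1})"
   unfolding J_def[abs_def] using that by (intro integral_has_vector_derivative cg) auto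
  moreover have "at t within {0..t+1} = at t within {0..}"
   by (rule at_within_nhd[of t "{..<t+1}"]) auto
  ultimately show ?thesis by simp
 qed
 have Jn: "norm (J \<nu> t) <= M * t" if "0 <= t" for \<nu> and t :: real
 proof -
  have "norm (integral {0..t} (g \<nu>)) <= integral {0..t} (%s. M)"
   by (rule integral_norm_bound_integral[OF ig]) (auto simp: g_def M)
  then show ?thesis using that by (simp add: J_def mult.commute)
 qed
 \<comment> \<open>The fixed point is sought among functions on the whole line; the absolute value
   extends to negative times, whose values are irrelevant.\<close>
 define Q where "Q \<nu> t = exp (- 2 * L * \<bar>t\<bar>) *R J \<nu> \<bar>t\<bar>" for \<nu> t
 have contJ: "continuous_on {0..} (J \<nu>)" for \<nu>
  unfolding continuous_on_eq_continuous_within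
 proof
  show "continuous (at t within {0..}) (J \<nu>)" if "t \<in> {0..}" for t
   by (rule has_vector_derivative_continuous[OF J']) (use that in simp)
 qed
 have Qb: "Q \<nu> \<in> bcontfun" for \<nu>
 proof (rule bcontfun_normI)
  show "continuous_on UNIV (Q \<nu>)" unfolding Q_def
   by (intro continuous_intros continuous_on_compose2[OF contJ]) auto
  fix t
  have "2 * L * \<bar>t\<bar> <= exp (2 * L * \<bar>t\<bar>)" using exp_ge_add_one_self[of "2 * L * \<bar>t\<bar>"] by linarith
  then have "\<bar>t\<bar> * exp (- 2 * L * \<bar>t\<bar>) <= 1 / (2 * L)" using L(1) by (simp add: exp_minus field_simps)
  then have "M * (\<bar>t\<bar> * exp (- 2 * L * \<bar>t\<bar>)) <= M * (1 / (2 * L))" using M0 by (rule mult_left_mono)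
  moreover have "norm (Q \<nu> t) <= exp (- 2 * L * \<bar>t\<bar>) * (M * \<bar>t\<bar>)"
   unfolding Q_def using Jn[of "\<bar>t\<bar>"] by simp
  ultimately show "norm (Q \<nu> t) <= M * (1 / (2 * L))" by (simp add: algebra_simps)
 qed
 define P where "P \<nu> = Bcontfun (Q \<nu>)" for \<nu>
 have P: "apply_bcontfun (P \<nu>) = Q \<nu>" for \<nu> unfolding P_def by (rule Bcontfun_inverse[OF Qb])
 have "\<exists>!\<nu>. P \<nu> = \<nu>"
 proof (rule banach_fix_type)
  show "0 <= (1/2::real)" "(1/2::real) < 1" by auto
  show "\<forall>\<nu> \<eta>. dist (P \<nu>) (P \<eta>) <= 1 / 2 * dist \<nu> \<eta>"
  proof (intro allI dist_bound)
   fix \<nu> \<eta> :: "real \<Rightarrow>\<^sub>C plane" and t :: real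
   let ?t = "\<bar>t\<bar>" and ?d = "dist \<nu> \<eta>"
   have gd: "norm (g \<nu> s - g \<eta> s) <= L * exp (2 * L * s) * ?d" for s
   proof -
    have "norm (g \<nu> s - g \<eta> s) <= L * norm (exp (2 * L * s) *R (apply_bcontfun \<nu> s - apply_bcontfun \<eta> s))"
     unfolding g_def using L(2)[of "x + exp (2 * L * s) *R apply_bcontfun \<nu> s" "x + exp (2 * L * s) *R apply_bcontfun \<eta> s"]
     by (simp add: scaleR_diff_right)
    also have "... = L * exp (2 * L * s) * dist (apply_bcontfun \<nu> s) (apply_bcontfun \<eta> s)" by (simp add: dist_norm)
    also have "... <= L * exp (2 * L * s) * ?d" using L(1) dist_bounded by (intro mult_left_mono) auto
    finally show ?thesis .
   qed
   have I: "((%s. L * exp (2 * L * s) * ?d) has_integral (exp (2 * L * ?t) / 2 * ?d - exp (2 * L * 0) / 2 * ?d)) {0..?t}"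
    by (rule fundamental_theorem_of_calculus)
     (auto intro!: derivative_eq_intros simp: has_real_derivative_iff_has_vector_derivative[symmetric])
   have "norm (J \<nu> ?t - J \<eta> ?t) = norm (integral {0..?t} (%s. g \<nu> s - g \<eta> s))"
    unfolding J_def by (simp add: integral_diff ig)
   also have "... <= integral {0..?t} (%s. L * exp (2 * L * s) * ?d)"
    using I by (intro integral_norm_bound_integral integrable_diff ig gd) auto
   also have "... = exp (2 * L * ?t) / 2 * ?d - ?d / 2" by (subst integral_unique[OF I]) simp
   finally have "norm (J \<nu> ?t - J \<eta> ?t) <= exp (2 * L * ?t) / 2 * ?d" by (smt (verit) zero_le_dist divide_nonneg_nonneg)
   then have "exp (- 2 * L * ?t) * norm (J \<nu> ?t - J \<eta> ?t) <= exp (- 2 * L * ?t) * (exp (2 * L * ?t) / 2 * ?d)"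
    by (intro mult_left_mono) auto
   also have "... = 1 / 2 * ?d" by (simp add: exp_minus)
   finally show "dist (apply_bcontfun (P \<nu>) t) (apply_bcontfun (P \<eta>) t) <= 1 / 2 * ?d"
    unfolding P Q_def dist_norm by (simp add: scaleR_diff_right[symmetric])
  qed
 qed
 then obtain \<nu> where \<nu>: "P \<nu> = \<nu>" by blast
 have z: "apply_bcontfun \<nu> t = exp (- 2 * L * t) *R J \<nu> t" if "0 <= t" for t
  using P[of \<nu>] that unfolding \<nu> Q_def by simp
 define \<xi> where "\<xi> t = x + J \<nu> t" for t
 have gx: "g \<nu> t = V (\<xi> t)" if "0 <= t" for t
  unfolding g_def \<xi>_def z[OF that] by (simp add: exp_minus)
 have "(\<xi> has_vector_derivative V (\<xi> t)) (at t within {0..})" if "0 <= t" for t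
  using J'[OF that, of \<nu>] gx[OF that] unfolding \<xi>_def[abs_def]
  by (auto intro!: derivative_eq_intros)
 moreover have "\<xi> 0 = x" by (simp add: \<xi>_def J_def)
 ultimately show ?thesis by blast
qed

section \<open>Flow lines and the flow map\<close>

definition flow_line :: "(plane => plane) => (real => plane) => bool" where
 "flow_line V \<xi> \<longleftrightarrow> (ALL t. (\<xi> has_vector_derivative V (\<xi> t)) (at t))"

definition flow :: "(plane => plane) => real => plane => plane" where
 "flow V t x = (THE \<xi>. flow_line V \<xi> & \<xi> 0 = x) t"

lemma flow_line_reverse: "flow_line V \<xi> ==> flow_line (%x. c *R V x) (%t. \<xi> (c * t))"
 unfolding flow_line_def
proof
 fix t assume "ALL t. (\<xi> has_vector_derivative V (\<xi> t)) (at t)"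
 then have "(\<xi> has_vector_derivative V (\<xi> (c * t))) (at (c * t))" by blast
 moreover have "((%t. c * t) has_vector_derivative c) (at t)"
  by (auto intro!: derivative_eq_intros)
 ultimately show "((%t. \<xi> (c * t)) has_vector_derivative c *R V (\<xi> (c * t))) (at t)"
  using vector_diff_chain_at[of "%t. c * t" c t \<xi>] by (simp add: o_def)
qed

lemma flow_line_shift: "flow_line V \<xi> ==> flow_line V (%t. \<xi> (t + s))"
 unfolding flow_line_def
proof
 fix t assume "ALL t. (\<xi> has_vector_derivative V (\<xi> t)) (at t)"
 then have "(\<xi> has_vector_derivative V (\<xi> (t + s))) (at (t + s))" by blast
 moreover have "((%t. t + s) has_vector_derivative 1) (at t)"
  by (auto intro!: derivative_eq_intros)
 ultimately show "((%t. \<xi> (t + s)) has_vector_derivative V (\<xi> (t + s))) (at t)"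
  using vector_diff_chain_at[of "%t. t + s" 1 t \<xi>] by (simp add: o_def)
qed

locale lipschitz_field =
 fixes V :: "plane => plane" and M L :: real
 assumes cV: "cper V" and M: "!!x. norm (V x) <= M"
  and L: "0 < L" "!!x y. norm (V x - V y) <= L * norm (x - y)"
begin

lemma M_nonneg: "0 <= M" using M[of 0] norm_ge_zero order_trans by blast

lemma flow_line_exists: "\<exists>\<xi>. flow_line V \<xi> & \<xi> 0 = x"
proof -
 obtain \<xi> where \<xi>: "\<xi> 0 = x" "!!t. 0 <= t ==> (\<xi> has_vector_derivative V (\<xi> t)) (at t within {0..})"
  using Picard_forward[OF M L] by blast
 obtain \<eta> where \<eta>: "\<eta> 0 = x" "!!t. 0 <= t ==> (\<eta> has_vector_derivative - V (\<eta> t)) (at t within {0..})"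
  using Picard_forward[of "%x. - V x" M L x] M L by (auto simp: norm_minus_commute)
 define \<nu> where "\<nu> t = (if 0 <= t then \<xi> t else \<eta> (- t))" for t
 have r: "(\<nu> has_vector_derivative V (\<nu> t)) (at t within {0..})" if "0 <= t" for t
  using \<xi>(2)[OF that] that
  by (rule_tac has_vector_derivative_transform[where f=\<xi>]) (auto simp: \<nu>_def)
 have l: "(\<nu> has_vector_derivative V (\<nu> t)) (at t within {..0})" if "t <= 0" for t
 proof -
  have "((%t. - t) has_vector_derivative - 1) (at t within {..0})"
   by (auto intro!: derivative_eq_intros)
  moreover have "(\<eta> has_vector_derivative - V (\<eta> (- t))) (at (- t) within uminus ` {..0})"
   using \<eta>(2)[of "- t"] that by simp
  ultimately have "((\<eta> \<circ> uminus) has_vector_derivative (- 1) *R (- V (\<eta> (- t)))) (at t within {..0})"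
   by (rule vector_diff_chain_within)
  then have "((\<eta> \<circ> uminus) has_vector_derivative V (\<nu> t)) (at t within {..0})"
   using that \<xi>(1) \<eta>(1) by (auto simp: \<nu>_def)
  then show ?thesis
   by (rule has_vector_derivative_transform[rotated 2]) (use that \<xi>(1) \<eta>(1) in \<open>auto simp: \<nu>_def\<close>)
 qed
 have "(\<nu> has_vector_derivative V (\<nu> t)) (at t)" for t
 proof (cases t "0::real" rule: linorder_cases)
  case less
  have "at t within {..0} = at t" using less by (intro at_within_interior) simp
  then show ?thesis using l[of t] less by simp
 next
  case greater
  have "at t within {0..} = at t" using greater by (intro at_within_interior) simp
  then show ?thesis using r[of t] greater by simp
 next
  case equal
  have "{0..} \<union> {..0::real} = UNIV" by auto
  then show ?thesis using has_vector_derivative_within_Un[OF r[of t] l[of t]] equal by simp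
 qed
 then show ?thesis using \<xi>(1) by (intro exI[of _ \<nu>]) (auto simp: flow_line_def \<nu>_def)
qed

text \<open>Gronwall's inequality, by monotonicity of the squared distance times
  \<open>exp (- 2 * L * t)\<close>.\<close>

lemma flow_line_dist_forward:
 assumes "flow_line V \<xi>" "flow_line V \<eta>" "0 <= t"
 shows "norm (\<xi> t - \<eta> t) <= exp (L * t) * norm (\<xi> 0 - \<eta> 0)"
proof -
 define w where "w t = \<xi> t - \<eta> t" for t
 define h where "h t = exp (- 2 * L * t) * (w t \<bullet> w t)" for t
 have w': "(w has_vector_derivative V (\<xi> t) - V (\<eta> t)) (at t)" for t
  unfolding w_def using assms by (intro has_vector_derivative_diff) (auto simp: flow_line_def)
 have h': "(h has_real_derivative exp (- 2 * L * t) * (2 * (w t \<bullet> (V (\<xi> t) - V (\<eta> t)) - L * (w t \<bullet> w t)))) (at t)" for t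
 proof -
  have "((%t. w t \<bullet> w t) has_vector_derivative w t \<bullet> (V (\<xi> t) - V (\<eta> t)) + (V (\<xi> t) - V (\<eta> t)) \<bullet> w t) (at t)"
   using bounded_bilinear.has_vector_derivative[OF bounded_bilinear_inner w' w'] .
  then have "((%t. w t \<bullet> w t) has_real_derivative 2 * (w t \<bullet> (V (\<xi> t) - V (\<eta> t)))) (at t)"
   by (simp add: has_real_derivative_iff_has_vector_derivative inner_commute)
  then show ?thesis unfolding h_def
   by (auto intro!: derivative_eq_intros simp: algebra_simps)
 qed
 have "h t <= h 0"
 proof (rule DERIV_nonpos_imp_nonincreasing[OF assms(3)])
  fix s assume "0 <= s" "s <= t"
  have "w s \<bullet> (V (\<xi> s) - V (\<eta> s)) <= norm (w s) * norm (V (\<xi> s) - V (\<eta> s))" by (rule norm_cauchy_schwarz)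
  also have "... <= norm (w s) * (L * norm (w s))" unfolding w_def by (intro mult_left_mono L) auto
  also have "... = L * (w s \<bullet> w s)" by (simp add: power2_norm_eq_inner[symmetric] power2_eq_square)
  finally have "exp (- 2 * L * s) * (2 * (w s \<bullet> (V (\<xi> s) - V (\<eta> s)) - L * (w s \<bullet> w s))) <= 0"
   by (intro mult_nonneg_nonpos) auto
  then show "EX y. (h has_real_derivative y) (at s) & y <= 0" using h'[of s] by blast
 qed
 then have "w t \<bullet> w t <= exp (2 * L * t) * (w 0 \<bullet> w 0)"
  by (simp add: h_def exp_minus field_simps)
 also have "exp (2 * L * t) = (exp (L * t))\<^sup>2" by (simp add: power2_eq_square exp_add[symmetric])
 finally have "(norm (w t))\<^sup>2 <= (exp (L * t) * norm (w 0))\<^sup>2"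
  by (simp add: power2_norm_eq_inner[symmetric] power_mult_distrib)
 then show ?thesis unfolding w_def by (rule power2_le_imp_le) simp
qed

lemma lipschitz_field_scale: "c ~= 0 ==> lipschitz_field (%x. c *R V x) (\<bar>c\<bar> * M) (\<bar>c\<bar> * L)"
proof
 show "cper (%x. c *R V x)" by (intro cper_intros cV)
 show "norm (c *R V x) <= \<bar>c\<bar> * M" for x using M[of x] by (simp add: mult_left_mono)
 show "norm (c *R V x - c *R V y) <= \<bar>c\<bar> * L * norm (x - y)" for x y
  using L(2)[of x y] by (simp add: scaleR_diff_right[symmetric] mult.assoc mult_left_mono)
 show "0 < \<bar>c\<bar> * L" if "c ~= 0" using L(1) that by simp
qed

lemma flow_line_dist:
 assumes "flow_line V \<xi>" "flow_line V \<eta>"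
 shows "norm (\<xi> t - \<eta> t) <= exp (L * \<bar>t\<bar>) * norm (\<xi> 0 - \<eta> 0)"
proof (cases "0 <= t")
 case True
 then show ?thesis using flow_line_dist_forward[OF assms] by simp
next
 case False
 interpret R: lipschitz_field "%x. (-1) *R V x" "\<bar>-1\<bar> * M" "\<bar>-1\<bar> * L" by (rule lipschitz_field_scale) simp
 show ?thesis
  using R.flow_line_dist_forward[OF flow_line_reverse[OF assms(1)] flow_line_reverse[OF assms(2)], of "- t"] False by simp
qed

lemma flow_line_unique: "flow_line V \<xi> ==> flow_line V \<eta> ==> \<xi> 0 = \<eta> 0 ==> \<xi> = \<eta>"
 using flow_line_dist[of \<xi> \<eta>] by (auto simp: fun_eq_iff)

lemma flow_exists1: "\<exists>!\<xi>. flow_line V \<xi> & \<xi> 0 = x"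
 using flow_line_exists[of x] flow_line_unique by metis

lemma flow_line_flow: "flow_line V (%t. flow V t x)" and flow_0 [simp]: "flow V 0 x = x"
 using theI'[OF flow_exists1[of x]] by (auto simp: flow_def)

lemma flow_eq: "flow_line V \<xi> ==> \<xi> 0 = x ==> flow V t x = \<xi> t"
 using flow_line_unique[OF flow_line_flow[of x], of \<xi>] by (metis flow_0)

lemma flow_has_derivative: "((%t. flow V t x) has_vector_derivative V (flow V t x)) (at t)"
 using flow_line_flow by (simp add: flow_line_def)

lemma flow_add: "flow V (s + t) x = flow V s (flow V t x)"
 using flow_eq[OF flow_line_shift[OF flow_line_flow[of x], of t]] by simp

lemma flow_lipschitz: "norm (flow V t x - flow V t y) <= exp (L * \<bar>t\<bar>) * norm (x - y)"
 using flow_line_dist[OF flow_line_flow[of x] flow_line_flow[of y]] by simp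

lemma flow_periodic:
 assumes "k \<in> int_lattice" shows "flow V t (x + k) = flow V t x + k"
proof (rule flow_eq)
 show "flow_line V (%t. flow V t x + k)"
  using flow_has_derivative[of x] periodicD[OF cperD(2)[OF cV] assms]
  by (auto simp: flow_line_def intro!: derivative_eq_intros)
qed simp

lemma flow_speed: "norm (flow V t x - flow V s x) <= M * \<bar>t - s\<bar>"
proof -
 have "norm (flow V t x - flow V s x) <= M * norm (t - s)"
 proof (rule differentiable_bound[of UNIV "%t. flow V t x" "%t h. h *R V (flow V t x)"])
  show "((%t. flow V t x) has_derivative (%h. h *R V (flow V t x))) (at t within UNIV)" for t
   using flow_has_derivative by (simp add: has_vector_derivative_def)
  show "onorm (%h. h *R V (flow V t x)) <= M" for t
   by (rule onorm_le) (use M[of "flow V t x"] in \<open>simp add: mult.commute[of M] mult_left_mono\<close>)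
 qed auto
 then show ?thesis by simp
qed

text \<open>Up to time t the field along the trajectory changes by at most L M |t|, so a straight
  step errs to second order. This compares the flow with directional derivatives and with discrete
  controls.\<close>

lemma flow_Euler: "norm (flow V t x - x - t *R V x) <= L * M * t\<^sup>2"
proof -
 let ?S = "closed_segment 0 t"
 let ?h = "%s. flow V s x - s *R V x"
 have "norm (?h t - ?h 0) <= L * M * \<bar>t\<bar> * norm (t - 0)"
 proof (rule differentiable_bound[of ?S ?h "%s h. h *R (V (flow V s x) - V x)"])
  show "(?h has_derivative (%h. h *R (V (flow V s x) - V x))) (at s within ?S)" for s
  proof -
   have "(?h has_vector_derivative V (flow V s x) - V x) (at s)"
    by (intro has_vector_derivative_diff flow_has_derivative) (auto intro!: derivative_eq_intros)
   then show ?thesis using has_vector_derivative_at_within has_vector_derivative_def by blast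
  qed
  show "onorm (%h. h *R (V (flow V s x) - V x)) <= L * M * \<bar>t\<bar>" if "s \<in> ?S" for s
  proof (rule onorm_le)
   fix h :: real
   have "\<bar>s\<bar> <= \<bar>t\<bar>" using that by (auto simp: closed_segment_eq_real_ivl split: if_splits)
   then have "M * \<bar>s\<bar> <= M * \<bar>t\<bar>" using M_nonneg by (intro mult_left_mono) auto
   then have "norm (flow V s x - x) <= M * \<bar>t\<bar>" using flow_speed[of s x 0] by simp
   then have "L * norm (flow V s x - x) <= L * (M * \<bar>t\<bar>)" using L(1) by (intro mult_left_mono) auto
   then have "norm (V (flow V s x) - V x) <= L * M * \<bar>t\<bar>" using L(2)[of "flow V s x" x] by simp
   then have "\<bar>h\<bar> * norm (V (flow V s x) - V x) <= \<bar>h\<bar> * (L * M * \<bar>t\<bar>)" by (rule mult_left_mono) simp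
   then show "norm (h *R (V (flow V s x) - V x)) <= L * M * \<bar>t\<bar> * norm h" by (simp add: mult.commute)
  qed
 qed auto
 then show ?thesis by (simp add: power2_eq_square algebra_simps abs_mult_self_eq)
qed

lemma flow_continuous: "continuous_on S (%t. flow V t x)"
 using flow_has_derivative has_vector_derivative_continuous
 by (intro continuous_at_imp_continuous_on ballI) blast

lemma flow_continuous_space: "continuous_on S (%x. flow V t x)"
 by (rule lipschitz_continuous[OF flow_lipschitz])

end

lemma smooth_flow_line:
 assumes V: "smooth V" and \<xi>: "flow_line V \<xi>" shows "smooth \<xi>"
 unfolding smooth_def
proof
 have der: "(\<xi> has_derivative (%h. h *R V (\<xi> t))) (at t)" for t
  using \<xi> by (simp add: flow_line_def has_vector_derivative_def)
 show "C_k k \<xi>" for k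
 proof (induction k)
  case 0
  have "isCont \<xi> t" for t by (rule has_derivative_continuous[OF der])
  then show ?case by (simp add: continuous_at_imp_continuous_on)
 next
  case (Suc k)
  show ?case by (rule C_k_SucI[OF der]) (simp add: C_k_compose[OF smooth_C_k[OF V] Suc])
 qed
qed

lemma orbit_iff_flow_line: "smooth V ==> orbit V \<xi> \<longleftrightarrow> flow_line V \<xi>"
 using smooth_flow_line by (auto simp: orbit_def flow_line_def)

lemma smooth_lipschitz_field:
 assumes V: "C_k 1 V" "periodic V"
 obtains M L where "lipschitz_field V M L"
proof -
 have cV: "cper V" using C_k_cper[OF V] .
 obtain M where M: "!!x. norm (V x) <= M" using cper_bounded[OF cV] by blast
 have "cper (pd i V)" for i using V cper_dir_deriv[of 0 V] by simp
 then have "EX B>0. ALL x. norm (pd i V x) <= B" for i by (rule cper_bounded)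
 then obtain B where B: "!!i. B i > 0" "!!i x. norm (pd i V x) <= B i" by metis
 have d: "V differentiable (at x)" for x using V by simp
 have "norm (V x - V y) <= (B 1 + B 2) * norm (x - y)" for x y
 proof (rule differentiable_bound[of UNIV V "%x. frechet_derivative V (at x)"])
  show "(V has_derivative frechet_derivative V (at x)) (at x within UNIV)" for x
   using d frechet_derivative_works by auto
  show "onorm (frechet_derivative V (at x)) <= B 1 + B 2" for x
  proof (rule onorm_le)
   fix h :: plane
   have "norm (frechet_derivative V (at x) h) <= \<bar>h \<bullet> axis 1 1\<bar> * norm (pd 1 V x) + \<bar>h \<bullet> axis 2 1\<bar> * norm (pd 2 V x)"
    unfolding frechet_expand[OF d] sum_Basis_plane by (rule order_trans[OF norm_triangle_ineq]) simp
   also have "... <= norm h * B 1 + norm h * B 2"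
    using Basis_le_norm[of "axis 1 1" h] Basis_le_norm[of "axis 2 1" h] B less_imp_le by (intro add_mono mult_mono) auto
   finally show "norm (frechet_derivative V (at x) h) <= (B 1 + B 2) * norm h" by (simp add: algebra_simps)
  qed
 qed auto
 then have "lipschitz_field V M (B 1 + B 2)"
  using cV M B(1)[of 1] B(1)[of 2] by unfold_locales (auto intro: add_pos_pos)
 then show ?thesis by (rule that)
qed

subsection \<open>Integration by parts on the torus\<close>

abbreviation mean :: "(plane => 'b::euclidean_space) => 'b" where
 "mean g \<equiv> integral (cbox 0 1) g"

lemma mean_add: "cper f ==> cper g ==> mean (%x. f x + g x) = mean f + mean g"
 by (intro integral_add cper_integrable)

lemma mean_diff: "cper f ==> cper g ==> mean (%x. f x - g x) = mean f - mean g"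
 by (intro integral_diff cper_integrable)

lemma mean_cmult: "mean (%x. c * f x) = c * (mean f :: real)"
 by simp

lemma mean_mono: "cper f ==> cper g ==> (!!x. f x <= g x) ==> mean f <= (mean g :: real)"
 by (intro integral_le cper_integrable)

lemma mean_pos:
 assumes g: "cper (g :: plane => real)" "!!x. 0 <= g x" and y: "0 < g y"
 shows "0 < mean g"
proof -
 obtain k where k: "k \<in> int_lattice" "y + k \<in> cbox 0 1" using cell_reduce by blast
 have gk: "g (y + k) > 0" using periodicD[OF cperD(2)[OF g(1)] k(1)] y by simp
 have "mean g ~= 0"
 proof
  assume "mean g = 0"
  then have "(g has_integral 0) (cbox 0 1)"
   using integrable_integral[OF cper_integrable[OF g(1)], of 0 1] by simp
  moreover have "(\<chi> i. 1 / 2) \<in> box 0 (1::plane)" by (simp add: mem_box_cart)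
  then have "box 0 (1::plane) ~= {}" by blast
  ultimately have "g (y + k) = 0"
   using has_integral_0_cbox_imp_0[OF cperD(1)[OF g(1)] g(2)] k(2) by blast
  then show False using gk by simp
 qed
 moreover have "0 <= mean g" using g by (intro integral_nonneg cper_integrable) auto
 ultimately show ?thesis by simp
qed

lemma integral_by_parts_axis:
 fixes f g :: "plane => real"
 assumes f: "C_k 1 f" "periodic f" and g: "C_k 1 g" "periodic g" and e: "e \<in> Basis"
 shows "mean (%x. f x * dir_deriv e g x) = - mean (%x. dir_deriv e f x * g x)"
proof -
 have c: "cper f" "cper g" "cper (dir_deriv e f)" "cper (dir_deriv e g)"
  using C_k_cper[OF f] C_k_cper[OF g] cper_dir_deriv[of 0 f e] cper_dir_deriv[of 0 g e] f g e by auto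
 have fg: "C_k 1 (%x. f x * g x)" "periodic (%x. f x * g x)"
  using C_k_mult[OF f(1) g(1)] f(2) g(2) by (auto simp: periodic_def)
 have "dir_deriv e (%x. f x * g x) = (%x. f x * dir_deriv e g x + dir_deriv e f x * g x)"
  using f(1) g(1) by (auto simp: dir_deriv_mult)
 then have "mean (%x. f x * dir_deriv e g x + dir_deriv e f x * g x) = 0"
  using integral_dir_deriv[OF fg e] by simp
 then show ?thesis by (simp add: mean_add cper_mult c)
qed

lemma grad_inner_Basis: "grad f x \<bullet> grad g x = (\<Sum>e\<in>(Basis::plane set). dir_deriv e f x * dir_deriv e g x)"
 using euclidean_inner[of "grad f x" "grad g x"] by (simp add: inner_grad)

lemma integral_laplacian_parts:
 fixes m v :: "plane => real"
 assumes m: "C_k 1 m" "periodic m" and v: "C_k 2 v" "periodic v"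
 shows "mean (%x. m x * laplacian v x) = - mean (%x. grad m x \<bullet> grad v x)"
proof -
 have v2: "C_k (Suc (Suc 0)) v" using v(1) by (simp add: numeral_2_eq_2)
 have dv: "C_k 1 (pd i v)" "periodic (pd i v)" for i
  using v2 v(2) by (auto intro: periodic_dir_deriv)
 have c: "cper m" "cper (pd i m)" "cper (pd i v)"
  "cper (pd i (pd i v))" for i
  using C_k_cper[OF m] cper_dir_deriv[of 0 m] C_k_cper[OF dv] cper_dir_deriv[OF _ dv(2), of 0 i] m dv(1)[of i] by auto
 have "(%x. m x * laplacian v x) = (%x. m x * pd 1 (pd 1 v) x + m x * pd 2 (pd 2 v) x)"
  by (simp add: laplacian_def sum_Basis_plane distrib_left)
 moreover have "(%x. grad m x \<bullet> grad v x) = (%x. pd 1 m x * pd 1 v x + pd 2 m x * pd 2 v x)"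
  by (simp add: grad_inner_Basis sum_Basis_plane)
 ultimately show ?thesis
  by (simp add: mean_add cper_mult c integral_by_parts_axis[OF m dv])
qed

lemma cper_divergence:
 assumes "C_k 1 W" "periodic W" shows "cper (divergence W)"
proof -
 have "cper (%x. dir_deriv e W x \<bullet> e)" if "e \<in> Basis" for e
  using assms that by (intro cper_inner cper_dir_deriv[of 0]) auto
 then show ?thesis unfolding divergence_def[abs_def] sum_Basis_plane by (intro cper_add) auto
qed

lemma integral_divergence_parts:
 fixes W :: "plane => plane" and g :: "plane => real"
 assumes W: "C_k 1 W" "periodic W" and g: "C_k 1 g" "periodic g"
 shows "mean (%x. W x \<bullet> grad g x) = - mean (%x. divergence W x * g x)"
proof -
 define w where "w e x = W x \<bullet> e" for e x
 have w: "C_k 1 (w e)" "periodic (w e)" for e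
  unfolding w_def using C_k_inner[OF W(1) C_k_const] W(2) by (auto simp: periodic_def)
 have dw: "dir_deriv e (w e) x = dir_deriv e W x \<bullet> e" for e x
  using W(1) unfolding w_def by (subst dir_deriv_linear[OF bounded_linear_inner_left]) auto
 have c: "cper (w e)" "cper (pd i g)" "cper (pd i (w e))" "cper g" for e i
  using C_k_cper[OF w] cper_dir_deriv[of 0 g] cper_dir_deriv[of 0 "w e"] g w[of e] C_k_cper[OF g] by auto
 have "(%x. W x \<bullet> grad g x) = (%x. w (axis 1 1) x * pd 1 g x + w (axis 2 1) x * pd 2 g x)"
 proof
  fix x show "W x \<bullet> grad g x = w (axis 1 1) x * pd 1 g x + w (axis 2 1) x * pd 2 g x"
   using euclidean_inner[of "W x" "grad g x"] by (simp add: inner_grad w_def sum_Basis_plane)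
 qed
 moreover have "(%x. divergence W x * g x) = (%x. pd 1 (w (axis 1 1)) x * g x + pd 2 (w (axis 2 1)) x * g x)"
  by (simp add: divergence_def sum_Basis_plane dw distrib_right)
 ultimately show ?thesis
  by (simp add: mean_add cper_mult c integral_by_parts_axis[OF w g])
qed

lemma integral_grad_const:
 assumes g: "C_k 1 g" "periodic (g :: plane => real)"
 shows "mean (%x. q \<bullet> grad g x) = 0"
proof -
 have "divergence (%x. q) x = 0" for x by (simp add: divergence_def)
 then show ?thesis using integral_divergence_parts[of "%x. q", OF C_k_const _ g] by (simp add: periodic_def)
qed

subsection \<open>The viscous Hamilton--Jacobi equation\<close>

definition viscous_HJ :: "(plane => plane) => real => plane => (plane => real) => plane => real" where
 "viscous_HJ V A p u x = - laplacian u x + (norm (p + grad u x))\<^sup>2 + A * (V x \<bullet> (p + grad u x))"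

text \<open>Hopf-Cole transformation: for \<open>u = - ln \<phi>\<close> the squared gradient
  cancels against the one produced by the Laplacian, and what remains is the linear eigenvalue
  problem with drift -2 p - A V and potential |p|^2 + A V . p.\<close>

lemma viscous_HJ_exists:
 assumes V: "smooth V" "periodic V"
 shows "\<exists>u \<kappa>. smooth u & periodic u & (ALL x. viscous_HJ V A p u x = \<kappa>)"
proof -
 let ?b = "%x. - (2 *R p) - A *R V x" and ?c = "%x. (norm p)\<^sup>2 + A * (V x \<bullet> p)"
 have Vk: "C_k k V" for k by (rule smooth_C_k[OF V(1)])
 have "smooth ?b" "periodic ?b" "smooth ?c" "periodic ?c"
  using V(2) unfolding smooth_def
  by (auto intro!: C_k_diff C_k_scaleR C_k_const Vk C_k_add C_k_mult C_k_inner simp: periodic_def simp del: C_k.simps)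
 from principal_eigenfunction[OF this] obtain \<phi> \<kappa> where \<phi>: "smooth \<phi>" "periodic \<phi>" "!!x. 0 < \<phi> x"
  and eq: "!!x. laplacian \<phi> x + ?b x \<bullet> grad \<phi> x + ?c x * \<phi> x = \<kappa> * \<phi> x" by blast
 define u where "u x = - ln (\<phi> x)" for x
 have \<phi>k: "C_k k \<phi>" for k by (rule smooth_C_k[OF \<phi>(1)])
 have d: "\<phi> differentiable (at x)" for x using \<phi>k[of "Suc 0"] by simp
 have dd: "dir_deriv e \<phi> differentiable (at x)" if "e \<in> Basis" for x e using \<phi>k[of "Suc (Suc 0)"] that by simp
 have "smooth u" unfolding smooth_def u_def using C_k_minus[OF C_k_ln[OF \<phi>k \<phi>(3)]] by auto
 moreover have "periodic u" using \<phi>(2) by (simp add: periodic_def u_def)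
 moreover have "viscous_HJ V A p u x = \<kappa>" for x
 proof -
  have inv: "((%x. inverse (\<phi> x)) has_derivative (%h. - (inverse (\<phi> x) * frechet_derivative \<phi> (at x) h * inverse (\<phi> x)))) (at x)" for x
   using d \<phi>(3)[of x] by (intro Deriv.has_derivative_inverse) (auto simp: frechet_derivative_works)
  have du: "dir_deriv e u = (%x. - (inverse (\<phi> x) * dir_deriv e \<phi> x))" for e
  proof
   fix x
   have "((%x. ln (\<phi> x)) has_derivative (%h. frechet_derivative \<phi> (at x) h * inverse (\<phi> x))) (at x)"
    using has_derivative_ln[where g=\<phi> and x=x, OF \<phi>(3)[of x]] d frechet_derivative_works by blast
   then have "(u has_derivative (%h. - (frechet_derivative \<phi> (at x) h * inverse (\<phi> x)))) (at x)"
    unfolding u_def[abs_def] by (rule has_derivative_minus)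
   then show "dir_deriv e u x = - (inverse (\<phi> x) * dir_deriv e \<phi> x)"
    by (simp add: dir_deriv_eq) (simp add: dir_deriv_def)
  qed
  have ddu: "dir_deriv e (dir_deriv e u) x = (dir_deriv e \<phi> x)\<^sup>2 / (\<phi> x)\<^sup>2 - dir_deriv e (dir_deriv e \<phi>) x / \<phi> x" if e: "e \<in> Basis" for e x
  proof -
   have di: "(%x. inverse (\<phi> x)) differentiable (at x)" using inv differentiable_def by blast
   have "dir_deriv e (%x. inverse (\<phi> x)) x = - (inverse (\<phi> x) * dir_deriv e \<phi> x * inverse (\<phi> x))"
    by (simp add: dir_deriv_eq[OF inv]) (simp add: dir_deriv_def)
   then have "dir_deriv e (%x. inverse (\<phi> x) * dir_deriv e \<phi> x) x =
    inverse (\<phi> x) * dir_deriv e (dir_deriv e \<phi>) x - inverse (\<phi> x) * dir_deriv e \<phi> x * inverse (\<phi> x) * dir_deriv e \<phi> x"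
    by (simp add: dir_deriv_mult[OF di dd[OF e]])
   moreover have "(%x. inverse (\<phi> x) * dir_deriv e \<phi> x) differentiable (at x)"
    by (rule differentiable_mult[OF di dd[OF e]])
   ultimately show ?thesis unfolding du
    by (simp add: dir_deriv_minus divide_inverse power2_eq_square)
  qed
  have gu: "grad u x = - (inverse (\<phi> x)) *R grad \<phi> x"
   by (simp add: grad_def du scaleR_sum_right sum_negf)
  have gn: "(\<Sum>e\<in>(Basis::plane set). (dir_deriv e \<phi> x)\<^sup>2) = grad \<phi> x \<bullet> grad \<phi> x"
   by (simp add: grad_inner_Basis power2_eq_square)
  have lu: "laplacian u x = (grad \<phi> x \<bullet> grad \<phi> x) / (\<phi> x)\<^sup>2 - laplacian \<phi> x / \<phi> x"
   unfolding laplacian_def using ddu by (simp add: sum_subtractf sum_divide_distrib[symmetric] gn)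
  let ?i = "inverse (\<phi> x)"
  have "viscous_HJ V A p u x = ?i * (laplacian \<phi> x + ?b x \<bullet> grad \<phi> x) + ?c x"
   unfolding viscous_HJ_def lu gu power2_norm_eq_inner
   by (simp add: inner_add_left inner_add_right inner_diff_left inner_commute divide_inverse power2_eq_square algebra_simps)
  also have "... = ?i * (laplacian \<phi> x + ?b x \<bullet> grad \<phi> x + ?c x * \<phi> x)"
   using \<phi>(3)[of x] by (simp add: distrib_left)
  also have "... = \<kappa>" unfolding eq using \<phi>(3)[of x] by simp
  finally show ?thesis .
 qed
 ultimately show ?thesis by blast
qed

text \<open>At a maximum of the difference of two C^2 functions the gradients agree and the
  Laplacians are ordered, so the two nonlinear expressions are comparable there.\<close>

lemma viscous_HJ_compare:
 assumes u: "C_k 2 u" "periodic u" "!!x. viscous_HJ V A p u x = \<kappa>" and v: "C_k 2 v" "periodic v"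
 shows "EX x. \<kappa> <= viscous_HJ V A p v x" "EX x. viscous_HJ V A p v x <= \<kappa>"
proof -
 have cmp: "EX x. viscous_HJ V A p f x <= viscous_HJ V A p g x"
  if f: "C_k 2 f" "periodic f" and g: "C_k 2 g" "periodic g" for f g
 proof -
  have f2: "C_k (Suc (Suc 0)) f" "C_k (Suc (Suc 0)) g" using f g by (simp_all add: numeral_2_eq_2)
  have w: "C_k 2 (%x. g x - f x)" by (rule C_k_diff[OF g(1) f(1)])
  moreover have "cper (%x. g x - f x)" by (intro cper_diff C_k_cper[OF f] C_k_cper[OF g])
  then obtain x where "!!y. g y - f y <= g x - f x" using cper_attains_sup by blast
  ultimately have z: "grad (%x. g x - f x) x = 0" "laplacian (%x. g x - f x) x <= 0"
   using laplacian_at_max[of "%x. g x - f x" x] by auto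
  have d: "f differentiable (at x)" "g differentiable (at x)" for x using f2 by auto
  have dd: "dir_deriv e f differentiable (at x)" "dir_deriv e g differentiable (at x)" if "e \<in> Basis" for x e using f2 that by auto
  have "grad f x = grad g x" using z(1) by (simp add: grad_diff d)
  moreover have "dir_deriv e (%x. g x - f x) = (%x. dir_deriv e g x - dir_deriv e f x)" for e
   by (intro ext dir_deriv_diff d)
  then have "laplacian (%x. g x - f x) x = laplacian g x - laplacian f x"
   by (simp add: laplacian_def dir_deriv_diff dd sum_subtractf)
  ultimately show ?thesis using z(2) by (intro exI[of _ x]) (simp add: viscous_HJ_def)
 qed
 show "EX x. \<kappa> <= viscous_HJ V A p v x" "EX x. viscous_HJ V A p v x <= \<kappa>"
  using cmp[OF u(1,2) v] cmp[OF v u(1,2)] u(3) by auto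
qed

lemma kappa_solution:
 assumes V: "smooth V" "periodic V"
 obtains u where "smooth u" "periodic u" "!!x. viscous_HJ V A p u x = kappa V A p"
proof -
 obtain u \<kappa> where u: "smooth u" "periodic u" "!!x. viscous_HJ V A p u x = \<kappa>"
  using viscous_HJ_exists[OF V] by blast
 have "kappa V A p = \<kappa>"
  unfolding kappa_def viscous_HJ_def[symmetric]
 proof (rule the_equality)
  show "EX u. smooth u & periodic u & (ALL x. viscous_HJ V A p u x = \<kappa>)" using u by blast
  fix c assume "EX u. smooth u & periodic u & (ALL x. viscous_HJ V A p u x = c)"
  then obtain v where v: "smooth v" "periodic v" "!!x. viscous_HJ V A p v x = c" by blast
  show "c = \<kappa>"
   using viscous_HJ_compare[OF smooth_C_k[OF u(1)] u(2,3) smooth_C_k[OF v(1)] v(2)] v(3) by auto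
 qed
 then show ?thesis using u that by simp
qed

lemma kappa_le:
 assumes V: "smooth V" "periodic V" and v: "C_k 2 v" "periodic v" and b: "!!x. viscous_HJ V A p v x <= K"
 shows "kappa V A p <= K"
proof -
 obtain u where u: "smooth u" "periodic u" "!!x. viscous_HJ V A p u x = kappa V A p"
  using kappa_solution[OF V] by blast
 show ?thesis using viscous_HJ_compare(1)[OF smooth_C_k[OF u(1)] u(2,3) v] b by (meson order_trans)
qed

section \<open>The effective viscous Hamiltonian for a divergence-free drift\<close>

locale incompressible =
 fixes V :: "plane => plane"
 assumes smV: "smooth V" and pV: "periodic V" and divV: "!!x. divergence V x = 0" and meanV: "mean_zero V"
begin

lemma CkV: "C_k k V" by (rule smooth_C_k[OF smV])

lemma cV: "cper V" by (rule C_k_cper[OF CkV[of 0] pV])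

lemma integral_V_grad:
 assumes "C_k 1 g" "periodic g" shows "mean (%x. V x \<bullet> grad g x) = 0"
 using integral_divergence_parts[OF CkV pV assms] by (simp add: divV)

lemma integral_V_const: "mean (%x. V x \<bullet> p) = 0"
proof -
 have "mean V = 0" using meanV by (simp add: mean_zero_def)
 then have "(V has_integral 0) (cbox 0 1)" using cper_integrable[OF cV, of 0 1] by (metis integrable_integral)
 from has_integral_linear[OF this bounded_linear_inner_left[of p]] show ?thesis by (simp add: o_def integral_unique)
qed

text \<open>Multiply the equation by \<open>w\<^sup>2\<close> and complete the square.\<close>

lemma kappa_lower:
 assumes w: "C_k 1 w" "periodic w" "!!x. V x \<bullet> grad w x = 0"
 shows "A * mean (%x. (w x)\<^sup>2 * (V x \<bullet> p)) - mean (%x. (norm (grad w x))\<^sup>2)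
  <= kappa V A p * mean (%x. (w x)\<^sup>2)"
proof -
 obtain u where u: "smooth u" "periodic u" "!!x. viscous_HJ V A p u x = kappa V A p"
  using kappa_solution[OF smV pV] by blast
 have uk: "C_k k u" for k by (rule smooth_C_k[OF u(1)])
 let ?m = "%x. w x * w x"
 have m: "C_k 1 ?m" "periodic ?m" using C_k_mult[OF w(1) w(1)] w(2) by (auto simp: periodic_def)
 have gm: "grad ?m x = (2 * w x) *R grad w x" for x
  using w(1) by (simp add: grad_mult scaleR_left_distrib[symmetric])
 have c: "cper w" "cper (grad w)" "cper (grad u)" "cper (laplacian u)" "cper u"
  using C_k_cper[OF w(1,2)] cper_grad[of 0 w] w cper_grad[OF uk u(2)] cper_laplacian[OF uk u(2)] C_k_cper[OF uk u(2)] by auto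
 have Z1: "mean (%x. ?m x * laplacian u x + grad ?m x \<bullet> grad u x) = 0"
  using integral_laplacian_parts[OF m uk u(2)]
  by (subst mean_add) (auto simp: gm intro!: cper_intros c)
 have Z2: "mean (%x. V x \<bullet> grad (%x. ?m x * u x) x) = 0"
  by (rule integral_V_grad) (use C_k_mult[OF m(1) uk] m(2) u(2) in \<open>auto simp: periodic_def simp del: C_k.simps\<close>)
 have V2: "V x \<bullet> grad (%x. ?m x * u x) x = ?m x * (V x \<bullet> grad u x)" for x
 proof -
  have "?m differentiable (at x)" "u differentiable (at x)" using m(1) uk[of "Suc 0"] by auto
  then show ?thesis using w(3)[of x] by (subst grad_mult) (auto simp: inner_add_right gm)
 qed
 have Z3: "mean (%x. p \<bullet> grad ?m x) = 0" by (rule integral_grad_const[OF m])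
 let ?F = "%x. A * (?m x * (V x \<bullet> p)) - (norm (grad w x))\<^sup>2"
 \<comment> \<open>Adding \<open>?Z\<close>, whose mean is zero, turns the integral inequality into
   a pointwise one: nonnegativity of the square of w (p + Du) + Dw.\<close>
 let ?Z = "%x. (?m x * laplacian u x + grad ?m x \<bullet> grad u x) - A * (?m x * (V x \<bullet> grad u x)) + p \<bullet> grad ?m x"
 have cF: "cper ?F" "cper ?Z" "cper ?m" unfolding gm power2_norm_eq_inner
  by (intro cper_intros c cV)+
 have Z: "mean ?Z = 0"
 proof -
  have "mean ?Z = mean (%x. ?m x * laplacian u x + grad ?m x \<bullet> grad u x)
   - mean (%x. A * (?m x * (V x \<bullet> grad u x))) + mean (%x. p \<bullet> grad ?m x)"
   unfolding gm by (subst mean_add mean_diff, (intro cper_intros c cV)+)+ simp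
  then show ?thesis using Z1 Z2 Z3 unfolding V2 by simp
 qed
 have "?F x <= kappa V A p * ?m x + ?Z x" for x
 proof -
  have "0 <= (norm (w x *R (p + grad u x) + grad w x))\<^sup>2" by simp
  also have "... = ?m x * (norm (p + grad u x))\<^sup>2 + 2 * w x * ((p + grad u x) \<bullet> grad w x) + (norm (grad w x))\<^sup>2"
   unfolding power2_norm_eq_inner by (simp add: algebra_simps inner_commute)
  finally have "0 <= ..." .
  moreover have "kappa V A p * ?m x = ?m x * (- laplacian u x + (norm (p + grad u x))\<^sup>2 + A * (V x \<bullet> (p + grad u x)))"
   using u(3)[of x] by (simp add: viscous_HJ_def)
  ultimately show ?thesis unfolding gm by (simp add: algebra_simps inner_commute)
 qed
 then have "mean ?F <= mean (%x. kappa V A p * ?m x + ?Z x)"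
  by (intro mean_mono cF cper_intros)
 also have "... = kappa V A p * mean ?m"
  using Z by (subst mean_add) (auto intro!: cF cper_intros)
 also have "mean ?F = A * mean (%x. ?m x * (V x \<bullet> p)) - mean (%x. (norm (grad w x))\<^sup>2)"
  by (subst mean_diff) (auto simp: power2_norm_eq_inner intro!: cper_intros c cV)
 finally show ?thesis by (simp add: power2_eq_square)
qed

lemma kappa_nonneg: "0 <= kappa V A p"
proof -
 have g: "grad (%x::plane. 1::real) x = 0" for x by (simp add: grad_def)
 show ?thesis using kappa_lower[of "%x. 1" A p] by (simp add: g periodic_def integral_V_const)
qed

text \<open>The density is the principal eigenfunction of the adjoint operator
  \<open>\<Delta>m + div (b m)\<close>. Testing with the constant 1 shows that the eigenvalue is
  zero, since m has positive mean.\<close>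

lemma adjoint_density:
 assumes b: "smooth b" "periodic b"
 obtains m where "smooth m" "periodic m" "!!x. 0 < m x"
  "!!v. C_k 2 v ==> periodic v ==> mean (%x. m x * (- laplacian v x + b x \<bullet> grad v x)) = 0"
proof -
 have bk: "C_k k b" for k by (rule smooth_C_k[OF b(1)])
 have "C_k k (divergence b)" for k
  unfolding divergence_def[abs_def] using bk[of "Suc k"] by (intro C_k_sum C_k_inner C_k_const) auto
 then have d: "smooth (divergence b)" "periodic (divergence b)"
  using cper_divergence[OF bk b(2)] by (auto simp: smooth_def cper_def)
 obtain m \<kappa> where m: "smooth m" "periodic m" "!!x. 0 < m x"
  and eq: "!!x. laplacian m x + b x \<bullet> grad m x + divergence b x * m x = \<kappa> * m x"
  using principal_eigenfunction[OF b d] by blast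
 have mk: "C_k k m" for k by (rule smooth_C_k[OF m(1)])
 have c: "cper m" "cper (grad m)" "cper (laplacian m)" "cper b" "cper (divergence b)"
  using C_k_cper[OF mk m(2)] cper_grad[OF mk m(2)] cper_laplacian[OF mk m(2)] C_k_cper[OF bk b(2)] cper_divergence[OF bk b(2)] by auto
 have test: "mean (%x. \<kappa> * (m x * v x)) = - mean (%x. grad v x \<bullet> grad m x + m x * (b x \<bullet> grad v x))"
  if v: "C_k 1 v" "periodic v" for v
 proof -
  have cv: "cper v" "cper (grad v)" using C_k_cper[OF v] cper_grad[of 0 v] v by auto
  have mv: "C_k 1 (%x. m x * v x)" "periodic (%x. m x * v x)"
   using C_k_mult[OF mk v(1)] m(2) v(2) by (auto simp: periodic_def)
  have g: "grad (%x. m x * v x) x = m x *R grad v x + v x *R grad m x" for x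
   using mk[of "Suc 0"] v(1) by (intro grad_mult) auto
  have 1: "mean (%x. v x * laplacian m x) = - mean (%x. grad v x \<bullet> grad m x)"
   by (rule integral_laplacian_parts[OF v mk m(2)])
  have 2: "mean (%x. b x \<bullet> grad (%x. m x * v x) x) = - mean (%x. divergence b x * (m x * v x))"
   by (rule integral_divergence_parts[OF bk b(2) mv])
  have "(%x. \<kappa> * (m x * v x)) = (%x. v x * laplacian m x + (b x \<bullet> grad (%x. m x * v x) x - m x * (b x \<bullet> grad v x)) + divergence b x * (m x * v x))"
  proof
   fix x
   have "\<kappa> * (m x * v x) = v x * (\<kappa> * m x)" by simp
   also have "... = v x * laplacian m x + (b x \<bullet> grad (%x. m x * v x) x - m x * (b x \<bullet> grad v x)) + divergence b x * (m x * v x)"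
    unfolding eq[of x, symmetric] g by (simp add: inner_add_right algebra_simps)
   finally show "\<kappa> * (m x * v x) = ..." .
  qed
  then have "mean (%x. \<kappa> * (m x * v x)) = mean (%x. v x * laplacian m x)
   + (mean (%x. b x \<bullet> grad (%x. m x * v x) x) - mean (%x. m x * (b x \<bullet> grad v x))) + mean (%x. divergence b x * (m x * v x))"
   unfolding g by (simp only:) ((subst mean_add mean_diff, (intro cper_intros c cv)+)+, rule refl)
  moreover have "mean (%x. grad v x \<bullet> grad m x + m x * (b x \<bullet> grad v x)) = mean (%x. grad v x \<bullet> grad m x) + mean (%x. m x * (b x \<bullet> grad v x))"
   by (subst mean_add) (intro cper_intros c cv refl)+
  ultimately show ?thesis using 1 2 by linarith
 qed
 have "\<kappa> = 0"
 proof -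
  have g1: "grad (%x::plane. 1::real) x = 0" for x by (simp add: grad_def)
  have "\<kappa> * mean m = 0" using test[of "%x. 1"] by (simp add: g1 periodic_def)
  moreover have "0 < mean m" using mean_pos[OF c(1) less_imp_le[OF m(3)] m(3)] .
  ultimately show ?thesis by simp
 qed
 show ?thesis
 proof (rule that[OF m])
  fix v :: "plane => real" assume v: "C_k 2 v" "periodic v"
  have v1: "C_k 1 v" using C_k_mono[OF v(1), of 1] by simp
  have cv: "cper (grad v)" "cper (laplacian v)" using cper_grad[of 0 v] cper_laplacian[of 0 v] v1 v by (auto simp: numeral_2_eq_2)
  have "mean (%x. grad v x \<bullet> grad m x + m x * (b x \<bullet> grad v x)) = 0"
   using test[OF v1 v(2)] \<open>\<kappa> = 0\<close> by simp
  then have "mean (%x. grad m x \<bullet> grad v x) + mean (%x. m x * (b x \<bullet> grad v x)) = 0"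
   by (subst (asm) mean_add) (auto simp: inner_commute intro!: cper_intros c cv)
  moreover have "mean (%x. m x * laplacian v x) = - mean (%x. grad m x \<bullet> grad v x)"
   by (rule integral_laplacian_parts) (use mk m(2) v in auto)
  moreover have "mean (%x. m x * (- laplacian v x + b x \<bullet> grad v x)) =
   mean (%x. m x * (b x \<bullet> grad v x)) - mean (%x. m x * laplacian v x)"
   by (subst mean_diff[symmetric]) (auto intro!: cper_intros c cv simp: algebra_simps)
  ultimately show "mean (%x. m x * (- laplacian v x + b x \<bullet> grad v x)) = 0" by linarith
 qed
qed

text \<open>Adding half the logarithm of a density to the corrector turns the weighted equation into a form without
 second derivatives, in which the drift and the gradient scale separately.\<close>

lemma weighted_HJ_integral:
 assumes m: "smooth m" "periodic m" "!!x. 0 < m x" and v: "C_k 2 v" "periodic v"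
 defines "g \<equiv> %x. (1 / (2 * m x)) *R grad m x"
 shows "mean (%x. m x * viscous_HJ V A q v x) =
  mean (%x. m x * ((norm (q + grad v x + g x))\<^sup>2 + A * (V x \<bullet> (q + grad v x + g x)) - (norm (g x))\<^sup>2))"
proof -
 have mk: "C_k k m" for k by (rule smooth_C_k[OF m(1)])
 have v1: "C_k 1 v" using C_k_mono[OF v(1), of 1] by simp
 have c: "cper m" "cper (grad m)" "cper (grad v)" "cper (laplacian v)"
  using C_k_cper[OF mk m(2)] cper_grad[OF mk m(2)] cper_grad[of 0 v] cper_laplacian[of 0 v] v1 v by (auto simp: numeral_2_eq_2)
 have "cper (%x. 1 / (2 * m x))"
  using c(1) m(3) unfolding cper_def periodic_def by (auto intro!: continuous_intros simp: less_imp_neq[symmetric])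
 then have cg: "cper g" unfolding g_def by (intro cper_scaleR c)
 \<comment> \<open>These terms are the divergences of m Dv, m q and (A / 2) m V, so they integrate
   to zero.\<close>
 let ?Z = "%x. (grad m x \<bullet> grad v x + m x * laplacian v x) + q \<bullet> grad m x + (A / 2) * (V x \<bullet> grad m x)"
 have Z: "mean ?Z = 0"
 proof -
  have "mean ?Z = (mean (%x. grad m x \<bullet> grad v x) + mean (%x. m x * laplacian v x))
   + mean (%x. q \<bullet> grad m x) + mean (%x. (A / 2) * (V x \<bullet> grad m x))"
   by (subst mean_add, (intro cper_intros c cV)+)+ simp
  then show ?thesis
   using integral_laplacian_parts[OF mk m(2) v] integral_grad_const[OF mk m(2), of q] integral_V_grad[OF mk m(2)] by simp
 qed
 have "m x * ((norm (q + grad v x + g x))\<^sup>2 + A * (V x \<bullet> (q + grad v x + g x)) - (norm (g x))\<^sup>2) = m x * viscous_HJ V A q v x + ?Z x" for x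
 proof -
  have gm: "grad m x = (2 * m x) *R g x" using m(3)[of x] by (simp add: g_def)
  show ?thesis unfolding viscous_HJ_def gm power2_norm_eq_inner
   by (simp add: inner_add_left inner_add_right inner_commute algebra_simps)
 qed
 moreover have "mean (%x. m x * viscous_HJ V A q v x + ?Z x) = mean (%x. m x * viscous_HJ V A q v x) + mean ?Z"
  unfolding viscous_HJ_def by (subst mean_add) (intro cper_intros c cV refl | simp add: power2_norm_eq_inner)+
 ultimately show ?thesis using Z by simp
qed

text \<open>Let m be the invariant density of the equation linearised at the corrector for
  \<open>B\<close>. By convexity of the square, the m-weighted mean of the expression for any
  competitor v bounds the effective Hamiltonian from above. In the form without second derivatives v
  is chosen so that its total gradient is A / B times that of the corrector for A: the drift terms
  then agree, and the quadratic term decreases.\<close>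

lemma kappa_scaling_mono:
 assumes A: "0 < A" "A <= B"
 shows "kappa V B ((A / B) *R p) <= kappa V A p"
proof -
 define s where "s = A / B"
 have s: "0 < s" "s <= 1" "B * s = A" using A by (auto simp: s_def)
 let ?q = "s *R p"
 obtain u where u: "smooth u" "periodic u" "!!x. viscous_HJ V B ?q u x = kappa V B ?q"
  using kappa_solution[OF smV pV] by blast
 obtain w where w: "smooth w" "periodic w" "!!x. viscous_HJ V A p w x = kappa V A p"
  using kappa_solution[OF smV pV] by blast
 have uk: "C_k k u" and wk: "C_k k w" for k using smooth_C_k u(1) w(1) by auto
 \<comment> \<open>The derivative of the Hamiltonian in the gradient at the corrector
   \<open>u\<close>, that is, the drift of the linearised operator.\<close>
 define b where "b x = 2 *R (?q + grad u x) + B *R V x" for x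
 have "smooth b" unfolding smooth_def b_def
  by (auto intro!: C_k_add C_k_scaleR C_k_const CkV C_k_grad uk)
 moreover have "periodic b" using cper_grad[OF uk[of "Suc 0"] u(2)] pV by (simp add: b_def cper_def periodic_def)
 ultimately obtain m where m: "smooth m" "periodic m" "!!x. 0 < m x"
  and adj: "!!v. C_k 2 v ==> periodic v ==> mean (%x. m x * (- laplacian v x + b x \<bullet> grad v x)) = 0"
  using adjoint_density by blast
 have mk: "C_k k m" for k by (rule smooth_C_k[OF m(1)])
 define lg where "lg x = ln (m x) / 2" for x
 define g where "g x = (1 / (2 * m x)) *R grad m x" for x
 have lk: "C_k k lg" for k unfolding lg_def divide_inverse by (intro C_k_mult C_k_ln mk m C_k_const)
 have lp: "periodic lg" using m(2) by (simp add: lg_def periodic_def)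
 have gl: "grad lg x = g x" for x
 proof (rule grad_eq)
  have "m differentiable (at x)" using mk[of "Suc 0"] by simp
  from has_derivative_ln[OF m(3) has_derivative_grad[OF this]]
  have "((%x. ln (m x)) has_derivative (%h. (grad m x \<bullet> h) * inverse (m x))) (at x)" .
  then have "((%x. ln (m x) / 2) has_derivative (%h. (grad m x \<bullet> h) * inverse (m x) / 2)) (at x)"
   by (rule bounded_linear.has_derivative[OF bounded_linear_divide])
  then show "(lg has_derivative (%h. g x \<bullet> h)) (at x)"
   unfolding lg_def[abs_def]
  proof (rule has_derivative_eq_rhs)
   show "(%h. grad m x \<bullet> h * inverse (m x) / 2) = (%h. g x \<bullet> h)"
    by (simp add: g_def field_simps)
  qed
 qed
 \<comment> \<open>Chosen to satisfy s p + Dv + g = s (p + Dw + g), where \<open>g\<close> is the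
   gradient of \<open>lg\<close>.\<close>
 define v where "v x = s * (w x + lg x) - lg x" for x
 have vk: "C_k k v" for k unfolding v_def by (intro C_k_diff C_k_mult C_k_const C_k_add wk lk)
 have vp: "periodic v" using w(2) lp by (simp add: v_def periodic_def)
 have df: "w differentiable (at x)" "lg differentiable (at x)" "u differentiable (at x)" "v differentiable (at x)" for x
  using wk[of "Suc 0"] lk[of "Suc 0"] uk[of "Suc 0"] vk[of "Suc 0"] by auto
 have gv: "grad v x = s *R (grad w x + g x) - g x" for x
 proof -
  have 1: "(%x. w x + lg x) differentiable (at x)" using df by auto
  then have 2: "(%x. s * (w x + lg x)) differentiable (at x)" by auto
  show ?thesis unfolding v_def by (simp add: grad_diff[OF 2 df(2)] grad_cmult[OF 1] grad_add df gl)
 qed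
 have c: "cper m" "cper (grad m)" "cper (grad v)" "cper (laplacian v)" "cper (grad w)" "cper (laplacian w)" "cper (grad u)" "cper (laplacian u)" "cper g"
 proof -
  have "cper (grad lg)" using cper_grad[OF lk lp] .
  moreover have "grad lg = g" using gl by auto
  ultimately show "cper g" by simp
 qed (use C_k_cper[OF mk m(2)] cper_grad[OF mk m(2)] cper_grad[OF vk vp] cper_laplacian[OF vk vp] cper_grad[OF wk w(2)] cper_laplacian[OF wk w(2)]
   cper_grad[OF uk u(2)] cper_laplacian[OF uk u(2)] in auto)
 have cH: "cper (viscous_HJ V B ?q v)" "cper (viscous_HJ V B ?q u)"
  unfolding viscous_HJ_def power2_norm_eq_inner by (intro cper_intros c cV)+
 let ?d = "%x. v x - u x"
 have dk: "C_k 2 ?d" "periodic ?d" using C_k_diff[OF vk uk] vp u(2) by (auto simp: periodic_def)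
 have conv: "m x * kappa V B ?q + m x * (- laplacian ?d x + b x \<bullet> grad ?d x) <= m x * viscous_HJ V B ?q v x" for x
 proof -
  have gd: "grad ?d x = grad v x - grad u x" by (rule grad_diff[OF df(4,3)])
  have dd: "dir_deriv e v differentiable (at x)" "dir_deriv e u differentiable (at x)" if "e \<in> Basis" for x e
   using vk[of "Suc (Suc 0)"] uk[of "Suc (Suc 0)"] that by auto
  have "dir_deriv e ?d = (%x. dir_deriv e v x - dir_deriv e u x)" for e by (intro ext dir_deriv_diff df)
  then have ld: "laplacian ?d x = laplacian v x - laplacian u x"
   by (simp add: laplacian_def dir_deriv_diff dd sum_subtractf)
  have "0 <= (norm (grad v x - grad u x))\<^sup>2" by simp
  then have "kappa V B ?q + (- laplacian ?d x + b x \<bullet> grad ?d x) <= viscous_HJ V B ?q v x"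
   unfolding u(3)[of x, symmetric] viscous_HJ_def gd ld b_def power2_norm_eq_inner
   by (simp add: inner_add_left inner_add_right inner_diff_left inner_diff_right inner_commute algebra_simps)
  then show ?thesis using mult_left_mono[OF _ less_imp_le[OF m(3)[of x]]] by (simp add: distrib_left[symmetric])
 qed
 have cd: "cper (%x. m x * (- laplacian ?d x + b x \<bullet> grad ?d x))"
 proof -
  have "cper (grad ?d)" "cper (laplacian ?d)"
   using cper_grad[of 1 ?d] cper_laplacian[of 0 ?d] dk by (auto simp: numeral_2_eq_2)
  moreover have "cper b" unfolding b_def by (intro cper_intros c cV)
  ultimately show ?thesis by (intro cper_intros c)
 qed
 let ?I = "mean m"
 have "kappa V B ?q * ?I = mean (%x. m x * kappa V B ?q) + mean (%x. m x * (- laplacian ?d x + b x \<bullet> grad ?d x))"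
  using adj[OF dk] by simp
 also have "... = mean (%x. m x * kappa V B ?q + m x * (- laplacian ?d x + b x \<bullet> grad ?d x))"
  by (rule mean_add[symmetric, OF cper_mult[OF c(1) cper_const] cd])
 also have "... <= mean (%x. m x * viscous_HJ V B ?q v x)"
  by (rule mean_mono[OF cper_add[OF cper_mult[OF c(1) cper_const] cd] cper_mult[OF c(1) cH(1)] conv])
 also have "... = mean (%x. m x * ((norm (?q + grad v x + g x))\<^sup>2 + B * (V x \<bullet> (?q + grad v x + g x)) - (norm (g x))\<^sup>2))"
  using weighted_HJ_integral[OF m vk vp] by (simp add: g_def)
 also have "... <= mean (%x. m x * ((norm (p + grad w x + g x))\<^sup>2 + A * (V x \<bullet> (p + grad w x + g x)) - (norm (g x))\<^sup>2))"
 proof (rule mean_mono)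
  show "m x * ((norm (?q + grad v x + g x))\<^sup>2 + B * (V x \<bullet> (?q + grad v x + g x)) - (norm (g x))\<^sup>2)
   <= m x * ((norm (p + grad w x + g x))\<^sup>2 + A * (V x \<bullet> (p + grad w x + g x)) - (norm (g x))\<^sup>2)" for x
  proof -
   let ?Y = "p + grad w x + g x"
   have Y: "?q + grad v x + g x = s *R ?Y" unfolding gv by (simp add: algebra_simps)
   have "s\<^sup>2 * (norm ?Y)\<^sup>2 <= 1 * (norm ?Y)\<^sup>2" using s by (intro mult_right_mono) (auto simp: power_le_one)
   moreover have "B * (V x \<bullet> (s *R ?Y)) = A * (V x \<bullet> ?Y)" using s(3) by (simp add: mult.assoc[symmetric])
   ultimately show ?thesis unfolding Y using m(3)[of x] by (intro mult_left_mono) (auto simp: power_mult_distrib)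
  qed
 qed (auto simp: power2_norm_eq_inner intro!: cper_intros c cV)
 also have "... = mean (%x. m x * viscous_HJ V A p w x)"
  using weighted_HJ_integral[OF m wk w(2)] by (simp add: g_def)
 also have "... = kappa V A p * ?I" by (simp add: w(3))
 finally have "kappa V B ?q * ?I <= kappa V A p * ?I" .
 moreover have "0 < ?I" using mean_pos[OF c(1) less_imp_le[OF m(3)] m(3)] .
 ultimately show ?thesis by (simp add: s_def)
qed

end

subsection \<open>Flame speeds\<close>

lemma KPP_slope_pos:
 assumes "KPP f" shows "0 < deriv01 f 0"
proof -
 have "(1/2::real) \<in> {0<..<1}" by simp
 then have "0 < f (1/2) & f (1/2) <= (1/2) * deriv01 f 0" using assms unfolding KPP_def by blast
 then show ?thesis by linarith
qed

context incompressible
begin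

context
 fixes f :: "real => real" assumes f0: "0 < deriv01 f 0"
begin

lemma flame_speed_le:
 assumes "0 < l" shows "flame_speed V f A p <= (deriv01 f 0 + kappa V A (l *R p)) / l"
 unfolding flame_speed_def
proof (rule cINF_lower)
 show "bdd_below ((%l. (deriv01 f 0 + kappa V A (l *R p)) / l) ` {0<..})"
  using kappa_nonneg f0 by (intro bdd_belowI2[of _ 0]) (auto intro!: divide_nonneg_pos add_nonneg_nonneg simp: less_imp_le)
qed (use assms in simp)

lemma flame_speed_ge:
 assumes "!!l. 0 < l ==> c <= (deriv01 f 0 + kappa V A (l *R p)) / l" shows "c <= flame_speed V f A p"
 unfolding flame_speed_def using assms by (intro cINF_greatest) auto

lemma flame_speed_nonneg: "0 <= flame_speed V f A p"
 using kappa_nonneg f0 by (intro flame_speed_ge divide_nonneg_pos add_nonneg_nonneg) (auto simp: less_imp_le)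

text \<open>The substitution l -> l A / B in the infimum for \<open>B\<close> turns
  \<open>kappa_scaling_mono\<close> into this comparison.\<close>

lemma flame_speed_ratio_antimono:
 assumes A: "0 < A" "A <= B"
 shows "flame_speed V f B p / B <= flame_speed V f A p / A"
proof -
 have B: "0 < B" using A by simp
 have "A * flame_speed V f B p / B <= flame_speed V f A p"
 proof (rule flame_speed_ge)
  fix l :: real assume l: "0 < l"
  let ?k = "l * (A / B)"
  have k: "0 < ?k" using l A B by simp
  have "flame_speed V f B p <= (deriv01 f 0 + kappa V B (?k *R p)) / ?k" by (rule flame_speed_le[OF k])
  also have "... <= (deriv01 f 0 + kappa V A (l *R p)) / ?k"
   using kappa_scaling_mono[OF A, of "l *R p"] k by (intro divide_right_mono) (auto simp: mult.commute)
  finally have "A / B * flame_speed V f B p <= A / B * ((deriv01 f 0 + kappa V A (l *R p)) / ?k)"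
   using A B by (intro mult_left_mono) auto
  also have "... = (deriv01 f 0 + kappa V A (l *R p)) / l" using A B by simp
  finally show "A * flame_speed V f B p / B <= (deriv01 f 0 + kappa V A (l *R p)) / l" by simp
 qed
 then show ?thesis using A by (simp add: field_simps)
qed

text \<open>A nonnegative nonincreasing function of A converges to its infimum; this justifies
  reading \<open>Lim\<close> in the definition of \<open>c_star\<close> as a limit.\<close>

lemma c_star_tendsto: "((%A. flame_speed V f A p / A) \<longlongrightarrow> c_star V f p) at_top"
proof -
 define h where "h A = flame_speed V f A p / A" for A
 have h0: "0 <= h A" if "0 < A" for A using flame_speed_nonneg that by (simp add: h_def)
 define c where "c = (INF A\<in>{0<..}. h A)"
 have bdd: "bdd_below (h ` {0<..})" using h0 by (intro bdd_belowI2[of _ 0]) auto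
 have "(h \<longlongrightarrow> c) at_top"
 proof (rule tendstoI)
  fix e :: real assume "e > 0"
  then obtain A0 where A0: "A0 > 0" "h A0 < c + e"
   using cInf_lessD[of "h ` {0<..}" "c + e"] by (force simp: c_def)
  have "dist (h A) c < e" if "A >= A0" for A
  proof -
   have "c <= h A" unfolding c_def using bdd A0 that by (intro cINF_lower) auto
   moreover have "h A <= h A0" unfolding h_def using flame_speed_ratio_antimono[OF A0(1) that] .
   ultimately show ?thesis using A0(2) by (simp add: dist_real_def)
  qed
  then show "\<forall>\<^sub>F A in at_top. dist (h A) c < e" unfolding eventually_at_top_linorder by blast
 qed
 then have lim: "((%A. flame_speed V f A p / A) \<longlongrightarrow> c) at_top" by (simp add: h_def[abs_def])
 then have "c_star V f p = c" unfolding c_star_def by (intro tendsto_Lim) auto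
 then show ?thesis using lim by simp
qed

lemma c_star_nonneg: "0 <= c_star V f p"
 by (rule tendsto_lowerbound[OF c_star_tendsto])
  (auto intro!: eventually_at_top_linorderI[of 1] simp: flame_speed_nonneg)

text \<open>The test function is smoothed to C^2 so that it may enter the viscous equation. With l =
  1 the Laplacian, the square and f'(0) contribute a bounded amount, which disappears after division
  by A.\<close>

lemma c_star_le:
 assumes \<phi>: "C_k 1 \<phi>" "periodic \<phi>" and S: "!!x. V x \<bullet> (p + grad \<phi> x) <= S"
 shows "c_star V f p <= S"
proof (rule field_le_epsilon)
 fix e :: real assume e: "e > 0"
 obtain M where M: "M > 0" "!!x. norm (V x) <= M" using cper_bounded[OF cV] by blast
 have "e / M > 0" using e M by simp
 then obtain \<psi> where \<psi>: "C_k 2 \<psi>" "periodic \<psi>" "!!x. norm (grad \<psi> x - grad \<phi> x) <= e / M"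
  using C1_approx_C2[OF \<phi>] by blast
 have S': "V x \<bullet> (p + grad \<psi> x) <= S + e" for x
 proof -
  have "V x \<bullet> (grad \<psi> x - grad \<phi> x) <= norm (V x) * norm (grad \<psi> x - grad \<phi> x)" by (rule norm_cauchy_schwarz)
  also have "... <= M * (e / M)" using M \<psi>(3) by (intro mult_mono) auto
  finally have "V x \<bullet> (grad \<psi> x - grad \<phi> x) <= e" using M by simp
  then show ?thesis using S[of x] by (simp add: inner_add_right inner_diff_right)
 qed
 have "cper (%x. - laplacian \<psi> x + (norm (p + grad \<psi> x))\<^sup>2)"
  unfolding power2_norm_eq_inner using \<psi> cper_grad[of 1 \<psi>] cper_laplacian[of 0 \<psi>]
  by (intro cper_intros) (auto simp: numeral_2_eq_2)
 then obtain C where C: "!!x. - laplacian \<psi> x + (norm (p + grad \<psi> x))\<^sup>2 <= C"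
  using cper_attains_sup by blast
 have le: "flame_speed V f A p / A <= (deriv01 f 0 + C) / A + (S + e)" if A: "0 < A" for A
 proof -
  have "viscous_HJ V A p \<psi> x <= C + A * (S + e)" for x
   unfolding viscous_HJ_def using C[of x] mult_left_mono[OF S'[of x] less_imp_le[OF A]] by linarith
  then have "kappa V A p <= C + A * (S + e)" by (rule kappa_le[OF smV pV \<psi>(1,2)])
  then have "flame_speed V f A p <= deriv01 f 0 + C + A * (S + e)"
   using flame_speed_le[of 1 A p] by simp
  then have "flame_speed V f A p / A <= (deriv01 f 0 + C + A * (S + e)) / A"
   using A by (intro divide_right_mono) auto
  then show ?thesis using A by (simp add: add_divide_distrib)
 qed
 have "((%A. (deriv01 f 0 + C) / A + (S + e)) \<longlongrightarrow> 0 + (S + e)) at_top"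
  by (intro tendsto_add tendsto_const real_tendsto_divide_at_top[OF tendsto_const] filterlim_ident)
 then have "c_star V f p <= 0 + (S + e)"
  by (rule tendsto_le[OF trivial_limit_at_top_linorder _ c_star_tendsto])
   (auto intro!: eventually_at_top_linorderI[of 1] le)
 then show "c_star V f p <= S + e" by simp
qed

lemma V_grad_bdd:
 assumes "\<phi> \<in> C1_torus" shows "bdd_above (range (%x. V x \<bullet> (p + grad \<phi> x)))"
proof -
 have "cper (grad \<phi>)" using assms cper_grad[of 0 \<phi>] by (simp add: C1_torus_def)
 then have "cper (%x. V x \<bullet> (p + grad \<phi> x))" by (intro cper_intros cV)
 then show ?thesis using cper_attains_sup by (metis (no_types, lifting) bdd_above.I2)
qed

lemma SUP_V_grad_nonneg:
 assumes "\<phi> \<in> C1_torus" shows "0 <= (SUP x. V x \<bullet> (p + grad \<phi> x))"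
proof -
 let ?S = "SUP x. V x \<bullet> (p + grad \<phi> x)"
 have \<phi>: "C_k 1 \<phi>" "periodic \<phi>" using assms by (auto simp: C1_torus_def)
 have c: "cper (grad \<phi>)" using cper_grad[of 0 \<phi>] \<phi> by simp
 have "mean (%x. V x \<bullet> p + V x \<bullet> grad \<phi> x) = 0"
  by (subst mean_add) (auto intro!: cper_intros cV c simp: integral_V_const integral_V_grad[OF \<phi>])
 moreover have "mean (%x. V x \<bullet> p + V x \<bullet> grad \<phi> x) <= mean (%x. ?S)"
 proof (intro mean_mono cper_intros cV c)
  show "V x \<bullet> p + V x \<bullet> grad \<phi> x <= ?S" for x
   using cSUP_upper[OF UNIV_I V_grad_bdd[OF assms], of x p] by (simp add: inner_add_right)
 qed
 ultimately show ?thesis by simp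
qed

lemma c_lim_le:
 assumes "\<phi> \<in> C1_torus" "!!x. V x \<bullet> (p + grad \<phi> x) <= S" shows "c_lim V p <= S"
proof -
 have "c_lim V p <= (SUP x. V x \<bullet> (p + grad \<phi> x))"
  unfolding c_lim_def using SUP_V_grad_nonneg assms(1) by (intro cINF_lower bdd_belowI2[of _ 0]) auto
 also have "... <= S" by (rule cSUP_least) (use assms(2) in auto)
 finally show ?thesis .
qed

lemma zero_in_C1_torus: "(%x. 0) \<in> C1_torus"
 by (auto simp: C1_torus_def periodic_def simp del: C_k.simps)

lemma c_lim_nonneg: "0 <= c_lim V p"
 unfolding c_lim_def using SUP_V_grad_nonneg zero_in_C1_torus by (intro cINF_greatest) auto

lemma c_star_le_c_lim: "c_star V f p <= c_lim V p"
 unfolding c_lim_def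
proof (rule cINF_greatest)
 show "C1_torus ~= {}" using zero_in_C1_torus by blast
 fix \<phi> assume \<phi>: "\<phi> \<in> C1_torus"
 show "c_star V f p <= (SUP x. V x \<bullet> (p + grad \<phi> x))"
  using \<phi> cSUP_upper[OF UNIV_I V_grad_bdd[OF \<phi>]] by (intro c_star_le[of \<phi>]) (auto simp: C1_torus_def simp del: C_k.simps)
qed

text \<open>The lower half of the variational formula. In \<open>kappa_lower\<close> for l p the
  Dirichlet integral costs at most f'(0) times the mean of w^2, exactly what the numerator of the
  flame speed adds back, so the bound does not depend on l.\<close>

lemma c_star_ge:
 assumes w: "C_k 1 w" "periodic w" "!!x. V x \<bullet> grad w x = 0" and w0: "0 < mean (%x. (w x)\<^sup>2)"
  and D: "mean (%x. (norm (grad w x))\<^sup>2) <= deriv01 f 0 * mean (%x. (w x)\<^sup>2)"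
  and c: "c * mean (%x. (w x)\<^sup>2) <= mean (%x. (w x)\<^sup>2 * (V x \<bullet> p))"
 shows "c <= c_star V f p"
proof -
 let ?I = "mean (%x. (w x)\<^sup>2)"
 have "c <= flame_speed V f A p / A" if A: "0 < A" for A
 proof -
  have "A * c <= flame_speed V f A p"
  proof (rule flame_speed_ge)
   fix l :: real assume l: "0 < l"
   have "(A * l * c) * ?I <= A * l * mean (%x. (w x)\<^sup>2 * (V x \<bullet> p))"
    using mult_left_mono[OF c, of "A * l"] A l by (simp add: mult.assoc)
   also have "... = A * mean (%x. (w x)\<^sup>2 * (V x \<bullet> (l *R p)))"
    by (simp add: mult.left_commute)
   finally have "(A * l * c - deriv01 f 0) * ?I <= kappa V A (l *R p) * ?I"
    using kappa_lower[OF w, of A "l *R p"] D by (simp add: left_diff_distrib)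
   then have "A * l * c - deriv01 f 0 <= kappa V A (l *R p)" using w0 by simp
   then show "A * c <= (deriv01 f 0 + kappa V A (l *R p)) / l" using l by (simp add: field_simps)
  qed
  then show ?thesis using A by (simp add: field_simps)
 qed
 then show ?thesis
  by (intro tendsto_lowerbound[OF c_star_tendsto] eventually_at_top_linorderI[of 1]) auto
qed

end

end

subsection \<open>Stream functions\<close>

lemma periodic_axisI:
 assumes "!!x i. g (x + axis i 1) = g x" shows "periodic (g :: plane => 'b)"
 unfolding periodic_def
proof safe
 have Z: "g (x + of_int n *R axis i 1) = g x" for x i n
 proof (induction n rule: int_induct[where k=0])
  case (step1 n)
  then show ?case using assms[of "x + of_int n *R axis i 1" i] by (simp add: algebra_simps)
 next
  case (step2 n)
  then show ?case using assms[of "x + of_int (n - 1) *R axis i 1" i] by (simp add: algebra_simps)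
 qed simp
 fix k x :: plane assume "k \<in> int_lattice"
 then have "k $ 1 \<in> \<int>" "k $ 2 \<in> \<int>" by (auto simp: int_lattice_def)
 then obtain n1 n2 where n: "k $ 1 = of_int n1" "k $ 2 = of_int n2"
  by (auto elim!: Ints_cases)
 have "x + k = (x + of_int n1 *R axis 1 1) + of_int n2 *R axis 2 1"
  by (simp add: vec_eq_iff forall_2 axis_nth_plane n)
 then show "g (x + k) = g x" by (simp only: Z)
qed

text \<open>The counterclockwise quarter turn.\<close>

definition rot :: "plane => plane" where "rot v = (\<chi> i. if i = 1 then - v $ 2 else v $ 1)"

lemma rot_nth [simp]: "rot v $ 1 = - v $ 2" "rot v $ 2 = v $ 1"
 by (simp_all add: rot_def)

lemma bounded_linear_rot: "bounded_linear rot"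
 unfolding linear_conv_bounded_linear[symmetric] by (auto intro!: linearI simp: vec_eq_iff forall_2)

lemma plane_inner: "(v :: plane) \<bullet> w = v $ 1 * w $ 1 + v $ 2 * w $ 2"
 by (simp add: inner_vec_def sum_2)

lemma rot_inner_self [simp]: "v \<bullet> rot v = 0" "rot v \<bullet> v = 0"
 by (simp_all add: plane_inner)

text \<open>Poincare lemma: \<open>\<Phi>\<close> integrates F along rays from the origin. After
  differentiation under the integral, closedness identifies the integrand with the t-derivative of t
  times a component of \<open>F (t *R x)\<close>.\<close>

lemma closed_form_primitive:
 fixes F :: "plane => plane"
 assumes F: "C_k 1 F"
  and closed: "!!x i j. pd i F x $ j = pd j F x $ i"
 obtains \<Phi> where "C_k 2 \<Phi>" "!!x. grad \<Phi> x = F x"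
proof -
 have dF: "F differentiable (at x)" for x using F by simp
 have cF: "continuous_on S F" for S using C_k_continuous[OF F] continuous_on_subset by blast
 have cdF: "continuous_on S (pd i F)" for S i
  using F continuous_on_subset[of UNIV "pd i F"] by simp
 define \<Phi> where "\<Phi> x = integral {0..1} (%t. F (t *R x) \<bullet> x)" for x
 have "((%s. \<Phi> (x + s *R axis i 1)) has_real_derivative F x $ i) (at 0)" for x i
 proof -
  let ?e = "axis i 1 :: plane"
  let ?f' = "%s t. (t *R dir_deriv ?e F (t *R (x + s *R ?e))) \<bullet> (x + s *R ?e) + F (t *R (x + s *R ?e)) \<bullet> ?e"
  have "((%s. integral (cbox 0 1) (%t. F (t *R (x + s *R ?e)) \<bullet> (x + s *R ?e))) has_field_derivative integral (cbox 0 1) (?f' 0)) (at 0 within UNIV)"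
  proof (rule leibniz_rule_field_derivative)
   fix s t :: real
   have "((%r. F (t *R x + r *R ?e)) has_vector_derivative dir_deriv ?e F (t *R x + (t * s) *R ?e)) (at (t * s))"
    by (rule dir_deriv_line[OF dF])
   moreover have "((%s. t * s) has_vector_derivative t) (at s)" by (auto intro!: derivative_eq_intros)
   ultimately have "((%s. F (t *R x + (t * s) *R ?e)) has_vector_derivative t *R dir_deriv ?e F (t *R x + (t * s) *R ?e)) (at s)"
    using vector_diff_chain_at[of "%s. t * s" t s "%r. F (t *R x + r *R ?e)"] by (simp add: o_def)
   then have 1: "((%s. F (t *R (x + s *R ?e))) has_vector_derivative t *R dir_deriv ?e F (t *R (x + s *R ?e))) (at s)"
    by (simp add: scaleR_add_right)
   have 2: "((%s. x + s *R ?e) has_vector_derivative ?e) (at s)" by (auto intro!: derivative_eq_intros)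
   show "((%s. F (t *R (x + s *R ?e)) \<bullet> (x + s *R ?e)) has_field_derivative ?f' s t) (at s within UNIV)"
    using bounded_bilinear.has_vector_derivative[OF bounded_bilinear_inner 1 2]
    by (simp add: has_real_derivative_iff_has_vector_derivative add.commute)
  next
   show "(%t. F (t *R (x + s *R ?e)) \<bullet> (x + s *R ?e)) integrable_on cbox 0 1" for s
    by (intro integrable_continuous continuous_intros continuous_on_compose2[OF cF[of UNIV]]) auto
   show "continuous_on (UNIV \<times> cbox 0 1) (%(s, t). ?f' s t)"
    unfolding split_beta
    by (intro continuous_intros continuous_on_compose2[OF cF[of UNIV]] continuous_on_compose2[OF cdF[of UNIV i]]) auto
  qed auto
  moreover have "integral (cbox 0 1) (?f' 0) = F x $ i"
  proof -
   have "((%t. ?f' 0 t) has_integral (1 * (F (1 *R x) \<bullet> ?e) - 0 * (F (0 *R x) \<bullet> ?e))) {0..1}"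
   proof (rule fundamental_theorem_of_calculus)
    fix t :: real assume "t \<in> {0..1}"
    have "((%t. F (0 + t *R x)) has_vector_derivative dir_deriv x F (0 + t *R x)) (at t)"
     by (rule dir_deriv_line[OF dF])
    then have 1: "((%t. F (t *R x)) has_vector_derivative dir_deriv x F (t *R x)) (at t)" by simp
    have "((%t. F (t *R x) \<bullet> ?e) has_vector_derivative dir_deriv x F (t *R x) \<bullet> ?e) (at t)"
     by (rule bounded_linear.has_vector_derivative[OF bounded_linear_inner_left 1])
    then have "((%t. F (t *R x) \<bullet> ?e) has_real_derivative dir_deriv x F (t *R x) \<bullet> ?e) (at t)"
     by (simp add: has_real_derivative_iff_has_vector_derivative)
    then have "((%t. t * (F (t *R x) \<bullet> ?e)) has_real_derivative t * (dir_deriv x F (t *R x) \<bullet> ?e) + F (t *R x) \<bullet> ?e) (at t)"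
     by (auto intro!: derivative_eq_intros)
    moreover have "dir_deriv x F y \<bullet> ?e = dir_deriv ?e F y \<bullet> x" for y
    proof -
     have "dir_deriv x F y = (x \<bullet> axis 1 1) *R pd 1 F y + (x \<bullet> axis 2 1) *R pd 2 F y"
      unfolding dir_deriv_def[of x] frechet_expand[OF dF] sum_Basis_plane ..
     then have "dir_deriv x F y \<bullet> ?e = x $ 1 * (pd 1 F y $ i) + x $ 2 * (pd 2 F y $ i)"
      by (simp add: inner_axis inner_axis')
     also have "... = dir_deriv ?e F y \<bullet> x" unfolding closed[of _ _ i] by (simp add: plane_inner)
     finally show ?thesis .
    qed
    ultimately show "((%t. t * (F (t *R x) \<bullet> ?e)) has_vector_derivative ?f' 0 t) (at t within {0..1})"
     by (auto simp: has_real_derivative_iff_has_vector_derivative intro: has_vector_derivative_at_within)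
   qed simp
   then show ?thesis by (simp add: integral_unique inner_axis)
  qed
  ultimately show ?thesis by (simp add: \<Phi>_def)
 qed
 moreover have "C_k 1 (%x. F x $ i)" for i by (rule C_k_linear[OF bounded_linear_vec_nth F])
 ultimately have "C_k (Suc 1) \<Phi>" "!!i. pd i \<Phi> = (%x. F x $ i)"
  using C1_partials[of \<Phi> "%i x. F x $ i" 1] by blast+
 then have "grad \<Phi> x = F x" "C_k 2 \<Phi>" for x
  by (simp_all add: grad_def sum_Basis_plane vec_eq_iff forall_2 axis_nth_plane numeral_2_eq_2)
 then show ?thesis by (intro that)
qed

text \<open>The increments of a primitive under lattice shifts are constants c. Removing a linear
  function leaves a periodic function with gradient F - c, whose mean vanishes; subtracting the mean
  of W makes the mean of F zero, hence c = 0 and the primitive itself is periodic.\<close>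

lemma stream_function:
 fixes W :: "plane => plane"
 assumes W: "C_k 1 W" "periodic W" and div: "!!x. divergence W x = 0"
 obtains \<Phi> where "C_k 2 \<Phi>" "periodic \<Phi>" "!!x. grad \<Phi> x = rot (W x - mean W)"
proof -
 let ?m = "mean W"
 define F where "F x = rot (W x - ?m)" for x
 have W0: "C_k 1 (%x. W x - ?m)" by (intro C_k_diff W C_k_const)
 have F: "C_k 1 F" unfolding F_def by (rule C_k_linear[OF bounded_linear_rot W0])
 have cW: "cper W" by (rule C_k_cper[OF W])
 have cF: "cper F"
 proof (rule C_k_cper[OF F])
  show "periodic F" using W(2) by (simp add: periodic_def F_def)
 qed
 have dF: "dir_deriv e F x = rot (dir_deriv e W x)" for e x
 proof -
  have d: "W differentiable (at x)" "(%x. W x - ?m) differentiable (at x)" using W W0 by auto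
  show ?thesis unfolding F_def dir_deriv_linear[OF bounded_linear_rot d(2)]
   using dir_deriv_diff[OF d(1), of "%x. ?m" e] by simp
 qed
 have dv: "pd 1 W x $ 1 + pd 2 W x $ 2 = 0" for x
  using div[of x] by (simp add: divergence_def sum_Basis_plane inner_axis)
 have "pd i F x $ j = pd j F x $ i" for x i j
  using exhaust_2[of i] exhaust_2[of j] dv[of x] by (auto simp: dF)
 then obtain \<Phi> where \<Phi>: "C_k 2 \<Phi>" "!!x. grad \<Phi> x = F x" using closed_form_primitive[OF F] by blast
 have d\<Phi>: "\<Phi> differentiable (at x)" for x using \<Phi>(1) by (simp add: numeral_2_eq_2)
 define c where "c i = \<Phi> (axis i 1) - \<Phi> 0" for i
 have const: "\<Phi> (x + axis i 1) - \<Phi> x = c i" for x i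
 proof -
  have "((%x. \<Phi> (x + axis i 1) - \<Phi> x) has_derivative (%h. 0)) (at x within UNIV)" for x
  proof -
   have "((%x. \<Phi> (x + axis i 1) - \<Phi> x) has_derivative (%h. grad \<Phi> (x + axis i 1) \<bullet> h - grad \<Phi> x \<bullet> h)) (at x)"
    by (intro has_derivative_diff has_derivative_translate has_derivative_grad d\<Phi>)
   then show ?thesis using periodicD[OF cperD(2)[OF cF]] by (simp add: \<Phi>(2))
  qed
  then obtain k where "!!x. \<Phi> (x + axis i 1) - \<Phi> x = k"
   using has_derivative_zero_constant[of UNIV "%x. \<Phi> (x + axis i 1) - \<Phi> x"] by auto
  from this[of x] this[of 0] show ?thesis by (simp add: c_def)
 qed
 define v where "v = (\<chi> i. c i)"
 define \<Psi> where "\<Psi> x = \<Phi> x - v \<bullet> x" for x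
 have \<Psi>p: "periodic \<Psi>"
 proof (rule periodic_axisI)
  fix x and i :: 2 show "\<Psi> (x + axis i 1) = \<Psi> x"
   using const[of x i] by (simp add: \<Psi>_def inner_add_right inner_axis v_def)
 qed
 have \<Psi>1: "C_k 1 \<Psi>" unfolding \<Psi>_def
  using C_k_mono[OF \<Phi>(1), of 1] by (intro C_k_diff C_k_inner C_k_const C_k_id) auto
 have d\<Psi>: "pd i \<Psi> x = F x $ i - c i" for i x
 proof -
  have "(\<Psi> has_derivative (%h. grad \<Phi> x \<bullet> h - v \<bullet> h)) (at x)"
   unfolding \<Psi>_def by (intro has_derivative_diff has_derivative_grad d\<Phi>) (auto intro!: derivative_eq_intros)
  from dir_deriv_eq[OF this] show ?thesis by (simp add: \<Phi>(2) inner_axis v_def)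
 qed
 have c0: "c i = 0" for i
 proof -
  have "mean (%x. F x $ i - c i) = 0"
   using integral_dir_deriv[OF \<Psi>1 \<Psi>p, of "axis i 1"] by (simp add: d\<Psi>[abs_def])
  moreover have "mean (%x. F x $ i) = 0"
  proof -
   have "((%x. W x - ?m) has_integral ?m - ?m) (cbox 0 1)"
    using has_integral_diff[OF integrable_integral[OF cper_integrable[OF cW]] has_integral_const[of ?m 0 1]] by simp
   then have "((%x. F x $ i) has_integral 0) (cbox 0 1)"
    using has_integral_linear[of "%x. W x - ?m" 0 "cbox 0 1" "%y. rot y $ i"]
     bounded_linear_compose[OF bounded_linear_vec_nth bounded_linear_rot, of i]
    by (simp add: o_def F_def linear_0[OF bounded_linear.linear[OF bounded_linear_rot]])
   then show ?thesis by (rule integral_unique)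
  qed
  moreover have "mean (%x. F x $ i - c i) = mean (%x. F x $ i) - mean (%x::plane. c i)"
   by (intro mean_diff cper_nth cF cper_const)
  ultimately show ?thesis by simp
 qed
 then have "v = 0" by (simp add: v_def vec_eq_iff)
 then have "periodic \<Phi>" using \<Psi>p by (simp add: \<Psi>_def[abs_def])
 then show ?thesis using \<Phi> by (intro that) (auto simp: F_def)
qed

subsection \<open>Functions differentiable along a flow\<close>

context lipschitz_field
begin

lemma flow_derivative_uniform:
 assumes d: "cper d" and der: "!!x. ((%s. \<phi> (flow V s x)) has_real_derivative d x) (at 0)" and e: "0 < e"
 shows "EX t0>0. ALL t x. \<bar>t\<bar> < t0 --> \<bar>\<phi> (flow V t x) - \<phi> x - t * d x\<bar> <= e * \<bar>t\<bar>"
proof -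
 obtain r where r: "r > 0" "!!x y. dist x y < r ==> dist (d x) (d y) < e" using cper_uniform[OF d e] by blast
 have der': "((%s. \<phi> (flow V s x)) has_real_derivative d (flow V s x)) (at s)" for s x
 proof -
  have "((%h. \<phi> (flow V (h + s) x)) has_real_derivative d (flow V s x)) (at 0)"
   using der[of "flow V s x"] by (simp add: flow_add)
  then have "((%h. \<phi> (flow V (h + s) x)) has_real_derivative d (flow V s x)) (at (s - s))" by simp
  then show ?thesis using DERIV_shift[of "%h. \<phi> (flow V h x)" "d (flow V s x)" 0 s] by simp
 qed
 have "\<bar>\<phi> (flow V t x) - \<phi> x - t * d x\<bar> <= e * \<bar>t\<bar>" if t: "\<bar>t\<bar> < r / (M + 1)" for t x
 proof -
  obtain z where z: "\<bar>z\<bar> <= \<bar>t\<bar>" "\<phi> (flow V t x) - \<phi> (flow V 0 x) = t * d (flow V z x)"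
   using mvt_line[OF der'] by blast
  have "norm (flow V z x - x) <= M * \<bar>z\<bar>" using flow_speed[of z x 0] by simp
  also have "... <= (M + 1) * \<bar>t\<bar>" using z(1) M_nonneg by (intro mult_mono) auto
  also have "... < r" using t M_nonneg by (simp add: field_simps)
  finally have "\<bar>d (flow V z x) - d x\<bar> <= e" using r(2) by (force simp: dist_norm)
  then have "\<bar>t\<bar> * \<bar>d (flow V z x) - d x\<bar> <= \<bar>t\<bar> * e" by (rule mult_left_mono) simp
  moreover have "\<phi> (flow V t x) - \<phi> x - t * d x = t * (d (flow V z x) - d x)" using z(2) by (simp add: algebra_simps)
  ultimately show ?thesis by (simp add: abs_mult mult.commute)
 qed
 moreover have "r / (M + 1) > 0" using r(1) M_nonneg by simp
 ultimately show ?thesis by blast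
qed

text \<open>Averaging over small squares makes \<open>\<phi>\<close> continuously differentiable; the error from moving the drift
 through the average is controlled by the Lipschitz constants.\<close>

lemma flow_derivative_approx:
 assumes \<phi>: "cper \<phi>" and lip: "!!x y. \<bar>\<phi> x - \<phi> y\<bar> <= \<Lambda> * norm (x - y)"
  and d: "cper d" and der: "!!x. ((%s. \<phi> (flow V s x)) has_real_derivative d x) (at 0)" and e: "0 < e"
 shows "\<exists>\<psi>. C_k 1 \<psi> & periodic \<psi> & (ALL x. \<bar>V x \<bullet> grad \<psi> x - d x\<bar> <= e)"
proof -
 define \<Lambda>' where "\<Lambda>' = \<bar>\<Lambda>\<bar> + 1"
 have "\<Lambda> * norm (x - y) <= \<Lambda>' * norm (x - y)" for x y
  by (rule mult_right_mono) (auto simp: \<Lambda>'_def)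
 from order_trans[OF lip this] have \<Lambda>': "\<Lambda>' > 0" "\<bar>\<phi> x - \<phi> y\<bar> <= \<Lambda>' * norm (x - y)" for x y
  by (auto simp: \<Lambda>'_def)
 obtain r0 where r0: "r0 > 0" "!!r x. 0 <= r ==> r < r0 ==> \<bar>stek r d x - d x\<bar> <= e / 2"
  using stek_tendsto[OF d half_gt_zero[OF e]] by blast
 define r where "r = min (r0 / 2) (e / (16 * \<Lambda>' * L))"
 have r: "0 < r" "r < r0" "\<Lambda>' * (L * (2 * r)) <= e / 8"
 proof -
  show "0 < r" using r0(1) e \<Lambda>'(1) L(1) by (simp add: r_def)
  have "r <= r0 / 2" by (simp add: r_def)
  then show "r < r0" using r0(1) by linarith
  have "r <= e / (16 * \<Lambda>' * L)" by (simp add: r_def)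
  then show "\<Lambda>' * (L * (2 * r)) <= e / 8" using \<Lambda>'(1) L(1) by (simp add: field_simps)
 qed
 have "e / 8 > 0" using e by simp
 from flow_derivative_uniform[OF d der this] obtain t0 where t0: "t0 > 0"
  "!!t x. \<bar>t\<bar> < t0 ==> \<bar>\<phi> (flow V t x) - \<phi> x - t * d x\<bar> <= e / 8 * \<bar>t\<bar>" by blast
 define t1 where "t1 = min t0 (e / (8 * \<Lambda>' * L * (M + 1)))"
 have t1: "t1 > 0" using t0(1) e \<Lambda>'(1) L(1) M_nonneg by (simp add: t1_def)
 \<comment> \<open>The flow is replaced by a straight step, which is compared below with a
   translation by the fixed vector \<open>V x\<close>; translations commute with averaging.\<close>
 have step: "\<bar>\<phi> (y + t *R V y) - \<phi> y - t * d y\<bar> <= e / 4 * t" if t: "0 < t" "t < t1" for t y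
 proof -
  have "\<bar>\<phi> (y + t *R V y) - \<phi> (flow V t y)\<bar> <= \<Lambda>' * norm (flow V t y - y - t *R V y)"
   using \<Lambda>'(2)[of "y + t *R V y" "flow V t y"] by (simp add: norm_minus_commute algebra_simps)
  also have "... <= \<Lambda>' * (L * M * t\<^sup>2)" using flow_Euler \<Lambda>'(1) by (intro mult_left_mono) auto
  also have "... <= \<Lambda>' * (L * (M + 1) * t\<^sup>2)" using \<Lambda>'(1) L(1) by (intro mult_left_mono mult_right_mono) auto
  also have "... = (\<Lambda>' * L * (M + 1) * t) * t" by (simp add: power2_eq_square)
  also have "... <= e / 8 * t"
  proof (rule mult_right_mono)
   have "t <= e / (8 * \<Lambda>' * L * (M + 1))" using t by (simp add: t1_def)
   moreover have "8 * \<Lambda>' * L * (M + 1) > 0" using \<Lambda>'(1) L(1) M_nonneg by simp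
   ultimately have "t * (8 * \<Lambda>' * L * (M + 1)) <= e" by (simp add: pos_le_divide_eq)
   then show "\<Lambda>' * L * (M + 1) * t <= e / 8" by (simp add: algebra_simps)
  qed (use t in simp)
  finally have 1: "\<bar>\<phi> (y + t *R V y) - \<phi> (flow V t y)\<bar> <= e / 8 * t" .
  have "\<bar>\<phi> (flow V t y) - \<phi> y - t * d y\<bar> <= e / 8 * t" using t0(2)[of t y] t by (simp add: t1_def)
  with 1 show ?thesis by linarith
 qed
 let ?\<psi> = "stek r \<phi>"
 note ti = stek_trans_inv[of r]
 have \<psi>1: "C_k 1 ?\<psi>" using stek_C_k[of 0 \<phi> r] \<phi> r(1) by (simp add: cper_def)
 have \<psi>p: "periodic ?\<psi>" using trans_inv_cper[OF ti \<phi>] by (simp add: cper_def)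
 have "\<bar>V x \<bullet> grad ?\<psi> x - d x\<bar> <= e" for x
 proof -
  let ?v = "V x"
  have q: "\<bar>(?\<psi> (x + t *R ?v) - ?\<psi> (x + 0 *R ?v)) / (t - 0) - stek r d x\<bar> <= e / 2" if t: "0 < t" "t < t1" for t
  proof -
   let ?g = "%y. \<phi> (y + t *R ?v) - \<phi> y - t * d y"
   have "stek r ?g = (%y. ?\<psi> (y + t *R ?v) - ?\<psi> y - t * stek r d y)"
    by (simp add: trans_inv_diff[OF ti] trans_inv_cmult[OF ti] trans_inv_translate[OF ti] cper_intros \<phi> d)
   moreover have "\<bar>stek r ?g x - 0\<bar> <= e / 2 * t"
   proof (rule stek_near)
    show "cper ?g" by (intro cper_intros \<phi> d)
    show "0 <= r" using r(1) by simp
    \<comment> \<open>Freezing the drift at x instead of x + y costs at most 2 r L per unit of time,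
      which explains the size of r.\<close>
    fix y :: plane assume y: "norm y <= 2 * r"
    have "norm (?v - V (x + y)) <= L * (2 * r)"
     using L(2)[of x "x + y"] y mult_left_mono[OF y less_imp_le[OF L(1)]] by simp
    then have "t * norm (?v - V (x + y)) <= t * (L * (2 * r))" using t by (intro mult_left_mono) auto
    then have "\<Lambda>' * (t * norm (?v - V (x + y))) <= \<Lambda>' * (t * (L * (2 * r)))" using \<Lambda>'(1) by (rule_tac mult_left_mono) auto
    also have "... = t * (\<Lambda>' * (L * (2 * r)))" by simp
    also have "... <= t * (e / 8)" using r(3) t by (intro mult_left_mono) auto
    finally have 3: "\<Lambda>' * (t * norm (?v - V (x + y))) <= t * (e / 8)" .
    have "\<bar>\<phi> (x + y + t *R ?v) - \<phi> (x + y + t *R V (x + y))\<bar> <= \<Lambda>' * norm ((x + y + t *R ?v) - (x + y + t *R V (x + y)))"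
     by (rule \<Lambda>'(2))
    also have "norm ((x + y + t *R ?v) - (x + y + t *R V (x + y))) = t * norm (?v - V (x + y))"
     using t by (simp add: scaleR_diff_right[symmetric])
    finally have "\<bar>\<phi> (x + y + t *R ?v) - \<phi> (x + y + t *R V (x + y))\<bar> <= t * (e / 8)" using 3 by (rule order_trans)
    moreover have "\<bar>\<phi> (x + y + t *R V (x + y)) - \<phi> (x + y) - t * d (x + y)\<bar> <= e / 4 * t" by (rule step[OF t])
    moreover have "t * (e / 8) + e / 4 * t <= e / 2 * t" using t e by simp
    ultimately show "\<bar>?g (x + y) - 0\<bar> <= e / 2 * t" by linarith
   qed
   ultimately have "\<bar>?\<psi> (x + t *R ?v) - ?\<psi> x - t * stek r d x\<bar> <= e / 2 * t" by simp
   then have "\<bar>?\<psi> (x + t *R ?v) - ?\<psi> x - t * stek r d x\<bar> / t <= e / 2" using t by (simp add: field_simps)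
   moreover have "(?\<psi> (x + t *R ?v) - ?\<psi> (x + 0 *R ?v)) / (t - 0) - stek r d x = (?\<psi> (x + t *R ?v) - ?\<psi> x - t * stek r d x) / t"
    using t by (simp add: field_simps)
   ultimately show ?thesis using t by simp
  qed
  have \<psi>d: "?\<psi> differentiable (at y)" for y using \<psi>1 by simp
  have "((%t. ?\<psi> (x + t *R ?v)) has_real_derivative dir_deriv ?v ?\<psi> x) (at 0)"
   using dir_deriv_line_real[of ?\<psi> x 0 ?v] \<psi>d by simp
  moreover have "dir_deriv ?v ?\<psi> x = V x \<bullet> grad ?\<psi> x"
   using grad_inner[OF \<psi>d] by (simp add: dir_deriv_def inner_commute)
  ultimately have "((%t. (?\<psi> (x + t *R ?v) - ?\<psi> (x + 0 *R ?v)) / (t - 0)) \<longlongrightarrow> V x \<bullet> grad ?\<psi> x) (at_right 0)"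
   unfolding has_field_derivative_iff by (auto intro: tendsto_mono[OF at_le])
  then have "((%t. \<bar>(?\<psi> (x + t *R ?v) - ?\<psi> (x + 0 *R ?v)) / (t - 0) - stek r d x\<bar>) \<longlongrightarrow> \<bar>V x \<bullet> grad ?\<psi> x - stek r d x\<bar>) (at_right 0)"
   by (intro tendsto_intros)
  then have "\<bar>V x \<bullet> grad ?\<psi> x - stek r d x\<bar> <= e / 2"
  proof (rule tendsto_upperbound)
   show "\<forall>\<^sub>F t in at_right 0. \<bar>(?\<psi> (x + t *R ?v) - ?\<psi> (x + 0 *R ?v)) / (t - 0) - stek r d x\<bar> <= e / 2"
    unfolding eventually_at_right_field using t1 q by blast
  qed simp
  moreover have "\<bar>stek r d x - d x\<bar> <= e / 2" using r0(2) r by simp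
  ultimately show ?thesis by linarith
 qed
 then show ?thesis using \<psi>1 \<psi>p by blast
qed

text \<open>The average of p . (X_t x - x) over t in [0, T] has, along the flow, the derivative p .
  (X_T x - x) / T - p . V x. It is Lipschitz in x, which is the regularity that
  \<open>flow_derivative_approx\<close> asks for.\<close>

lemma average_displacement_approx:
 assumes T: "0 < T" and e: "0 < e"
 shows "\<exists>\<psi>. C_k 1 \<psi> & periodic \<psi> & (ALL x. \<bar>V x \<bullet> (p + grad \<psi> x) - p \<bullet> (flow V T x - x) / T\<bar> <= e)"
proof -
 define \<phi> where "\<phi> x = (1 / T) * integral {0..T} (%t. p \<bullet> (flow V t x - x))" for x
 define d where "d x = p \<bullet> (flow V T x - x) / T - p \<bullet> V x" for x
 have int: "(%t. p \<bullet> (flow V t x - x)) integrable_on {0..T}" for x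
  by (intro integrable_continuous_interval continuous_intros flow_continuous)
 have lip: "\<bar>\<phi> x - \<phi> y\<bar> <= (norm p * (exp (L * T) + 1)) * norm (x - y)" for x y
 proof -
  have "\<bar>integral {0..T} (%t. p \<bullet> (flow V t x - x) - p \<bullet> (flow V t y - y))\<bar> <= integral {0..T} (%t. norm p * ((exp (L * T) + 1) * norm (x - y)))"
   unfolding real_norm_def[symmetric]
  proof (rule integral_norm_bound_integral)
   show "(%t. p \<bullet> (flow V t x - x) - p \<bullet> (flow V t y - y)) integrable_on {0..T}" by (intro integrable_diff int)
   fix t assume t: "t \<in> {0..T}"
   have "norm ((flow V t x - x) - (flow V t y - y)) <= norm (flow V t x - flow V t y) + norm (x - y)"
    using norm_triangle_ineq4[of "flow V t x - flow V t y" "x - y"] by (simp add: algebra_simps)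
   also have "... <= exp (L * T) * norm (x - y) + norm (x - y)"
   proof -
    have "exp (L * \<bar>t\<bar>) <= exp (L * T)" using t L(1) by simp
    then show ?thesis using flow_lipschitz[of t x y] mult_right_mono[of "exp (L * \<bar>t\<bar>)" "exp (L * T)" "norm (x - y)"] by simp
   qed
   finally have "norm ((flow V t x - x) - (flow V t y - y)) <= (exp (L * T) + 1) * norm (x - y)" by (simp add: algebra_simps)
   then have "norm p * norm ((flow V t x - x) - (flow V t y - y)) <= norm p * ((exp (L * T) + 1) * norm (x - y))" by (rule mult_left_mono) simp
   moreover have "\<bar>p \<bullet> ((flow V t x - x) - (flow V t y - y))\<bar> <= norm p * norm ((flow V t x - x) - (flow V t y - y))"
    by (rule Cauchy_Schwarz_ineq2)
   ultimately show "norm (p \<bullet> (flow V t x - x) - p \<bullet> (flow V t y - y)) <= norm p * ((exp (L * T) + 1) * norm (x - y))"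
    by (simp add: inner_diff_right)
  qed auto
  also have "... = T * (norm p * ((exp (L * T) + 1) * norm (x - y)))" using T by simp
  finally have "(1 / T) * \<bar>integral {0..T} (%t. p \<bullet> (flow V t x - x) - p \<bullet> (flow V t y - y))\<bar> <= (1 / T) * (T * (norm p * ((exp (L * T) + 1) * norm (x - y))))"
   using T by (intro mult_left_mono) auto
  also have "... = norm p * (exp (L * T) + 1) * norm (x - y)" using T by simp
  finally have 1: "(1 / T) * \<bar>integral {0..T} (%t. p \<bullet> (flow V t x - x) - p \<bullet> (flow V t y - y))\<bar> <= norm p * (exp (L * T) + 1) * norm (x - y)" .
  have "\<phi> x - \<phi> y = (1 / T) * integral {0..T} (%t. p \<bullet> (flow V t x - x) - p \<bullet> (flow V t y - y))"
   unfolding \<phi>_def integral_diff[OF int int] by (rule right_diff_distrib[symmetric])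
  then show ?thesis using 1 T by (simp add: abs_mult)
 qed
 have \<phi>: "cper \<phi>"
  unfolding cper_def
 proof
  show "continuous_on UNIV \<phi>" by (rule lipschitz_continuous) (use lip in auto)
  show "periodic \<phi>" by (simp add: periodic_def \<phi>_def flow_periodic)
 qed
 have cd: "cper d"
  unfolding cper_def
 proof
  show "continuous_on UNIV d" unfolding d_def
   using T by (intro continuous_intros flow_continuous_space cperD(1)[OF cV]) auto
  show "periodic d" using cperD(2)[OF cV] by (simp add: periodic_def d_def flow_periodic)
 qed
 have "((%s. \<phi> (flow V s x)) has_real_derivative d x) (at 0)" for x
 proof -
  let ?q = "%t. p \<bullet> flow V t x"
  have q': "(?q has_real_derivative p \<bullet> V (flow V t x)) (at t)" for t
   using bounded_linear.has_vector_derivative[OF bounded_linear_inner_right flow_has_derivative]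
   by (simp add: has_real_derivative_iff_has_vector_derivative)
  have cq: "continuous_on S (%t. p \<bullet> V (flow V t x))" for S
   by (intro continuous_intros continuous_on_compose2[OF cperD(1)[OF cV, of UNIV]] flow_continuous) auto
  have ic: "continuous_on S (%t. ?q (t + s))" for S s
   by (intro continuous_intros continuous_on_compose2[OF flow_continuous[of UNIV]]) auto
  have "((%s. integral (cbox 0 T) (%t. ?q (t + s))) has_field_derivative integral (cbox 0 T) (%t. p \<bullet> V (flow V (t + 0) x))) (at 0 within UNIV)"
  proof (rule leibniz_rule_field_derivative)
   show "((%s. ?q (t + s)) has_field_derivative p \<bullet> V (flow V (t + s) x)) (at s within UNIV)" for s t
   proof -
    have "((%s. t + s) has_real_derivative 1) (at s)" by (auto intro!: derivative_eq_intros)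
    from DERIV_chain2[OF q' this] show ?thesis by simp
   qed
   show "(%t. ?q (t + s)) integrable_on cbox 0 T" for s by (intro integrable_continuous ic)
   show "continuous_on (UNIV \<times> cbox 0 T) (%(s, t). p \<bullet> V (flow V (t + s) x))"
    unfolding split_beta by (rule continuous_on_compose2[OF cq[of UNIV]]) (auto intro!: continuous_intros)
  qed auto
  moreover have "integral (cbox 0 T) (%t. p \<bullet> V (flow V (t + 0) x)) = ?q T - ?q 0"
  proof -
   have "((%t. p \<bullet> V (flow V t x)) has_integral (?q T - ?q 0)) {0..T}"
    using T q' by (intro fundamental_theorem_of_calculus)
     (auto simp: has_real_derivative_iff_has_vector_derivative intro: has_vector_derivative_at_within)
   then show ?thesis by (simp add: integral_unique)
  qed
  ultimately have I: "((%s. integral {0..T} (%t. ?q (t + s))) has_real_derivative ?q T - ?q 0) (at 0)" by simp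
  have eq: "\<phi> (flow V s x) = (1 / T) * integral {0..T} (%t. ?q (t + s)) - ?q s" for s
  proof -
   have "integral {0..T} (%t. p \<bullet> (flow V t (flow V s x) - flow V s x)) = integral {0..T} (%t. ?q (t + s) - ?q s)"
    by (simp add: flow_add inner_diff_right)
   also have "... = integral {0..T} (%t. ?q (t + s)) - T * ?q s"
    using T by (subst integral_diff) (auto intro!: integrable_continuous_interval ic)
   finally show ?thesis using T by (simp add: \<phi>_def right_diff_distrib)
  qed
  have "((%s. (1 / T) * integral {0..T} (%t. ?q (t + s)) - ?q s) has_real_derivative (1 / T) * (?q T - ?q 0) - p \<bullet> V (flow V 0 x)) (at 0)"
   by (intro DERIV_diff DERIV_cmult I q')
  then show ?thesis by (simp add: eq d_def inner_diff_right)
 qed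
 from flow_derivative_approx[OF \<phi> lip cd this e] obtain \<psi> where
  "C_k 1 \<psi>" "periodic \<psi>" "!!x. \<bar>V x \<bullet> grad \<psi> x - d x\<bar> <= e" by blast
 then show ?thesis by (intro exI[of _ \<psi>]) (auto simp: d_def inner_add_right inner_commute algebra_simps simp del: C_k.simps)
qed

end

subsection \<open>Flow boxes and periodic orbits\<close>

text \<open>The last time at the level is taken: the function stays above it afterwards, so its
  derivative there cannot be negative, and higher levels are crossed later.\<close>

lemma last_crossing:
 fixes g :: "real => real"
 assumes g: "!!t. (g has_real_derivative g' t) (at t)" and c: "g 0 <= c" "c < g T" and T: "0 <= T"
 obtains s where "0 <= s" "s < T" "g s = c" "0 <= g' s" "!!t. s < t ==> t <= T ==> c < g t"
proof -
 have cont: "continuous_on S g" for S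
  using g DERIV_isCont by (intro continuous_at_imp_continuous_on ballI) blast
 define K where "K = {0..T} \<inter> g -` {c}"
 have "closed K" unfolding K_def by (rule continuous_closed_preimage[OF cont]) auto
 moreover have "{0..T} \<inter> K = K" by (auto simp: K_def)
 ultimately have K: "compact K" using compact_Int_closed[OF compact_Icc, of K 0 T] by simp
 have "EX z>=0. z <= T & g z = c"
  using IVT'[of g 0 c T, OF c(1) less_imp_le[OF c(2)] T cont] by metis
 then have "K ~= {}" by (auto simp: K_def)
 from compact_attains_sup[OF K this] obtain s where s: "s \<in> K" "!!t. t \<in> K ==> t <= s" by blast
 have s': "0 <= s" "g s = c" "s < T" using s(1) c by (auto simp: K_def less_le)
 have after: "c < g t" if t: "s < t" "t <= T" for t
 proof (rule ccontr)
  assume "\<not> c < g t"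
  then obtain z where "t <= z" "z <= T" "g z = c" by (meson IVT'[OF _ less_imp_le[OF c(2)] t(2) cont] not_less)
  then have "z \<in> K" using s' t by (auto simp: K_def)
  from s(2)[OF this] show False using \<open>t <= z\<close> t by linarith
 qed
 have "0 <= g' s"
 proof (rule ccontr)
  assume "\<not> 0 <= g' s"
  then obtain d where d: "d > 0" "!!h. 0 < h ==> h < d ==> g (s + h) < g s"
   using DERIV_neg_dec_right[OF g[of s]] by force
  define h where "h = min d (T - s) / 2"
  have h: "0 < h" "h < d" "s + h <= T" using d(1) s' by (auto simp: h_def min_def field_simps)
  show False using d(2)[OF h(1,2)] after[of "s + h"] h s' by simp
 qed
 then show ?thesis using that s' after by blast
qed

lemma perp_multiple_rot:
 assumes "(w :: plane) \<bullet> v = 0" "v ~= 0" shows "EX s. w = s *R rot v"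
proof -
 have n: "v \<bullet> v > 0" using assms(2) by simp
 have eq: "w $ 1 * v $ 1 = - (w $ 2 * v $ 2)" using assms(1) by (simp add: plane_inner)
 have "w $ 1 * (v \<bullet> v) = (w \<bullet> rot v) * (rot v $ 1)" "w $ 2 * (v \<bullet> v) = (w \<bullet> rot v) * (rot v $ 2)"
  using eq by (simp_all add: plane_inner, algebra+)
 then have "w = ((w \<bullet> rot v) / (v \<bullet> v)) *R rot v"
  using n by (simp add: vec_eq_iff forall_2 field_simps del: rot_nth)
 then show ?thesis by blast
qed

locale incompressible_flow = incompressible V + lipschitz_field V M L for V M L
begin

lemma stream: obtains H where "C_k 2 H" "periodic H" "!!x. grad H x = rot (V x)"
proof -
 have "mean V = 0" using meanV by (simp add: mean_zero_def)
 then show ?thesis using stream_function[OF CkV pV divV] that by (metis diff_zero)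
qed

context
 fixes H assumes H: "C_k 2 H" "periodic H" "!!x. grad H x = rot (V x)"
begin

lemma H_derivative: "(H has_derivative (%h. rot (V x) \<bullet> h)) (at x)"
 using has_derivative_grad[of H x] H(1,3) by (simp add: numeral_2_eq_2)

lemma H_flow: "H (flow V t x) = H x"
proof -
 have "((%t. H (flow V t x)) has_real_derivative 0) (at t)" for t
 proof -
  have "((%t. H (flow V t x)) has_derivative (%h. rot (V (flow V t x)) \<bullet> (h *R V (flow V t x)))) (at t)"
   using has_derivative_compose[OF flow_has_derivative[unfolded has_vector_derivative_def] H_derivative] .
  then show ?thesis by (simp add: has_field_derivative_def mult_zero_left[abs_def])
 qed
 then have "H (flow V t x) = H (flow V 0 x)" using DERIV_isconst_all[of "%t. H (flow V t x)" t 0] by blast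
 then show ?thesis by simp
qed

text \<open>From a the flow is followed until it meets the line through b perpendicular to
  \<open>V y\<close>. On that line the stream function is strictly monotone near y, because its
  gradient \<open>rot V\<close> has a positive component along \<open>rot (V y)\<close>; equal
  levels force the meeting point to be b.\<close>

lemma flow_box:
 assumes v0: "0 < v0"
 shows "\<exists>\<rho>>0. ALL y a b. v0 <= norm (V y) --> norm (a - y) < \<rho> --> norm (b - y) < \<rho> --> H a = H b --> (EX t. b = flow V t a)"
proof -
 define R where "R = v0 / (2 * L)"
 have R: "R > 0" using v0 L(1) by (simp add: R_def)
 \<comment> \<open>In the time \<tau> used below a trajectory travels at most 4 \<rho> M / v0, so
   from distance \<rho> it stays within \<rho> K < R, where V differs from \<open>V y\<close> by at
   most half the length of \<open>V y\<close>.\<close>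
 define K where "K = 1 + 4 * M / v0"
 have K: "K >= 1" using M_nonneg v0 by (simp add: K_def)
 define \<rho> where "\<rho> = R / (2 * K)"
 have \<rho>: "\<rho> > 0" "\<rho> * K < R"
  using R K by (auto simp: \<rho>_def field_simps)
 have \<rho>R: "\<rho> < R" using \<rho> K mult_left_mono[of 1 K \<rho>] by linarith
 have "EX t. b = flow V t a" if y: "v0 <= norm (V y)" and a: "norm (a - y) < \<rho>" and b: "norm (b - y) < \<rho>" and Hab: "H a = H b" for y a b
 proof -
  let ?v = "V y"
  define n where "n = norm ?v"
  have n: "n >= v0" "n > 0" using y v0 by (auto simp: n_def)
  have near: "V x \<bullet> ?v >= n\<^sup>2 / 2" if x: "norm (x - y) <= R" for x
  proof -
   have "norm (?v - V x) <= L * norm (y - x)" by (rule L(2))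
   also have "... <= L * R" using x L(1) by (intro mult_left_mono) (auto simp: norm_minus_commute)
   also have "... <= n / 2" using L(1) n(1) by (simp add: R_def)
   finally have "norm (?v - V x) * n <= n / 2 * n" using n by (intro mult_right_mono) auto
   moreover have "(?v - V x) \<bullet> ?v <= norm (?v - V x) * n" unfolding n_def by (rule norm_cauchy_schwarz)
   ultimately have "(?v - V x) \<bullet> ?v <= n\<^sup>2 / 2" by (simp add: power2_eq_square)
   moreover have "?v \<bullet> ?v = n\<^sup>2" by (simp add: n_def power2_norm_eq_inner)
   ultimately show ?thesis by (simp add: inner_diff_left)
  qed
  \<comment> \<open>Long enough for \<open>g\<close> to change sign: it starts within 2 \<rho> n of
    zero, and its derivative is at least n^2 / 2.\<close>
  define \<tau> where "\<tau> = 4 * \<rho> / n"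
  have \<tau>: "\<tau> > 0" using \<rho> n by (simp add: \<tau>_def)
  have stay: "norm (flow V t a - y) <= R" if t: "\<bar>t\<bar> <= \<tau>" for t
  proof -
   have "norm (flow V t a - a) <= M * \<bar>t\<bar>" using flow_speed[of t a 0] by simp
   also have "... <= M * \<tau>" using t M_nonneg by (intro mult_left_mono) auto
   also have "... <= M * (4 * \<rho> / v0)" unfolding \<tau>_def using n v0 \<rho>(1) M_nonneg
    by (intro mult_left_mono divide_left_mono) auto
   finally have "norm (flow V t a - a) <= \<rho> * (4 * M / v0)" by (simp add: algebra_simps)
   moreover have "norm (flow V t a - y) <= norm (flow V t a - a) + norm (a - y)"
    using norm_triangle_ineq[of "flow V t a - a" "a - y"] by simp
   ultimately have "norm (flow V t a - y) <= \<rho> * K" using a by (simp add: K_def distrib_left)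
   then show ?thesis using \<rho>(2) by linarith
  qed
  define g where "g t = (flow V t a - b) \<bullet> ?v" for t
  have g': "(g has_real_derivative V (flow V t a) \<bullet> ?v) (at t)" for t
  proof -
   have "((%t. flow V t a - b) has_vector_derivative V (flow V t a) - 0) (at t)"
    by (intro has_vector_derivative_diff flow_has_derivative has_vector_derivative_const)
   from bounded_linear.has_vector_derivative[OF bounded_linear_inner_left this]
   show ?thesis unfolding g_def by (simp add: has_real_derivative_iff_has_vector_derivative)
  qed
  have mv: "(t - s) * (n\<^sup>2 / 2) <= g t - g s" if ts: "s < t" "\<bar>s\<bar> <= \<tau>" "\<bar>t\<bar> <= \<tau>" for s t
  proof -
   obtain z where z: "s < z" "z < t" "g t - g s = (t - s) * (V (flow V z a) \<bullet> ?v)"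
    using MVT2[OF ts(1), of g "%t. V (flow V t a) \<bullet> ?v"] g' by blast
   have "n\<^sup>2 / 2 <= V (flow V z a) \<bullet> ?v" using z ts by (intro near stay) auto
   then show ?thesis using z(3) ts by (simp add: mult_left_mono)
  qed
  have g0: "\<bar>g 0\<bar> <= 2 * \<rho> * n"
  proof -
   have "\<bar>g 0\<bar> <= norm (a - b) * n" unfolding g_def n_def using Cauchy_Schwarz_ineq2[of "a - b" ?v] by simp
   also have "... <= (2 * \<rho>) * n"
    using norm_triangle_ineq4[of "a - y" "b - y"] a b n by (intro mult_right_mono) auto
   finally show ?thesis .
  qed
  have tn: "\<tau> * (n\<^sup>2 / 2) = 2 * \<rho> * n" using n by (simp add: \<tau>_def power2_eq_square)
  have "g \<tau> >= 0" using mv[of 0 \<tau>] \<tau> tn g0 by simp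
  moreover have "g (- \<tau>) <= 0" using mv[of "- \<tau>" 0] \<tau> tn g0 by simp
  moreover have "continuous_on {- \<tau>..\<tau>} g"
   using g' DERIV_isCont by (intro continuous_at_imp_continuous_on ballI) blast
  ultimately obtain t where t: "- \<tau> <= t" "t <= \<tau>" "g t = 0"
   using IVT'[of g "- \<tau>" 0 \<tau>] \<tau> by auto
  let ?c = "flow V t a"
  have cR: "norm (?c - y) <= R" using t by (intro stay) auto
  have "?v ~= 0" using n by (auto simp: n_def)
  then obtain s where s: "?c - b = s *R rot ?v" using perp_multiple_rot[of "?c - b" ?v] t(3) by (auto simp: g_def)
  have "s = 0"
  proof (rule ccontr)
   assume "s ~= 0"
   define F where "F r = H (b + r *R (?c - b))" for r
   have F': "(F has_real_derivative rot (V (b + r *R (?c - b))) \<bullet> (?c - b)) (at r)" for r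
   proof -
    have "((%r. b + r *R (?c - b)) has_derivative (%h. h *R (?c - b))) (at r)"
     by (auto intro!: derivative_eq_intros)
    from has_derivative_compose[OF this H_derivative] show ?thesis
     unfolding F_def has_field_derivative_def
     by (rule has_derivative_eq_rhs) (simp add: fun_eq_iff)
   qed
   obtain r where r: "0 < r" "r < 1" "F 1 - F 0 = (1 - 0) * (rot (V (b + r *R (?c - b))) \<bullet> (?c - b))"
    using MVT2[of 0 1 F "%r. rot (V (b + r *R (?c - b))) \<bullet> (?c - b)"] F' by auto
   have "F 1 = F 0" using Hab H_flow[of t a] by (simp add: F_def)
   then have z: "rot (V (b + r *R (?c - b))) \<bullet> (s *R rot ?v) = 0" using r(3) s by simp
   have "b + r *R (?c - b) \<in> cball y R"
   proof -
    have "b \<in> cball y R" "?c \<in> cball y R" using b \<rho>R cR by (auto simp: dist_norm norm_minus_commute)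
    then have "(1 - r) *R b + r *R ?c \<in> cball y R" using r by (intro convexD[OF convex_cball]) auto
    then show ?thesis by (simp add: algebra_simps)
   qed
   then have "V (b + r *R (?c - b)) \<bullet> ?v >= n\<^sup>2 / 2" by (intro near) (auto simp: dist_norm norm_minus_commute)
   then have "V (b + r *R (?c - b)) \<bullet> ?v > 0" using n by (smt (verit) zero_less_power half_gt_zero)
   moreover have "rot u \<bullet> rot w = u \<bullet> w" for u w by (simp add: plane_inner)
   ultimately show False using z \<open>s ~= 0\<close> by simp
  qed
  then show ?thesis using s by (intro exI[of _ t]) simp
 qed
 then show ?thesis using \<rho>(1) by blast
qed

end

text \<open>A long trajectory crosses many well separated levels with a definite speed; by the pigeonhole principle two of
 the crossing points lie in a common flow box modulo the lattice, hence on the same orbit.\<close>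

lemma long_displacement_periodic:
 assumes \<mu>: "0 < \<mu>" and far: "!!T0. EX T>=T0. EX x. \<mu> * T <= p \<bullet> (flow V T x - x)"
 shows "\<exists>T \<xi>. flow_line V \<xi> & 0 < T & \<xi> T - \<xi> 0 \<in> int_lattice & \<xi> T ~= \<xi> 0"
proof -
 obtain H where H: "C_k 2 H" "periodic H" "!!x. grad H x = rot (V x)" using stream by blast
 define P where "P = norm p + 1"
 have P: "P > 0" "norm p <= P" by (auto simp: P_def add_nonneg_pos)
 \<comment> \<open>At a crossing p . V >= \<mu> / 2, so the speed there is at least
   \<open>v0\<close> and flow boxes of one size \<rho> suffice.\<close>
 define v0 where "v0 = \<mu> / (2 * P)"
 have v0: "v0 > 0" using \<mu> P by (simp add: v0_def)
 obtain \<rho> where \<rho>: "\<rho> > 0" and box: "!!y a b. v0 <= norm (V y) ==> norm (a - y) < \<rho> ==> norm (b - y) < \<rho> ==> H a = H b ==> EX t. b = flow V t a"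
  using flow_box[OF H v0] by blast
 define Y where "Y = cbox 0 1 \<inter> {y. v0 <= norm (V y)}"
 have "compact Y" unfolding Y_def
  by (intro compact_Int_closed compact_cbox closed_Collect_le continuous_intros cperD(1)[OF cV])
 then obtain C where C: "finite C" "C \<subseteq> Y" "Y \<subseteq> (\<Union>c\<in>C. ball c \<rho>)"
  using compactE_image[of Y Y "%c. ball c \<rho>"] \<rho> by (metis (no_types, lifting) UN_I centre_in_ball open_ball subsetI)
 define N where "N = card C"
 \<comment> \<open>Crossings of different levels are at least w apart in direction p, hence never in
   one ball of radius \<rho>; if they share a ball modulo the lattice, their lattice shifts
   differ.\<close>
 define w where "w = 2 * \<rho> * P"
 have w: "w > 0" using \<rho> P by (simp add: w_def)
 \<comment> \<open>T is so large that all levels 0, w, ..., N w lie below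
   \<open>\<mu> / 2 * T\<close>: one level more than there are balls.\<close>
 obtain T x where T: "T >= 2 * (real N * w + 1) / \<mu>" and disp: "\<mu> * T <= p \<bullet> (flow V T x - x)" using far by blast
 have "2 * (real N * w + 1) / \<mu> > 0" using w \<mu> by (simp add: add_nonneg_pos)
 then have T0: "0 < T" using T by linarith
 have T1: "real N * w < \<mu> / 2 * T" using T \<mu> by (simp add: field_simps)
 \<comment> \<open>Half of the mean drift is subtracted, so that an upward crossing has p . V >=
   \<mu> / 2 and not merely a nonnegative value.\<close>
 define g where "g t = p \<bullet> (flow V t x - x) - \<mu> / 2 * t" for t
 have g': "(g has_real_derivative p \<bullet> V (flow V t x) - \<mu> / 2) (at t)" for t
 proof -
  have "((%t. flow V t x - x) has_vector_derivative V (flow V t x) - 0) (at t)"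
   by (intro has_vector_derivative_diff flow_has_derivative has_vector_derivative_const)
  from bounded_linear.has_vector_derivative[OF bounded_linear_inner_right this]
  have "((%t. p \<bullet> (flow V t x - x)) has_real_derivative p \<bullet> V (flow V t x)) (at t)"
   by (simp add: has_real_derivative_iff_has_vector_derivative)
  then show ?thesis unfolding g_def by (auto intro!: derivative_eq_intros)
 qed
 have ex: "EX s. 0 <= s & s < T & g s = real j * w & 0 <= p \<bullet> V (flow V s x) - \<mu> / 2 & (ALL t. s < t & t <= T --> real j * w < g t)"
  if j: "j <= N" for j
 proof -
  have "real j * w <= real N * w" using j w by (intro mult_right_mono) auto
  then have "real j * w < g T" using T1 disp by (simp add: g_def)
  moreover have "g 0 <= real j * w" using w by (simp add: g_def)
  ultimately show ?thesis using last_crossing[OF g', of "real j * w" T] T0 by (metis less_imp_le)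
 qed
 then obtain s where s: "!!j. j <= N ==> 0 <= s j & s j < T & g (s j) = real j * w & 0 <= p \<bullet> V (flow V (s j) x) - \<mu> / 2 & (ALL t. s j < t & t <= T --> real j * w < g t)"
  by metis
 have order: "w <= p \<bullet> (flow V (s j) x - flow V (s i) x)" if ij: "i < j" "j <= N" for i j
 proof -
  have wij: "real j * w - real i * w >= w"
  proof -
   have "real i + 1 <= real j" using ij(1) by simp
   from mult_right_mono[OF this less_imp_le[OF w]] show ?thesis by (simp add: algebra_simps)
  qed
  have "s i <= s j"
  proof (rule ccontr)
   assume "\<not> s i <= s j"
   moreover have h: "ALL t. s j < t & t <= T --> real j * w < g t" using s[OF ij(2)] by blast
   ultimately have "real j * w < g (s i)" by (intro h[rule_format]) (use s[of i] ij in auto)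
   then show False using s[of i] wij ij w by auto
  qed
  then have "\<mu> / 2 * s i <= \<mu> / 2 * s j" using \<mu> by (intro mult_left_mono) auto
  moreover have "g (s j) - g (s i) >= w" using s[of i] s[of j] ij wij by simp
  ultimately show ?thesis unfolding g_def by (simp add: inner_diff_right)
 qed
 have cov: "EX k c. k \<in> int_lattice & c \<in> C & norm (flow V (s j) x + k - c) < \<rho>" if j: "j <= N" for j
 proof -
  obtain k where k: "k \<in> int_lattice" "flow V (s j) x + k \<in> cbox 0 1" using cell_reduce by blast
  have "\<mu> / 2 <= p \<bullet> V (flow V (s j) x)" using s[OF j] by linarith
  also have "... <= norm p * norm (V (flow V (s j) x))" by (rule norm_cauchy_schwarz)
  also have "... <= P * norm (V (flow V (s j) x))" using P by (intro mult_right_mono) auto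
  finally have "v0 <= norm (V (flow V (s j) x))" using P by (simp add: v0_def field_simps)
  then have "flow V (s j) x + k \<in> Y" using k periodicD[OF pV k(1)] by (simp add: Y_def)
  then obtain c where "c \<in> C" "flow V (s j) x + k \<in> ball c \<rho>" using C(3) by blast
  then show ?thesis using k(1) by (intro exI[of _ k] exI[of _ c]) (auto simp: dist_norm norm_minus_commute)
 qed
 then obtain k c where kc: "!!j. j <= N ==> k j \<in> int_lattice & c j \<in> C & norm (flow V (s j) x + k j - c j) < \<rho>" by metis
 have "\<not> inj_on c {..N}"
 proof
  assume "inj_on c {..N}"
  then have "card {..N} <= card C" using kc C(1) by (intro card_inj_on_le[of c]) auto
  then show False by (simp add: N_def)
 qed
 then obtain i j where ij: "i < j" "j <= N" "c i = c j"
  unfolding inj_on_def by (metis atMost_iff linorder_neqE_nat)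
 let ?a = "flow V (s i) x + k i" and ?b = "flow V (s j) x + k j"
 have ci: "c i \<in> C" "norm (?a - c i) < \<rho>" "norm (?b - c i) < \<rho>" "k i \<in> int_lattice" "k j \<in> int_lattice"
  using kc[of i] kc[of j] ij by auto
 have "H ?a = H ?b" using periodicD[OF H(2)] ci(4,5) H_flow[OF H] by simp
 moreover have "v0 <= norm (V (c i))" using ci(1) C(2) by (auto simp: Y_def)
 ultimately obtain t where t: "?b = flow V t ?a" using box[OF _ ci(2,3)] by blast
 have "?b = flow V (t + s i) x + k i" unfolding t flow_periodic[OF ci(4)] by (simp add: flow_add)
 then have b: "flow V (s j) x = flow V (t + s i) x + (k i - k j)" by (simp add: algebra_simps)
 have kne: "k i ~= k j"
 proof
  assume eq: "k i = k j"
  have "flow V (s j) x - flow V (s i) x = (?b - c i) - (?a - c i)" by (simp add: eq)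
  then have "norm (flow V (s j) x - flow V (s i) x) <= norm (?b - c i) + norm (?a - c i)" by (metis norm_triangle_ineq4)
  then have "norm (flow V (s j) x - flow V (s i) x) < 2 * \<rho>" using ci by linarith
  then have "P * norm (flow V (s j) x - flow V (s i) x) < P * (2 * \<rho>)" using P by (intro mult_strict_left_mono) auto
  moreover have "p \<bullet> (flow V (s j) x - flow V (s i) x) <= norm p * norm (flow V (s j) x - flow V (s i) x)" by (rule norm_cauchy_schwarz)
  moreover have "norm p * norm (flow V (s j) x - flow V (s i) x) <= P * norm (flow V (s j) x - flow V (s i) x)" using P by (intro mult_right_mono) auto
  ultimately have "p \<bullet> (flow V (s j) x - flow V (s i) x) < w" by (simp add: w_def mult.commute)
  then show False using order[OF ij(1,2)] by linarith
 qed
 have main: "\<exists>T \<xi>. flow_line V \<xi> & 0 < T & \<xi> T - \<xi> 0 \<in> int_lattice & \<xi> T ~= \<xi> 0"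
  if "t2 > t1" "flow V t2 x = flow V t1 x + m" "m \<in> int_lattice" "m ~= 0" for t1 t2 m
  using that by (intro exI[of _ "t2 - t1"] exI[of _ "%r. flow V (r + t1) x"]) (auto intro: flow_line_shift flow_line_flow)
 \<comment> \<open>The connecting time t may have either sign. Equality would make the two lattice
   shifts equal.\<close>
 consider "s j > t + s i" | "s j < t + s i" | "s j = t + s i" by linarith
 then show ?thesis
 proof cases
  case 1
  then show ?thesis using main[OF 1 b] kne ci int_lattice_diff by auto
 next
  case 2
  have "flow V (t + s i) x = flow V (s j) x + (k j - k i)" using b by simp
  from main[OF 2 this] show ?thesis using kne ci int_lattice_diff by auto
 next
  case 3
  then show ?thesis using b kne by simp
 qed
qed

text \<open>Without winding orbits all displacements in direction p over a long time T are below e T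
  / 2, and the time-averaged test function then gives \<open>c_lim V p <= e\<close>.\<close>

lemma no_periodic_orbit_c_lim:
 assumes "!!T \<xi>. flow_line V \<xi> ==> 0 < T ==> \<xi> T - \<xi> 0 \<in> int_lattice ==> \<xi> T = \<xi> 0"
  and f0: "0 < deriv01 f 0"
 shows "c_lim V p = 0" "c_star V f p = 0"
proof -
 have le: "c_lim V p <= 0 + e" if e: "e > 0" for e
 proof -
  have e2: "e / 2 > 0" using e by simp
  obtain T0 where T0: "!!T x. T >= T0 ==> p \<bullet> (flow V T x - x) < e / 2 * T"
   using long_displacement_periodic[OF e2, of p] assms(1) by (metis not_less)
  define T where "T = max T0 1"
  have T: "T > 0" "T >= T0" by (auto simp: T_def)
  obtain \<psi> where \<psi>: "C_k 1 \<psi>" "periodic \<psi>" "!!x. \<bar>V x \<bullet> (p + grad \<psi> x) - p \<bullet> (flow V T x - x) / T\<bar> <= e / 2"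
   using average_displacement_approx[OF T(1) e2, of p] by blast
  show ?thesis
  proof (rule c_lim_le[OF f0])
   show "\<psi> \<in> C1_torus" using \<psi>(1,2) by (simp add: C1_torus_def del: C_k.simps)
   fix x
   have "p \<bullet> (flow V T x - x) / T <= e / 2" using T0[OF T(2), of x] T(1) by (simp add: field_simps)
   then show "V x \<bullet> (p + grad \<psi> x) <= 0 + e" using \<psi>(3)[of x] by linarith
  qed
 qed
 then have "c_lim V p <= 0" by (rule field_le_epsilon)
 then show "c_lim V p = 0" using c_lim_nonneg[OF f0, of p] by simp
 then show "c_star V f p = 0" using c_star_le_c_lim[OF f0, of p] c_star_nonneg[OF f0, of p] by simp
qed

end

subsection \<open>The tube around a periodic orbit\<close>

text \<open>Supplies the C^1 profile of the cutoff around the orbit.\<close>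

lemma square_positive_part_derivative:
 "((%u. (max 0 u)\<^sup>2) has_real_derivative 2 * max 0 u) (at (u::real))"
proof (cases u "0::real" rule: linorder_cases)
 case less
 have "((%u. 0) has_real_derivative 0) (at u)" by simp
 then have "((%u. (max 0 u)\<^sup>2) has_real_derivative 0) (at u)"
  by (rule has_field_derivative_transform_within_open[where S="{..<0}"]) (use less in auto)
 then show ?thesis using less by simp
next
 case greater
 have "((%u. u\<^sup>2) has_real_derivative 2 * u) (at u)" by (auto intro!: derivative_eq_intros)
 then have "((%u. (max 0 u)\<^sup>2) has_real_derivative 2 * u) (at u)"
  by (rule has_field_derivative_transform_within_open[where S="{0<..}"]) (use greater in auto)
 then show ?thesis using greater by simp
next
 case equal
 have "((%h. ((max 0 (0 + h))\<^sup>2 - (max 0 0)\<^sup>2) / h) \<longlongrightarrow> 0) (at (0::real))"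
 proof (rule Lim_null_comparison)
  show "\<forall>\<^sub>F h in at (0::real). norm (((max 0 (0 + h))\<^sup>2 - (max 0 0)\<^sup>2) / h) <= \<bar>h\<bar>"
   by (rule always_eventually) (auto simp: max_def power2_eq_square)
  show "((%h::real. \<bar>h\<bar>) \<longlongrightarrow> 0) (at 0)" by (intro tendsto_rabs_zero tendsto_ident_at)
 qed
 then show ?thesis by (simp add: equal DERIV_def)
qed

lemma closed_int_lattice: "closed int_lattice"
proof -
 have "int_lattice = {k. k $ 1 \<in> \<int>} \<inter> {k. k $ 2 \<in> \<int>}" by (auto simp: int_lattice_def forall_2)
 moreover have "closed {k :: plane. k $ i \<in> \<int>}" for i
  using continuous_closed_vimage[OF closed_Ints, of "%k. k $ i"] by (simp add: vimage_def continuous_intros)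
 ultimately show ?thesis using closed_Int by metis
qed

context incompressible_flow
begin

context
 fixes \<xi> T k
 assumes \<xi>: "flow_line V \<xi>" and T: "0 < T" and k: "k = \<xi> T - \<xi> 0" "k \<in> int_lattice" "k ~= 0"
begin

lemma periodic_line_flow: "\<xi> (t + s) = flow V t (\<xi> s)"
 using flow_eq[OF flow_line_shift[OF \<xi>, of s], of "\<xi> s" t] by simp

lemma periodic_line_period: "\<xi> (t + T) = \<xi> t + k"
proof -
 have "\<xi> T = \<xi> 0 + k" using k(1) by simp
 then show ?thesis using periodic_line_flow[of t T] periodic_line_flow[of t 0] flow_periodic[OF k(2), of t "\<xi> 0"] by simp
qed

lemma periodic_line_period_int: "\<exists>m\<in>int_lattice. \<xi> (t + of_int n * T) = \<xi> t + m"
proof (induction n rule: int_induct[where k=0])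
 case base
 then show ?case by (intro bexI[of _ 0]) auto
next
 case (step1 n)
 then obtain m where m: "m \<in> int_lattice" "\<xi> (t + of_int n * T) = \<xi> t + m" by blast
 have "\<xi> (t + of_int (n + 1) * T) = \<xi> t + (m + k)"
  using periodic_line_period[of "t + of_int n * T"] m(2) by (simp add: algebra_simps)
 then show ?case using int_lattice_add[OF m(1) k(2)] by blast
next
 case (step2 n)
 then obtain m where m: "m \<in> int_lattice" "\<xi> (t + of_int n * T) = \<xi> t + m" by blast
 have "\<xi> (t + of_int (n - 1) * T) = \<xi> t + (m - k)"
  using periodic_line_period[of "t + of_int (n - 1) * T"] m(2) by (simp add: algebra_simps)
 then show ?case using int_lattice_diff[OF m(1) k(2)] by blast
qed

text \<open>The full preimage in the plane of the closed orbit on the torus.\<close>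

definition orbit_set :: "plane set" where "orbit_set = {\<xi> t + m | t m. m \<in> int_lattice}"

text \<open>Reduction to one period presents the set as the sum of a compact and a closed set, from
  which its closedness follows.\<close>

lemma orbit_set_eq: "orbit_set = (\<Union>x\<in>\<xi> ` {0..T}. \<Union>m\<in>int_lattice. {x + m})"
proof
 show "orbit_set \<subseteq> (\<Union>x\<in>\<xi> ` {0..T}. \<Union>m\<in>int_lattice. {x + m})"
 proof
  fix x assume "x \<in> orbit_set"
  then obtain t m where x: "x = \<xi> t + m" "m \<in> int_lattice" by (auto simp: orbit_set_def)
  define n where "n = \<lfloor>t / T\<rfloor>"
  define s where "s = t - of_int n * T"
  have "of_int n <= t / T" "t / T < of_int n + 1" unfolding n_def by linarith+
  then have s: "0 <= s" "s <= T" using T by (auto simp: s_def field_simps)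
  obtain m' where m': "m' \<in> int_lattice" "\<xi> (s + of_int n * T) = \<xi> s + m'" using periodic_line_period_int by blast
  then have "x = \<xi> s + (m' + m)" using x by (simp add: s_def)
  then show "x \<in> (\<Union>x\<in>\<xi> ` {0..T}. \<Union>m\<in>int_lattice. {x + m})" using s int_lattice_add[OF m'(1) x(2)] by auto
 qed
qed (auto simp: orbit_set_def)

lemma closed_orbit_set: "closed orbit_set"
proof -
 have "continuous_on {0..T} \<xi>"
  using \<xi> has_vector_derivative_continuous unfolding flow_line_def
  by (intro continuous_at_imp_continuous_on ballI) blast
 then have "compact (\<xi> ` {0..T})" by (intro compact_continuous_image) auto
 then show ?thesis unfolding orbit_set_eq by (rule compact_closed_sums[OF _ closed_int_lattice])
qed

lemma orbit_set_nonempty: "\<xi> 0 \<in> orbit_set" "orbit_set ~= {}"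
proof -
 have "\<xi> 0 = \<xi> 0 + 0" by simp
 then show "\<xi> 0 \<in> orbit_set" unfolding orbit_set_def using int_lattice_zero by blast
 then show "orbit_set ~= {}" by blast
qed

lemma orbit_set_add: "c \<in> orbit_set ==> m \<in> int_lattice ==> c + m \<in> orbit_set"
 unfolding orbit_set_def using int_lattice_add by (auto simp: add.assoc) blast

lemma orbit_set_flow: "c \<in> orbit_set ==> flow V t c \<in> orbit_set"
proof -
 assume "c \<in> orbit_set"
 then obtain s m where c: "c = \<xi> s + m" "m \<in> int_lattice" by (auto simp: orbit_set_def)
 have "flow V t c = \<xi> (t + s) + m" unfolding c(1) flow_periodic[OF c(2)] periodic_line_flow ..
 then show ?thesis unfolding orbit_set_def using c(2) by blast
qed

lemma orbit_set_period: "c \<in> orbit_set ==> flow V T c - c = k"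
proof -
 assume "c \<in> orbit_set"
 then obtain s m where c: "c = \<xi> s + m" "m \<in> int_lattice" by (auto simp: orbit_set_def)
 have "\<xi> (T + s) = \<xi> s + k" using periodic_line_period[of s] by (simp only: add.commute)
 then have "flow V T c = \<xi> s + k + m" unfolding c(1) flow_periodic[OF c(2)] using periodic_line_flow[of T s] by simp
 then show ?thesis by (simp add: c(1))
qed

text \<open>A zero of V on the curve would be a rest point, against the nonzero displacement k;
  compactness of one period makes the bound uniform.\<close>

lemma orbit_set_speed: "EX v0>0. \<forall>c\<in>orbit_set. v0 <= norm (V c)"
proof -
 have ne: "V (\<xi> t) ~= 0" for t
 proof
  assume z: "V (\<xi> t) = 0"
  have "flow_line V (%s. \<xi> t)" unfolding flow_line_def using z by (auto intro!: derivative_eq_intros)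
  then have "flow V s (\<xi> t) = \<xi> t" for s using flow_eq by blast
  then have "\<xi> (t + T) = \<xi> t" using periodic_line_flow[of T t] by (simp add: add.commute)
  then show False using periodic_line_period[of t] k(3) by simp
 qed
 have cont: "continuous_on {0..T} (%t. norm (V (\<xi> t)))"
 proof -
  have "continuous_on {0..T} \<xi>"
   using \<xi> has_vector_derivative_continuous unfolding flow_line_def
   by (intro continuous_at_imp_continuous_on ballI) blast
  then show ?thesis by (intro continuous_intros continuous_on_compose2[OF cperD(1)[OF cV, of UNIV]]) auto
 qed
 have "{0..T} ~= {}" using T by simp
 then obtain s where s: "s \<in> {0..T}" "!!t. t \<in> {0..T} ==> norm (V (\<xi> s)) <= norm (V (\<xi> t))"
  using continuous_attains_inf[OF compact_Icc _ cont] by blast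
 have "norm (V (\<xi> s)) <= norm (V c)" if c: "c \<in> orbit_set" for c
 proof -
  obtain t m where "t \<in> {0..T}" "m \<in> int_lattice" "c = \<xi> t + m" using c unfolding orbit_set_eq by blast
  then show ?thesis using s(2) periodicD[OF pV] by simp
 qed
 then show ?thesis using ne[of s] by (intro exI[of _ "norm (V (\<xi> s))"]) auto
qed

lemma infdist_orbit_set_periodic:
 assumes m: "m \<in> int_lattice" shows "infdist (x + m) orbit_set = infdist x orbit_set"
proof -
 have le: "infdist (x + m) orbit_set <= infdist x orbit_set" if m: "m \<in> int_lattice" for x m
 proof -
  obtain c where c: "c \<in> orbit_set" "infdist x orbit_set = dist x c"
   using infdist_attains_inf[OF closed_orbit_set orbit_set_nonempty(2)] by metis
  have "infdist (x + m) orbit_set <= dist (x + m) (c + m)" by (rule infdist_le[OF orbit_set_add[OF c(1) m]])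
  then show ?thesis using c(2) by simp
 qed
 show ?thesis using le[OF m, of x] le[OF int_lattice_minus[OF m], of "x + m"] by simp
qed

text \<open>Near the orbit \<open>\<psi>\<close> is a function of the stream function, so it is
  invariant under the flow; elsewhere it is zero. The two prescriptions agree where the distance
  lies between r and 2 r, as the level of the orbit is not attained there and |H - h| >= \<mu>. For
  the mean, V . (k + D\<phi>) is positive on the tube with \<phi> from time averaging, and the part
  with D\<phi> integrates to zero against the invariant \<psi>.\<close>

lemma tube_cutoff:
 obtains \<psi> where "C_k 1 \<psi>" "periodic \<psi>" "!!x. V x \<bullet> grad \<psi> x = 0" "mean (%x. \<psi> x * (V x \<bullet> k)) > 0"
proof -
 obtain H where H: "C_k 2 H" "periodic H" "!!x. grad H x = rot (V x)" using stream by blast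
 obtain v0 where v0: "v0 > 0" "!!c. c \<in> orbit_set ==> v0 <= norm (V c)" using orbit_set_speed by blast
 obtain \<rho> where \<rho>: "\<rho> > 0" and box: "!!y a b. v0 <= norm (V y) ==> norm (a - y) < \<rho> ==> norm (b - y) < \<rho> ==> H a = H b ==> EX t. b = flow V t a"
  using flow_box[OF H v0(1)] by blast
 define h where "h = H (\<xi> 0)"
 have Hc: "H c = h" if c: "c \<in> orbit_set" for c
 proof -
  obtain t m where "m \<in> int_lattice" "c = \<xi> t + m" using c by (auto simp: orbit_set_def)
  then show ?thesis using periodicD[OF H(2)] H_flow[OF H, of t "\<xi> 0"] periodic_line_flow[of t 0] by (simp add: h_def)
 qed
 have kk: "k \<bullet> k > 0" using k(3) by simp
 define \<Lambda> where "\<Lambda> = norm k * (exp (L * T) + 1)"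
 have \<Lambda>: "\<Lambda> > 0" using k(3) by (simp add: \<Lambda>_def add_pos_pos)
 \<comment> \<open>The first bound keeps the tube of radius 2 r inside flow boxes; the second lets k
   . (X_T x - x) drop by at most k . k / 4 from its value k . k on the orbit.\<close>
 define r where "r = min (\<rho> / 3) (k \<bullet> k / (8 * \<Lambda>))"
 have r: "r > 0" "2 * r < \<rho>" "\<Lambda> * (2 * r) <= k \<bullet> k / 4"
 proof -
  show "r > 0" using \<rho> kk \<Lambda> by (simp add: r_def)
  have "r <= \<rho> / 3" by (simp add: r_def)
  then show "2 * r < \<rho>" using \<rho> by linarith
  have "r <= k \<bullet> k / (8 * \<Lambda>)" by (simp add: r_def)
  then have "r * (8 * \<Lambda>) <= k \<bullet> k" using \<Lambda> by (simp add: pos_le_divide_eq)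
  then show "\<Lambda> * (2 * r) <= k \<bullet> k / 4" by (simp add: algebra_simps)
 qed
 have "k \<bullet> k / (4 * T) > 0" using kk T by simp
 then obtain \<phi> where \<phi>: "C_k 1 \<phi>" "periodic \<phi>" "!!x. \<bar>V x \<bullet> (k + grad \<phi> x) - k \<bullet> (flow V T x - x) / T\<bar> <= k \<bullet> k / (4 * T)"
  using average_displacement_approx[OF T, of "k \<bullet> k / (4 * T)" k] by blast
 let ?d = "%x. infdist x orbit_set"
 have cd: "continuous_on S ?d" for S by (intro continuous_intros)
 have pos: "V x \<bullet> (k + grad \<phi> x) > 0" if x: "?d x < 2 * r" for x
 proof -
  obtain c where c: "c \<in> orbit_set" "?d x = dist x c"
   using infdist_attains_inf[OF closed_orbit_set orbit_set_nonempty(2)] by metis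
  have "norm ((flow V T c - c) - (flow V T x - x)) <= norm (flow V T c - flow V T x) + norm (c - x)"
   using norm_triangle_ineq4[of "flow V T c - flow V T x" "c - x"] by (simp add: algebra_simps)
  also have "... <= (exp (L * T) + 1) * norm (c - x)" using flow_lipschitz[of T c x] T by (simp add: algebra_simps)
  finally have "norm (k - (flow V T x - x)) <= (exp (L * T) + 1) * norm (c - x)" unfolding orbit_set_period[OF c(1)] .
  then have "norm k * norm (k - (flow V T x - x)) <= norm k * ((exp (L * T) + 1) * norm (c - x))" by (rule mult_left_mono) simp
  also have "... = \<Lambda> * norm (c - x)" by (simp add: \<Lambda>_def)
  also have "... <= \<Lambda> * (2 * r)" using \<Lambda> x c(2) by (intro mult_left_mono) (auto simp: dist_norm norm_minus_commute)
  finally have "norm k * norm (k - (flow V T x - x)) <= k \<bullet> k / 4" using r(3) by linarith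
  moreover have "k \<bullet> (k - (flow V T x - x)) <= norm k * norm (k - (flow V T x - x))" by (rule norm_cauchy_schwarz)
  ultimately have "k \<bullet> (flow V T x - x) >= 3 / 4 * (k \<bullet> k)" by (simp add: inner_diff_right)
  then have "3 / 4 * (k \<bullet> k) / T <= k \<bullet> (flow V T x - x) / T" using T by (intro divide_right_mono) auto
  moreover have "k \<bullet> k / T > 0" using kk T by simp
  ultimately show ?thesis using \<phi>(3)[of x] by (simp add: field_simps abs_le_iff)
 qed
 \<comment> \<open>A flow box around the nearest orbit point joins a point of the same level to it
   by the flow, and the orbit is invariant.\<close>
 have level: "x \<in> orbit_set" if x: "?d x <= 2 * r" "H x = h" for x
 proof -
  obtain c where c: "c \<in> orbit_set" "?d x = dist x c"
   using infdist_attains_inf[OF closed_orbit_set orbit_set_nonempty(2)] by metis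
  then obtain t where "x = flow V t c"
   using box[OF v0(2)[OF c(1)], of c x] x r \<rho> Hc[OF c(1)] by (auto simp: dist_norm)
  then show ?thesis using orbit_set_flow[OF c(1)] by simp
 qed
 have cH: "continuous_on S H" for S using C_k_continuous[OF H(1)] continuous_on_subset by blast
 define S where "S = cbox 0 1 \<inter> {x. r <= ?d x & ?d x <= 2 * r}"
 have compS: "compact S"
  unfolding S_def Collect_conj_eq
  by (intro compact_Int_closed compact_cbox closed_Int closed_Collect_le cd continuous_intros)
 have Spos: "\<bar>H x - h\<bar> > 0" if "x \<in> S" for x
 proof -
  have "H x ~= h"
  proof
   assume "H x = h"
   then have "x \<in> orbit_set" using level that by (auto simp: S_def)
   then have "?d x = 0" by simp
   then show False using that r(1) by (simp add: S_def)
  qed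
  then show ?thesis by simp
 qed
 obtain \<mu> where \<mu>: "\<mu> > 0" "!!x. x \<in> S ==> \<mu> <= \<bar>H x - h\<bar>"
 proof (cases "S = {}")
  case True
  then show ?thesis using that[of 1] by simp
 next
  case False
  have "continuous_on S (%x. \<bar>H x - h\<bar>)" by (intro continuous_intros cH)
  then obtain a where "a \<in> S" "!!x. x \<in> S ==> \<bar>H a - h\<bar> <= \<bar>H x - h\<bar>"
   using continuous_attains_inf[OF compS False] by blast
  then show ?thesis using that Spos by blast
 qed
 have far: "\<mu> <= \<bar>H x - h\<bar>" if x: "r <= ?d x" "?d x <= 2 * r" for x
 proof -
  obtain m where m: "m \<in> int_lattice" "x + m \<in> cbox 0 1" using cell_reduce by blast
  then have "x + m \<in> S" using x infdist_orbit_set_periodic[OF m(1)] by (simp add: S_def)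
  from \<mu>(2)[OF this] show ?thesis using periodicD[OF H(2) m(1)] by simp
 qed
 \<comment> \<open>A bump that vanishes together with its derivative once |s| >= \<mu>.\<close>
 define \<eta> where "\<eta> s = (max 0 (1 - (s / \<mu>)\<^sup>2))\<^sup>2" for s
 define \<eta>' where "\<eta>' s = 2 * max 0 (1 - (s / \<mu>)\<^sup>2) * (- (2 * s / \<mu>\<^sup>2))" for s
 have \<eta>d: "(\<eta> has_real_derivative \<eta>' s) (at s)" for s
 proof -
  have "((%s. 1 - (s / \<mu>)\<^sup>2) has_real_derivative - (2 * s / \<mu>\<^sup>2)) (at s)"
   using \<mu>(1) by (auto intro!: derivative_eq_intros simp: power2_eq_square)
  from DERIV_chain2[OF square_positive_part_derivative this] show ?thesis unfolding \<eta>_def \<eta>'_def .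
 qed
 have \<eta>0: "\<eta> s = 0" "\<eta>' s = 0" if "\<mu> <= \<bar>s\<bar>" for s
 proof -
  have "1 <= \<bar>s / \<mu>\<bar>" using that \<mu>(1) by simp
  then have "1 <= (s / \<mu>)\<^sup>2" using one_le_power[of "\<bar>s / \<mu>\<bar>" 2] by (simp only: power2_abs)
  then show "\<eta> s = 0" "\<eta>' s = 0" by (simp_all add: \<eta>_def \<eta>'_def)
 qed
 have c\<eta>': "continuous_on A \<eta>'" for A unfolding \<eta>'_def using \<mu>(1) by (intro continuous_intros) auto
 define \<psi> where "\<psi> x = (if ?d x < 2 * r then \<eta> (H x - h) else 0)" for x
 define G where "G x = (if ?d x < 2 * r then \<eta>' (H x - h) *R rot (V x) else 0)" for x
 have U: "open {x. ?d x < 2 * r}" "open {x. r < ?d x}"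
  by (intro open_Collect_less cd continuous_intros)+
 have UU: "{x. ?d x < 2 * r} \<union> {x. r < ?d x} = UNIV" using r(1) by force
 have out: "\<psi> x = 0" "G x = 0" if "r < ?d x" for x
  using far[of x] \<eta>0[of "H x - h"] that by (auto simp: \<psi>_def G_def)
 have der: "(\<psi> has_derivative (%y. G x \<bullet> y)) (at x)" for x
 proof (cases "?d x < 2 * r")
  case True
  have "((%x. H x - h) has_derivative (%y. rot (V x) \<bullet> y)) (at x)"
   using has_derivative_diff[OF H_derivative[OF H] has_derivative_const[of h]] by simp
  from has_derivative_compose[OF this \<eta>d[unfolded has_field_derivative_def]]
  have "((%x. \<eta> (H x - h)) has_derivative (%y. G x \<bullet> y)) (at x)"
   using True by (simp add: G_def)
  then show ?thesis
   by (rule has_derivative_transform_within_open[OF _ U(1)]) (use True in \<open>auto simp: \<psi>_def\<close>)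
 next
  case False
  then have o: "r < ?d x" using r(1) by simp
  have "((%x. 0) has_derivative (%y. G x \<bullet> y)) (at x)" using out(2)[OF o] by simp
  then show ?thesis
   by (rule has_derivative_transform_within_open[OF _ U(2)]) (use o out(1) in auto)
 qed
 have "continuous_on ({x. ?d x < 2 * r} \<union> {x. r < ?d x}) G"
 proof (rule continuous_on_open_Un[OF U])
  have "continuous_on {x. ?d x < 2 * r} (%x. \<eta>' (H x - h) *R rot (V x))"
   by (intro continuous_on_scaleR continuous_on_compose2[OF c\<eta>'[of UNIV]] continuous_intros cH
     bounded_linear.continuous_on[OF bounded_linear_rot] cperD(1)[OF cV]) auto
  then show "continuous_on {x. ?d x < 2 * r} G" by (rule continuous_on_eq) (simp add: G_def)
  show "continuous_on {x. r < ?d x} G" by (rule continuous_on_eq[OF continuous_on_const[of _ 0]]) (simp add: out)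
 qed
 then have "C_k 0 G" unfolding UU by simp
 from C_k_gradI[OF der this] have \<psi>1: "C_k 1 \<psi>" and g\<psi>: "grad \<psi> = G" by simp_all
 have \<psi>p: "periodic \<psi>"
  using infdist_orbit_set_periodic H(2) by (simp add: periodic_def \<psi>_def)
 have V\<psi>: "V x \<bullet> grad \<psi> x = 0" for x by (simp add: g\<psi> G_def)
 have c: "cper \<psi>" "cper \<phi>" "cper (grad \<psi>)" "cper (grad \<phi>)"
  using C_k_cper[OF \<psi>1 \<psi>p] C_k_cper[OF \<phi>(1,2)] cper_grad[of 0 \<psi>] cper_grad[of 0 \<phi>] \<psi>1 \<psi>p \<phi>(1,2) by auto
 have "mean (%x. \<psi> x * (V x \<bullet> (k + grad \<phi> x))) > 0"
 proof (rule mean_pos)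
  show "cper (%x. \<psi> x * (V x \<bullet> (k + grad \<phi> x)))" by (intro cper_intros c cV)
  show "0 <= \<psi> x * (V x \<bullet> (k + grad \<phi> x))" for x
   using pos[of x] by (auto simp: \<psi>_def \<eta>_def)
  have "?d (\<xi> 0) = 0" using orbit_set_nonempty(1) by simp
  then show "0 < \<psi> (\<xi> 0) * (V (\<xi> 0) \<bullet> (k + grad \<phi> (\<xi> 0)))"
   using pos[of "\<xi> 0"] r(1) by (simp add: \<psi>_def \<eta>_def h_def)
 qed
 also have "mean (%x. \<psi> x * (V x \<bullet> (k + grad \<phi> x))) = mean (%x. \<psi> x * (V x \<bullet> k)) + mean (%x. \<psi> x * (V x \<bullet> grad \<phi> x))"
  unfolding inner_add_right distrib_left by (rule mean_add) (intro cper_intros c cV)+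
 also have "mean (%x. \<psi> x * (V x \<bullet> grad \<phi> x)) = 0"
 proof -
  have m: "C_k 1 (%x. \<psi> x * \<phi> x)" "periodic (%x. \<psi> x * \<phi> x)"
   using C_k_mult[OF \<psi>1 \<phi>(1)] \<psi>p \<phi>(2) by (auto simp: periodic_def)
  have "V x \<bullet> grad (%x. \<psi> x * \<phi> x) x = \<psi> x * (V x \<bullet> grad \<phi> x)" for x
  proof -
   have "\<psi> differentiable (at x)" "\<phi> differentiable (at x)" using \<psi>1 \<phi>(1) by auto
   then show ?thesis using V\<psi>[of x] by (simp add: grad_mult inner_add_right)
  qed
  then show ?thesis using integral_V_grad[OF m] by simp
 qed
 finally show ?thesis using that[OF \<psi>1 \<psi>p V\<psi>] by simp
qed

text \<open>The field \<psi> V is divergence free. With I its mean and q = rot I, its stream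
  function satisfies q + D\<Phi> = \<psi> rot V, which is perpendicular to V. Along the orbit q . x
  + \<Phi> is constant, so q . k = 0; hence I is parallel to k, and I . p vanishes only if p . k
  does.\<close>

lemma tube_functions:
 obtains \<psi> q \<Phi> where "C_k 1 \<psi>" "periodic \<psi>" "!!x. V x \<bullet> grad \<psi> x = 0"
  "!!p. p \<bullet> k ~= 0 ==> mean (%x. \<psi> x * (V x \<bullet> p)) ~= 0"
  "C_k 2 \<Phi>" "periodic \<Phi>" "q ~= 0" "q \<bullet> k = 0" "!!x. V x \<bullet> (q + grad \<Phi> x) = 0"
proof -
 obtain \<psi> where \<psi>: "C_k 1 \<psi>" "periodic \<psi>" "!!x. V x \<bullet> grad \<psi> x = 0" "mean (%x. \<psi> x * (V x \<bullet> k)) > 0"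
  using tube_cutoff by blast
 define W where "W x = \<psi> x *R V x" for x
 have W1: "C_k 1 W" unfolding W_def by (rule C_k_scaleR[OF \<psi>(1) CkV])
 have Wp: "periodic W" using \<psi>(2) pV by (simp add: periodic_def W_def)
 have cW: "cper W" by (rule C_k_cper[OF W1 Wp])
 have d: "\<psi> differentiable (at x)" "V differentiable (at x)" for x using \<psi>(1) CkV[of "Suc 0"] by auto
 have "divergence W x = 0" for x
 proof -
  have "dir_deriv e W x \<bullet> e = \<psi> x * (dir_deriv e V x \<bullet> e) + dir_deriv e \<psi> x * (V x \<bullet> e)" for e
   unfolding W_def dir_deriv_scaleR[OF d] by (simp add: inner_add_left)
  then have "divergence W x = \<psi> x * divergence V x + (\<Sum>e\<in>Basis. dir_deriv e \<psi> x * (V x \<bullet> e))"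
   by (simp add: divergence_def sum.distrib sum_distrib_left)
  also have "(\<Sum>e\<in>Basis. dir_deriv e \<psi> x * (V x \<bullet> e)) = V x \<bullet> grad \<psi> x"
   by (simp add: grad_def inner_sum_right)
  finally show ?thesis using divV[of x] \<psi>(3)[of x] by simp
 qed
 then obtain \<Phi> where \<Phi>: "C_k 2 \<Phi>" "periodic \<Phi>" "!!x. grad \<Phi> x = rot (W x - mean W)"
  using stream_function[OF W1 Wp] by blast
 let ?I = "mean W"
 have I: "mean (%x. \<psi> x * (V x \<bullet> p)) = ?I \<bullet> p" for p
 proof -
  have "((%x. W x \<bullet> p) has_integral ?I \<bullet> p) (cbox 0 1)"
   using has_integral_linear[OF integrable_integral[OF cper_integrable[OF cW]] bounded_linear_inner_left[of p]] by (simp add: o_def)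
  then show ?thesis by (simp add: W_def integral_unique)
 qed
 define q where "q = rot ?I"
 have rd: "rot (a - b) = rot a - rot b" for a b by (rule linear_diff[OF bounded_linear.linear[OF bounded_linear_rot]])
 have Vq: "V x \<bullet> (q + grad \<Phi> x) = 0" for x
 proof -
  have "q + grad \<Phi> x = rot (W x)" unfolding q_def \<Phi>(3) rd by simp
  moreover have "rot (W x) = \<psi> x *R rot (V x)" by (simp add: W_def vec_eq_iff forall_2)
  ultimately show ?thesis by simp
 qed
 have qk: "q \<bullet> k = 0"
 proof -
  define g where "g t = q \<bullet> \<xi> t + \<Phi> (\<xi> t)" for t
  have "(g has_real_derivative 0) (at t)" for t
  proof -
   have dx: "(\<xi> has_derivative (%h. h *R V (\<xi> t))) (at t)" using \<xi> by (simp add: flow_line_def has_vector_derivative_def)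
   have "\<Phi> differentiable (at (\<xi> t))" using \<Phi>(1) by (simp add: numeral_2_eq_2)
   from has_derivative_compose[OF dx has_derivative_grad[OF this]]
   have "(g has_derivative (%h. q \<bullet> (h *R V (\<xi> t)) + grad \<Phi> (\<xi> t) \<bullet> (h *R V (\<xi> t)))) (at t)"
    unfolding g_def by (intro has_derivative_add has_derivative_inner_right[OF dx])
   then show ?thesis unfolding has_field_derivative_def
   proof (rule has_derivative_eq_rhs)
    have "q \<bullet> (h *R V (\<xi> t)) + grad \<Phi> (\<xi> t) \<bullet> (h *R V (\<xi> t)) = h * (V (\<xi> t) \<bullet> (q + grad \<Phi> (\<xi> t)))" for h
     by (simp add: inner_add_right inner_commute[of _ "V (\<xi> t)"] distrib_left)
    then show "(%h. q \<bullet> (h *R V (\<xi> t)) + grad \<Phi> (\<xi> t) \<bullet> (h *R V (\<xi> t))) = (*) 0"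
     by (simp add: Vq fun_eq_iff)
   qed
  qed
  then have "g T = g 0" using DERIV_isconst_all by blast
  moreover have "\<xi> T = \<xi> 0 + k" using k(1) by simp
  then have "\<Phi> (\<xi> T) = \<Phi> (\<xi> 0)" using periodicD[OF \<Phi>(2) k(2)] by simp
  ultimately show ?thesis using k(1) by (simp add: g_def inner_diff_right)
 qed
 have Ik: "?I \<bullet> k > 0" using \<psi>(4) I by simp
 have q0: "q ~= 0"
 proof
  assume "q = 0"
  then have "?I = 0" by (simp add: q_def vec_eq_iff forall_2)
  then show False using Ik by simp
 qed
 have nz: "?I \<bullet> p ~= 0" if p: "p \<bullet> k ~= 0" for p
 proof
  assume Ip: "?I \<bullet> p = 0"
  have qk': "?I $ 1 * k $ 2 = ?I $ 2 * k $ 1" using qk by (simp add: q_def plane_inner)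
  \<comment> \<open>An identity valid because I is a multiple of k.\<close>
  have "(?I \<bullet> k) * (p \<bullet> k) = (k \<bullet> k) * (?I \<bullet> p)"
   unfolding plane_inner using qk' by algebra
  then show False using Ip Ik p by simp
 qed
 show ?thesis by (rule that[OF \<psi>(1-3) _ \<Phi>(1,2) q0 qk Vq]) (use I nz in auto)
qed

text \<open>For w = 1 + \<theta> \<psi> the constant part of w^2 contributes nothing to the mean of
  w^2 V . p, since V has mean zero; the linear term 2 \<theta> J decides, with the sign of \<theta>
  at choice. The gradient enters quadratically, so the Dirichlet constraint holds for small
  \<theta>.\<close>

lemma periodic_orbit_c_star_pos:
 assumes f0: "0 < deriv01 f 0" and p: "p \<bullet> k ~= 0"
 shows "0 < c_star V f p"
proof -
 obtain \<psi> where \<psi>: "C_k 1 \<psi>" "periodic \<psi>" "!!x. V x \<bullet> grad \<psi> x = 0"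
  "!!p. p \<bullet> k ~= 0 ==> mean (%x. \<psi> x * (V x \<bullet> p)) ~= 0" by (rule tube_functions) blast
 have c: "cper \<psi>" "cper (grad \<psi>)" using C_k_cper[OF \<psi>(1,2)] cper_grad[of 0 \<psi>] \<psi>(1,2) by auto
 define J where "J = mean (%x. \<psi> x * (V x \<bullet> p))"
 define K where "K = mean (%x. \<psi> x * \<psi> x * (V x \<bullet> p))"
 define a where "a = mean \<psi>"
 define b where "b = mean (%x. \<psi> x * \<psi> x)"
 define D where "D = mean (%x. (norm (grad \<psi> x))\<^sup>2)"
 let ?f = "deriv01 f 0"
 have J: "J ~= 0" using \<psi>(4)[OF p] by (simp add: J_def)
 have b0: "0 <= b" unfolding b_def by (intro integral_nonneg cper_integrable cper_mult c) auto
 have D0: "0 <= D" unfolding D_def power2_norm_eq_inner by (intro integral_nonneg cper_integrable cper_inner c) auto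
 \<comment> \<open>The four bounds give in turn t^2 <= t, a mean of w^2 of at least 1/2, the
   Dirichlet constraint, and that t^2 K consumes at most half of 2 t |J|.\<close>
 define t where "t = min 1 (min (1 / (4 * (\<bar>a\<bar> + 1))) (min (?f / (2 * (D + 1))) (\<bar>J\<bar> / (\<bar>K\<bar> + 1))))"
 have t: "0 < t" "t <= 1" "t * \<bar>a\<bar> <= 1 / 4" "t * D <= ?f / 2" "t * \<bar>K\<bar> <= \<bar>J\<bar>"
 proof -
  show "0 < t" "t <= 1" using f0 D0 J by (auto simp: t_def add_nonneg_pos)
  have "t <= 1 / (4 * (\<bar>a\<bar> + 1))" "t <= ?f / (2 * (D + 1))" "t <= \<bar>J\<bar> / (\<bar>K\<bar> + 1)" unfolding t_def by linarith+
  then have "t * (4 * (\<bar>a\<bar> + 1)) <= 1" "t * (2 * (D + 1)) <= ?f" "t * (\<bar>K\<bar> + 1) <= \<bar>J\<bar>"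
   using D0 by (auto simp: pos_le_divide_eq add_nonneg_pos)
  then show "t * \<bar>a\<bar> <= 1 / 4" "t * D <= ?f / 2" "t * \<bar>K\<bar> <= \<bar>J\<bar>" using \<open>0 < t\<close> by (auto simp: algebra_simps)
 qed
 define \<theta> where "\<theta> = (if J > 0 then t else - t)"
 have \<theta>: "\<bar>\<theta>\<bar> = t" "\<theta> * J = t * \<bar>J\<bar>" "\<theta>\<^sup>2 = t\<^sup>2" using t(1) by (auto simp: \<theta>_def)
 define w where "w x = 1 + \<theta> * \<psi> x" for x
 have w1: "C_k 1 w" unfolding w_def by (intro C_k_add C_k_mult C_k_const \<psi>)
 have wp: "periodic w" using \<psi>(2) by (simp add: w_def periodic_def)
 have gw: "grad w x = \<theta> *R grad \<psi> x" for x
 proof -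
  have d: "\<psi> differentiable (at x)" "(%x. \<theta> * \<psi> x) differentiable (at x)" using \<psi>(1) C_k_mult[OF C_k_const \<psi>(1), of \<theta>] by auto
  have "grad (%x::plane. 1::real) x = 0" by (simp add: grad_def)
  then show ?thesis unfolding w_def using grad_add[of "%x. 1" x, OF _ d(2)] grad_cmult[OF d(1)] by simp
 qed
 have w2: "mean (%x. (w x)\<^sup>2) = 1 + 2 * \<theta> * a + t\<^sup>2 * b"
 proof -
  have "(%x. (w x)\<^sup>2) = (%x. 1 + ((2 * \<theta>) * \<psi> x + \<theta>\<^sup>2 * (\<psi> x * \<psi> x)))"
   by (auto simp: w_def power2_eq_square algebra_simps)
  moreover have "mean (%x. 1 + ((2 * \<theta>) * \<psi> x + \<theta>\<^sup>2 * (\<psi> x * \<psi> x))) = 1 + ((2 * \<theta>) * a + \<theta>\<^sup>2 * b)"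
   unfolding a_def b_def by (subst mean_add, (intro cper_intros c)+)+ simp
  ultimately show ?thesis by (simp add: \<theta>(3))
 qed
 have wVp: "mean (%x. (w x)\<^sup>2 * (V x \<bullet> p)) = 2 * t * \<bar>J\<bar> + t\<^sup>2 * K"
 proof -
  have "(%x. (w x)\<^sup>2 * (V x \<bullet> p)) = (%x. V x \<bullet> p + ((2 * \<theta>) * (\<psi> x * (V x \<bullet> p)) + \<theta>\<^sup>2 * (\<psi> x * \<psi> x * (V x \<bullet> p))))"
   by (auto simp: w_def power2_eq_square algebra_simps)
  moreover have "mean (%x. V x \<bullet> p + ((2 * \<theta>) * (\<psi> x * (V x \<bullet> p)) + \<theta>\<^sup>2 * (\<psi> x * \<psi> x * (V x \<bullet> p)))) = 0 + ((2 * \<theta>) * J + \<theta>\<^sup>2 * K)"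
   unfolding J_def K_def integral_V_const[of p, symmetric] by (subst mean_add, (intro cper_intros c cV)+)+ simp
  ultimately show ?thesis using \<theta> by simp
 qed
 have wD: "mean (%x. (norm (grad w x))\<^sup>2) = t\<^sup>2 * D"
  unfolding gw D_def using \<theta>(3) by (simp add: power_mult_distrib)
 have half: "mean (%x. (w x)\<^sup>2) >= 1 / 2"
 proof -
  have "\<bar>\<theta> * a\<bar> <= 1 / 4" using t(3) \<theta>(1) by (simp add: abs_mult)
  moreover have "0 <= t\<^sup>2 * b" using b0 by simp
  ultimately show ?thesis unfolding w2 by (simp add: abs_le_iff)
 qed
 let ?I = "mean (%x. (w x)\<^sup>2)"
 have I0: "?I > 0" using half by linarith
 have tt: "t\<^sup>2 * y <= t * y" if "0 <= y" for y
 proof -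
  have "t\<^sup>2 <= t" using t(1,2) by (simp add: power2_eq_square mult_left_le)
  then show ?thesis using that by (rule mult_right_mono)
 qed
 have "(t * \<bar>J\<bar> / ?I) <= c_star V f p"
 proof (rule c_star_ge[OF f0 w1 wp])
  show "V x \<bullet> grad w x = 0" for x by (simp add: gw \<psi>(3))
  show "0 < ?I" by (rule I0)
  have "t\<^sup>2 * D <= ?f / 2" using tt[OF D0] t(4) by linarith
  also have "?f / 2 <= ?f * ?I" using mult_left_mono[OF half, of ?f] f0 by simp
  finally show "mean (%x. (norm (grad w x))\<^sup>2) <= ?f * ?I" unfolding wD .
  have "t\<^sup>2 * \<bar>K\<bar> = t * (t * \<bar>K\<bar>)" by (simp add: power2_eq_square)
  also have "... <= t * \<bar>J\<bar>" using t(1,5) by (intro mult_left_mono) auto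
  finally have "t\<^sup>2 * \<bar>K\<bar> <= t * \<bar>J\<bar>" .
  moreover have "- (t\<^sup>2 * \<bar>K\<bar>) <= t\<^sup>2 * K" using mult_left_mono[of "- \<bar>K\<bar>" K "t\<^sup>2"] by simp
  ultimately have "t * \<bar>J\<bar> <= 2 * t * \<bar>J\<bar> + t\<^sup>2 * K" by linarith
  then show "t * \<bar>J\<bar> / ?I * ?I <= mean (%x. (w x)\<^sup>2 * (V x \<bullet> p))" unfolding wVp using I0 by simp
 qed
 moreover have "t * \<bar>J\<bar> / ?I > 0" using t(1) J I0 by simp
 ultimately show ?thesis by linarith
qed

end

end

subsection \<open>Comparison for first-order equations\<close>

lemma visc_subD: "visc_sub H c v ==> C_k 1 \<phi> ==> (!!y. v y - \<phi> y <= v x - \<phi> x) ==> H x (grad \<phi> x) <= c"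
 and visc_superD: "visc_super H c v ==> C_k 1 \<phi> ==> (!!y. v x - \<phi> x <= v y - \<phi> y) ==> c <= H x (grad \<phi> x)"
 by (auto simp: visc_sub_def visc_super_def simp del: C_k.simps One_nat_def)

lemma quadratic_test_function:
 fixes y :: "'a::euclidean_space"
 shows "C_k 1 (%x. c * ((x - y) \<bullet> (x - y)))" "grad (%x. c * ((x - y) \<bullet> (x - y))) = (%x. (2 * c) *R (x - y))"
proof -
 have d: "((%x. c * ((x - y) \<bullet> (x - y))) has_derivative (%h. ((2 * c) *R (x - y)) \<bullet> h)) (at x)" for x
  by (auto intro!: derivative_eq_intros simp: inner_commute algebra_simps fun_eq_iff)
 have "C_k 0 (%x. (2 * c) *R (x - y))" by (auto intro!: continuous_intros)
 from C_k_gradI[OF d this] show "C_k 1 (%x. c * ((x - y) \<bullet> (x - y)))"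
  "grad (%x. c * ((x - y) \<bullet> (x - y))) = (%x. (2 * c) *R (x - y))" by simp_all
qed

text \<open>Doubling of variables; in terms of \<open>z = y - x\<close> the penalised difference is periodic in \<open>x\<close>
 and decays in \<open>z\<close>, so it attains its maximum.\<close>

lemma viscosity_comparison:
 fixes u v :: "plane => real"
 assumes L: "0 < L" "!!x y. norm (W x - W y) <= L * norm (x - y)"
  and u: "cper u" "visc_sub (%x q. N (p + q) + W x \<bullet> (p + q)) a u"
  and v: "cper v" "visc_super (%x q. N (p + q) + W x \<bullet> (p + q)) b v"
 shows "b <= a"
proof -
 obtain B1 where B1: "B1 > 0" "!!x. \<bar>u x\<bar> <= B1" using cper_bounded[OF u(1)] by auto
 obtain B2 where B2: "B2 > 0" "!!x. \<bar>v x\<bar> <= B2" using cper_bounded[OF v(1)] by auto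
 define B where "B = B1 + B2"
 have B: "B > 0" "!!x y. \<bar>u x - v y\<bar> <= B"
 proof -
  show "B > 0" using B1(1) B2(1) by (simp add: B_def)
  show "\<bar>u x - v y\<bar> <= B" for x y using B1(2)[of x] B2(2)[of y] unfolding B_def by linarith
 qed
 have main: "b <= a + L * \<eta> * (norm p + 2)" if \<eta>: "\<eta> > 0" for \<eta>
 proof -
  obtain d' where d': "d' > 0" "!!x y. dist x y < d' ==> dist (u x) (u y) < \<eta>" using cper_uniform[OF u(1) \<eta>] by blast
  define d where "d = min d' \<eta> / 2"
  have d: "0 < d" "d < d'" "d <= \<eta>" using d'(1) \<eta> by (auto simp: d_def)
  \<comment> \<open>At distance d the penalty is 3 B, more than the range 2 B of the unpenalised
    difference, so larger z cannot compete with z = 0.\<close>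
  define c where "c = 3 * B / d\<^sup>2"
  have c: "c > 0" "c * d\<^sup>2 = 3 * B" using B(1) d(1) by (auto simp: c_def)
  define F where "F w = u (fst w) - v (fst w + snd w) - c * (snd w \<bullet> snd w)" for w :: "plane \<times> plane"
  have cF: "continuous_on S F" for S unfolding F_def
   by (intro continuous_intros continuous_on_compose2[OF cperD(1)[OF u(1), of UNIV]] continuous_on_compose2[OF cperD(1)[OF v(1), of UNIV]]) auto
  have cS: "compact (cbox 0 (1::plane) \<times> cball (0::plane) d)" by (intro compact_Times compact_cbox compact_cball)
  have "(0::plane) \<in> cbox 0 1" by (simp add: mem_box_cart)
  moreover have "(0::plane) \<in> cball 0 d" using d(1) by simp
  ultimately have neS: "cbox 0 (1::plane) \<times> cball (0::plane) d ~= {}" by blast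
  obtain w where w: "w \<in> cbox 0 1 \<times> cball 0 d" "!!w'. w' \<in> cbox 0 1 \<times> cball 0 d ==> F w' <= F w"
   using continuous_attains_sup[OF cS neS cF] by metis
  have near: "F (x, z) <= F w" if z: "norm z <= d" for x z
  proof -
   obtain k where k: "k \<in> int_lattice" "x + k \<in> cbox 0 1" using cell_reduce by blast
   have "F (x + k, z) = F (x, z)"
    using periodicD[OF cperD(2)[OF u(1)] k(1), of x] periodicD[OF cperD(2)[OF v(1)] k(1), of "x + z"]
    by (simp add: F_def add.assoc add.commute[of k])
   then show ?thesis using w(2)[of "(x + k, z)"] k(2) z by simp
  qed
  have max: "F (x, z) <= F w" for x z
  proof (cases "norm z <= d")
   case False
   then have "d\<^sup>2 <= (norm z)\<^sup>2" using d(1) by (intro power_mono) auto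
   then have "3 * B <= c * (z \<bullet> z)" using c mult_left_mono[of "d\<^sup>2" "z \<bullet> z" c] by (simp add: power2_norm_eq_inner)
   then have "F (x, z) <= F (x, 0)" using B(2)[of x "x + z"] B(2)[of x x] B(1) by (simp add: F_def)
   also have "... <= F w" using near[of 0] d(1) by simp
   finally show ?thesis .
  qed (rule near)
  define x y where "x = fst w" and "y = fst w + snd w"
  have Fw: "F w = u x - v y - c * ((x - y) \<bullet> (x - y))" by (simp add: F_def x_def y_def)
  have nz: "norm (x - y) <= d" using w(1) by (auto simp: x_def y_def mem_Times_iff)
  define q where "q = (2 * c) *R (x - y)"
  have "N (p + grad (%x. c * ((x - y) \<bullet> (x - y))) x) + W x \<bullet> (p + grad (%x. c * ((x - y) \<bullet> (x - y))) x) <= a"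
  proof (rule visc_subD[OF u(2) quadratic_test_function(1)])
   show "u x' - c * ((x' - y) \<bullet> (x' - y)) <= u x - c * ((x - y) \<bullet> (x - y))" for x'
    using max[of x' "y - x'"] unfolding Fw by (simp add: F_def inner_diff_left inner_diff_right inner_commute algebra_simps)
  qed
  then have sub: "N (p + q) + W x \<bullet> (p + q) <= a" by (simp add: quadratic_test_function q_def)
  have "b <= N (p + grad (%y. (- c) * ((y - x) \<bullet> (y - x))) y) + W y \<bullet> (p + grad (%y. (- c) * ((y - x) \<bullet> (y - x))) y)"
  proof (rule visc_superD[OF v(2) quadratic_test_function(1)])
   show "v y - (- c) * ((y - x) \<bullet> (y - x)) <= v y' - (- c) * ((y' - x) \<bullet> (y' - x))" for y'
    using max[of x "y' - x"] unfolding Fw by (simp add: F_def inner_diff_left inner_diff_right inner_commute algebra_simps)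
  qed
  moreover have "(2 * - c) *R (y - x) = q" by (simp add: q_def algebra_simps)
  ultimately have super: "b <= N (p + q) + W y \<bullet> (p + q)" unfolding quadratic_test_function(2) by (simp only:)
  have "dist (u x) (u y) < \<eta>" using d'(2)[of x y] nz d(2) by (simp add: dist_norm)
  moreover have "F (y, 0) <= F w" by (rule max)
  \<comment> \<open>Comparison with the pair (y, 0) bounds the penalty by the modulus of u alone. As
    |x - y| |q| is twice the penalty, the drift term becomes small although q itself is not
    bounded.\<close>
  ultimately have pen: "c * ((x - y) \<bullet> (x - y)) <= \<eta>" unfolding Fw by (simp add: F_def dist_real_def)
  \<comment> \<open>Both test functions have the gradient q, so the term with N, which is
    independent of the point, cancels.\<close>
  have "b - a <= (W y - W x) \<bullet> (p + q)" using sub super by (simp add: inner_diff_left)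
  also have "... <= norm (W y - W x) * norm (p + q)" by (rule norm_cauchy_schwarz)
  also have "... <= (L * norm (x - y)) * (norm p + norm q)"
   using L(2)[of y x] L(1) by (intro mult_mono norm_triangle_ineq) (auto simp: norm_minus_commute)
  also have "norm q = 2 * c * norm (x - y)" using c(1) by (simp add: q_def)
  also have "(L * norm (x - y)) * (norm p + 2 * c * norm (x - y)) = L * (norm (x - y) * norm p + 2 * (c * ((x - y) \<bullet> (x - y))))"
   by (simp add: power2_norm_eq_inner[symmetric] power2_eq_square algebra_simps)
  also have "... <= L * (\<eta> * norm p + 2 * \<eta>)"
   using L(1) pen nz d(3) by (intro mult_left_mono add_mono mult_right_mono) auto
  finally show ?thesis by (simp add: algebra_simps)
 qed
 show ?thesis
 proof (rule field_le_epsilon)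
  fix e :: real assume e: "e > 0"
  have P: "L * (norm p + 2) > 0" using L(1) by (intro mult_pos_pos add_nonneg_pos) auto
  have "b <= a + L * (e / (L * (norm p + 2))) * (norm p + 2)" by (rule main) (use e P in simp)
  also have "L * (e / (L * (norm p + 2))) * (norm p + 2) = (e / (L * (norm p + 2))) * (L * (norm p + 2))"
   by (simp only: mult_ac)
  also have "... = e" using P by (simp only: times_divide_eq_left nonzero_mult_div_cancel_right[OF less_imp_neq[OF P, symmetric]])
  finally show "b <= a + e" .
 qed
qed

subsection \<open>A discrete dynamic programming scheme\<close>

text \<open>The added square makes the maximum at x strict without changing the gradient there, so
  maximisers of the approximating functions over a fixed ball converge to x.\<close>

lemma local_max_perturbation:
 fixes \<phi> :: "plane => real"
 assumes v: "continuous_on UNIV v" and u: "!!n. continuous_on UNIV (u n)" and \<phi>: "C_k 1 \<phi>"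
  and conv: "!!e. e > 0 ==> \<exists>N::nat. ALL n>=N. ALL x. \<bar>u n x - v x\<bar> <= e"
  and max: "\<forall>\<^sub>F y in nhds x. v y - \<phi> y <= v x - \<phi> x"
 obtains r y \<psi> where "0 < r" "y \<longlonglongrightarrow> x" "C_k 1 \<psi>" "grad \<psi> x = grad \<phi> x"
  "!!n z. z \<in> cball x r ==> u n z - \<psi> z <= u n (y n) - \<psi> (y n)"
proof -
 define \<psi> where "\<psi> y = \<phi> y + 1 * ((y - x) \<bullet> (y - x))" for y
 note Q = quadratic_test_function[of 1 x]
 have \<psi>: "C_k 1 \<psi>" unfolding \<psi>_def by (rule C_k_add[OF \<phi> Q(1)])
 have "\<phi> differentiable (at x)" "(%y. 1 * ((y - x) \<bullet> (y - x))) differentiable (at x)"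
  using \<phi> Q(1) by auto
 then have g: "grad \<psi> x = grad \<phi> x" unfolding \<psi>_def using Q(2) by (subst grad_add) (auto simp: fun_eq_iff)
 obtain r where r: "r > 0" "!!y. y \<in> cball x r ==> v y - \<phi> y <= v x - \<phi> x"
 proof -
  obtain d where "d > 0" "!!y. dist y x < d ==> v y - \<phi> y <= v x - \<phi> x" using max unfolding eventually_nhds_metric by blast
  then show ?thesis using that[of "d / 2"] by (auto simp: dist_commute)
 qed
 have "EX y. y \<in> cball x r & (\<forall>z\<in>cball x r. u n z - \<psi> z <= u n y - \<psi> y)" for n
 proof -
  have "continuous_on (cball x r) (%y. u n y - \<psi> y)"
   using u[of n] C_k_continuous[OF \<psi>] by (intro continuous_intros) (auto intro: continuous_on_subset)
  moreover have "cball x r ~= {}" using r(1) by simp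
  ultimately show ?thesis using continuous_attains_sup[OF compact_cball] by blast
 qed
 then obtain y where y: "!!n. y n \<in> cball x r" "!!n z. z \<in> cball x r ==> u n z - \<psi> z <= u n (y n) - \<psi> (y n)" by metis
 have "y \<longlonglongrightarrow> x"
 proof (rule metric_LIMSEQ_I)
  fix e :: real assume e: "0 < e"
  have "e\<^sup>2 / 4 > 0" using e by simp
  then obtain N where N: "!!n z. n >= N ==> \<bar>u n z - v z\<bar> <= e\<^sup>2 / 4" using conv by blast
  have "dist (y n) x < e" if n: "n >= N" for n
  proof -
   have "u n x - \<psi> x <= u n (y n) - \<psi> (y n)" using y(2)[of x] r(1) by simp
   then have "(y n - x) \<bullet> (y n - x) <= (u n (y n) - \<phi> (y n)) - (u n x - \<phi> x)" by (simp add: \<psi>_def)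
   also have "... <= e\<^sup>2 / 2" using r(2)[OF y(1)[of n]] N[OF n, of x] N[OF n, of "y n"] by linarith
   also have "... < e\<^sup>2" using e by simp
   finally have "(norm (y n - x))\<^sup>2 < e\<^sup>2" by (simp add: power2_norm_eq_inner)
   then show ?thesis using e by (simp add: dist_norm power_less_imp_less_base)
  qed
  then show "EX N. ALL n>=N. dist (y n) x < e" by blast
 qed
 then show ?thesis using that[OF r(1) _ \<psi> g y(2)] by blast
qed

lemma C1_mvt:
 fixes \<psi> :: "plane => real"
 assumes "C_k 1 \<psi>" shows "\<exists>\<nu>. norm (\<nu> - y) <= norm (t *R w) & \<psi> y - \<psi> (y - t *R w) = t * (grad \<psi> \<nu> \<bullet> w)"
proof -
 have "((%s. \<psi> (y - s *R w)) has_real_derivative - (grad \<psi> (y - s *R w) \<bullet> w)) (at s)" for s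
 proof -
  have "\<psi> differentiable (at (y - s *R w))" using assms by simp
  moreover have "((%s. y - s *R w) has_derivative (%h. - (h *R w))) (at s)" by (auto intro!: derivative_eq_intros)
  ultimately have "((%s. \<psi> (y - s *R w)) has_derivative (%h. grad \<psi> (y - s *R w) \<bullet> (- (h *R w)))) (at s)"
   using has_derivative_compose has_derivative_grad by blast
  then show ?thesis unfolding has_field_derivative_def by (rule has_derivative_eq_rhs) (auto simp: fun_eq_iff)
 qed
 from mvt_line[OF this, of t] obtain z where z: "\<bar>z\<bar> <= \<bar>t\<bar>"
  "\<psi> (y - t *R w) - \<psi> (y - 0 *R w) = t * - (grad \<psi> (y - z *R w) \<bullet> w)" by blast
 then show ?thesis by (intro exI[of _ "y - z *R w"]) (auto simp: mult_right_mono)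
qed

context lipschitz_field
begin

text \<open>One Euler step against the velocity \<open>a + V x\<close>, at the rate
  \<open>cost a - (a + V x) \<bullet> p\<close>. The discount enters through the separate argument
  \<open>g\<close>, so that it is unaffected when a constant is subtracted from u.\<close>

definition step_cost :: "(plane => real) => plane => real => (plane => real) => (plane => real) => plane => plane => real" where
 "step_cost cost p \<tau> u g x a = \<tau> * (cost a - (a + V x) \<bullet> p) + u (x - \<tau> *R (a + V x)) + \<tau> * g (x - \<tau> *R (a + V x))"

text \<open>The dynamic programming principle: u is the minimum over the controls. The inequality
  and the attained equality are the halves that yield, in the limit, the subsolution and the
  supersolution property.\<close>

definition scheme :: "(plane => real) => real => plane => real => (plane => real) => (plane => real) => bool" where
 "scheme cost R p \<tau> u g \<longleftrightarrow> (ALL x. (\<forall>a\<in>cball 0 R. u x <= step_cost cost p \<tau> u g x a) & (\<exists>a\<in>cball 0 R. u x = step_cost cost p \<tau> u g x a))"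

context
 fixes cost :: "plane => real" and R :: real and p :: plane
 assumes cost_continuous: "continuous_on (cball 0 R) cost" and R: "0 <= R"
begin

lemma step_point_norm: "a \<in> cball 0 R ==> norm (a + V x) <= R + M"
 using M[of x] norm_triangle_le[of a "V x"] by simp

context
 fixes u :: "nat => plane => real" and v g' and \<tau> :: "nat => real" and g
 assumes u: "!!n. cper (u n)" and v: "cper v" and g': "cper g'" and \<tau>: "!!n. 0 < \<tau> n" "\<tau> \<longlonglongrightarrow> 0"
  and s: "!!n. scheme cost R p (\<tau> n) (u n) (g n)"
  and uv: "!!e. e > 0 ==> \<exists>N::nat. ALL n>=N. ALL x. \<bar>u n x - v x\<bar> <= e"
  and gg: "!!e. e > 0 ==> \<exists>N::nat. ALL n>=N. ALL x. \<bar>g n x - g' x\<bar> <= e"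
begin

lemma scheme_limit_tendsto:
 assumes y: "y \<longlonglongrightarrow> x" and a: "!!n. a n \<in> cball 0 R"
 shows "(%n. y n - \<tau> n *R (a n + V (y n))) \<longlonglongrightarrow> x" "(%n. g n (y n - \<tau> n *R (a n + V (y n)))) \<longlonglongrightarrow> g' x"
  and "(!!n. norm (\<nu> n - y n) <= norm (\<tau> n *R (a n + V (y n)))) ==> \<nu> \<longlonglongrightarrow> x"
proof -
 have "(%n. \<tau> n * (R + M)) \<longlonglongrightarrow> 0" using tendsto_mult_right[OF \<tau>(2), of "R + M"] by simp
 moreover have le: "norm (\<tau> n *R (a n + V (y n))) <= \<tau> n * (R + M)" for n
  using step_point_norm[OF a[of n], of "y n"] \<tau>(1)[of n] by simp
 ultimately have z: "(%n. \<tau> n *R (a n + V (y n))) \<longlonglongrightarrow> 0"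
  by (rule_tac Lim_null_comparison[where g="%n. \<tau> n * (R + M)"]) auto
 let ?z = "%n. y n - \<tau> n *R (a n + V (y n))"
 show z': "?z \<longlonglongrightarrow> x" using tendsto_diff[OF y z] by simp
 have "(%n. g n (?z n) - g' (?z n)) \<longlonglongrightarrow> 0"
 proof (rule metric_LIMSEQ_I)
  fix e :: real assume "0 < e"
  then obtain N where "!!n x. n >= N ==> \<bar>g n x - g' x\<bar> <= e / 2" using gg[OF half_gt_zero] by blast
  then have "\<bar>g n (?z n) - g' (?z n)\<bar> <= e / 2" if "n >= N" for n using that by blast
  then have "dist (g n (?z n) - g' (?z n)) 0 < e" if "n >= N" for n
   using le_less_trans[of "\<bar>g n (?z n) - g' (?z n)\<bar>" "e / 2" e] that \<open>0 < e\<close> by (simp add: dist_real_def)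
  then show "EX N. ALL n>=N. dist (g n (?z n) - g' (?z n)) 0 < e" by blast
 qed
 moreover have "(%n. g' (?z n)) \<longlonglongrightarrow> g' x" by (rule isCont_tendsto_compose[OF cper_isCont[OF g'] z'])
 ultimately show "(%n. g n (?z n)) \<longlonglongrightarrow> g' x" using tendsto_add by fastforce
 assume "!!n. norm (\<nu> n - y n) <= norm (\<tau> n *R (a n + V (y n)))"
 then have "(%n. \<nu> n - y n) \<longlonglongrightarrow> 0" by (intro Lim_null_comparison[OF _ tendsto_norm_zero[OF z]]) simp
 from tendsto_add[OF this y] show "\<nu> \<longlonglongrightarrow> x" by simp
qed

text \<open>A fixed control is inserted at the maximisers of the perturbed problem. The mean value
  theorem turns the increment of the test function into \<tau> times a gradient, and \<tau> is
  divided out before the limit.\<close>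

lemma scheme_limit_sub:
 assumes \<phi>: "C_k 1 \<phi>" and max: "\<forall>\<^sub>F y in nhds x. v y - \<phi> y <= v x - \<phi> x" and a: "a \<in> cball 0 R"
 shows "(a + V x) \<bullet> (p + grad \<phi> x) - cost a <= g' x"
proof -
 obtain r y \<psi> where r: "0 < r" "y \<longlonglongrightarrow> x" "C_k 1 \<psi>" "grad \<psi> x = grad \<phi> x"
  "!!n z. z \<in> cball x r ==> u n z - \<psi> z <= u n (y n) - \<psi> (y n)"
  by (rule local_max_perturbation[OF cperD(1)[OF v] cperD(1)[OF u] \<phi> uv max]) (assumption, rule that)
 let ?w = "%n. a + V (y n)"
 let ?z = "%n. y n - \<tau> n *R ?w n"
 note lim = scheme_limit_tendsto[OF r(2), of "%n. a", OF a]
 have "\<exists>\<nu>. ALL n. norm (\<nu> n - y n) <= norm (\<tau> n *R ?w n) & \<psi> (y n) - \<psi> (?z n) = \<tau> n * (grad \<psi> (\<nu> n) \<bullet> ?w n)"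
  using C1_mvt[OF r(3)] by (intro choice) blast
 then obtain \<nu> where \<nu>: "!!n. norm (\<nu> n - y n) <= norm (\<tau> n *R ?w n)"
  "!!n. \<psi> (y n) - \<psi> (?z n) = \<tau> n * (grad \<psi> (\<nu> n) \<bullet> ?w n)" by blast
 have \<nu>x: "\<nu> \<longlonglongrightarrow> x" by (rule lim(3)[OF \<nu>(1)])
 have cg: "isCont (grad \<psi>) x" using C_k_grad[of 0 \<psi>] r(3) by (simp add: continuous_on_eq_continuous_at)
 have Vy: "(%n. V (y n)) \<longlonglongrightarrow> V x" by (rule isCont_tendsto_compose[OF cper_isCont[OF cV] r(2)])
 have "eventually (%n. dist (?z n) x < r) sequentially" using tendstoD[OF lim(1) r(1)] .
 then have ev: "eventually (%n. grad \<psi> (\<nu> n) \<bullet> ?w n <= cost a - ?w n \<bullet> p + g n (?z n)) sequentially"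
 proof eventually_elim
  case (elim n)
  have "u n (?z n) - \<psi> (?z n) <= u n (y n) - \<psi> (y n)" using elim by (intro r(5)) (auto simp: dist_commute)
  moreover have "u n (y n) <= step_cost cost p (\<tau> n) (u n) (g n) (y n) a" using s[of n] a unfolding scheme_def by blast
  ultimately have "\<tau> n * (grad \<psi> (\<nu> n) \<bullet> ?w n) <= \<tau> n * (cost a - ?w n \<bullet> p + g n (?z n))"
   unfolding \<nu>(2)[symmetric] step_cost_def by (simp add: algebra_simps)
  then show ?case using \<tau>(1)[of n] by simp
 qed
 have "grad \<psi> x \<bullet> (a + V x) <= cost a - (a + V x) \<bullet> p + g' x"
  by (rule tendsto_le[OF _ _ _ ev])
   (auto intro!: tendsto_intros isCont_tendsto_compose[OF cg \<nu>x] Vy lim(2))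
 then show ?thesis by (simp add: r(4) inner_add_right inner_commute)
qed

text \<open>The optimal controls need not converge; they are eliminated first, by the bound
  \<open>N\<close> on the Legendre transform, and the limit is taken afterwards.\<close>

lemma scheme_limit_super:
 assumes \<phi>: "C_k 1 \<phi>" and min: "\<forall>\<^sub>F y in nhds x. v x - \<phi> x <= v y - \<phi> y"
  and N: "continuous_on UNIV N" "!!a q. a \<in> cball 0 R ==> a \<bullet> q - cost a <= N q"
 shows "g' x <= N (p + grad \<phi> x) + V x \<bullet> (p + grad \<phi> x)"
proof -
 have neg: "continuous_on UNIV (%x. - v x)" "continuous_on UNIV (%x. - u n x)" for n
  using cper_minus[OF v] cper_minus[OF u] by (auto simp: cper_def)
 have nuv: "EX N. ALL n>=N. ALL x. \<bar>- u n x - - v x\<bar> <= e" if e: "e > 0" for e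
  using uv[OF e] by (simp add: abs_minus_commute)
 have nmax: "\<forall>\<^sub>F y in nhds x. - v y - - \<phi> y <= - v x - - \<phi> x" using min by eventually_elim simp
 obtain r y \<psi> where r: "0 < r" "y \<longlonglongrightarrow> x" "C_k 1 \<psi>" "grad \<psi> x = grad (%x. - \<phi> x) x"
  "!!n z. z \<in> cball x r ==> - u n z - \<psi> z <= - u n (y n) - \<psi> (y n)"
  by (rule local_max_perturbation[OF neg C_k_minus[OF \<phi>] nuv nmax]) (assumption, rule that)
 have "grad (%x. - \<phi> x) x = - grad \<phi> x" using grad_cmult[of \<phi> x "-1"] \<phi> by simp
 then have r4: "grad \<psi> x = - grad \<phi> x" using r(4) by simp
 have "EX a. ALL n. a n \<in> cball 0 R & u n (y n) = step_cost cost p (\<tau> n) (u n) (g n) (y n) (a n)"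
  using s unfolding scheme_def by (intro choice) blast
 then obtain a where a: "!!n. a n \<in> cball 0 R" "!!n. u n (y n) = step_cost cost p (\<tau> n) (u n) (g n) (y n) (a n)" by blast
 let ?w = "%n. a n + V (y n)"
 let ?z = "%n. y n - \<tau> n *R ?w n"
 note lim = scheme_limit_tendsto[OF r(2), of a, OF a(1)]
 have "\<exists>\<nu>. ALL n. norm (\<nu> n - y n) <= norm (\<tau> n *R ?w n) & \<psi> (y n) - \<psi> (?z n) = \<tau> n * (grad \<psi> (\<nu> n) \<bullet> ?w n)"
  using C1_mvt[OF r(3)] by (intro choice) blast
 then obtain \<nu> where \<nu>: "!!n. norm (\<nu> n - y n) <= norm (\<tau> n *R ?w n)"
  "!!n. \<psi> (y n) - \<psi> (?z n) = \<tau> n * (grad \<psi> (\<nu> n) \<bullet> ?w n)" by blast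
 have \<nu>x: "\<nu> \<longlonglongrightarrow> x" by (rule lim(3)[OF \<nu>(1)])
 have cg: "isCont (grad \<psi>) x" using C_k_grad[of 0 \<psi>] r(3) by (simp add: continuous_on_eq_continuous_at)
 have Vy: "(%n. V (y n)) \<longlonglongrightarrow> V x" by (rule isCont_tendsto_compose[OF cper_isCont[OF cV] r(2)])
 have G: "(%n. p - grad \<psi> (\<nu> n)) \<longlonglongrightarrow> p + grad \<phi> x"
  using tendsto_diff[OF tendsto_const isCont_tendsto_compose[OF cg \<nu>x], of p] r4 by simp
 have "isCont N (p + grad \<phi> x)" using N(1) by (simp add: continuous_on_eq_continuous_at)
 from isCont_tendsto_compose[OF this G] have NG: "(%n. N (p - grad \<psi> (\<nu> n))) \<longlonglongrightarrow> N (p + grad \<phi> x)" .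
 have "eventually (%n. dist (?z n) x < r) sequentially" using tendstoD[OF lim(1) r(1)] .
 then have ev: "eventually (%n. g n (?z n) <= N (p - grad \<psi> (\<nu> n)) + V (y n) \<bullet> (p - grad \<psi> (\<nu> n))) sequentially"
 proof eventually_elim
  case (elim n)
  have "- u n (?z n) - \<psi> (?z n) <= - u n (y n) - \<psi> (y n)" using elim by (intro r(5)) (auto simp: dist_commute)
  with a(2)[of n] have "\<tau> n * (cost (a n) - ?w n \<bullet> p + g n (?z n)) <= - (\<psi> (y n) - \<psi> (?z n))"
   unfolding step_cost_def by (simp add: algebra_simps)
  also have "... = \<tau> n * - (grad \<psi> (\<nu> n) \<bullet> ?w n)" unfolding \<nu>(2) by simp
  finally have "cost (a n) - ?w n \<bullet> p + g n (?z n) <= - (grad \<psi> (\<nu> n) \<bullet> ?w n)" using mult_le_cancel_left_pos[OF \<tau>(1)[of n]] by blast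
  then have "g n (?z n) <= (a n \<bullet> (p - grad \<psi> (\<nu> n)) - cost (a n)) + V (y n) \<bullet> (p - grad \<psi> (\<nu> n))"
   by (simp add: inner_add_left inner_add_right inner_diff_right inner_commute)
  then show ?case using N(2)[OF a(1)[of n], of "p - grad \<psi> (\<nu> n)"] by linarith
 qed
 show ?thesis
  by (rule tendsto_le[OF _ _ _ ev]) (auto intro!: tendsto_intros G NG Vy lim(2))
qed

end

text \<open>The Bellman operator contracts by the factor 1 - \<mu> \<tau>; that it preserves
  continuity holds because nearby points may use the same control.\<close>

lemma scheme_exists:
 assumes \<mu>: "0 < \<mu>" "0 < \<tau>" "\<mu> * \<tau> < 1"
 obtains u where "cper u" "scheme cost R p \<tau> u (%x. - (\<mu> * u x))"
proof -
 define S where "S u x a = step_cost cost p \<tau> u (%x. - (\<mu> * u x)) x a" for u x a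
 have S: "S u x a = \<tau> * (cost a - (a + V x) \<bullet> p) + (1 - \<mu> * \<tau>) * u (x - \<tau> *R (a + V x))" for u x a
  by (simp add: S_def step_cost_def algebra_simps)
 define Q where "Q u x = (INF a\<in>cball 0 R. S u x a)" for u x
 have min: "\<exists>a\<in>cball 0 R. Q u x = S u x a & (\<forall>b\<in>cball 0 R. S u x a <= S u x b)" if u: "cper u" for u x
 proof -
  have "continuous_on (cball 0 R) (S u x)" unfolding S[abs_def]
   by (intro continuous_intros cost_continuous continuous_on_compose2[OF cperD(1)[OF u, of UNIV]]) auto
  moreover have "cball (0::plane) R ~= {}" using R by simp
  ultimately obtain a where a: "a \<in> cball 0 R" "\<forall>b\<in>cball 0 R. S u x a <= S u x b"
   using continuous_attains_inf[OF compact_cball] by blast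
  then have "Q u x = S u x a" unfolding Q_def by (intro cInf_eq_minimum) auto
  then show ?thesis using a by blast
 qed
 have Q_le: "Q u x <= Q w y + e" if u: "cper u" "cper w" and e: "!!a. a \<in> cball 0 R ==> S u x a <= S w y a + e" for u w x y e
 proof -
  obtain a where a: "a \<in> cball 0 R" "Q w y = S w y a" using min[OF u(2)] by blast
  obtain b where b: "Q u x = S u x b" "!!c. c \<in> cball 0 R ==> S u x b <= S u x c" using min[OF u(1)] by blast
  show ?thesis using a(2) b(1) b(2)[OF a(1)] e[OF a(1)] by linarith
 qed
 have Q_per: "cper (Q u)" if u: "cper u" for u
  unfolding cper_def
 proof
  have "S u (x + k) a = S u x a" if k: "k \<in> int_lattice" for x k a
  proof -
   have "u (x - \<tau> *R (a + V x) + k) = u (x - \<tau> *R (a + V x))" by (rule periodicD[OF cperD(2)[OF u] k])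
   moreover have "x - \<tau> *R (a + V x) + k = x + k - \<tau> *R (a + V x)" by simp
   ultimately show ?thesis unfolding S periodicD[OF cperD(2)[OF cV] k] by simp
  qed
  then show "periodic (Q u)" by (simp add: periodic_def Q_def)
  have "isCont (Q u) x" for x
   unfolding continuous_at_eps_delta
  proof (intro allI impI)
   fix e :: real assume e: "0 < e"
   obtain d where d: "d > 0" "!!x y. dist x y < d ==> dist (u x) (u y) < e / 4"
    using cper_uniform[OF u, of "e / 4"] e by auto
   \<comment> \<open>The first bound controls the shift of the end point of a step, the second the
     change of its cost.\<close>
   define c where "c = min (d / (1 + \<tau> * L)) (e / (4 * (\<tau> * L * norm p + 1)))"
   have P: "1 + \<tau> * L > 0" "\<tau> * L * norm p + 1 > 0" using \<mu>(2) L(1) by (auto intro!: add_pos_pos add_nonneg_pos)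
   have c: "c > 0" using d(1) e P by (simp add: c_def)
   have cc: "c <= d / (1 + \<tau> * L)" "c <= e / (4 * (\<tau> * L * norm p + 1))" unfolding c_def by linarith+
   have close: "S u y a <= S u z a + e / 2" if yz: "norm (y - z) < c" for y z a
   proof -
    have "norm (V y - V z) <= L * norm (y - z)" by (rule L(2))
    then have t: "norm (\<tau> *R (V y - V z)) <= \<tau> * L * norm (y - z)" using \<mu>(2) by (simp add: mult.assoc mult_left_mono)
    have "norm ((y - \<tau> *R (a + V y)) - (z - \<tau> *R (a + V z))) <= norm (y - z) + norm (\<tau> *R (V y - V z))"
     using norm_triangle_ineq4[of "y - z" "\<tau> *R (V y - V z)"] by (simp add: algebra_simps)
    also have "... <= norm (y - z) * (1 + \<tau> * L)" using t by (simp add: algebra_simps)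
    also have "... < d" using yz cc(1) P(1) by (simp add: pos_le_divide_eq) (metis less_le_trans mult_strict_right_mono P(1))
    finally have "dist (u (y - \<tau> *R (a + V y))) (u (z - \<tau> *R (a + V z))) < e / 4" by (intro d(2)) (simp add: dist_norm)
    then have "u (y - \<tau> *R (a + V y)) - u (z - \<tau> *R (a + V z)) <= e / 4" unfolding dist_real_def by linarith
    then have "(1 - \<mu> * \<tau>) * (u (y - \<tau> *R (a + V y)) - u (z - \<tau> *R (a + V z))) <= (1 - \<mu> * \<tau>) * (e / 4)"
     using \<mu>(3) by (intro mult_left_mono) auto
    also have "... <= 1 * (e / 4)" using \<mu> e by (intro mult_right_mono) auto
    finally have 1: "(1 - \<mu> * \<tau>) * (u (y - \<tau> *R (a + V y)) - u (z - \<tau> *R (a + V z))) <= e / 4" by simp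
    have "- (\<tau> * ((V y - V z) \<bullet> p)) <= norm (\<tau> *R (V y - V z)) * norm p"
     using norm_cauchy_schwarz[of "- (\<tau> *R (V y - V z))" p] by (simp only: norm_minus_cancel inner_minus_left inner_scaleR_left)
    also have "... <= (\<tau> * L * norm (y - z)) * norm p" using t by (rule mult_right_mono) simp
    also have "... = norm (y - z) * (\<tau> * L * norm p)" by simp
    also have "... <= c * (\<tau> * L * norm p + 1)" using yz \<mu>(2) L(1) c by (intro mult_mono) auto
    also have "... <= e / 4" using cc(2) P(2) by (simp add: pos_le_divide_eq algebra_simps)
    finally have 2: "- (\<tau> * ((V y - V z) \<bullet> p)) <= e / 4" .
    have "S u y a - S u z a = - (\<tau> * ((V y - V z) \<bullet> p)) + (1 - \<mu> * \<tau>) * (u (y - \<tau> *R (a + V y)) - u (z - \<tau> *R (a + V z)))"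
     unfolding S by (simp add: inner_add_left inner_diff_left algebra_simps)
    then show ?thesis using 1 2 by linarith
   qed
   have "dist (Q u y) (Q u x) < e" if "dist y x < c" for y
   proof -
    have "norm (y - x) < c" "norm (x - y) < c" using that by (simp_all add: dist_norm norm_minus_commute)
    then have "Q u y <= Q u x + e / 2" "Q u x <= Q u y + e / 2" using Q_le[OF u u] close by blast+
    then show ?thesis using e by (auto simp: dist_real_def abs_less_iff)
   qed
   then show "EX d>0. ALL x'. dist x' x < d --> dist (Q u x') (Q u x) < e" using c by blast
  qed
  then show "continuous_on UNIV (Q u)" by (simp add: continuous_at_imp_continuous_on)
 qed
 have Q_con: "\<bar>Q f x - Q g x\<bar> <= (1 - \<mu> * \<tau>) * d" if fg: "cper f" "cper g" "!!x. \<bar>f x - g x\<bar> <= d" for f g d x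
 proof -
  have "S f x a <= S g x a + (1 - \<mu> * \<tau>) * d" "S g x a <= S f x a + (1 - \<mu> * \<tau>) * d" for a
  proof -
   let ?y = "x - \<tau> *R (a + V x)"
   have "(1 - \<mu> * \<tau>) * f ?y <= (1 - \<mu> * \<tau>) * (g ?y + d)" "(1 - \<mu> * \<tau>) * g ?y <= (1 - \<mu> * \<tau>) * (f ?y + d)"
    using fg(3)[of ?y] \<mu>(3) by (intro mult_left_mono; linarith)+
   then show "S f x a <= S g x a + (1 - \<mu> * \<tau>) * d" "S g x a <= S f x a + (1 - \<mu> * \<tau>) * d"
    unfolding S by (simp_all add: distrib_left)
  qed
  then have "Q f x <= Q g x + (1 - \<mu> * \<tau>) * d" "Q g x <= Q f x + (1 - \<mu> * \<tau>) * d"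
   using Q_le fg(1,2) by blast+
  then show ?thesis by (simp add: abs_le_iff)
 qed
 have "EX f. cper f & Q f = f"
 proof (rule cper_contraction[where q="1 - \<mu> * \<tau>"])
  show "0 <= 1 - \<mu> * \<tau>" "1 - \<mu> * \<tau> < 1" using \<mu> by auto
 qed (fact Q_per, fact Q_con)
 then obtain u where u: "cper u" "Q u = u" by (elim exE conjE)
 have "\<exists>a\<in>cball 0 R. u x = S u x a & (\<forall>b\<in>cball 0 R. S u x a <= S u x b)" for x using min[OF u(1), of x] unfolding u(2) .
 then have "(\<forall>a\<in>cball 0 R. u x <= S u x a) & (\<exists>a\<in>cball 0 R. u x = S u x a)" for x by metis
 then have "scheme cost R p \<tau> u (%x. - (\<mu> * u x))" unfolding scheme_def S_def by blast
 then show ?thesis using that u(1) by blast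
qed

text \<open>The lower bound reads the equation at a minimum of u with an optimal control, the upper
  bound at a maximum with control zero.\<close>

lemma scheme_bounds:
 assumes u: "cper u" "scheme cost R p \<tau> u (%x. - (\<mu> * u x))" and \<mu>: "0 < \<mu>" "0 < \<tau>" "\<mu> * \<tau> < 1"
  and C: "!!a x. a \<in> cball 0 R ==> - C0 <= cost a - (a + V x) \<bullet> p" "!!x. cost 0 - V x \<bullet> p <= C"
 shows "- C0 <= \<mu> * u x" "\<mu> * u x <= C"
proof -
 obtain y where y: "!!z. u y <= u z" using cper_attains_inf[OF u(1)] by blast
 obtain a where a: "a \<in> cball 0 R" "u y = step_cost cost p \<tau> u (%x. - (\<mu> * u x)) y a" using u(2) unfolding scheme_def by blast
 let ?z = "y - \<tau> *R (a + V y)"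
 have "(1 - \<mu> * \<tau>) * u y <= (1 - \<mu> * \<tau>) * u ?z" using y \<mu> by (intro mult_left_mono) auto
 moreover have "\<tau> * - C0 <= \<tau> * (cost a - (a + V y) \<bullet> p)" using C(1)[OF a(1)] \<mu> by (intro mult_left_mono) auto
 moreover have "u y = \<tau> * (cost a - (a + V y) \<bullet> p) + (1 - \<mu> * \<tau>) * u ?z" using a(2) by (simp add: step_cost_def algebra_simps)
 moreover have "(1 - \<mu> * \<tau>) * u y = u y - \<tau> * (\<mu> * u y)" by (simp add: algebra_simps)
 ultimately have "\<tau> * - C0 <= \<tau> * (\<mu> * u y)" by linarith
 then have "- C0 <= \<mu> * u y" using mult_le_cancel_left_pos[OF \<mu>(2)] by blast
 also have "... <= \<mu> * u x" using y \<mu> by (intro mult_left_mono) auto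
 finally show "- C0 <= \<mu> * u x" .
 obtain y where y: "!!z. u z <= u y" using cper_attains_sup[OF u(1)] by blast
 let ?z = "y - \<tau> *R (0 + V y)"
 have "(0::plane) \<in> cball 0 R" using R by simp
 then have a: "u y <= step_cost cost p \<tau> u (%x. - (\<mu> * u x)) y 0" using u(2) unfolding scheme_def by blast
 have "(1 - \<mu> * \<tau>) * u ?z <= (1 - \<mu> * \<tau>) * u y" using y \<mu> by (intro mult_left_mono) auto
 moreover have "\<tau> * (cost 0 - V y \<bullet> p) <= \<tau> * C" using C(2) \<mu> by (intro mult_left_mono) auto
 ultimately have "\<tau> * (\<mu> * u y) <= \<tau> * C" using a unfolding step_cost_def by (simp add: algebra_simps)
 then have "\<mu> * u y <= C" using \<mu> by simp
 moreover have "\<mu> * u x <= \<mu> * u y" using y \<mu> by (intro mult_left_mono) auto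
 ultimately show "\<mu> * u x <= C" by linarith
qed

text \<open>Following two trajectories with the same controls for \<open>k\<close> steps.\<close>

lemma scheme_modulus:
 assumes u: "scheme cost R p \<tau> u (%x. - (\<mu> * u x))" and \<mu>: "0 < \<mu>" "0 < \<tau>" "\<mu> * \<tau> < 1" and B: "!!x. \<bar>u x\<bar> <= B"
 shows "u x - u y <= real k * \<tau> * (L * norm p) * (1 + \<tau> * L) ^ k * norm (x - y) + 2 * B * (1 - \<mu> * \<tau>) ^ k"
proof (induction k arbitrary: x y)
 case 0
 show ?case using B[of x] B[of y] by (simp add: abs_le_iff)
next
 case (Suc k)
 obtain a where a: "a \<in> cball 0 R" "u y = step_cost cost p \<tau> u (%x. - (\<mu> * u x)) y a" using u unfolding scheme_def by blast
 then have b: "u x <= step_cost cost p \<tau> u (%x. - (\<mu> * u x)) x a" using u unfolding scheme_def by blast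
 let ?x = "x - \<tau> *R (a + V x)" and ?y = "y - \<tau> *R (a + V y)"
 let ?n = "norm (x - y)" and ?q = "1 - \<mu> * \<tau>" and ?K = "\<tau> * (L * norm p)" and ?E = "1 + \<tau> * L"
 have E: "1 <= ?E" "0 <= ?K" "0 <= ?q" "?q <= 1" using \<mu> L(1) by auto
 have t: "norm (\<tau> *R (V x - V y)) <= \<tau> * L * ?n" using L(2)[of x y] \<mu>(2) by (simp add: mult.assoc mult_left_mono)
 have "norm (?x - ?y) <= ?n + norm (\<tau> *R (V x - V y))"
  using norm_triangle_ineq4[of "x - y" "\<tau> *R (V x - V y)"] by (simp add: algebra_simps)
 also have "... <= ?E * ?n" using t by (simp add: algebra_simps)
 finally have n: "norm (?x - ?y) <= ?E * ?n" .
 have "- (\<tau> * ((V x - V y) \<bullet> p)) <= norm (\<tau> *R (V x - V y)) * norm p"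
  using norm_cauchy_schwarz[of "- (\<tau> *R (V x - V y))" p] by (simp only: norm_minus_cancel inner_minus_left inner_scaleR_left)
 also have "... <= (\<tau> * L * ?n) * norm p" using t by (rule mult_right_mono) simp
 also have "... = ?K * 1 * ?n" by simp
 also have "... <= ?K * ?E ^ Suc k * ?n" using E by (intro mult_right_mono mult_left_mono one_le_power) auto
 finally have 1: "- (\<tau> * ((V x - V y) \<bullet> p)) <= ?K * ?E ^ Suc k * ?n" .
 have "u ?x - u ?y <= real k * \<tau> * (L * norm p) * ?E ^ k * norm (?x - ?y) + 2 * B * ?q ^ k" by (rule Suc.IH)
 also have "real k * \<tau> * (L * norm p) * ?E ^ k * norm (?x - ?y) <= real k * \<tau> * (L * norm p) * ?E ^ k * (?E * ?n)"
  using n E \<mu> L(1) by (intro mult_left_mono) auto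
 finally have "?q * (u ?x - u ?y) <= ?q * (real k * \<tau> * (L * norm p) * ?E ^ k * (?E * ?n) + 2 * B * ?q ^ k)"
  using E by (intro mult_left_mono) auto
 also have "... = ?q * (real k * ?K * ?E ^ Suc k * ?n) + 2 * B * ?q ^ Suc k" by (simp only: distrib_left[of ?q] power_Suc mult_ac)
 also have "?q * (real k * ?K * ?E ^ Suc k * ?n) <= 1 * (real k * ?K * ?E ^ Suc k * ?n)"
  using E \<mu>(2) L(1) by (intro mult_right_mono mult_nonneg_nonneg) auto
 finally have 2: "?q * (u ?x - u ?y) <= real k * ?K * ?E ^ Suc k * ?n + 2 * B * ?q ^ Suc k" by simp
 have "u x - u y <= - (\<tau> * ((V x - V y) \<bullet> p)) + ?q * (u ?x - u ?y)"
  using b a(2) unfolding step_cost_def by (simp add: inner_add_left inner_diff_left algebra_simps)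
 also have "... <= ?K * ?E ^ Suc k * ?n + (real k * ?K * ?E ^ Suc k * ?n + 2 * B * ?q ^ Suc k)" using 1 2 by linarith
 also have "... = real (Suc k) * \<tau> * (L * norm p) * ?E ^ Suc k * ?n + 2 * B * ?q ^ Suc k"
  by (simp only: of_nat_Suc distrib_right distrib_left mult_ac)
 finally show ?case .
qed

text \<open>The discount stays fixed while the time step 1 / (n + 1) tends to zero. With (n + 1) j
  steps the estimate of \<open>scheme_modulus\<close> depends on j only, as the growth factor is at
  most exp (L j) and the discount factor at most exp (- \<mu> j); fixing j first gives
  equicontinuity.\<close>

lemma discount_limit:
 assumes \<mu>: "0 < \<mu>" "\<mu> < 1"
  and C: "!!a x. a \<in> cball 0 R ==> - C <= cost a - (a + V x) \<bullet> p" "!!x. cost 0 - V x \<bullet> p <= C"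
 obtains m u v where "strict_mono (m :: nat => nat)" "!!n. cper (u n)" "cper v"
  "!!n. scheme cost R p (1 / real (Suc (m n))) (u n) (%x. - (\<mu> * u n x))"
  "!!e. e > 0 ==> \<exists>N::nat. ALL n>=N. ALL x. \<bar>u n x - v x\<bar> <= e"
proof -
 have t: "0 < 1 / real (Suc n)" "\<mu> * (1 / real (Suc n)) < 1" for n
 proof -
  show "0 < 1 / real (Suc n)" by simp
  have "\<mu> < real (Suc n)" using \<mu>(2) by simp
  then show "\<mu> * (1 / real (Suc n)) < 1" by simp
 qed
 have "EX u. cper u & scheme cost R p (1 / real (Suc n)) u (%x. - (\<mu> * u x))" for n
  using scheme_exists[OF \<mu>(1) t] by metis
 then obtain u where u: "!!n. cper (u n)" "!!n. scheme cost R p (1 / real (Suc n)) (u n) (%x. - (\<mu> * u n x))" by metis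
 have B: "\<bar>u n x\<bar> <= C / \<mu>" for n x
  using scheme_bounds[OF u(1,2) \<mu>(1) t C, of n x] \<mu>(1) by (auto simp: abs_le_iff pos_le_divide_eq mult.commute)
 have B0: "0 <= C / \<mu>" using B[of 0 0] by linarith
 have eq: "EX d>0. ALL n x y. dist x y < d --> \<bar>u n x - u n y\<bar> < e" if e: "0 < e" for e
 proof -
  have "0 < e / (4 * (C / \<mu> + 1))" using e B0 by simp
  moreover have "exp (- \<mu>) < 1" "\<bar>exp (- \<mu>)\<bar> < 1" using \<mu>(1) by auto
  ultimately obtain j where j: "exp (- \<mu>) ^ j < e / (4 * (C / \<mu> + 1))"
   using real_arch_pow_inv by blast
  define K where "K = real j * (L * norm p) * exp L ^ j"
  have K: "0 <= K" using L(1) by (simp add: K_def)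
  have le: "u n x - u n y <= K * norm (x - y) + e / 2" for n x y
  proof -
   let ?\<tau> = "1 / real (Suc n)"
   have "(1 + ?\<tau> * L) ^ Suc n <= exp (?\<tau> * L) ^ Suc n"
    using exp_ge_add_one_self[of "?\<tau> * L"] L(1) by (intro power_mono) auto
   also have "... = exp L" by (simp only: exp_of_nat_mult[symmetric]) simp
   finally have "((1 + ?\<tau> * L) ^ Suc n) ^ j <= exp L ^ j" using L(1) by (intro power_mono) auto
   then have 1: "(1 + ?\<tau> * L) ^ (Suc n * j) <= exp L ^ j" unfolding power_mult .
   have "(1 - \<mu> * ?\<tau>) ^ Suc n <= exp (- (\<mu> * ?\<tau>)) ^ Suc n"
    using exp_ge_add_one_self[of "- (\<mu> * ?\<tau>)"] t(2)[of n] by (intro power_mono) auto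
   also have "... = exp (- \<mu>)" by (simp only: exp_of_nat_mult[symmetric]) simp
   finally have "((1 - \<mu> * ?\<tau>) ^ Suc n) ^ j <= exp (- \<mu>) ^ j" using t(2)[of n] by (intro power_mono) auto
   then have 2: "(1 - \<mu> * ?\<tau>) ^ (Suc n * j) <= exp (- \<mu>) ^ j" unfolding power_mult .
   have "u n x - u n y <= real (Suc n * j) * ?\<tau> * (L * norm p) * (1 + ?\<tau> * L) ^ (Suc n * j) * norm (x - y)
    + 2 * (C / \<mu>) * (1 - \<mu> * ?\<tau>) ^ (Suc n * j)"
    by (rule scheme_modulus[OF u(2) \<mu>(1) t B])
   also have "real (Suc n * j) * ?\<tau> = real j" unfolding of_nat_mult by (simp del: of_nat_Suc)
   also have "real j * (L * norm p) * (1 + ?\<tau> * L) ^ (Suc n * j) * norm (x - y) <= K * norm (x - y)"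
    unfolding K_def using 1 L(1) by (intro mult_right_mono mult_left_mono) auto
   also have "2 * (C / \<mu>) * (1 - \<mu> * ?\<tau>) ^ (Suc n * j) <= 2 * (C / \<mu> + 1) * exp (- \<mu>) ^ j"
    using 2 B0 t(2)[of n] by (intro mult_mono) auto
   also have "2 * (C / \<mu> + 1) * exp (- \<mu>) ^ j <= 2 * (C / \<mu> + 1) * (e / (4 * (C / \<mu> + 1)))"
    using j B0 by (intro mult_left_mono) auto
   also have "... = e / 2"
   proof -
    have "2 * X * (e / (4 * X)) = e / 2" if "X ~= 0" for X using that by simp
    moreover have "C / \<mu> + 1 ~= 0" using B0 by linarith
    ultimately show ?thesis by blast
   qed
   finally show ?thesis by simp
  qed
  have "\<bar>u n x - u n y\<bar> < e" if d: "dist x y < e / (2 * (K + 1))" for n x y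
  proof -
   have "norm (x - y) * (2 * (K + 1)) < e" using d K by (simp add: dist_norm pos_less_divide_eq)
   moreover have "norm (x - y) * (2 * (K + 1)) = 2 * (K * norm (x - y)) + 2 * norm (x - y)" by (simp add: algebra_simps)
   ultimately have "K * norm (x - y) < e / 2" using norm_ge_zero[of "x - y"] by linarith
   then show ?thesis using le[of n x y] le[of n y x] by (simp add: abs_less_iff norm_minus_commute)
  qed
  then show ?thesis using e K by (intro exI[of _ "e / (2 * (K + 1))"]) auto
 qed
 show ?thesis
 proof (rule cper_Arzela_Ascoli[OF u(1) B eq])
  fix v and m :: "nat => nat"
  assume v: "cper v" "strict_mono m" "!!e. e > 0 ==> EX N. ALL n>=N. ALL x. \<bar>u (m n) x - v x\<bar> <= e"
  show ?thesis by (rule that[OF v(2) u(1) v(1) u(2) v(3)])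
 qed
qed

end

end

subsection \<open>Oscillation bound from measure preservation\<close>

lemma mean_abs_le:
 assumes "cper (f :: plane => real)" "!!x. \<bar>f x\<bar> <= e" shows "\<bar>mean f\<bar> <= e"
proof -
 have "f x <= e" "- e <= f x" for x using assms(2)[of x] by (auto simp: abs_le_iff)
 then have "mean f <= mean (%x::plane. e)" "mean (%x::plane. - e) <= mean f"
  using mean_mono[OF assms(1) cper_const] mean_mono[OF cper_const assms(1)] by blast+
 then show ?thesis by (simp add: abs_le_iff)
qed

context incompressible_flow
begin

lemma cper_flow: "cper g ==> cper (%x. g (flow V t x))"
 unfolding cper_def periodic_def using flow_periodic
 by (auto intro!: continuous_on_compose2[OF _ flow_continuous_space])

text \<open>The time derivative of the mean is the mean of \<open>d\<close> composed with the flow,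
  which is the derivative along the flow of the Lipschitz function g o X_t. By
  \<open>flow_derivative_approx\<close> it is uniformly close to functions V . D\<psi> of mean zero.
  No Jacobian of the flow is involved.\<close>

lemma flow_measure_preserving_C1:
 assumes g: "C_k 1 g" "periodic g"
 shows "mean (%x. g (flow V t x)) = mean (g :: plane => real)"
proof -
 have c: "cper g" "cper (grad g)" using C_k_cper[OF g] cper_grad[of 0 g] g by auto
 obtain B where B: "B > 0" "!!x. norm (grad g x) <= B" using cper_bounded[OF c(2)] by blast
 have glip: "\<bar>g x - g y\<bar> <= B * norm (x - y)" for x y
 proof -
  obtain \<nu> where "g x - g (x - 1 *R (x - y)) = 1 * (grad g \<nu> \<bullet> (x - y))" using C1_mvt[OF g(1)] by blast
  then have "\<bar>g x - g y\<bar> = \<bar>grad g \<nu> \<bullet> (x - y)\<bar>" by simp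
  also have "... <= norm (grad g \<nu>) * norm (x - y)" by (rule Cauchy_Schwarz_ineq2)
  also have "... <= B * norm (x - y)" using B(2) by (rule mult_right_mono) simp
  finally show ?thesis .
 qed
 define d where "d x = grad g x \<bullet> V x" for x
 have cd: "cper d" unfolding d_def by (intro cper_intros c cV)
 have der: "((%s. g (flow V s x)) has_real_derivative d (flow V s x)) (at s)" for s x
 proof -
  have "g differentiable (at (flow V s x))" using g(1) by simp
  from has_derivative_compose[OF flow_has_derivative[of x s, unfolded has_vector_derivative_def] has_derivative_grad[OF this]]
  show ?thesis unfolding has_field_derivative_def
   by (rule has_derivative_eq_rhs) (auto simp: d_def fun_eq_iff)
 qed
 have d0: "mean (%x. d (flow V t x)) = 0" for t
 proof -
  have "\<bar>mean (%x. d (flow V t x))\<bar> <= e" if e: "0 < e" for e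
  proof -
   have lip: "\<bar>g (flow V t x) - g (flow V t y)\<bar> <= (B * exp (L * \<bar>t\<bar>)) * norm (x - y)" for x y
    using order_trans[OF glip mult_left_mono[OF flow_lipschitz less_imp_le[OF B(1)]]] by (simp add: mult.assoc)
   have der0: "((%s. g (flow V t (flow V s x))) has_real_derivative d (flow V t x)) (at 0)" for x
    using DERIV_shift[of "%s. g (flow V s x)" "d (flow V t x)" 0 t] der[of x t] by (simp add: flow_add[symmetric] add.commute)
   obtain \<psi> where \<psi>: "C_k 1 \<psi>" "periodic \<psi>" "!!x. \<bar>V x \<bullet> grad \<psi> x - d (flow V t x)\<bar> <= e"
    using flow_derivative_approx[OF cper_flow[OF c(1)] lip cper_flow[OF cd] der0 e] by blast
   have cp: "cper (%x. V x \<bullet> grad \<psi> x)" using cper_grad[of 0 \<psi>] \<psi> by (intro cper_intros cV) auto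
   have "\<bar>mean (%x. V x \<bullet> grad \<psi> x - d (flow V t x))\<bar> <= e"
    by (rule mean_abs_le[OF cper_diff[OF cp cper_flow[OF cd]] \<psi>(3)])
   then show ?thesis using integral_V_grad[OF \<psi>(1,2)] mean_diff[OF cp cper_flow[OF cd, of t]] by simp
  qed
  then show ?thesis by (metis abs_le_zero_iff field_le_epsilon add_0)
 qed
 define F where "F t = mean (%x. g (flow V t x))" for t
 have "(F has_real_derivative 0) (at t)" for t
  unfolding DERIV_def
 proof (rule LIM_I)
  fix e :: real assume e: "0 < e"
  obtain t0 where t0: "t0 > 0" "!!h x. \<bar>h\<bar> < t0 ==> \<bar>g (flow V h x) - g x - h * d x\<bar> <= e / 2 * \<bar>h\<bar>"
   using flow_derivative_uniform[OF cd _ half_gt_zero[OF e], of g] der[of _ 0] by auto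
  have "norm ((F (t + h) - F t) / h - 0) < e" if h: "h ~= 0" "norm (h - 0) < t0" for h
  proof -
   let ?D = "%x. g (flow V (t + h) x) - g (flow V t x) - h * d (flow V t x)"
   have "\<bar>?D x\<bar> <= e / 2 * \<bar>h\<bar>" for x
    using t0(2)[of h "flow V t x"] h(2) by (simp add: flow_add[symmetric] add.commute)
   moreover have "cper ?D" by (intro cper_diff cper_mult cper_const cper_flow c cd)
   ultimately have "\<bar>mean ?D\<bar> <= e / 2 * \<bar>h\<bar>" by (rule_tac mean_abs_le)
   moreover have "mean ?D = F (t + h) - F t - h * 0"
    unfolding F_def d0[of t, symmetric] mean_cmult[symmetric]
    by (simp only: mean_diff cper_diff cper_mult cper_const cper_flow c cd)
   ultimately have "\<bar>F (t + h) - F t\<bar> <= e / 2 * \<bar>h\<bar>" by simp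
   also have "... < e * \<bar>h\<bar>" using e h(1) by simp
   finally show ?thesis using h(1) by (simp add: pos_divide_less_eq)
  qed
  then show "EX s>0. ALL h. h ~= 0 & norm (h - 0) < s --> norm ((F (t + h) - F t) / h - 0) < e" using t0(1) by blast
 qed
 then have "F t = F 0" using DERIV_isconst_all by blast
 then show ?thesis by (simp add: F_def)
qed

lemma flow_measure_preserving:
 assumes g: "cper (g :: plane => real)" shows "mean (%x. g (flow V t x)) = mean g"
proof -
 have "\<bar>mean (%x. g (flow V t x)) - mean g\<bar> <= e" if e: "0 < e" for e
 proof -
  obtain h where h: "C_k 1 h" "periodic h" "!!x. \<bar>h x - g x\<bar> <= e / 2" using cper_approx_C_k[OF g half_gt_zero[OF e]] by metis
  have ch: "cper h" using C_k_cper[OF h(1,2)] .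
  have "\<bar>mean (%x. h x - g x)\<bar> <= e / 2" "\<bar>mean (%x. h (flow V t x) - g (flow V t x))\<bar> <= e / 2"
   by (intro mean_abs_le cper_diff cper_flow ch g h(3))+
  then show ?thesis
   using flow_measure_preserving_C1[OF h(1,2), of t]
   unfolding mean_diff[OF ch g] mean_diff[OF cper_flow[OF ch] cper_flow[OF g]]
   by linarith
 qed
 then have "\<bar>mean (%x. g (flow V t x)) - mean g\<bar> <= 0" by (metis field_le_epsilon add_0)
 then show ?thesis by simp
qed

end

text \<open>With m x the minimum of u over the ball of radius c0 about x, the hypothesis reads u <=
  m o X + D. As X preserves means, u - m is nonnegative with mean at most D, so every ball of radius
  c0 / 4 contains a point where u exceeds m by at most a fixed multiple of D. A chain of such points
  joins any two points, modulo the lattice, in a bounded number of steps.\<close>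

lemma oscillation_bound:
 fixes X :: "plane => plane"
 assumes X: "!!g :: plane => real. cper g ==> cper (%x. g (X x)) & mean (%x. g (X x)) = mean g"
  and c0: "0 < c0"
 shows "\<exists>K :: real. ALL u D. cper u --> 0 < D --> (ALL x z. norm (z - X x) <= c0 --> u x <= u z + D) --> (ALL x w. u x - u w <= K * D)"
proof -
 \<comment> \<open>A tent of height 1 at each lattice point, vanishing beyond distance c0 / 4; its
   translates detect balls made up of bad points only.\<close>
 define h where "h x = max 0 (1 - 4 / c0 * infdist x int_lattice)" for x :: plane
 have inf_per: "infdist (x + k) int_lattice = infdist x int_lattice" if k: "k \<in> int_lattice" for x k
 proof -
  have "infdist (x + k) int_lattice <= infdist x int_lattice" if k: "k \<in> int_lattice" for x k
  proof -
   obtain m where m: "m \<in> int_lattice" "infdist x int_lattice = dist x m"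
    using infdist_attains_inf[OF closed_int_lattice, of x] int_lattice_zero by blast
   have "infdist (x + k) int_lattice <= dist (x + k) (m + k)" by (rule infdist_le[OF int_lattice_add[OF m(1) k]])
   then show ?thesis using m(2) by simp
  qed
  from this[OF k, of x] this[OF int_lattice_minus[OF k], of "x + k"] show ?thesis by simp
 qed
 have ch: "cper h" unfolding cper_def h_def periodic_def using c0 by (auto simp: inf_per intro!: continuous_intros)
 define \<kappa> where "\<kappa> = mean h"
 have \<kappa>: "\<kappa> > 0" unfolding \<kappa>_def
 proof (rule mean_pos[OF ch])
  show "0 <= h x" for x by (simp add: h_def)
  show "0 < h 0" using int_lattice_zero by (simp add: h_def)
 qed
 \<comment> \<open>Points reduced to the unit cell are at distance at most 4, and each step of the
   chain advances by at least c0 / 4.\<close>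
 obtain N :: nat where N: "real N >= 16 / c0" using real_arch_simple by blast
 have N4: "4 <= c0 + real N * (c0 / 4)" using N c0 by (simp add: field_simps)
 define K where "K = 1 + (real N + 1) * (2 / \<kappa>)"
 have main: "u x - u w <= K * D"
  if u: "cper u" and D: "0 < D" and hop: "!!x z. norm (z - X x) <= c0 ==> u x <= u z + D" for u D x w
 proof -
  define m where "m x = (INF z\<in>cball x c0. u z)" for x
  have min: "\<exists>z\<in>cball x c0. m x = u z & (\<forall>y\<in>cball x c0. m x <= u y)" for x
  proof -
   have "cball x c0 ~= {}" using c0 by simp
   then obtain z where z: "z \<in> cball x c0" "\<forall>y\<in>cball x c0. u z <= u y"
    using continuous_attains_inf[OF compact_cball _ cperD(1)[OF u]] by metis
   then have "m x = u z" unfolding m_def by (intro cInf_eq_minimum) auto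
   then show ?thesis using z by auto
  qed
  have m_le: "m x <= u y" if "norm (y - x) <= c0" for x y
   using min[of x] that by (auto simp: dist_norm norm_minus_commute)
  have cm: "cper m"
  proof -
   have sh: "m (x + a) <= m x + e" if e: "!!y. u (y + a) <= u y + e" for x a e
   proof -
    obtain z where z: "z \<in> cball x c0" "m x = u z" using min by blast
    have "m (x + a) <= u (z + a)" using z(1) by (intro m_le) (simp add: dist_norm norm_minus_commute)
    then show ?thesis using e[of z] z(2) by linarith
   qed
   have "periodic m" unfolding periodic_def
   proof (intro ballI allI antisym)
    fix k x :: plane assume k: "k \<in> int_lattice"
    have "u (y + k) <= u y + 0" for y using periodicD[OF cperD(2)[OF u] k, of y] by simp
    from sh[OF this] show "m (x + k) <= m x" by simp
    have "u (y + - k) <= u y + 0" for y using periodicD[OF cperD(2)[OF u] int_lattice_minus[OF k], of y] by simp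
    from sh[OF this, of "x + k"] show "m x <= m (x + k)" by simp
   qed
   moreover have "isCont m x" for x unfolding continuous_at_eps_delta
   proof (intro allI impI)
    fix e :: real assume e: "0 < e"
    obtain d where d: "d > 0" "!!x y. dist x y < d ==> dist (u x) (u y) < e / 2" using cper_uniform[OF u half_gt_zero[OF e]] by blast
    have "dist (m x') (m x) < e" if x': "dist x' x < d" for x'
    proof -
     have le: "u (y + a) <= u y + e / 2" if "norm a < d" for y a
     proof -
      have "dist (u (y + a)) (u y) < e / 2" by (rule d(2)) (use that in \<open>simp add: dist_norm\<close>)
      then show ?thesis unfolding dist_real_def by linarith
     qed
     have "m (x + (x' - x)) <= m x + e / 2" by (rule sh[OF le]) (use x' in \<open>simp add: dist_norm\<close>)
     moreover have "m (x' + (x - x')) <= m x' + e / 2" by (rule sh[OF le]) (use x' in \<open>simp add: dist_norm norm_minus_commute\<close>)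
     ultimately show ?thesis using e by (simp add: dist_real_def abs_less_iff)
    qed
    then show "EX d>0. ALL x'. dist x' x < d --> dist (m x') (m x) < e" using d(1) by blast
   qed
   ultimately show ?thesis by (simp add: cper_def continuous_at_imp_continuous_on)
  qed
  have "u x <= m (X x) + D" for x
  proof -
   obtain z where z: "z \<in> cball (X x) c0" "m (X x) = u z" using min by blast
   then show ?thesis using hop[of z x] by (simp add: dist_norm norm_minus_commute)
  qed
  then have "mean u <= mean (%x. m (X x) + D)" using X[OF cm] u by (intro mean_mono cper_add cper_const) auto
  also have "... = mean m + D" using X[OF cm] by (simp add: mean_add)
  finally have um: "mean (%x. u x - m x) <= D" using mean_diff[OF u cm] by simp
  \<comment> \<open>Twice what the mean allows: a ball of bad points would give 2 D <= D.\<close>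
  define K1 where "K1 = 2 * D / \<kappa>"
  have K1: "K1 > 0" using D \<kappa> by (simp add: K1_def)
  have good: "EX x. norm (x - z) <= c0 / 4 & u x <= m x + K1" for z
  proof (rule ccontr)
   assume "\<not> ?thesis"
   then have bad: "m x + K1 < u x" if "norm (x - z) <= c0 / 4" for x using that by (meson not_le)
   have "K1 * h (x + - z) <= u x - m x" for x
   proof (cases "h (x + - z) = 0")
    case True
    then show ?thesis using m_le[of x x] c0 by simp
   next
    case False
    then have i: "4 / c0 * infdist (x + - z) int_lattice < 1" unfolding h_def max_def by (meson diff_gt_0_iff_gt not_le order_le_less)
    obtain k where k: "k \<in> int_lattice" "infdist (x + - z) int_lattice = dist (x + - z) k"
     using infdist_attains_inf[OF closed_int_lattice, of "x + - z"] int_lattice_zero by blast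
    have "norm (x + - k - z) <= c0 / 4"
     using i c0 unfolding k(2) by (simp add: dist_norm field_simps diff_diff_eq add.commute)
    from bad[OF this] have "K1 < u (x + - k) - m (x + - k)" by linarith
    also have "... = u x - m x"
     using periodicD[OF cperD(2)[OF u] int_lattice_minus[OF k(1)]] periodicD[OF cperD(2)[OF cm] int_lattice_minus[OF k(1)]] by simp
    finally have "K1 < u x - m x" .
    moreover have "h (x + - z) <= 1" using c0 by (simp add: h_def infdist_nonneg)
    then have "K1 * h (x + - z) <= K1 * 1" using K1 by (intro mult_left_mono) auto
    ultimately show ?thesis by simp
   qed
   then have "mean (%x. K1 * h (x + - z)) <= mean (%x. u x - m x)"
    by (intro mean_mono cper_mult cper_const cper_translate[OF ch] cper_diff u cm)
   also have "mean (%x. K1 * h (x + - z)) = K1 * \<kappa>"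
    unfolding mean_cmult \<kappa>_def integral_cell_translate[OF ch] ..
   finally have "2 * D <= D" using um \<kappa> by (simp add: K1_def)
   then show False using D by simp
  qed
  have chain: "u x <= m x + K1 ==> norm (x - w) <= c0 + real n * (c0 / 4) ==> u x <= u w + (real n + 1) * K1" for n x w
  proof (induction n arbitrary: x)
   case 0
   then show ?case using m_le[of w x] by (simp add: norm_minus_commute)
  next
   case (Suc n)
   show ?case
   proof (cases "norm (x - w) <= c0")
    case True
    then have "u x <= u w + K1" using m_le[of w x] Suc.prems(1) by (simp add: norm_minus_commute)
    moreover have "0 <= real (Suc n) * K1" using K1 by simp
    ultimately show ?thesis by (simp only: distrib_right)
   next
    case False
    \<comment> \<open>A step of c0 / 2 towards w is followed by a correction of at most c0 / 4 to a
      good point. The net progress is at least c0 / 4, and the new point remains in the ball over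
      which \<open>m x\<close> is the minimum.\<close>
    define s where "s = c0 / 2 / norm (x - w)"
    have s: "0 < s" "s < 1" "s * norm (x - w) = c0 / 2"
    proof -
     have "norm (x - w) > 0" using False c0 by linarith
     then show "0 < s" "s < 1" "s * norm (x - w) = c0 / 2" using False c0 by (auto simp: s_def pos_divide_less_eq)
    qed
    define z where "z = x - s *R (x - w)"
    have zx: "norm (z - x) = c0 / 2" using s by (simp add: z_def)
    have "z - w = (1 - s) *R (x - w)" by (simp add: z_def algebra_simps)
    then have "norm (z - w) = (1 - s) * norm (x - w)" using s by simp
    then have zw: "norm (z - w) = norm (x - w) - c0 / 2" using s(3) by (simp add: algebra_simps)
    obtain x1 where x1: "norm (x1 - z) <= c0 / 4" "u x1 <= m x1 + K1" using good by blast
    have "norm (x1 - w) <= norm (x1 - z) + norm (z - w)" using norm_triangle_ineq[of "x1 - z" "z - w"] by simp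
    moreover have "real (Suc n) * (c0 / 4) = real n * (c0 / 4) + c0 / 4" by (simp add: algebra_simps)
    ultimately have "norm (x1 - w) <= c0 + real n * (c0 / 4)" using x1(1) zw Suc.prems(2) by linarith
    from Suc.IH[OF x1(2) this] have "u x1 <= u w + (real n + 1) * K1" .
    moreover have "norm (x1 - x) <= norm (x1 - z) + norm (z - x)" using norm_triangle_ineq[of "x1 - z" "z - x"] by simp
    then have "m x <= u x1" using x1(1) zx c0 by (intro m_le) linarith
    ultimately show ?thesis using Suc.prems(1) by (simp add: algebra_simps)
   qed
  qed
  obtain x0 where x0: "norm (x0 - X x) <= c0 / 4" "u x0 <= m x0 + K1" using good by blast
  obtain k1 where k1: "k1 \<in> int_lattice" "x0 + k1 \<in> cbox 0 1" using cell_reduce by blast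
  obtain k2 where k2: "k2 \<in> int_lattice" "w + k2 \<in> cbox 0 1" using cell_reduce by blast
  let ?w = "w + (k2 - k1)"
  have "x0 - ?w = (x0 + k1) - (w + k2)" by simp
  then have "norm (x0 - ?w) <= norm (x0 + k1) + norm (w + k2)" using norm_triangle_ineq4 by metis
  then have "norm (x0 - ?w) <= c0 + real N * (c0 / 4)" using cell_norm[OF k1(2)] cell_norm[OF k2(2)] N4 by linarith
  from chain[OF x0(2) this] have "u x0 <= u w + (real N + 1) * K1"
   using periodicD[OF cperD(2)[OF u] int_lattice_diff[OF k2(1) k1(1)], of w] by simp
  moreover have "u x <= u x0 + D" using x0(1) c0 by (intro hop) linarith
  moreover have "K * D = D + (real N + 1) * K1" by (simp add: K_def K1_def algebra_simps)
  ultimately show ?thesis by linarith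
 qed
 show ?thesis
 proof (intro exI[of _ K] allI impI)
  fix u :: "plane => real" and D x w
  assume a: "cper u" "0 < D" "ALL x z. norm (z - X x) <= c0 --> u x <= u z + D"
  show "u x - u w <= K * D" by (rule main[OF a(1,2)]) (use a(3) in blast)
 qed
qed

subsection \<open>Solutions of the cell problems\<close>

context lipschitz_field
begin

text \<open>The controls \<open>a\<close> of norm at most one allow the discrete trajectory to follow exactly a
 perturbation of a flow line of \<open>- V\<close> whose drift has norm at most \<open>1 / (2 * (1 + L))\<close>.\<close>

lemma scheme_reach:
 assumes u: "scheme (%a. 0) 1 p (1 / real n) u g" and n: "n > 0" "2 * (L * M) <= real n"
  and C: "!!a x. a \<in> cball 0 1 ==> - ((a + V x) \<bullet> p) <= C" "!!x. g x <= C"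
  and z: "norm (z - flow (%x. (-1) *R V x) 1 x) <= 1 / (2 * (1 + L))"
 shows "u x <= u z + 2 * C"
proof -
 interpret R: lipschitz_field "%x. (-1) *R V x" "\<bar>-1\<bar> * M" "\<bar>-1\<bar> * L" by (rule lipschitz_field_scale) simp
 let ?X = "flow (%x. (-1) *R V x)"
 define w where "w = z - ?X 1 x"
 define \<tau> where "\<tau> = 1 / real n"
 have \<tau>: "0 < \<tau>" "\<tau> * real n = 1" "\<tau> * (L * M) <= 1 / 2" using n by (auto simp: \<tau>_def pos_divide_le_eq)
 \<comment> \<open>The defect w is spread linearly over the steps, so that the path ends exactly at
   z.\<close>
 define Y where "Y j = ?X (real j * \<tau>) x + (real j * \<tau>) *R w" for j
 have w: "norm w * (1 + L) <= 1 / 2"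
 proof -
  have "norm w * (1 + L) <= 1 / (2 * (1 + L)) * (1 + L)" using z L(1) unfolding w_def by (intro mult_right_mono) auto
  also have "... = 1 / 2" using L(1) by (simp add: field_simps)
  finally show ?thesis .
 qed
 have step: "u (Y j) <= u (Y (Suc j)) + 2 * C * \<tau>" if j: "j < n" for j
 proof -
  let ?t = "real j * \<tau>"
  let ?x = "?X ?t x"
  \<comment> \<open>The control that the next step requires. Its norm is at most 1: the Euler error
    contributes at most 1/2, and so do the terms in w together with the variation of V they
    cause.\<close>
  define a where "a = (1 / \<tau>) *R (Y j - Y (Suc j)) - V (Y j)"
  have "?X (real (Suc j) * \<tau>) x = ?X \<tau> ?x" using R.flow_add[of \<tau> ?t x] by (simp add: algebra_simps)
  then have Y: "Y (Suc j) = ?X \<tau> ?x + (?t + \<tau>) *R w" by (simp add: Y_def algebra_simps)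
  have "\<tau> *R a = Y j - Y (Suc j) - \<tau> *R V (Y j)" using \<tau>(1) by (simp add: a_def scaleR_diff_right)
  then have a_eq: "\<tau> *R a = - ((?X \<tau> ?x - ?x - \<tau> *R ((-1) *R V ?x)) + \<tau> *R w + \<tau> *R (V (Y j) - V ?x))"
   unfolding Y by (simp add: Y_def[of j] algebra_simps)
  have "norm (\<tau> *R a) <= norm (?X \<tau> ?x - ?x - \<tau> *R ((-1) *R V ?x)) + norm (\<tau> *R w) + norm (\<tau> *R (V (Y j) - V ?x))"
   unfolding a_eq norm_minus_cancel by (intro order_trans[OF norm_triangle_ineq] add_mono norm_triangle_ineq order_refl)
  then have "\<tau> * norm a <= norm (?X \<tau> ?x - ?x - \<tau> *R ((-1) *R V ?x)) + \<tau> * norm w + \<tau> * norm (V (Y j) - V ?x)"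
   using \<tau>(1) by simp
  moreover have "norm (?X \<tau> ?x - ?x - \<tau> *R ((-1) *R V ?x)) <= \<tau> * (1 / 2)"
  proof -
   have "norm (?X \<tau> ?x - ?x - \<tau> *R ((-1) *R V ?x)) <= L * M * \<tau>\<^sup>2" using R.flow_Euler[of \<tau> ?x] by simp
   also have "... = \<tau> * (\<tau> * (L * M))" by (simp add: power2_eq_square)
   also have "... <= \<tau> * (1 / 2)" using \<tau> by (intro mult_left_mono) auto
   finally show ?thesis .
  qed
  moreover have "norm (V (Y j) - V ?x) <= L * norm w"
  proof -
   have "real j * \<tau> <= real n * \<tau>" using j \<tau>(1) by (intro mult_right_mono) auto
   then have t: "0 <= ?t" "?t <= 1" using \<tau> by (auto simp: mult.commute)
   have "norm (V (Y j) - V ?x) <= L * norm (Y j - ?x)" by (rule L(2))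
   also have "norm (Y j - ?x) = ?t * norm w" using t by (simp add: Y_def)
   also have "L * (?t * norm w) <= L * (1 * norm w)" using t L(1) by (intro mult_left_mono mult_right_mono) auto
   finally show ?thesis by simp
  qed
  then have "\<tau> * norm (V (Y j) - V ?x) <= \<tau> * (L * norm w)" using \<tau>(1) by (intro mult_left_mono) auto
  moreover have "\<tau> * (norm w * (1 + L)) <= \<tau> * (1 / 2)" using w \<tau>(1) by (intro mult_left_mono) auto
  ultimately have "\<tau> * norm a <= \<tau> * 1" by (simp add: algebra_simps)
  then have a1: "a \<in> cball 0 1" using \<tau>(1) by simp
  have "Y j - \<tau> *R (a + V (Y j)) = Y (Suc j)" using \<tau>(1) by (simp add: a_def)
  moreover have "u (Y j) <= step_cost (%a. 0) p \<tau> u g (Y j) a" using u a1 unfolding scheme_def \<tau>_def by blast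
  ultimately have "u (Y j) <= \<tau> * (- ((a + V (Y j)) \<bullet> p)) + u (Y (Suc j)) + \<tau> * g (Y (Suc j))"
   by (simp only: step_cost_def diff_0)
  moreover have "\<tau> * (- ((a + V (Y j)) \<bullet> p)) <= \<tau> * C" "\<tau> * g (Y (Suc j)) <= \<tau> * C"
   using C(1)[OF a1] C(2) \<tau>(1) by (intro mult_left_mono; simp)+
  ultimately show ?thesis by (simp add: algebra_simps)
 qed
 have "j <= n ==> u x <= u (Y j) + 2 * C * \<tau> * real j" for j
 proof (induction j)
  case (Suc j)
  then show ?case using step[of j] by (simp add: algebra_simps)
 qed (simp only: Y_def of_nat_0 mult_zero_left mult_zero_right R.flow_0 scaleR_zero_left add_0_right order_refl)
 from this[of n] have "u x <= u (Y n) + 2 * C * \<tau> * real n" by simp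
 moreover have "Y n = z" using \<tau>(2) by (simp add: Y_def w_def mult.commute)
 ultimately show ?thesis using \<tau>(2) by (simp add: mult.assoc)
qed

lemma control_norm: "\<exists>a\<in>cball 0 R. a \<bullet> q = R * norm q" if "0 <= R" for q :: plane
proof (cases "q = 0")
 case True
 then show ?thesis using that by (intro bexI[of _ 0]) auto
next
 case False
 then show ?thesis using that
  by (intro bexI[of _ "(R / norm q) *R q"]) (auto simp: power2_norm_eq_inner[symmetric] power2_eq_square)
qed

text \<open>The oscillation of the discounted solution v stays bounded as the discount \<mu> tends
  to zero, so \<mu> v becomes nearly constant and v itself is an approximate corrector. No limit of
  v is taken, since its modulus of continuity may deteriorate; c is a subsequential limit of - \<mu>
  v(0).\<close>

lemma approximate_front_solutions:
 assumes meas: "!!g :: plane => real. cper g ==> mean (%x. g (flow (%x. (-1) *R V x) 1 x)) = mean g"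
 shows "EX c. \<forall>\<epsilon>>0. EX G. cper G & visc_sub (%x q. norm (p + q) + V x \<bullet> (p + q)) (c + \<epsilon>) G &
  visc_super (%x q. norm (p + q) + V x \<bullet> (p + q)) (c - \<epsilon>) G"
proof -
 interpret R: lipschitz_field "%x. (-1) *R V x" "\<bar>-1\<bar> * M" "\<bar>-1\<bar> * L" by (rule lipschitz_field_scale) simp
 let ?X = "flow (%x. (-1) *R V x) 1"
 have cX: "cper (%x. g (?X x)) & mean (%x. g (?X x)) = mean g" if g: "cper g" for g :: "plane => real"
 proof -
  have "continuous_on UNIV (%x. g (?X x))"
   by (rule continuous_on_compose2[OF cperD(1)[OF g, of UNIV] R.flow_continuous_space subset_UNIV])
  moreover have "periodic (%x. g (?X x))"
   unfolding periodic_def by (intro ballI allI) (simp only: R.flow_periodic periodicD[OF cperD(2)[OF g]])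
  ultimately show ?thesis using meas[OF g] unfolding cper_def by blast
 qed
 define c0 where "c0 = 1 / (2 * (1 + L))"
 have c0: "0 < c0" using L(1) by (simp add: c0_def)
 obtain K :: real where K: "ALL u D. cper u --> 0 < D --> (ALL x z. norm (z - ?X x) <= c0 --> u x <= u z + D) --> (ALL x w. u x - u w <= K * D)"
  using oscillation_bound[OF cX c0] by blast
 define C where "C = (1 + M) * norm p + 1"
 have C1: "C >= 1" using M_nonneg by (simp add: C_def)
 have Ca: "\<bar>(a + V x) \<bullet> p\<bar> <= C" if "a \<in> cball 0 1" for a x
 proof -
  have "\<bar>(a + V x) \<bullet> p\<bar> <= norm (a + V x) * norm p" by (rule Cauchy_Schwarz_ineq2)
  also have "... <= (1 + M) * norm p" using that M[of x] by (intro mult_right_mono order_trans[OF norm_triangle_ineq]) auto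
  finally show ?thesis by (simp add: C_def)
 qed
 define P where "P \<mu> v \<longleftrightarrow> cper v & \<bar>\<mu> * v 0\<bar> <= C & (ALL x. \<bar>\<mu> * v x - \<mu> * v 0\<bar> <= \<mu> * (K * (2 * C))) &
  (ALL c. (ALL x. - (\<mu> * v x) <= c) --> visc_sub (%x q. norm (p + q) + V x \<bullet> (p + q)) c v) &
  (ALL c. (ALL x. c <= - (\<mu> * v x)) --> visc_super (%x q. norm (p + q) + V x \<bullet> (p + q)) c v)" for \<mu> v
 have disc: "EX v. P \<mu> v" if \<mu>: "0 < \<mu>" "\<mu> < 1" for \<mu>
 proof -
  have lo: "- C <= 0 - (a + V x) \<bullet> p" if "a \<in> cball 0 1" for a x using Ca[OF that, of x] by (simp add: abs_le_iff)
  have hi: "0 - V x \<bullet> p <= C" for x using Ca[of 0 x] by (simp add: abs_le_iff)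
  have one: "(0::real) <= 1" by simp
  obtain m u v where m: "strict_mono (m :: nat => nat)" and u: "!!n. cper (u n)" and v: "cper v"
   and s: "!!n. scheme (%a. 0) 1 p (1 / real (Suc (m n))) (u n) (%x. - (\<mu> * u n x))"
   and conv: "!!e. e > 0 ==> \<exists>N::nat. ALL n>=N. ALL x. \<bar>u n x - v x\<bar> <= e"
  proof (rule discount_limit[OF continuous_on_const one \<mu> lo hi])
   fix m :: "nat => nat" and u v
   assume "strict_mono m" "!!n. cper (u n)" "cper v" "!!n. scheme (%a. 0) 1 p (1 / real (Suc (m n))) (u n) (%x. - (\<mu> * u n x))"
    "!!e. e > 0 ==> \<exists>N::nat. ALL n>=N. ALL x. \<bar>u n x - v x\<bar> <= e"
   then show thesis by (rule that)
  qed
  have pt: "(%n. u n x) \<longlonglongrightarrow> v x" for x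
  proof (rule metric_LIMSEQ_I)
   fix e :: real assume e: "0 < e"
   obtain N where "ALL n>=N. ALL x. \<bar>u n x - v x\<bar> <= e / 2" using conv[OF half_gt_zero[OF e]] by blast
   then have "\<bar>u n x - v x\<bar> <= e / 2" if "N <= n" for n using that by blast
   then show "EX N. ALL n>=N. dist (u n x) (v x) < e"
    using e by (intro exI[of _ N]) (fastforce simp: dist_real_def)
  qed
  have t: "0 < 1 / real (Suc (m n))" "\<mu> * (1 / real (Suc (m n))) < 1" for n
  proof -
   show "0 < 1 / real (Suc (m n))" by simp
   have "\<mu> < real (Suc (m n))" using \<mu>(2) by simp
   then show "\<mu> * (1 / real (Suc (m n))) < 1" by simp
  qed
  have bd: "\<bar>\<mu> * u n x\<bar> <= C" for n x
   using scheme_bounds[OF continuous_on_const one u s \<mu>(1) t lo hi, of n x] by (simp add: abs_le_iff)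
  have bv: "\<bar>\<mu> * v 0\<bar> <= C"
   by (rule tendsto_upperbound[OF tendsto_rabs[OF tendsto_mult_left[OF pt]]]) (use bd in auto)
  \<comment> \<open>The reachability estimate holds once the time step is small and passes to the
    limit pointwise; its constant does not involve \<mu>.\<close>
  have hop: "v x <= v z + 2 * C" if z: "norm (z - ?X x) <= c0" for x z
  proof (rule tendsto_le[OF _ tendsto_add[OF pt[of z] tendsto_const] pt[of x]])
   obtain N :: nat where N: "2 * (L * M) <= real N" using real_arch_simple by blast
   show "eventually (%n. u n x <= u n z + 2 * C) sequentially"
   proof (rule eventually_sequentiallyI[of N])
    fix n assume "N <= n"
    then have "real N <= real (Suc (m n))" using seq_suble[OF m, of n] by simp
    then have "2 * (L * M) <= real (Suc (m n))" using N by linarith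
    moreover have "- (\<mu> * u n x) <= C" for x using bd[of n x] by (simp add: abs_le_iff)
    ultimately show "u n x <= u n z + 2 * C"
     using Ca z by (intro scheme_reach[OF s]) (auto simp: c0_def abs_le_iff)
   qed
  qed simp
  have osc: "\<bar>\<mu> * v x - \<mu> * v 0\<bar> <= \<mu> * (K * (2 * C))" for x
  proof -
   have "v x - v 0 <= K * (2 * C)" "v 0 - v x <= K * (2 * C)" using K v hop C1 by (auto simp del: mult_le_cancel_left)
   then have "\<bar>v x - v 0\<bar> <= K * (2 * C)" by linarith
   then have "\<mu> * \<bar>v x - v 0\<bar> <= \<mu> * (K * (2 * C))" using \<mu> by (intro mult_left_mono) auto
   then show ?thesis using \<mu>(1) by (simp add: right_diff_distrib[symmetric] abs_mult)
  qed
  have cg: "cper (%x. - (\<mu> * v x))" by (intro cper_minus cper_mult cper_const v)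
  have gg: "EX N. ALL n>=N. ALL x. \<bar>- (\<mu> * u n x) - - (\<mu> * v x)\<bar> <= e" if e: "0 < e" for e
  proof -
   obtain N where N: "ALL n>=N. ALL x. \<bar>u n x - v x\<bar> <= e / \<mu>" using conv[of "e / \<mu>"] e \<mu>(1) by auto
   have "\<bar>- (\<mu> * u n x) - - (\<mu> * v x)\<bar> <= e" if "N <= n" for n x
   proof -
    have "\<mu> * \<bar>u n x - v x\<bar> <= e" using N that \<mu>(1) by (simp add: pos_le_divide_eq mult.commute)
    moreover have "- (\<mu> * u n x) - - (\<mu> * v x) = - (\<mu> * (u n x - v x))" by (simp add: algebra_simps)
    ultimately show ?thesis using \<mu>(1) by (simp only: abs_minus_cancel abs_mult abs_of_pos)
   qed
   then show ?thesis by blast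
  qed
  have \<tau>0: "(%n. 1 / real (Suc (m n))) \<longlonglongrightarrow> 0"
   using LIMSEQ_subseq_LIMSEQ[OF LIMSEQ_inverse_real_of_nat m] by (simp add: o_def divide_inverse)
  have sub: "visc_sub (%x q. norm (p + q) + V x \<bullet> (p + q)) c v" if c: "!!x. - (\<mu> * v x) <= c" for c
   unfolding visc_sub_def
  proof (intro allI impI)
   fix \<phi> :: "plane => real" and x assume \<phi>: "C_k 1 \<phi>" "\<forall>\<^sub>F y in nhds x. v y - \<phi> y <= v x - \<phi> x"
   obtain a where a: "a \<in> cball 0 1" "a \<bullet> (p + grad \<phi> x) = 1 * norm (p + grad \<phi> x)" using control_norm[OF one] by blast
   show "norm (p + grad \<phi> x) + V x \<bullet> (p + grad \<phi> x) <= c"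
    using scheme_limit_sub[OF continuous_on_const one u v cg t(1) \<tau>0 s conv gg \<phi> a(1)] a(2) c[of x] by (simp add: inner_add_left)
  qed
  have super: "visc_super (%x q. norm (p + q) + V x \<bullet> (p + q)) c v" if c: "!!x. c <= - (\<mu> * v x)" for c
   unfolding visc_super_def
  proof (intro allI impI)
   fix \<phi> :: "plane => real" and x assume \<phi>: "C_k 1 \<phi>" "\<forall>\<^sub>F y in nhds x. v x - \<phi> x <= v y - \<phi> y"
   have N: "a \<bullet> q - 0 <= norm q" if "a \<in> cball 0 1" for a q :: plane
    using norm_cauchy_schwarz[of a q] mult_right_mono[of "norm a" 1 "norm q"] that by simp
   have "- (\<mu> * v x) <= norm (p + grad \<phi> x) + V x \<bullet> (p + grad \<phi> x)"
    by (rule scheme_limit_super[OF continuous_on_const one u v cg t(1) \<tau>0 s conv gg \<phi> continuous_on_norm_id N])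
   then show "c <= norm (p + grad \<phi> x) + V x \<bullet> (p + grad \<phi> x)" using c[of x] by linarith
  qed
  show ?thesis unfolding P_def using v bv osc sub super by blast
 qed
 define \<mu> where "\<mu> j = 1 / real (Suc (Suc j))" for j
 have \<mu>: "0 < \<mu> j" "\<mu> j < 1" for j by (auto simp: \<mu>_def)
 have "EX v. ALL j. P (\<mu> j) (v j)" by (intro choice allI disc \<mu>)
 then obtain v where "!!j. P (\<mu> j) (v j)" by blast
 then have v: "!!j. cper (v j)" "!!j. \<bar>\<mu> j * v j 0\<bar> <= C" "!!j x. \<bar>\<mu> j * v j x - \<mu> j * v j 0\<bar> <= \<mu> j * (K * (2 * C))"
  "!!j c. (ALL x. - (\<mu> j * v j x) <= c) ==> visc_sub (%x q. norm (p + q) + V x \<bullet> (p + q)) c (v j)"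
  "!!j c. (ALL x. c <= - (\<mu> j * v j x)) ==> visc_super (%x q. norm (p + q) + V x \<bullet> (p + q)) c (v j)"
  unfolding P_def by blast+
 have "bounded (range (%j. - (\<mu> j * v j 0)))" using v(2) by (intro boundedI[of _ C]) auto
 then obtain c r where r: "strict_mono r" "((%j. - (\<mu> j * v j 0)) \<circ> r) \<longlonglongrightarrow> c"
  using bounded_imp_convergent_subsequence by blast
 have "\<mu> \<longlonglongrightarrow> 0" unfolding \<mu>_def using LIMSEQ_Suc[OF LIMSEQ_inverse_real_of_nat] by (simp add: divide_inverse)
 then have "(%j. \<mu> (r j) * (K * (2 * C))) \<longlonglongrightarrow> 0 * (K * (2 * C))"
  using LIMSEQ_subseq_LIMSEQ[OF _ r(1)] by (intro tendsto_mult_right) (simp add: o_def)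
 then have d0: "(%j. \<mu> (r j) * (K * (2 * C))) \<longlonglongrightarrow> 0" by simp
 have "EX G. cper G & visc_sub (%x q. norm (p + q) + V x \<bullet> (p + q)) (c + \<epsilon>) G &
  visc_super (%x q. norm (p + q) + V x \<bullet> (p + q)) (c - \<epsilon>) G" if \<epsilon>: "0 < \<epsilon>" for \<epsilon>
 proof -
  have "eventually (%j. dist (((%j. - (\<mu> j * v j 0)) \<circ> r) j) c < \<epsilon> / 2) sequentially"
   by (rule tendstoD[OF r(2) half_gt_zero[OF \<epsilon>]])
  moreover have "eventually (%j. dist (\<mu> (r j) * (K * (2 * C))) 0 < \<epsilon> / 2) sequentially"
   by (rule tendstoD[OF d0 half_gt_zero[OF \<epsilon>]])
  ultimately obtain j where j: "dist (- (\<mu> (r j) * v (r j) 0)) c < \<epsilon> / 2" "dist (\<mu> (r j) * (K * (2 * C))) 0 < \<epsilon> / 2"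
   using eventually_happens'[OF sequentially_bot eventually_conj] by (auto simp: o_def)
  have "\<bar>- (\<mu> (r j) * v (r j) x) - c\<bar> <= \<epsilon>" for x
   using v(3)[of "r j" x] j unfolding dist_real_def by linarith
  then have b: "- (\<mu> (r j) * v (r j) x) <= c + \<epsilon>" "c - \<epsilon> <= - (\<mu> (r j) * v (r j) x)" for x by (simp_all add: abs_le_iff algebra_simps)
  show ?thesis using v(1) v(4)[of "r j" "c + \<epsilon>"] v(5)[of "c - \<epsilon>" "r j"] b by blast
 qed
 then show ?thesis by blast
qed

end

section \<open>The cell problem with quadratic Hamiltonian\<close>

context lipschitz_field
begin

lemma scheme_shift: "scheme cost R p \<tau> u g ==> scheme cost R p \<tau> (%x. u x - b) g"
proof -
 have "step_cost cost p \<tau> (%x. u x - b) g x a = step_cost cost p \<tau> u g x a - b" for x a by (simp add: step_cost_def)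
 then show "scheme cost R p \<tau> u g ==> scheme cost R p \<tau> (%x. u x - b) g" unfolding scheme_def by simp
qed

text \<open>The bound on the controls is so large that it does not affect the Legendre transform of
 \<open>(norm a)\<^sup>2 / 4\<close> on the gradients that occur, and every displacement of norm at most \<open>\<tau>\<close> is
 realised by a single step.\<close>

lemma quadratic_cell_solution:
 "EX c F. cper F & visc_sub (%x q. (norm (p + q))\<^sup>2 + V x \<bullet> (p + q)) c F &
  visc_super (%x q. (norm (p + q))\<^sup>2 + V x \<bullet> (p + q)) c F"
proof -
 define C0 where "C0 = (norm p)\<^sup>2 + M * norm p"
 have C0: "0 <= C0" using M_nonneg by (simp add: C0_def)
 \<comment> \<open>Yields \<open>C0 + R\<^sup>2 / 4 <= (R - M) * (R / 2)\<close>. Testing with a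
   control of norm R then bounds the occurring gradients q by R / 2, so the optimal control 2 q is
   admissible.\<close>
 define R where "R = 2 * M + 2 + 4 * C0"
 have R: "0 <= R" "1 + M <= R" using M_nonneg C0 by (auto simp: R_def)
 define cost where "cost a = (norm a)\<^sup>2 / 4" for a :: plane
 have cc: "continuous_on (cball 0 R) cost" unfolding cost_def by (intro continuous_intros) auto
 have Vp: "\<bar>V x \<bullet> p\<bar> <= M * norm p" for x
  using order_trans[OF Cauchy_Schwarz_ineq2 mult_right_mono[OF M[of x] norm_ge_zero[of p]]] .
 have quad: "a \<bullet> q - cost a <= (norm q)\<^sup>2" for a q :: plane
 proof -
  have "0 <= (norm a / 2 - norm q)\<^sup>2" by simp
  then show ?thesis using norm_cauchy_schwarz[of a q] by (simp add: cost_def power2_eq_square algebra_simps)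
 qed
 have lo: "- C0 <= cost a - (a + V x) \<bullet> p" for a x
  using quad[of a p] Vp[of x] by (simp add: C0_def inner_add_left abs_le_iff)
 have hi: "cost 0 - V x \<bullet> p <= C0" for x
 proof -
  have "0 <= (norm p)\<^sup>2" "cost 0 = 0" by (simp_all add: cost_def)
  then show ?thesis using abs_le_D2[OF Vp[of x]] unfolding C0_def by linarith
 qed
 \<comment> \<open>One sequence serves as time step and as discount. Controls that outweigh the
   drift give a Lipschitz bound up to the error \<open>t n\<close>, independent of the discount, so
   both may vanish together and the limit is an exact solution.\<close>
 define t where "t n = 1 / real (Suc (Suc n))" for n
 have t: "0 < t n" "t n <= 1" "t n * t n < 1" for n
 proof -
  show "0 < t n" "t n <= 1" by (auto simp: t_def)
  have "t n < 1" by (simp add: t_def)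
  then have "t n * t n < 1 * 1" using \<open>0 < t n\<close> by (intro mult_strict_mono) auto
  then show "t n * t n < 1" by simp
 qed
 have t0: "t \<longlonglongrightarrow> 0" unfolding t_def using LIMSEQ_Suc[OF LIMSEQ_inverse_real_of_nat] by (simp add: divide_inverse)
 have "EX u. cper u & scheme cost R p (t n) u (%x. - (t n * u x))" for n
  by (rule scheme_exists[OF cc R(1) t(1,1,3)]) blast
 then obtain u where u: "!!n. cper (u n)" "!!n. scheme cost R p (t n) (u n) (%x. - (t n * u n x))" by metis
 have bd: "\<bar>t n * u n x\<bar> <= C0" for n x
  using scheme_bounds[OF cc R(1) u t(1,1,3) lo hi, of n x] by (simp add: abs_le_iff)
 define K where "K = R\<^sup>2 / 4 + norm p + C0"
 have K: "0 <= K" using C0 by (simp add: K_def)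
 have step: "u n x <= u n (x - z) + t n * K" if z: "norm z <= t n" for n x z
 proof -
  \<comment> \<open>Cancels the drift and moves by -z in one step; admissible because 1 + M <=
    R.\<close>
  define a where "a = (1 / t n) *R z - V x"
  have z1: "norm ((1 / t n) *R z) <= 1" using z t(1)[of n] by (simp add: pos_divide_le_eq)
  then have aR: "norm a <= R"
   using norm_triangle_ineq4[of "(1 / t n) *R z" "V x"] M[of x] R(2) unfolding a_def by linarith
  then have cst: "cost a <= R\<^sup>2 / 4" unfolding cost_def by (intro divide_right_mono power_mono) auto
  have aV: "a + V x = (1 / t n) *R z" by (simp add: a_def)
  have "- ((a + V x) \<bullet> p) <= norm (a + V x) * norm p" using Cauchy_Schwarz_ineq2[of "a + V x" p] by linarith
  also have "... <= 1 * norm p" unfolding aV using z1 by (rule mult_right_mono) simp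
  finally have dp: "- ((a + V x) \<bullet> p) <= norm p" by simp
  have pt: "x - t n *R (a + V x) = x - z" using t(1)[of n] by (simp add: aV)
  have "u n x <= step_cost cost p (t n) (u n) (%x. - (t n * u n x)) x a" using u(2)[of n] aR unfolding scheme_def by simp
  then have "u n x <= u n (x - z) + t n * (cost a - (a + V x) \<bullet> p - t n * u n (x - z))"
   unfolding step_cost_def pt by (simp add: algebra_simps)
  also have "t n * (cost a - (a + V x) \<bullet> p - t n * u n (x - z)) <= t n * K"
   using cst dp bd[of n "x - z"] t(1)[of n] unfolding K_def by (intro mult_left_mono) (auto simp: abs_le_iff)
  finally show ?thesis by simp
 qed
 have chain: "norm (x - y) <= real j * t n ==> u n x <= u n y + real j * (t n * K)" for n j x y
 proof (induction j arbitrary: x)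
  case (Suc j)
  define z where "z = (1 / real (Suc j)) *R (x - y)"
  have "norm z <= t n" using Suc.prems by (simp add: z_def pos_divide_le_eq mult.commute del: of_nat_Suc)
  moreover have "norm (x - z - y) <= real j * t n"
  proof -
   have "x - z - y = (1 - 1 / real (Suc j)) *R (x - y)" by (simp add: z_def algebra_simps)
   also have "1 - 1 / real (Suc j) = real j / real (Suc j)" by (simp add: field_simps)
   finally have "norm (x - z - y) = real j / real (Suc j) * norm (x - y)" by simp
   also have "... <= real j / real (Suc j) * (real (Suc j) * t n)" using Suc.prems by (intro mult_left_mono) auto
   also have "... = real j * t n" by (simp del: of_nat_Suc)
   finally show ?thesis .
  qed
  ultimately show ?case using step[of z n x] Suc.IH[of "x - z"] by (simp add: algebra_simps)
 qed simp
 have lip: "\<bar>u n x - u n y\<bar> <= K * (norm (x - y) + t n)" for n x y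
 proof -
  have le: "u n x - u n y <= K * (norm (x - y) + t n)" for x y
  proof -
   define j where "j = nat \<lceil>norm (x - y) / t n\<rceil>"
   have "0 <= norm (x - y) / t n" using t(1)[of n] by simp
   then have "norm (x - y) / t n <= real j" "real j <= norm (x - y) / t n + 1" unfolding j_def by linarith+
   then have j: "norm (x - y) <= real j * t n" "real j * t n <= norm (x - y) + t n"
    using t(1)[of n] by (auto simp: field_simps)
   have "u n x - u n y <= K * (real j * t n)" using chain[OF j(1)] by (simp add: algebra_simps)
   also have "... <= K * (norm (x - y) + t n)" using j(2) K by (rule mult_left_mono)
   finally show ?thesis .
  qed
  show ?thesis using le[of x y] le[of y x] by (simp add: abs_le_iff norm_minus_commute)
 qed
 define F where "F n x = u n x - u n 0" for n x
 have F: "cper (F n)" for n unfolding F_def by (intro cper_diff cper_const u(1))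
 have Fb: "\<bar>F n x\<bar> <= 3 * K" for n x
 proof -
  obtain k where k: "k \<in> int_lattice" "x + k \<in> cbox 0 1" using cell_reduce by blast
  have "\<bar>F n x\<bar> <= K * (norm (x + k - 0) + t n)"
   using lip[of n "x + k" 0] periodicD[OF cperD(2)[OF u(1)] k(1)] by (simp add: F_def)
  also have "... <= K * 3" using cell_norm[OF k(2)] t(2)[of n] K by (intro mult_left_mono) auto
  finally show ?thesis by simp
 qed
 have half: "x / (2 * y) + x / (2 * y) = x / y" for x y :: real by (cases "y = 0") (auto simp: field_simps)
 have eq: "EX d>0. ALL n x y. dist x y < d --> \<bar>F n x - F n y\<bar> < e" if e: "0 < e" for e
 proof -
  have eK: "0 < e / (2 * (K + 1))" using e K by simp
  \<comment> \<open>The error \<open>t n\<close> in the Lipschitz estimate is harmless only for n >=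
    N; the finitely many remaining functions are uniformly continuous one by one.\<close>
  obtain N where N: "!!n. n >= N ==> dist (t n) 0 < e / (2 * (K + 1))"
   using t0 eK unfolding lim_sequentially by blast
  have "EX d>0. ALL x y. dist x y < d --> dist (u n x) (u n y) < e" for n by (rule cper_uniform[OF u(1) e])
  then obtain d where d: "!!n. d n > 0" "!!n x y. dist x y < d n ==> dist (u n x) (u n y) < e" by metis
  define d0 where "d0 = Min (insert (e / (2 * (K + 1))) (d ` {..<N}))"
  have d0: "d0 > 0" unfolding d0_def using eK d(1) by (subst Min_gr_iff) auto
  have "\<bar>F n x - F n y\<bar> < e" if xy: "dist x y < d0" for n x y
  proof (cases "n < N")
   case True
   then have "d0 <= d n" unfolding d0_def by (intro Min_le) auto
   then show ?thesis using d(2)[of x y n] xy by (simp add: F_def dist_real_def)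
  next
   case False
   have "d0 <= e / (2 * (K + 1))" unfolding d0_def by (intro Min_le) auto
   then have "norm (x - y) + t n < e / (2 * (K + 1)) + e / (2 * (K + 1))"
    using xy N[of n] False t(1)[of n] by (simp add: dist_norm)
   also have "... = e / (K + 1)" by (rule half)
   finally have "(norm (x - y) + t n) * (K + 1) < e" using K by (simp add: pos_less_divide_eq)
   moreover have "K * (norm (x - y) + t n) <= (norm (x - y) + t n) * (K + 1)"
    using t(1)[of n] by (simp add: algebra_simps)
   ultimately show ?thesis using lip[of n x y] by (simp add: F_def)
  qed
  then show ?thesis using d0 by blast
 qed
 have "bounded (range (%n. - (t n * u n 0)))" using bd by (intro boundedI[of _ C0]) auto
 then obtain c r where r: "strict_mono r" "((%n. - (t n * u n 0)) \<circ> r) \<longlonglongrightarrow> c"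
  using bounded_imp_convergent_subsequence by blast
 have eqr: "EX d>0. ALL n x y. dist x y < d --> \<bar>F (r n) x - F (r n) y\<bar> < e" if e: "0 < e" for e using eq[OF e] by blast
 obtain G k where G: "cper G" "strict_mono (k :: nat => nat)"
  "!!e. e > 0 ==> EX N. ALL n>=N. ALL x. \<bar>F (r (k n)) x - G x\<bar> <= e"
 proof (rule cper_Arzela_Ascoli[of "%n. F (r n)", OF F Fb eqr])
  fix G and k :: "nat => nat"
  assume "cper G" "strict_mono k" "!!e. e > 0 ==> EX N. ALL n>=N. ALL x. \<bar>F (r (k n)) x - G x\<bar> <= e"
  then show thesis by (rule that)
 qed
 let ?s = "%n. r (k n)"
 let ?g = "%n x. - (t (?s n) * u (?s n) x)"
 have ts: "(%n. t (?s n)) \<longlonglongrightarrow> 0"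
  using LIMSEQ_subseq_LIMSEQ[OF LIMSEQ_subseq_LIMSEQ[OF t0 r(1)] G(2)] by (simp add: o_def)
 have cs: "(%n. - (t (?s n) * u (?s n) 0)) \<longlonglongrightarrow> c" using LIMSEQ_subseq_LIMSEQ[OF r(2) G(2)] by (simp add: o_def)
 have gg: "EX N. ALL n>=N. ALL x. \<bar>?g n x - c\<bar> <= e" if e: "0 < e" for e
 proof -
  have "(%n. t (?s n) * (3 * K)) \<longlonglongrightarrow> 0 * (3 * K)" by (intro tendsto_intros ts)
  then have "eventually (%n. dist (t (?s n) * (3 * K)) 0 < e / 2) sequentially" using tendstoD half_gt_zero[OF e] by fastforce
  moreover have "eventually (%n. dist (- (t (?s n) * u (?s n) 0)) c < e / 2) sequentially"
   by (rule tendstoD[OF cs half_gt_zero[OF e]])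
  ultimately have "eventually (%n. ALL x. \<bar>?g n x - c\<bar> <= e) sequentially"
  proof eventually_elim
   case (elim n)
   have "\<bar>?g n x - c\<bar> <= e" for x
   proof -
    have "t (?s n) * \<bar>F (?s n) x\<bar> <= t (?s n) * (3 * K)" using Fb t(1)[of "?s n"] by (intro mult_left_mono) auto
    moreover have "\<bar>t (?s n) * F (?s n) x\<bar> = t (?s n) * \<bar>F (?s n) x\<bar>" using t(1)[of "?s n"] by (simp add: abs_mult)
    ultimately have "\<bar>t (?s n) * F (?s n) x\<bar> <= e / 2" using elim(1) unfolding dist_real_def by linarith
    moreover have "?g n x - c = (- (t (?s n) * u (?s n) 0) - c) - t (?s n) * F (?s n) x" by (simp add: F_def algebra_simps)
    ultimately show ?thesis using elim(2) unfolding dist_real_def by linarith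
   qed
   then show ?case by blast
  qed
  then show ?thesis by (simp add: eventually_sequentially)
 qed
 have sch: "scheme cost R p (t (?s n)) (F (?s n)) (?g n)" for n unfolding F_def by (rule scheme_shift[OF u(2)])
 have cC: "c <= C0"
  by (rule tendsto_upperbound[OF cs]) (use bd in \<open>auto simp: abs_le_iff\<close>)
 note lim = cc R(1) F G(1) cper_const t(1) ts sch G(3) gg
 have "visc_sub (%x q. (norm (p + q))\<^sup>2 + V x \<bullet> (p + q)) c G"
  unfolding visc_sub_def
 proof (intro allI impI)
  fix \<phi> :: "plane => real" and x assume \<phi>: "C_k 1 \<phi>" "\<forall>\<^sub>F y in nhds x. G y - \<phi> y <= G x - \<phi> x"
  let ?q = "p + grad \<phi> x"
  have sub: "(a + V x) \<bullet> ?q - cost a <= c" if "a \<in> cball 0 R" for a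
   by (rule scheme_limit_sub[OF lim \<phi> that])
  obtain a where a: "a \<in> cball 0 R" "a \<bullet> ?q = R * norm ?q" using control_norm[OF R(1)] by blast
  have "norm a <= R" using a(1) by simp
  then have "cost a <= R\<^sup>2 / 4" unfolding cost_def by (intro divide_right_mono power_mono) auto
  moreover have "- (M * norm ?q) <= V x \<bullet> ?q"
   using Cauchy_Schwarz_ineq2[of "V x" ?q] mult_right_mono[OF M[of x] norm_ge_zero[of ?q]] by linarith
  ultimately have "R * norm ?q - M * norm ?q <= C0 + R\<^sup>2 / 4" using sub[OF a(1)] a(2) cC unfolding inner_add_left by linarith
  moreover have "C0 + R\<^sup>2 / 4 <= (R - M) * (R / 2)"
  proof -
   have "C0 * 1 <= C0 * R" using C0 R M_nonneg by (intro mult_left_mono) linarith+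
   moreover have "R\<^sup>2 / 4 = R * M / 2 + R * 2 / 4 + C0 * R" by (simp add: power2_eq_square R_def field_simps)
   moreover have "(R - M) * (R / 2) = R\<^sup>2 / 4 + (R\<^sup>2 / 4 - R * M / 2)" by (simp add: power2_eq_square field_simps)
   ultimately show ?thesis using R(1) by linarith
  qed
  ultimately have "(R - M) * norm ?q <= (R - M) * (R / 2)" by (simp add: algebra_simps)
  then have "norm ?q <= R / 2" using R(2) mult_le_cancel_left_pos[of "R - M"] by simp
  then have "2 *R ?q \<in> cball 0 R" unfolding mem_cball_0 norm_scaleR by simp
  note sub[OF this, unfolded inner_add_left[of "2 *R ?q"]]
  moreover have leg: "(2 *R q) \<bullet> q - cost (2 *R q) = (norm q)\<^sup>2" for q :: plane
   by (simp add: cost_def power_mult_distrib) (simp add: power2_norm_eq_inner)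
  ultimately show "(norm ?q)\<^sup>2 + V x \<bullet> ?q <= c" using leg[of ?q] by linarith
 qed
 moreover have "visc_super (%x q. (norm (p + q))\<^sup>2 + V x \<bullet> (p + q)) c G"
  unfolding visc_super_def
 proof (intro allI impI)
  fix \<phi> :: "plane => real" and x assume \<phi>: "C_k 1 \<phi>" "\<forall>\<^sub>F y in nhds x. G x - \<phi> x <= G y - \<phi> y"
  have "continuous_on UNIV (%q :: plane. (norm q)\<^sup>2)" by (intro continuous_intros)
  from scheme_limit_super[OF lim \<phi> this quad] show "c <= (norm (p + grad \<phi> x))\<^sup>2 + V x \<bullet> (p + grad \<phi> x)" .
 qed
 ultimately show ?thesis using G(1) by blast
qed

end

subsection \<open>The effective Hamiltonians and the front speeds\<close>

text \<open>At a minimum of the difference, the periodic C^1 function touches the supersolution from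
  below up to a constant. This is the upper bound of the inf-max formula.\<close>

lemma visc_super_le_test:
 assumes G: "cper G" "visc_super H c G" and \<Phi>: "C_k 1 \<Phi>" "periodic \<Phi>" and K: "!!x. H x (grad \<Phi> x) <= K"
 shows "c <= K"
proof -
 have "cper (%x. G x - \<Phi> x)" using G(1) C_k_cper[OF \<Phi>] by (rule cper_diff)
 then obtain x where "!!y. G x - \<Phi> x <= G y - \<Phi> y" using cper_attains_inf by blast
 from visc_superD[OF G(2) \<Phi>(1) this] show ?thesis using K[of x] by linarith
qed

context incompressible_flow
begin

context
 fixes A :: real assumes A: "0 < A"
begin

text \<open>The time-one map of the reversed, scaled field is the flow of V at time -A, so measure
  preservation carries over to it.\<close>

lemma scaled_flow: "lipschitz_field (%x. A *R V x) (\<bar>A\<bar> * M) (\<bar>A\<bar> * L)" "flow (%x. (-1) *R (A *R V x)) 1 x = flow V (- A) x"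
proof -
 show "lipschitz_field (%x. A *R V x) (\<bar>A\<bar> * M) (\<bar>A\<bar> * L)" using A by (intro lipschitz_field_scale) simp
 interpret R: lipschitz_field "%x. (- A) *R V x" "\<bar>- A\<bar> * M" "\<bar>- A\<bar> * L" using A by (intro lipschitz_field_scale) simp
 have "(%x. (-1) *R (A *R V x)) = (%x. (- A) *R V x)" by simp
 then show "flow (%x. (-1) *R (A *R V x)) 1 x = flow V (- A) x"
  using R.flow_eq[OF flow_line_reverse[OF flow_line_flow[of x]], of x 1] by (simp only: mult_zero_right flow_0 mult_1_right)
qed

text \<open>Existence together with uniqueness, the latter by comparison, ensures that the definite
  description denotes.\<close>

lemma alpha_solution:
 assumes \<epsilon>: "0 < \<epsilon>"
 shows "EX G. continuous_on UNIV G & periodic G &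
  visc_sub (%x q. norm (p + q) + A * (V x \<bullet> (p + q))) (alpha V A p + \<epsilon>) G &
  visc_super (%x q. norm (p + q) + A * (V x \<bullet> (p + q))) (alpha V A p - \<epsilon>) G"
proof -
 interpret S: lipschitz_field "%x. A *R V x" "\<bar>A\<bar> * M" "\<bar>A\<bar> * L" by (rule scaled_flow)
 let ?P = "%c. \<forall>\<epsilon>>0. EX G. continuous_on UNIV G & periodic G &
  visc_sub (%x q. norm (p + q) + A * (V x \<bullet> (p + q))) (c + \<epsilon>) G &
  visc_super (%x q. norm (p + q) + A * (V x \<bullet> (p + q))) (c - \<epsilon>) G"
 have "mean (%x. g (flow (%x. (-1) *R (A *R V x)) 1 x)) = mean g" if "cper g" for g :: "plane => real"
  unfolding scaled_flow(2) by (rule flow_measure_preserving[OF that])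
 from S.approximate_front_solutions[OF this, of p] obtain c where c: "?P c" unfolding inner_scaleR_left cper_def by blast
 have le: "c2 <= c1" if "?P c1" "?P c2" for c1 c2
 proof (rule field_le_epsilon)
  fix e :: real assume e: "0 < e"
  obtain G1 where G1: "cper G1" "visc_sub (%x q. norm (p + q) + A * (V x \<bullet> (p + q))) (c1 + e / 2) G1"
   using \<open>?P c1\<close> half_gt_zero[OF e] unfolding cper_def by blast
  obtain G2 where G2: "cper G2" "visc_super (%x q. norm (p + q) + A * (V x \<bullet> (p + q))) (c2 - e / 2) G2"
   using \<open>?P c2\<close> half_gt_zero[OF e] unfolding cper_def by blast
  have "c2 - e / 2 <= c1 + e / 2"
   by (rule viscosity_comparison[OF S.L G1(1) _ G2(1), of norm p]) (use G1(2) G2(2) in \<open>simp_all only: inner_scaleR_left\<close>)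
  then show "c2 <= c1 + e" by simp
 qed
 have "\<exists>!c. ?P c" using c le by (intro ex1I[of _ c]) (auto intro: antisym)
 from theI'[OF this] show ?thesis using \<epsilon> unfolding alpha_def by blast
qed

lemma beta_solution:
 "EX F. cper F & visc_sub (%x q. (norm (p + q))\<^sup>2 + A * (V x \<bullet> (p + q))) (beta V A p) F &
  visc_super (%x q. (norm (p + q))\<^sup>2 + A * (V x \<bullet> (p + q))) (beta V A p) F"
proof -
 interpret S: lipschitz_field "%x. A *R V x" "\<bar>A\<bar> * M" "\<bar>A\<bar> * L" by (rule scaled_flow)
 let ?P = "%c. EX F. continuous_on UNIV F & periodic F &
  visc_sub (%x q. (norm (p + q))\<^sup>2 + A * (V x \<bullet> (p + q))) c F &
  visc_super (%x q. (norm (p + q))\<^sup>2 + A * (V x \<bullet> (p + q))) c F"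
 from S.quadratic_cell_solution[of p] obtain c where c: "?P c" unfolding inner_scaleR_left cper_def by blast
 have le: "c2 <= c1" if "?P c1" "?P c2" for c1 c2
 proof -
  obtain G1 where G1: "cper G1" "visc_sub (%x q. (norm (p + q))\<^sup>2 + A * (V x \<bullet> (p + q))) c1 G1"
   using \<open>?P c1\<close> unfolding cper_def by blast
  obtain G2 where G2: "cper G2" "visc_super (%x q. (norm (p + q))\<^sup>2 + A * (V x \<bullet> (p + q))) c2 G2"
   using \<open>?P c2\<close> unfolding cper_def by blast
  show ?thesis
   by (rule viscosity_comparison[OF S.L G1(1) _ G2(1), of "%q. (norm q)\<^sup>2" p]) (use G1(2) G2(2) in \<open>simp_all only: inner_scaleR_left\<close>)
 qed
 have "\<exists>!c. ?P c" using c le by (intro ex1I[of _ c]) (auto intro: antisym)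
 from theI'[OF this] show ?thesis unfolding beta_def cper_def by blast
qed

lemma alpha_le:
 assumes \<Phi>: "C_k 1 \<Phi>" "periodic \<Phi>" and K: "!!x. norm (p + grad \<Phi> x) + A * (V x \<bullet> (p + grad \<Phi> x)) <= K"
 shows "alpha V A p <= K"
proof (rule field_le_epsilon)
 fix e :: real assume "0 < e"
 then obtain G where "cper G" "visc_super (%x q. norm (p + q) + A * (V x \<bullet> (p + q))) (alpha V A p - e) G"
  using alpha_solution unfolding cper_def by blast
 from visc_super_le_test[OF this \<Phi> K] show "alpha V A p <= K + e" by simp
qed

lemma beta_le:
 assumes \<Phi>: "C_k 1 \<Phi>" "periodic \<Phi>" and K: "!!x. (norm (p + grad \<Phi> x))\<^sup>2 + A * (V x \<bullet> (p + grad \<Phi> x)) <= K"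
 shows "beta V A p <= K"
proof -
 obtain F where "cper F" "visc_super (%x q. (norm (p + q))\<^sup>2 + A * (V x \<bullet> (p + q))) (beta V A p) F"
  using beta_solution by blast
 from visc_super_le_test[OF this \<Phi> K] show ?thesis .
qed

text \<open>Bounds the quotients in the definition of \<open>gamma\<close> from below, so that their
  infimum lies below each of them.\<close>

lemma beta_ge: "(norm p)\<^sup>2 - A * M * norm p <= beta V A p"
proof -
 obtain F where F: "cper F" "visc_sub (%x q. (norm (p + q))\<^sup>2 + A * (V x \<bullet> (p + q))) (beta V A p) F"
  using beta_solution by blast
 obtain x where "!!y. F y - 0 <= F x - 0" using cper_attains_sup[OF F(1)] by auto
 from visc_subD[OF F(2) C_k_const this] have "(norm p)\<^sup>2 + A * (V x \<bullet> p) <= beta V A p" by (simp add: grad_def)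
 moreover have "- (M * norm p) <= V x \<bullet> p"
  using Cauchy_Schwarz_ineq2[of "V x" p] mult_right_mono[OF M[of x] norm_ge_zero[of p]] by linarith
 then have "A * - (M * norm p) <= A * (V x \<bullet> p)" using A by (intro mult_left_mono) auto
 ultimately show ?thesis by simp
qed

lemma gamma_le:
 assumes f0: "0 < deriv01 f 0" shows "gamma V f A p <= deriv01 f 0 + beta V A p"
proof -
 have "bdd_below ((%l. (deriv01 f 0 + beta V A (l *R p)) / l) ` {0<..})"
 proof (rule bdd_belowI2[of _ "- (A * M * norm p)"])
  fix l :: real assume "l \<in> {0<..}"
  then have l: "0 < l" by simp
  have "0 <= (norm (l *R p))\<^sup>2" "A * M * norm (l *R p) = (A * M * norm p) * l" using l by simp_all
  then have "- (A * M * norm p) * l <= deriv01 f 0 + beta V A (l *R p)"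
   using beta_ge[of "l *R p"] f0 unfolding mult_minus_left by linarith
  then show "- (A * M * norm p) <= (deriv01 f 0 + beta V A (l *R p)) / l" using l by (simp add: pos_le_divide_eq)
 qed
 from cINF_lower[OF this, of 1] show ?thesis unfolding gamma_def by simp
qed

end

text \<open>In the plane p and q are both orthogonal to k, so p = s q with |s| = 1 / |q|, and s
  \<Phi> is a test function with V . (p + D(s \<Phi>)) = 0. The terms with A vanish identically,
  which makes the bounds uniform.\<close>

lemma periodic_orbit_case_ii:
 assumes f0: "0 < deriv01 f 0" and \<xi>: "flow_line V \<xi>" and T: "0 < T" and k: "k = \<xi> T - \<xi> 0" "k \<in> int_lattice" "k ~= 0"
 shows "case_ii V f (k /\<^sub>R T)"
proof -
 have orth: "p \<bullet> (k /\<^sub>R T) = 0 \<longleftrightarrow> p \<bullet> k = 0" for p using T by simp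
 obtain q \<Phi> where \<Phi>: "C_k 2 \<Phi>" "periodic \<Phi>" and q: "q ~= 0" "q \<bullet> k = 0" and V\<Phi>: "!!x. V x \<bullet> (q + grad \<Phi> x) = 0"
  by (rule tube_functions[OF \<xi> T k]) (rule that)
 have \<Phi>1: "C_k 1 \<Phi>" by (rule C_k_mono[OF \<Phi>(1)]) simp
 have "cper (grad \<Phi>)" "cper (laplacian \<Phi>)" using \<Phi> cper_grad[of 0 \<Phi>] \<Phi>1 cper_laplacian[of 0 \<Phi>] by (auto simp: numeral_2_eq_2)
 then obtain B1 B2 where B: "B1 > 0" "B2 > 0" "!!x. norm (grad \<Phi> x) <= B1" "!!x. norm (laplacian \<Phi> x) <= B2"
  using cper_bounded by meson
 define \<sigma> where "\<sigma> = 1 / norm q"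
 have \<sigma>: "0 < \<sigma>" using q(1) by (simp add: \<sigma>_def)
 define a where "a = 1 + \<sigma> * B1"
 have a: "1 <= a" using \<sigma> B(1) by (simp add: a_def)
 define C where "C = deriv01 f 0 + a + a\<^sup>2 + \<sigma> * B2"
 have bounds: "alpha V A p <= C & beta V A p <= C & gamma V f A p <= C & kappa V A p <= C & flame_speed V f A p <= C"
  if A: "0 < A" and p: "norm p = 1" "p \<bullet> k = 0" for A p
 proof -
  obtain s1 s2 where s12: "q = s1 *R rot k" "p = s2 *R rot k" using perp_multiple_rot[OF _ k(3)] q(2) p(2) by metis
  define s where "s = s2 / s1"
  have ps: "p = s *R q" using q(1) s12 by (auto simp: s_def)
  have s: "\<bar>s\<bar> = \<sigma>" using p(1) q(1) unfolding ps \<sigma>_def by (simp add: field_simps)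
  define v where "v x = s * \<Phi> x" for x
  have v: "C_k 2 v" "C_k 1 v" unfolding v_def by (intro C_k_mult C_k_const \<Phi> \<Phi>1)+
  have vp: "periodic v" using \<Phi>(2) by (simp add: v_def periodic_def)
  have dv: "dir_deriv b v = (%x. s * dir_deriv b \<Phi> x)" for b
   using dir_deriv_linear[OF bounded_linear_mult_right[of s], of \<Phi>] \<Phi>1 unfolding v_def by auto
  have gv: "grad v x = s *R grad \<Phi> x" for x unfolding grad_def dv by (simp add: scaleR_sum_right)
  have lv: "laplacian v x = s * laplacian \<Phi> x" for x
  proof -
   have "dir_deriv b (dir_deriv b v) x = s * dir_deriv b (dir_deriv b \<Phi>) x" if "b \<in> Basis" for b
    unfolding dv using dir_deriv_linear[OF bounded_linear_mult_right[of s], of "dir_deriv b \<Phi>" x b] \<Phi>(1) that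
    by (simp add: numeral_2_eq_2)
   then show ?thesis unfolding laplacian_def by (simp add: sum_distrib_left)
  qed
  have Vv: "V x \<bullet> (p + grad v x) = 0" for x
  proof -
   have "p + grad v x = s *R (q + grad \<Phi> x)" unfolding gv ps by (simp add: scaleR_add_right)
   then show ?thesis using V\<Phi>[of x] by simp
  qed
  have na: "norm (p + grad v x) <= a" for x
  proof -
   have "norm (p + grad v x) <= norm p + norm (grad v x)" by (rule norm_triangle_ineq)
   also have "norm (grad v x) <= \<sigma> * B1" unfolding gv norm_scaleR s using B(3)[of x] \<sigma> by (intro mult_left_mono) auto
   finally show ?thesis using p(1) by (simp add: a_def)
  qed
  have na2: "(norm (p + grad v x))\<^sup>2 <= a\<^sup>2" for x using na[of x] by (intro power_mono) auto
  have nl: "- laplacian v x <= \<sigma> * B2" for x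
  proof -
   have "\<bar>s * laplacian \<Phi> x\<bar> <= \<sigma> * B2" unfolding abs_mult s using B(4)[of x] \<sigma> by (intro mult_left_mono) auto
   then show ?thesis unfolding lv by linarith
  qed
  have "alpha V A p <= a" by (rule alpha_le[OF A v(2) vp]) (simp add: Vv na)
  moreover have b: "beta V A p <= a\<^sup>2" by (rule beta_le[OF A v(2) vp]) (simp add: Vv na2)
  moreover have kp: "kappa V A p <= \<sigma> * B2 + a\<^sup>2"
  proof (rule kappa_le[OF smV pV v(1) vp])
   show "viscous_HJ V A p v x <= \<sigma> * B2 + a\<^sup>2" for x
    using nl[of x] na2[of x] by (simp add: viscous_HJ_def Vv)
  qed
  moreover have "gamma V f A p <= deriv01 f 0 + beta V A p" by (rule gamma_le[OF A f0])
  moreover have "flame_speed V f A p <= (deriv01 f 0 + kappa V A (1 *R p)) / 1" by (rule flame_speed_le[OF f0]) simp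
  then have "flame_speed V f A p <= deriv01 f 0 + kappa V A p" by simp
  moreover have "0 <= a\<^sup>2" "0 <= \<sigma> * B2" using \<sigma> B(2) by auto
  ultimately show ?thesis using f0 a unfolding C_def by linarith
 qed
 have "c_lim V p >= c_star V f p & c_star V f p > 0" if "p \<bullet> (k /\<^sub>R T) ~= 0" for p
  using c_star_le_c_lim[OF f0] periodic_orbit_c_star_pos[OF \<xi> T k f0] that orth by blast
 then show ?thesis unfolding case_ii_def orth using bounds by blast
qed

end

theorem theorem3p3:
  fixes V :: "real^2 \<Rightarrow> real^2" and f :: "real \<Rightarrow> real"
  assumes "smooth V" and "periodic V"
    and "\<And>x. divergence V x = 0" and "mean_zero V"
    and "KPP f"
  shows "(case_i V f \<or> (\<exists>Q. Q \<noteq> 0 \<and> case_ii V f Q)) \<and>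
    ((\<exists>Q. Q \<noteq> 0 \<and> case_ii V f Q) \<longleftrightarrow>
       (\<exists>T \<xi>. periodic_orbit V T \<xi> \<and> rotation_vector T \<xi> \<noteq> 0)) \<and>
    (\<forall>T \<xi>. periodic_orbit V T \<xi> \<and> rotation_vector T \<xi> \<noteq> 0 \<longrightarrow>
       case_ii V f (rotation_vector T \<xi>))"
proof -
  obtain M L where "lipschitz_field V M L"
    by (rule smooth_lipschitz_field[OF smooth_C_k[OF assms(1)] assms(2)])
  moreover have "incompressible V" using assms by unfold_locales
  ultimately interpret incompressible_flow V M L by (simp add: incompressible_flow_def)
  have f0: "0 < deriv01 f 0" by (rule KPP_slope_pos[OF assms(5)])
  have ii: "case_ii V f (rotation_vector T \<xi>)" if o: "periodic_orbit V T \<xi>" "rotation_vector T \<xi> \<noteq> 0" for T \<xi>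
  proof -
    have "flow_line V \<xi>" "0 < T" "\<xi> T - \<xi> 0 \<in> int_lattice"
      using o(1) orbit_iff_flow_line[OF assms(1)] by (auto simp: periodic_orbit_def)
    moreover have "\<xi> T - \<xi> 0 \<noteq> 0" using o(2) by (auto simp: rotation_vector_def)
    ultimately show ?thesis using periodic_orbit_case_ii[OF f0 _ _ refl] by (simp only: rotation_vector_def)
  qed
  have i: "case_i V f" if no: "\<not> (\<exists>T \<xi>. periodic_orbit V T \<xi> \<and> rotation_vector T \<xi> \<noteq> 0)"
  proof -
    have "\<xi> T = \<xi> 0" if "flow_line V \<xi>" "0 < T" "\<xi> T - \<xi> 0 \<in> int_lattice" for T \<xi>
    proof -
      have "periodic_orbit V T \<xi>" using that orbit_iff_flow_line[OF assms(1)] by (simp add: periodic_orbit_def)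
      then have "rotation_vector T \<xi> = 0" using no by blast
      then show ?thesis using that(2) by (simp add: rotation_vector_def)
    qed
    then show ?thesis using no_periodic_orbit_c_lim[OF _ f0] unfolding case_i_def by blast
  qed
  have all: "\<forall>T \<xi>. periodic_orbit V T \<xi> \<and> rotation_vector T \<xi> \<noteq> 0 \<longrightarrow> case_ii V f (rotation_vector T \<xi>)"
    using ii by blast
  show ?thesis
  proof (cases "\<exists>T \<xi>. periodic_orbit V T \<xi> \<and> rotation_vector T \<xi> \<noteq> 0")
    case True
    then have "\<exists>Q. Q \<noteq> 0 \<and> case_ii V f Q" using all by blast
    then show ?thesis using True by (intro conjI disjI2 iffI all) assumption+
  next
    case False
    \<comment> \<open>Case (ii) applied to p = Q itself would give a positive limit speed, against
      case (i); this settles the remaining direction of the equivalence.\<close>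
    have no: "\<not> case_ii V f Q" if Q: "Q \<noteq> 0" for Q
    proof
      have "Q \<bullet> Q \<noteq> 0" using Q by simp
      moreover assume "case_ii V f Q"
      ultimately have "0 < c_star V f Q" unfolding case_ii_def by blast
      moreover have "c_star V f Q = 0" using i[OF False] unfolding case_i_def by blast
      ultimately show False by simp
    qed
    then have "\<not> (\<exists>Q. Q \<noteq> 0 \<and> case_ii V f Q)" by blast
    then show ?thesis using False by (intro conjI disjI1 i[OF False] all) (simp only:)
  qed
qed

end
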